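(* Let $\Omega$ be the two-dimensional torus, or $\mathbb{R}^2$, or a bounded open regular subset of $\mathbb{R}^2$, and let $b:\Omega\to\mathbb{R}^2$ be an $L^1_{loc}$ vector field with $\operatorname{div} b=0$ in the sense of distributions (and tangent to $\partial\Omega$ in the case of a bounded domain). Let $\Omega'$ be an open subset of $\Omega$. Assume that $b\in L^2_{loc}(\Omega')$ and that for every $x\in\Omega'$ the following condition holds: $$(P_x)\qquad \exists\, \xi\in\mathbb{R}^2,\ \alpha>0,\ \epsilon>0\ \text{ such that } b(y)\cdot\xi\ge\alpha \text{ for almost all } y\in B(x,\epsilon).$$ Then condition (R) holds in $\Omega'$: for every $u^o\in L^\infty(\Omega')$, every solution $u\in L^\infty([0,\infty)\times\Omega')$ of the transport equation $\partial_t u+b\cdot\nabla_x u=0$ on $[0,\infty)\times\Omega'$ with initial condition $u^o$ is a renormalized solution on $[0,\infty)\times\Omega'$.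
   Context: The vector field $b=b(x)$ is autonomous. $B(x,\epsilon)$ is the open ball of centre $x$ and radius $\epsilon$ (contained in the domain); $\xi,\alpha,\epsilon$ may depend on $x$. Tangency of $b$ to $\partial\Omega$ means that the normal component of $b$ on $\partial\Omega$ vanishes (in the weak sense). Solution: for an open set $\omega$ and $u^o\in L^\infty(\omega)$, a function $u\in L^\infty([0,\infty)\times\omega)$ is a solution on $[0,\infty)\times\omega$ with initial condition $u^o$ if for all $\phi\in C_c^\infty([0,\infty)\times\omega)$ (test functions need not vanish at $t=0$) $$\int_{[0,\infty)\times\omega}u\,\big(\partial_t\phi+b\cdot\nabla_x\phi\big)\,dt\,dx=-\int_\omega u^o(x)\,\phi(0,x)\,dx.$$ Renormalized solution: $u$ is a renormalized solution on $[0,\infty)\times\omega$ with initial condition $u^o$ if for every $\beta\in C^1_b(\mathbb{R})$ (differentiable functions $\mathbb{R}\to\mathbb{R}$ with bounded continuous derivative), $\beta(u)$ is a solution on $[0,\infty)\times\omega$ with initial condition $\beta(u^o)$. *)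

theory Defs
  imports "HOL-Analysis.Analysis"
begin

text \<open>
  The torus is \<open>\<real>\<^sup>2/\<int>\<^sup>2\<close>. Subsets of it are represented by their \<open>\<int>\<^sup>2\<close>-invariant preimages in the
  plane, functions by their \<open>\<int>\<^sup>2\<close>-periodic lifts, and integrals over a subset are taken over the
  part of the preimage lying in the fundamental cell \<open>[0,1)\<^sup>2\<close>. For planar domains the group of
  periods is \<open>{0}\<close> and the cell is the whole plane, so that all conditions concerning periods are void.
\<close>

datatype ambient = Plane | Torus

fun periods :: "ambient \<Rightarrow> (real^2) set" where
  "periods Plane = {0}"
| "periods Torus = {z. \<forall>i. z $ i \<in> \<int>}"

fun cell :: "ambient \<Rightarrow> (real^2) set" where
  "cell Plane = UNIV"
| "cell Torus = {x. \<forall>i. 0 \<le> x $ i \<and> x $ i < 1}"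

definition invariant_under :: "'a::real_vector set \<Rightarrow> 'a set \<Rightarrow> bool" where
  "invariant_under \<Gamma> S \<longleftrightarrow> (\<forall>x\<in>S. \<forall>\<gamma>\<in>\<Gamma>. x + \<gamma> \<in> S)"

definition periodic_on :: "'a::real_vector set \<Rightarrow> 'a set \<Rightarrow> ('a \<Rightarrow> 'b) \<Rightarrow> bool" where
  "periodic_on \<Gamma> S f \<longleftrightarrow> (\<forall>x\<in>S. \<forall>\<gamma>\<in>\<Gamma>. f (x + \<gamma>) = f x)"


text \<open>Meant for open \<open>S\<close>: all directional derivatives of order at most \<open>k\<close> exist and are continuous.\<close>

primrec C_k_on :: "nat \<Rightarrow> 'a::real_normed_vector set \<Rightarrow> ('a \<Rightarrow> 'b::real_normed_vector) \<Rightarrow> bool" where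
  "C_k_on 0 S f \<longleftrightarrow> continuous_on S f"
| "C_k_on (Suc k) S f \<longleftrightarrow>
     f differentiable_on S \<and> (\<forall>v. C_k_on k S (\<lambda>x. frechet_derivative f (at x) v))"

definition smooth :: "('a::real_normed_vector \<Rightarrow> 'b::real_normed_vector) \<Rightarrow> bool" where
  "smooth f \<longleftrightarrow> (\<forall>k. C_k_on k UNIV f)"

definition grad :: "(real^'n \<Rightarrow> real) \<Rightarrow> real^'n \<Rightarrow> real^'n" where
  "grad f x = (\<chi> i. frechet_derivative f (at x) (axis i 1))"

definition C1b :: "(real \<Rightarrow> real) \<Rightarrow> bool" where
  "C1b \<beta> \<longleftrightarrow> \<beta> differentiable_on UNIV \<and> continuous_on UNIV (deriv \<beta>) \<and> bounded (range (deriv \<beta>))"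

definition L_loc :: "nat \<Rightarrow> 'a::euclidean_space set \<Rightarrow> ('a \<Rightarrow> 'b::euclidean_space) \<Rightarrow> bool" where
  "L_loc p S f \<longleftrightarrow> f \<in> borel_measurable (lebesgue_on S) \<and>
     (\<forall>K. compact K \<and> K \<subseteq> S \<longrightarrow> set_integrable lebesgue K (\<lambda>x. norm (f x) ^ p))"

definition L_inf :: "'a::euclidean_space set \<Rightarrow> 'a set \<Rightarrow> ('a \<Rightarrow> real) \<Rightarrow> bool" where
  "L_inf \<Gamma> S f \<longleftrightarrow> periodic_on \<Gamma> S f \<and> f \<in> borel_measurable (lebesgue_on S) \<and>
     (\<exists>C. AE x in lebesgue_on S. \<bar>f x\<bar> \<le> C)"

text \<open>Smooth functions with compact support in \<open>U\<close>, where compactness is understood modulo \<open>\<Gamma>\<close>.\<close>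

definition test_fun :: "'a::real_normed_vector set \<Rightarrow> 'a set \<Rightarrow> ('a \<Rightarrow> real) \<Rightarrow> bool" where
  "test_fun \<Gamma> U \<phi> \<longleftrightarrow> smooth \<phi> \<and> periodic_on \<Gamma> UNIV \<phi> \<and>
     (\<exists>K. compact K \<and> K \<subseteq> U \<and> (\<forall>x. \<phi> x \<noteq> 0 \<longrightarrow> (\<exists>\<gamma>\<in>\<Gamma>. x + \<gamma> \<in> K)))"

definition div_free :: "ambient \<Rightarrow> (real^2) set \<Rightarrow> (real^2 \<Rightarrow> real^2) \<Rightarrow> bool" where
  "div_free X \<Omega> b \<longleftrightarrow>
     (\<forall>\<phi>. test_fun (periods X) \<Omega> \<phi> \<longrightarrow> (LINT x:\<Omega> \<inter> cell X|lebesgue. b x \<bullet> grad \<phi> x) = 0)"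

text \<open>
  Open sets lying locally on one side of a \<open>C\<^sup>1\<close> boundary curve; this is the weakest boundary
  regularity for which there is a continuous normal field.
\<close>

definition regular_domain :: "(real^2) set \<Rightarrow> bool" where
  "regular_domain \<Omega> \<longleftrightarrow> open \<Omega> \<and>
     (\<forall>x\<in>frontier \<Omega>. \<exists>U \<rho>. open U \<and> x \<in> U \<and> C_k_on 1 U \<rho> \<and> (\<forall>y\<in>U. grad \<rho> y \<noteq> 0) \<and>
        \<Omega> \<inter> U = {y\<in>U. \<rho> y < 0})"

text \<open>
  Weak form of \<open>b \<cdot> n = 0\<close> on \<open>\<partial>\<Omega>\<close> for a divergence-free field: by Green's formula the normal trace
  acts on \<open>\<phi>\<close> as the integral of \<open>b \<cdot> \<nabla>\<phi>\<close> over \<open>\<Omega>\<close>, with test functions that need not vanish on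
  \<open>\<partial>\<Omega>\<close>. A field that is merely locally integrable in \<open>\<Omega>\<close> is tested against those \<open>\<phi>\<close> for which
  this integral exists; for \<open>b\<close> integrable on \<open>\<Omega>\<close> these are all of them.
\<close>

definition weakly_tangent :: "(real^2) set \<Rightarrow> (real^2 \<Rightarrow> real^2) \<Rightarrow> bool" where
  "weakly_tangent \<Omega> b \<longleftrightarrow>
     (\<forall>\<phi>. test_fun {0} UNIV \<phi> \<and> set_integrable lebesgue \<Omega> (\<lambda>x. b x \<bullet> grad \<phi> x) \<longrightarrow>
        (LINT x:\<Omega>|lebesgue. b x \<bullet> grad \<phi> x) = 0)"

text \<open>
  A ball of the torus is the image of the Euclidean ball of the same radius; as \<open>b\<close> is periodic, one
  Euclidean ball suffices.
\<close>

definition cond_P :: "(real^2) set \<Rightarrow> (real^2 \<Rightarrow> real^2) \<Rightarrow> real^2 \<Rightarrow> bool" where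
  "cond_P \<Omega> b x \<longleftrightarrow> (\<exists>\<xi> \<alpha> \<epsilon>. 0 < \<alpha> \<and> 0 < \<epsilon> \<and> ball x \<epsilon> \<subseteq> \<Omega> \<and>
     (AE y in lebesgue_on (ball x \<epsilon>). b y \<bullet> \<xi> \<ge> \<alpha>))"

text \<open>
  Test functions on \<open>[0,\<infinity>) \<times> \<omega>\<close> are the restrictions to \<open>t \<ge> 0\<close> of test functions on \<open>\<real> \<times> \<omega>\<close>;
  by Seeley's extension theorem these are all functions smooth up to \<open>t = 0\<close> with compact support.
\<close>

definition is_solution ::
    "ambient \<Rightarrow> (real^2 \<Rightarrow> real^2) \<Rightarrow> (real^2) set \<Rightarrow> (real^2 \<Rightarrow> real) \<Rightarrow> (real \<times> (real^2) \<Rightarrow> real) \<Rightarrow> bool" where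
  "is_solution X b \<omega> u\<^sub>0 u \<longleftrightarrow>
     L_inf (periods X) \<omega> u\<^sub>0 \<and> L_inf ({0} \<times> periods X) ({0..} \<times> \<omega>) u \<and>
     (\<forall>\<phi>. test_fun ({0} \<times> periods X) (UNIV \<times> \<omega>) \<phi> \<longrightarrow>
        (LINT (t, x):{0..} \<times> (\<omega> \<inter> cell X)|lebesgue.
           u (t, x) * (deriv (\<lambda>s. \<phi> (s, x)) t + b x \<bullet> grad (\<lambda>y. \<phi> (t, y)) x))
        = - (LINT x:\<omega> \<inter> cell X|lebesgue. u\<^sub>0 x * \<phi> (0, x)))"

definition is_renormalized_solution ::
    "ambient \<Rightarrow> (real^2 \<Rightarrow> real^2) \<Rightarrow> (real^2) set \<Rightarrow> (real^2 \<Rightarrow> real) \<Rightarrow> (real \<times> (real^2) \<Rightarrow> real) \<Rightarrow> bool" where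
  "is_renormalized_solution X b \<omega> u\<^sub>0 u \<longleftrightarrow>
     (\<forall>\<beta>. C1b \<beta> \<longrightarrow> is_solution X b \<omega> (\<beta> \<circ> u\<^sub>0) (\<beta> \<circ> u))"

definition cond_R :: "ambient \<Rightarrow> (real^2 \<Rightarrow> real^2) \<Rightarrow> (real^2) set \<Rightarrow> bool" where
  "cond_R X b \<omega> \<longleftrightarrow>
     (\<forall>u\<^sub>0 u. L_inf (periods X) \<omega> u\<^sub>0 \<longrightarrow> is_solution X b \<omega> u\<^sub>0 u \<longrightarrow>
        is_renormalized_solution X b \<omega> u\<^sub>0 u)"

end

theory Submission
  imports Defs
begin

text \<open>In two dimensions a divergence-free field has a stream function \<open>H\<close> with
  gradient \<open>(- b2, b1)\<close>, which is constant along trajectories. Where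
  \<open>b \<bullet> \<xi>\<close> is bounded below, a rotation makes
  \<open>b1 \<ge> \<alpha> > 0\<close> on a square. For fixed abscissa \<open>p\<close> the map
  \<open>q \<mapsto> H (p, q)\<close> is then strictly increasing with density \<open>b1\<close>, so
  \<open>(h, p)\<close> with \<open>h = H (p, q)\<close> are coordinates. In them a particle moves
  along the line of constant \<open>h\<close> with speed \<open>b1\<close>, and the travel time
  \<open>S (h, p)\<close>, a primitive of \<open>1 / b1\<close> in \<open>p\<close>, serves as
  second coordinate. The Jacobians \<open>b1\<close> and \<open>1 / b1\<close> cancel, so
  \<open>(p, q) \<mapsto> (h, S)\<close> preserves area (\<open>flow_coordinates\<close>, via
  \<open>fiber_map\<close>) and straightens the flow into unit translation of \<open>S\<close>. In
  the moving frame \<open>(h, S - t)\<close> the transport operator is a plain time derivative, and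
  renormalization becomes one-dimensional calculus on almost every line
  (\<open>renormalization_by_flow_coordinates\<close>, \<open>chain_rule_along_line\<close>).

  The difficulty is that \<open>b\<close> has no derivatives, so neither \<open>H\<close> nor
  \<open>S\<close> may simply be inserted into a test function. The stream functions
  \<open>H n\<close> of mollified fields may (\<open>stream_function\<close>). They are not constant
  along the trajectories of \<open>b\<close>, but the error \<open>b \<bullet> grad (H n)\<close> is
  a determinant of the mollified and the original field; it tends to 0 in L1 because the mollified
  fields converge in L2 and \<open>b\<close> is in L2. This is where square integrability enters
  (\<open>weak_sol_test_stream\<close>). Once functions of \<open>(t, p, H)\<close> are admissible,
  the travel time is mollified in the variables \<open>(h, p)\<close>; the unwanted term then
  carries the factor \<open>a * b1 - 1\<close>, which vanishes in the limit
  (\<open>weak_sol_test_flow\<close>).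

  Since the equation is known only against compactly supported test functions, what is transported
  is \<open>u * \<phi>c\<close>, with a cutoff \<open>\<phi>c\<close> equal to 1 on the support of
  the given test function \<open>\<phi>\<close>, and also \<open>\<phi>\<close> itself. Each
  satisfies a transport equation with a source; the equation for \<open>\<phi>\<close> is that of
  the constant solution 1, which is how vanishing divergence is expressed. The source of
  \<open>u * \<phi>c\<close> vanishes where \<open>\<phi>\<close> does not, so the product rule for
  \<open>\<beta> (u * \<phi>c) * \<phi>\<close> along a line has only the term containing the source
  of \<open>\<phi>\<close>, and its integral is the renormalized equation
  (\<open>local_renormalization\<close>).

  The remaining lemmas connect this with the given formulation. Weak solutions are local
  (\<open>weak_sol_local\<close>) and invariant under isometries (\<open>weak_sol_isometry\<close>);
  smooth and C1 test functions define the same solutions (\<open>weak_sol_smoothI\<close>); periodic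
  test functions on the torus and compactly supported ones in the plane are exchanged by
  periodization and by a periodic partition of unity (\<open>is_solution_imp_weak_sol\<close>,
  \<open>weak_sol_imp_solution\<close>).\<close>

abbreviation borel_fun :: "('a::topological_space \<Rightarrow> 'b::topological_space) set" where
  "borel_fun \<equiv> borel_measurable borel"

abbreviation L1 :: "('a::euclidean_space \<Rightarrow> 'b::{banach, second_countable_topology}) \<Rightarrow> bool" where
  "L1 \<equiv> integrable lborel"

text \<open>\<open>D\<close> stands for the space-time gradient of a test function, so this is the
  transport operator, time derivative plus \<open>b\<close> times spatial gradient, applied to that
  function.\<close>

abbreviation flux :: "('a::euclidean_space \<Rightarrow> 'a) \<Rightarrow> (real \<times> 'a \<Rightarrow> real \<times> 'a) \<Rightarrow> real \<times> 'a \<Rightarrow> real" where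
  "flux b D z \<equiv> D z \<bullet> (1, b (snd z))"

text \<open>Integrals run over the whole of space-time; this factor restricts them to nonnegative
  times.\<close>

abbreviation future :: "real \<times> 'a \<Rightarrow> real" where
  "future z \<equiv> indicator {0..} (fst z)"

section \<open>C1 functions together with their gradients\<close>

text \<open>The gradient is carried along as an explicit vector field, so that it can be paired with
  \<open>b\<close>, convolved and estimated. One continuous derivative is exactly what the weak
  equation pairs with \<open>b\<close>.\<close>

definition cgrad :: "('a::euclidean_space \<Rightarrow> real) \<Rightarrow> ('a \<Rightarrow> 'a) \<Rightarrow> bool" where
  "cgrad \<phi> D \<longleftrightarrow> (\<forall>z. (\<phi> has_derivative (\<lambda>v. D z \<bullet> v)) (at z)) \<and> continuous_on UNIV D"

lemma cgradD: "cgrad \<phi> D \<Longrightarrow> (\<phi> has_derivative (\<lambda>v. D z \<bullet> v)) (at z)"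
  by (simp add: cgrad_def)

lemma cgrad_continuous_grad: "cgrad \<phi> D \<Longrightarrow> continuous_on S D"
  unfolding cgrad_def by (meson continuous_on_subset top_greatest)

lemma cgrad_continuous: "cgrad \<phi> D \<Longrightarrow> continuous_on S \<phi>"
  by (meson cgradD continuous_at_imp_continuous_on has_derivative_continuous)

lemma borel_measurable_cgrad: "cgrad \<phi> D \<Longrightarrow> \<phi> \<in> borel_fun"
  by (meson borel_measurable_continuous_onI cgrad_continuous)

lemma borel_measurable_cgrad_grad: "cgrad \<phi> D \<Longrightarrow> D \<in> borel_fun"
  by (meson borel_measurable_continuous_onI cgrad_continuous_grad)

lemma cgrad_const: "cgrad (\<lambda>_. c) (\<lambda>_. 0)"
  by (simp add: cgrad_def)

lemma cgrad_add:
  assumes "cgrad f D" "cgrad g E" shows "cgrad (\<lambda>z. f z + g z) (\<lambda>z. D z + E z)"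
  using assms unfolding cgrad_def by (auto intro!: derivative_eq_intros continuous_intros simp: inner_add_left)

lemma cgrad_diff:
  assumes "cgrad f D" "cgrad g E" shows "cgrad (\<lambda>z. f z - g z) (\<lambda>z. D z - E z)"
  using assms unfolding cgrad_def by (auto intro!: derivative_eq_intros continuous_intros simp: inner_diff_left)

lemma cgrad_mult:
  assumes "cgrad f D" "cgrad g E" shows "cgrad (\<lambda>z. f z * g z) (\<lambda>z. g z *\<^sub>R D z + f z *\<^sub>R E z)"
  using assms cgrad_continuous[OF assms(1), of UNIV] cgrad_continuous[OF assms(2), of UNIV]
  unfolding cgrad_def
  by (auto intro!: derivative_eq_intros continuous_intros simp: inner_add_left algebra_simps)

lemma cgrad_sum:
  assumes "\<And>i. i \<in> I \<Longrightarrow> cgrad (f i) (D i)"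
  shows "cgrad (\<lambda>z. \<Sum>i\<in>I. f i z) (\<lambda>z. \<Sum>i\<in>I. D i z)"
proof (cases "finite I")
  case True
  then show ?thesis using assms
    by (induction I rule: finite_induct) (auto intro: cgrad_add cgrad_const)
qed (auto intro: cgrad_const)

lemma cgrad_compose:
  assumes f: "cgrad f D" and g: "\<And>x. (g has_real_derivative g' x) (at x)" and g': "continuous_on UNIV g'"
  shows "cgrad (\<lambda>z. g (f z)) (\<lambda>z. g' (f z) *\<^sub>R D z)"
  unfolding cgrad_def
proof (intro conjI allI)
  fix z show "((\<lambda>z. g (f z)) has_derivative (\<lambda>v. (g' (f z) *\<^sub>R D z) \<bullet> v)) (at z)"
    by (rule has_derivative_eq_rhs[OF has_derivative_compose[OF cgradD[OF f] g[unfolded has_field_derivative_def]]]) auto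
next
  show "continuous_on UNIV (\<lambda>z. g' (f z) *\<^sub>R D z)"
    using f by (intro continuous_intros continuous_on_compose2[OF g'] cgrad_continuous cgrad_continuous_grad) auto
qed

lemma cgrad_shift: assumes "cgrad f D" shows "cgrad (\<lambda>z. f (z + c)) (\<lambda>z. D (z + c))"
  unfolding cgrad_def
proof (intro conjI allI)
  fix z show "((\<lambda>z. f (z + c)) has_derivative (\<lambda>v. D (z + c) \<bullet> v)) (at z)"
    by (rule has_derivative_compose[OF _ cgradD[OF assms], of "\<lambda>z. z + c", simplified])
       (auto intro!: derivative_eq_intros)
next
  show "continuous_on UNIV (\<lambda>z. D (z + c))"
    by (intro continuous_on_compose2[OF cgrad_continuous_grad[OF assms, of UNIV]] continuous_intros) auto
qed

lemma cgrad_reflect: assumes "cgrad f D" shows "cgrad (\<lambda>z. f (c - z)) (\<lambda>z. - D (c - z))"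
  unfolding cgrad_def
proof (intro conjI allI)
  fix z
  have "((\<lambda>z. c - z) has_derivative (\<lambda>v. - v)) (at z)"
    by (auto intro!: derivative_eq_intros)
  from has_derivative_compose[OF this cgradD[OF assms]]
  show "((\<lambda>z. f (c - z)) has_derivative (\<lambda>v. - D (c - z) \<bullet> v)) (at z)"
    by simp
next
  show "continuous_on UNIV (\<lambda>z. - D (c - z))"
    by (intro continuous_intros continuous_on_compose2[OF cgrad_continuous_grad[OF assms, of UNIV]]) auto
qed

lemma inner_ext: "(\<And>v. x \<bullet> v = y \<bullet> v) \<Longrightarrow> x = (y::'a::real_inner)"
  by (metis inner_commute vector_eq_rdot)

lemma cgrad_eq_on_open:
  assumes "cgrad f D" "cgrad g E" "open S" "z \<in> S" "\<And>x. x \<in> S \<Longrightarrow> f x = g x"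
  shows "D z = E z"
proof -
  have "(g has_derivative (\<lambda>v. D z \<bullet> v)) (at z)"
    using has_derivative_transform_within_open[OF cgradD[OF assms(1)] assms(3,4)] assms(5) by auto
  then have "(\<lambda>v. D z \<bullet> v) = (\<lambda>v. E z \<bullet> v)"
    using cgradD[OF assms(2)] has_derivative_unique by blast
  then show ?thesis by (metis inner_ext)
qed

lemma cgrad_const_on_open:
  assumes "cgrad f D" "open S" "z \<in> S" "\<And>x. x \<in> S \<Longrightarrow> f x = c"
  shows "D z = 0"
  by (rule cgrad_eq_on_open[OF assms(1) cgrad_const[of c] assms(2,3) assms(4)])

lemma cgrad_zero_outside:
  assumes "cgrad f D" "closed K" "\<And>z. z \<notin> K \<Longrightarrow> f z = 0" "z \<notin> K"
  shows "D z = 0"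
  by (rule cgrad_const_on_open[OF assms(1), of "-K" z 0]) (use assms in auto)

lemma cgrad_unique:
  assumes "cgrad f D" "cgrad f E" shows "D = E"
proof
  fix z show "D z = E z" by (rule cgrad_eq_on_open[OF assms open_UNIV UNIV_I refl])
qed

section \<open>Convolution with a compactly supported kernel\<close>

definition locint :: "('a::euclidean_space \<Rightarrow> real) \<Rightarrow> bool" where
  "locint f \<longleftrightarrow> f \<in> borel_fun \<and> (\<forall>r. L1 (\<lambda>x. indicator (cball 0 r) x * f x))"

lemma locint_integrable: "L1 f \<Longrightarrow> locint f"
  unfolding locint_def
  using integrable_mult_indicator[of "cball 0 _" lborel f] by (auto simp: borel_measurable_integrable)

lemma locint_continuous: assumes "continuous_on UNIV f" shows "locint f"
  unfolding locint_def
proof (intro conjI allI)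
  show "f \<in> borel_fun" by (rule borel_measurable_continuous_onI[OF assms])
  fix r
  show "L1 (\<lambda>x. indicat_real (cball 0 r) x * f x)"
    using borel_integrable_compact[of "cball 0 r" f] continuous_on_subset[OF assms] by auto
qed

text \<open>The weight is real and the kernel may be vector valued, so that one operation covers
  convolution with a function and with its gradient.\<close>

definition conv :: "('a::euclidean_space \<Rightarrow> real) \<Rightarrow> ('a \<Rightarrow> 'b::euclidean_space) \<Rightarrow> 'a \<Rightarrow> 'b" where
  "conv f k x = (LBINT y. f y *\<^sub>R k (x - y))"

lemma conv_integrable:
  fixes k :: "'a::euclidean_space \<Rightarrow> 'b::euclidean_space"
  assumes f: "locint f" and k: "continuous_on UNIV k" and supp: "\<And>z. norm z > r \<Longrightarrow> k z = 0"
  shows "L1 (\<lambda>y. f y *\<^sub>R k (x - y))"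
proof -
  have fm[measurable]: "f \<in> borel_fun" using f by (simp add: locint_def)
  have km[measurable]: "k \<in> borel_fun" using k by (rule borel_measurable_continuous_onI)
  have "bounded (k ` cball 0 r)"
    by (intro compact_imp_bounded compact_continuous_image continuous_on_subset[OF k]) auto
  then obtain B where B: "\<And>z. norm z \<le> r \<Longrightarrow> norm (k z) \<le> B"
    by (force simp: bounded_iff)
  have B': "norm (k z) \<le> \<bar>B\<bar>" for z
    using B[of z] supp[of z] by (cases "norm z \<le> r") auto
  show ?thesis
  proof (rule Bochner_Integration.integrable_bound)
    show "L1 (\<lambda>y. \<bar>B\<bar> * \<bar>indicator (cball 0 (norm x + r)) y * f y\<bar>)"
      using f unfolding locint_def by auto
    show "AE y in lborel. norm (f y *\<^sub>R k (x - y)) \<le> norm (\<bar>B\<bar> * \<bar>indicat_real (cball 0 (norm x + r)) y * f y\<bar>)"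
    proof (intro AE_I2)
      fix y
      show "norm (f y *\<^sub>R k (x - y)) \<le> norm (\<bar>B\<bar> * \<bar>indicat_real (cball 0 (norm x + r)) y * f y\<bar>)"
      proof (cases "norm (x - y) > r")
        case False
        then have "norm y \<le> norm x + r" by norm
        then show ?thesis using B'[of "x - y"] by (simp add: mult.commute[of _ "\<bar>f y\<bar>"] mult_left_mono)
      qed (simp add: supp)
    qed
  qed measurable
qed

lemma conv_continuous:
  fixes k :: "'a::euclidean_space \<Rightarrow> 'b::euclidean_space"
  assumes f: "locint f" and k: "continuous_on UNIV k" and supp: "\<And>z. norm z > r \<Longrightarrow> k z = 0"
  shows "continuous_on UNIV (conv f k)"
proof -
  have fm[measurable]: "f \<in> borel_fun" using f by (simp add: locint_def)
  have km[measurable]: "k \<in> borel_fun" using k by (rule borel_measurable_continuous_onI)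
  have "bounded (k ` cball 0 r)"
    by (intro compact_imp_bounded compact_continuous_image continuous_on_subset[OF k]) auto
  then obtain B where B: "\<And>z. norm z \<le> r \<Longrightarrow> norm (k z) \<le> B"
    by (force simp: bounded_iff)
  have B': "norm (k z) \<le> \<bar>B\<bar>" for z
    using B[of z] supp[of z] by (cases "norm z \<le> r") auto
  have "(\<lambda>n. conv f k (s n)) \<longlonglongrightarrow> conv f k x" if s: "s \<longlonglongrightarrow> x" for s x
  proof -
    obtain M where M: "\<And>n. norm (s n) \<le> M"
      using s by (meson Bseq_def convergentI convergent_imp_Bseq)
    show ?thesis unfolding conv_def
    proof (rule integral_dominated_convergence)
      show "L1 (\<lambda>y. \<bar>B\<bar> * \<bar>indicator (cball 0 (M + r)) y * f y\<bar>)"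
        using f unfolding locint_def by auto
      show "AE y in lborel. (\<lambda>n. f y *\<^sub>R k (s n - y)) \<longlonglongrightarrow> f y *\<^sub>R k (x - y)"
        by (intro AE_I2 tendsto_intros continuous_on_tendsto_compose[OF k] s) auto
      fix n show "AE y in lborel. norm (f y *\<^sub>R k (s n - y)) \<le> \<bar>B\<bar> * \<bar>indicat_real (cball 0 (M + r)) y * f y\<bar>"
      proof (intro AE_I2)
        fix y
        show "norm (f y *\<^sub>R k (s n - y)) \<le> \<bar>B\<bar> * \<bar>indicat_real (cball 0 (M + r)) y * f y\<bar>"
        proof (cases "norm (s n - y) > r")
          case False
          then have "norm y \<le> M + r" using M[of n] by norm
          then show ?thesis using B'[of "s n - y"] by (simp add: mult.commute[of _ "\<bar>f y\<bar>"] mult_left_mono)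
        qed (simp add: supp)
      qed
    qed measurable
  qed
  then show ?thesis unfolding continuous_on_sequentially by (auto simp: comp_def)
qed

text \<open>The derivative falls on the kernel. By uniform continuity of \<open>D\<close> the
  linearisation error of \<open>k\<close> is at most \<open>e'\<close> times the increment,
  uniformly in \<open>y\<close>, and it vanishes for \<open>y\<close> outside a fixed ball, on which
  \<open>f\<close> is integrable.\<close>

lemma cgrad_conv:
  fixes k :: "'a::euclidean_space \<Rightarrow> real"
  assumes f: "locint f" and k: "cgrad k D" and supp: "\<And>z. norm z > r \<Longrightarrow> k z = 0"
  shows "cgrad (conv f k) (conv f D)"
  unfolding cgrad_def
proof (intro conjI allI)
  have Dsupp: "D z = 0" if "norm z > r" for z
    using cgrad_zero_outside[OF k, of "cball 0 r" z] supp that by auto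
  have kc: "continuous_on UNIV k" and Dc: "continuous_on UNIV D"
    using k cgrad_continuous cgrad_continuous_grad by auto
  show "continuous_on UNIV (conv f D)" by (rule conv_continuous[OF f Dc Dsupp])
  have "uniformly_continuous_on (cball 0 (r + 2)) D"
    by (intro compact_uniformly_continuous continuous_on_subset[OF Dc]) auto
  fix x :: 'a
  note ik = conv_integrable[OF f kc supp]
  note iD = conv_integrable[OF f Dc Dsupp]
  have fi: "L1 (\<lambda>y. indicator (cball 0 (norm x + r + 1)) y * f y)"
    using f by (simp add: locint_def)
  define C where "C = (LBINT y. \<bar>indicator (cball 0 (norm x + r + 1)) y * f y\<bar>)"
  have C0: "C \<ge> 0" unfolding C_def by simp
  show "(conv f k has_derivative (\<lambda>v. conv f D x \<bullet> v)) (at x)"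
    unfolding has_derivative_at_alt
  proof (intro conjI allI impI)
    show "bounded_linear (\<lambda>v. conv f D x \<bullet> v)" by (rule bounded_linear_inner_right)
    fix e :: real assume e: "e > 0"
    \<comment> \<open>The summand 1 keeps the quotient positive when \<open>C = 0\<close>; what
      matters is \<open>e' * C \<le> e\<close>.\<close>
    define e' where "e' = e / (C + 1)"
    have e': "e' > 0" using e C0 by (simp add: e'_def)
    from \<open>uniformly_continuous_on (cball 0 (r + 2)) D\<close> e' obtain d where d: "d > 0"
      "\<And>z z'. z \<in> cball 0 (r+2) \<Longrightarrow> z' \<in> cball 0 (r+2) \<Longrightarrow> dist z' z < d \<Longrightarrow> dist (D z') (D z) < e'"
      unfolding uniformly_continuous_on_def by metis
    show "\<exists>d>0. \<forall>y. norm (y - x) < d \<longrightarrow> norm (conv f k y - conv f k x - conv f D x \<bullet> (y - x)) \<le> e * norm (y - x)"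
    proof (intro exI[of _ "min d 1"] conjI allI impI)
      show "0 < min d 1" using d by simp
      fix x' assume x': "norm (x' - x) < min d 1"
      \<comment> \<open>As \<open>x'\<close> is at distance less than 1 from \<open>x\<close>, there
        are two cases: if \<open>norm (x - y) > r + 1\<close>, the segment from \<open>x - y\<close>
        to \<open>x' - y\<close> avoids the support of \<open>D\<close>; otherwise it stays in the
        ball of radius \<open>r + 2\<close>, where the modulus of continuity applies.\<close>
      have pt: "\<bar>k (x' - y) - k (x - y) - D (x - y) \<bullet> (x' - x)\<bar> \<le> norm (x' - x) * e' * indicator (cball 0 (norm x + r + 1)) y" for y
      proof (cases "y \<in> cball 0 (norm x + r + 1)")
        case False
        then have n: "norm y > norm x + r + 1" by simp
        have "norm (x - y) > r" "norm (x' - y) > r"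
          using n x' norm_triangle_ineq2[of y x] norm_triangle_ineq2[of y x'] norm_triangle_ineq2[of x' x] 
          by (auto simp: norm_minus_commute)
        then show ?thesis using e' by (simp add: supp Dsupp)
      next
        case True
        have close: "norm (D z - D (x - y)) \<le> e'" if "z \<in> closed_segment (x - y) (x' - y)" for z
        proof -
          have zz: "norm (z - (x - y)) \<le> norm (x' - x)"
            using segment_bound(1)[OF that] by (simp add: algebra_simps)
          show ?thesis
          proof (cases "norm (x - y) > r + 1")
            case True
            then have "norm z > r" using zz x' norm_triangle_ineq2[of "x - y" "z"] by (auto simp: norm_minus_commute)
            then show ?thesis using Dsupp True e' by auto
          next
            case False
            then have "norm z \<le> r + 2" using zz x' norm_triangle_ineq2[of z "x - y"] by auto
            then have "dist (D z) (D (x - y)) < e'" using False zz x' by (intro d) (auto simp: dist_norm norm_minus_commute)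
            then show ?thesis by (simp add: dist_norm)
          qed
        qed
        have "norm (k (x' - y) - k (x - y) - D (x - y) \<bullet> ((x' - y) - (x - y))) \<le> norm ((x' - y) - (x - y)) * e'"
        proof (rule differentiable_bound_linearization[where S="closed_segment (x - y) (x' - y)" and f' = "\<lambda>z v. D z \<bullet> v"])
          show "(k has_derivative (\<bullet>) (D z)) (at z within closed_segment (x - y) (x' - y))" for z
            using cgradD[OF k, of z] by (rule has_derivative_at_withinI)
          show "(x - y) + t *\<^sub>R ((x' - y) - (x - y)) \<in> closed_segment (x - y) (x' - y)" if "t \<in> {0..1}" for t
            using that by (auto simp: in_segment algebra_simps intro!: exI[of _ t])
          show "onorm ((\<bullet>) (D z) - (\<bullet>) (D (x - y))) \<le> e'" if "z \<in> closed_segment (x - y) (x' - y)" for z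
          proof (rule onorm_le)
            fix v
            have "norm (((\<bullet>) (D z) - (\<bullet>) (D (x - y))) v) = \<bar>(D z - D (x - y)) \<bullet> v\<bar>" by (simp add: inner_diff_left)
            also have "\<dots> \<le> norm (D z - D (x - y)) * norm v" by (rule Cauchy_Schwarz_ineq2)
            also have "\<dots> \<le> e' * norm v" using close[OF that] by (intro mult_right_mono) auto
            finally show "norm (((\<bullet>) (D z) - (\<bullet>) (D (x - y))) v) \<le> e' * norm v" .
          qed
        qed auto
        then show ?thesis using True by simp
      qed
      have "conv f k x' - conv f k x - conv f D x \<bullet> (x' - x) = 
          (LBINT y. f y * (k (x' - y) - k (x - y) - D (x - y) \<bullet> (x' - x)))"
      proof -
        have "conv f D x \<bullet> (x' - x) = (LBINT y. (f y *\<^sub>R D (x - y)) \<bullet> (x' - x))"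
          unfolding conv_def using iD by (subst integral_inner_left) auto
        also have "\<dots> = (LBINT y. f y * (D (x - y) \<bullet> (x' - x)))" by simp
        finally have 1: "conv f D x \<bullet> (x' - x) = \<dots>" .
        have i3: "L1 (\<lambda>y. f y * (D (x - y) \<bullet> (x' - x)))"
          using integrable_inner_left[OF iD, of "x' - x"] by simp
        show ?thesis
          unfolding 1 unfolding conv_def
          using ik[where x=x] ik[where x=x'] i3
          by (simp add: algebra_simps Bochner_Integration.integral_diff[symmetric] del: Bochner_Integration.integral_diff)
      qed
      also have "norm \<dots> \<le> (LBINT y. norm (x' - x) * e' * \<bar>indicator (cball 0 (norm x + r + 1)) y * f y\<bar>)"
      proof (rule Bochner_Integration.integral_norm_bound_integral)
        show "L1 (\<lambda>y. norm (x' - x) * e' * \<bar>indicator (cball 0 (norm x + r + 1)) y * f y\<bar>)"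
          using fi by auto
        show "L1 (\<lambda>y. f y * (k (x' - y) - k (x - y) - D (x - y) \<bullet> (x' - x)))"
          using ik[where x=x] ik[where x=x'] integrable_inner_left[OF iD, of "x' - x"]
          by (simp add: right_diff_distrib)
        fix y show "norm (f y * (k (x' - y) - k (x - y) - D (x - y) \<bullet> (x' - x)))
            \<le> norm (x' - x) * e' * \<bar>indicat_real (cball 0 (norm x + r + 1)) y * f y\<bar>"
          using mult_left_mono[OF pt[of y], of "\<bar>f y\<bar>"] by (simp add: abs_mult mult_ac)
      qed
      also have "\<dots> = norm (x' - x) * e' * C" unfolding C_def by simp
      also have "\<dots> \<le> e * norm (x' - x)"
      proof -
        have "e' * C \<le> e" unfolding e'_def using C0 e by (simp add: field_simps)
        then show ?thesis using mult_left_mono[of "e' * C" e "norm (x' - x)"] by (simp add: algebra_simps)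
      qed
      finally show "norm (conv f k x' - conv f k x - conv f D x \<bullet> (x' - x)) \<le> e * norm (x' - x)" .
    qed
  qed
qed

section \<open>Smooth functions and mollifiers\<close>

lemma C_k_on_mono: "C_k_on (Suc k) S f \<Longrightarrow> C_k_on k S f"
proof (induction k arbitrary: f)
  case 0 then show ?case by (auto intro: differentiable_imp_continuous_on)
next
  case (Suc k)
  then show ?case by (metis C_k_on.simps(2))
qed

lemma frechet_derivative_eq: "(f has_derivative f') (at x) \<Longrightarrow> frechet_derivative f (at x) v = f' v"
  by (metis frechet_derivative_at)

lemma C_k_on_SucI:
  assumes "\<And>x. (f has_derivative f' x) (at x)" "\<And>v. C_k_on k UNIV (\<lambda>x. f' x v)"
  shows "C_k_on (Suc k) UNIV f"
proof -
  have "frechet_derivative f (at x) v = f' x v" for x v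
    using assms(1) frechet_derivative_eq by blast
  moreover have "f differentiable_on UNIV"
    using assms(1) unfolding differentiable_on_def differentiable_def by auto
  ultimately show ?thesis using assms(2) by simp
qed

lemma C_k_on_SucD:
  assumes "C_k_on (Suc k) UNIV f"
  shows "(f has_derivative frechet_derivative f (at x)) (at x)" "C_k_on k UNIV (\<lambda>x. frechet_derivative f (at x) v)"
  using assms frechet_derivative_works by (auto simp: differentiable_on_def)

lemma C_k_on_const: "C_k_on k UNIV (\<lambda>_. c)"
proof (induction k arbitrary: c)
  case (Suc k)
  show ?case by (rule C_k_on_SucI[where f' = "\<lambda>_ _. 0"]) (auto intro: Suc)
qed simp

lemma C_k_on_add:
  fixes f g :: "'a::real_normed_vector \<Rightarrow> 'b::real_normed_vector"
  shows "C_k_on k UNIV f \<Longrightarrow> C_k_on k UNIV g \<Longrightarrow> C_k_on k UNIV (\<lambda>x. f x + g x)"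
proof (induction k arbitrary: f g)
  case 0 then show ?case by (auto intro: continuous_on_add)
next
  case (Suc k)
  show ?case
    by (rule C_k_on_SucI[OF has_derivative_add[OF C_k_on_SucD(1)[OF Suc.prems(1)] C_k_on_SucD(1)[OF Suc.prems(2)]]])
       (intro Suc.IH C_k_on_SucD Suc.prems)
qed

lemma C_k_on_mult:
  fixes f g :: "'a::real_normed_vector \<Rightarrow> real"
  shows "C_k_on k UNIV f \<Longrightarrow> C_k_on k UNIV g \<Longrightarrow> C_k_on k UNIV (\<lambda>x. f x * g x)"
proof (induction k arbitrary: f g)
  case 0 then show ?case by (auto intro: continuous_on_mult)
next
  case (Suc k)
  show ?case
    by (rule C_k_on_SucI[OF has_derivative_mult[OF C_k_on_SucD(1)[OF Suc.prems(1)] C_k_on_SucD(1)[OF Suc.prems(2)]]])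
       (intro C_k_on_add Suc.IH C_k_on_SucD Suc.prems C_k_on_mono[OF Suc.prems(1)] C_k_on_mono[OF Suc.prems(2)])
qed

lemma smooth_derivative: "smooth f \<Longrightarrow> smooth (\<lambda>x. frechet_derivative f (at x) v)"
  unfolding smooth_def using C_k_on_SucD(2) by blast

lemma smooth_has_derivative: "smooth f \<Longrightarrow> (f has_derivative frechet_derivative f (at x)) (at x)"
  unfolding smooth_def using C_k_on_SucD(1) by blast

lemma smooth_continuous: "smooth f \<Longrightarrow> continuous_on UNIV f"
  unfolding smooth_def by (metis C_k_on.simps(1))

lemma C_k_on_compose:
  fixes f :: "'a::real_normed_vector \<Rightarrow> real" and g :: "real \<Rightarrow> real"
  shows "smooth g \<Longrightarrow> C_k_on k UNIV f \<Longrightarrow> C_k_on k UNIV (\<lambda>x. g (f x))"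
proof (induction k arbitrary: g)
  case 0
  have "continuous_on UNIV f" using 0(2) by simp
  then show ?case using continuous_on_compose2[OF smooth_continuous[OF 0(1)], of UNIV f] by simp
next
  case (Suc k)
  have eq: "frechet_derivative g (at y) v = v * frechet_derivative g (at y) 1" for y v
    using linear_scale[OF has_derivative_linear[OF smooth_has_derivative[OF Suc.prems(1)]], of y v 1] by simp
  have "((\<lambda>x. g (f x)) has_derivative (\<lambda>v. frechet_derivative f (at x) v * frechet_derivative g (at (f x)) 1)) (at x)" for x
    using has_derivative_compose[OF C_k_on_SucD(1)[OF Suc.prems(2)] smooth_has_derivative[OF Suc.prems(1)], of x]
    by (subst (asm) eq)
  then show ?case
    by (rule C_k_on_SucI)
       (intro C_k_on_mult C_k_on_SucD(2)[OF Suc.prems(2)] Suc.IH[OF smooth_derivative[OF Suc.prems(1)]] C_k_on_mono[OF Suc.prems(2)])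
qed

text \<open>The functions \<open>s\<^sup>-\<^sup>n exp (- 1/s)\<close>, extended by \<open>0\<close>; their linear span is closed under differentiation.\<close>

definition flat :: "nat \<Rightarrow> real \<Rightarrow> real" where
  "flat n s = (if s > 0 then (1/s)^n * exp (- (1/s)) else 0)"

lemma flat_nonneg: "flat n s \<ge> 0" by (simp add: flat_def)

lemma flat_tendsto_0: "(flat n \<longlongrightarrow> 0) (at_right 0)"
proof -
  have "((\<lambda>x::real. x ^ n / exp x) \<longlongrightarrow> 0) at_top" for n :: nat
    by (rule tendsto_power_div_exp_0)
  from filterlim_compose[OF this filterlim_inverse_at_top_right]
  have "((\<lambda>s. (inverse s)^n / exp (inverse s)) \<longlongrightarrow> 0) (at_right (0::real))" .
  then show ?thesis
    by (rule Lim_transform_eventually)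
       (auto simp: eventually_at_filter flat_def exp_minus field_simps inverse_eq_divide)
qed

lemma flat_has_derivative: "(flat n has_real_derivative (flat (n+2) s - real n * flat (n+1) s)) (at s)"
proof -
  consider "s > 0" | "s < 0" | "s = 0" by linarith
  then show ?thesis
  proof cases
    case 1
    have "((\<lambda>s. (1/s)^n * exp (- (1/s))) has_real_derivative (flat (n+2) s - real n * flat (n+1) s)) (at s)"
      using 1 by (auto intro!: derivative_eq_intros simp: flat_def power2_eq_square field_simps power_Suc split: if_splits) (cases n; simp add: field_simps)
    then show ?thesis
      by (rule has_field_derivative_transform_within_open[where S="{0<..}"]) (use 1 in \<open>auto simp: flat_def\<close>)
  next
    case 2
    have "(flat n has_real_derivative 0) (at s)"
      by (rule has_field_derivative_transform_within_open[OF DERIV_const[of 0], where S="{..<0}"])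
         (use 2 in \<open>auto simp: flat_def\<close>)
    then show ?thesis using 2 by (simp add: flat_def)
  next
    case 3
    have "((\<lambda>h. (flat n (0 + h) - flat n 0) / h) \<longlongrightarrow> 0) (at 0)"
      unfolding filterlim_at_split
    proof
      show "((\<lambda>h. (flat n (0 + h) - flat n 0) / h) \<longlongrightarrow> 0) (at_left 0)"
        by (rule tendsto_eventually) (auto simp: eventually_at_filter flat_def)
      \<comment> \<open>For positive \<open>h\<close> the difference quotient of
        \<open>flat n\<close> at 0 is \<open>flat (Suc n) h\<close>.\<close>
      show "((\<lambda>h. (flat n (0 + h) - flat n 0) / h) \<longlongrightarrow> 0) (at_right 0)"
        by (rule Lim_transform_eventually[OF flat_tendsto_0[of "Suc n"]])
           (auto simp: eventually_at_filter flat_def)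
    qed
    then show ?thesis unfolding 3 DERIV_def by (simp add: flat_def)
  qed
qed

lemma smooth_flat: "smooth (flat n)"
proof -
  have "C_k_on k UNIV (flat n)" for k
  proof (induction k arbitrary: n)
    case 0
    have "continuous_on UNIV (flat n)"
      by (intro continuous_at_imp_continuous_on ballI DERIV_isCont[OF flat_has_derivative])
    then show ?case by simp
  next
    case (Suc k)
    have "(flat n has_derivative (\<lambda>v. (flat (n+2) s + (- real n) * flat (n+1) s) * v)) (at s)" for s
      using flat_has_derivative[of n s] by (simp add: has_field_derivative_def)
    then show ?case
      by (rule C_k_on_SucI) (intro C_k_on_add C_k_on_mult C_k_on_const Suc)
  qed
  then show ?thesis by (simp add: smooth_def)
qed

lemma C_k_on_inner_const:
  fixes a :: "'a::real_inner"
  shows "C_k_on k UNIV (\<lambda>z. z \<bullet> a)"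
proof (cases k)
  case (Suc j)
  then show ?thesis
    by (auto intro!: C_k_on_SucI[where f' = "\<lambda>_ v. v \<bullet> a"] C_k_on_const derivative_eq_intros simp del: C_k_on.simps)
qed (auto intro!: continuous_intros)

lemma C_k_on_norm_square:
  shows "C_k_on k UNIV (\<lambda>z::'a::real_inner. c + (- 1) * (z \<bullet> z))"
proof (cases k)
  case (Suc j)
  have "((\<lambda>z. c + (- 1) * (z \<bullet> z)) has_derivative (\<lambda>v. (-2) * (z \<bullet> v))) (at z)" for z :: 'a
    by (auto intro!: derivative_eq_intros simp: inner_commute)
  then show ?thesis unfolding Suc
    by (rule C_k_on_SucI) (intro C_k_on_mult C_k_on_const C_k_on_inner_const)
qed (auto intro!: continuous_intros)

text \<open>The radicand is written as a sum with \<open>(- 1) *\<close> to match the closure of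
  \<open>C_k_on\<close> under sums and products.\<close>

definition bump :: "real \<Rightarrow> 'a::euclidean_space \<Rightarrow> real" where
  "bump e z = flat 0 (e\<^sup>2 + (- 1) * (z \<bullet> z))"

lemma smooth_bump: "smooth (bump e)"
  unfolding smooth_def bump_def using C_k_on_compose[OF smooth_flat C_k_on_norm_square] by blast

lemma bump_nonneg: "bump e z \<ge> 0" by (simp add: bump_def flat_nonneg)

lemma bump_support: "e > 0 \<Longrightarrow> norm z > e \<Longrightarrow> bump e z = 0"
  using power_strict_mono[of e "norm z" 2] by (simp add: bump_def flat_def dot_square_norm)

lemma bump_integrable:
  assumes "e > 0" shows "L1 (bump e :: 'a::euclidean_space \<Rightarrow> real)"
proof -
  have c: "continuous_on UNIV (bump e :: 'a \<Rightarrow> real)" by (rule smooth_continuous[OF smooth_bump])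
  have "L1 (\<lambda>x::'a. indicator (cball 0 e) x *\<^sub>R bump e x)"
    by (intro borel_integrable_compact continuous_on_subset[OF c]) auto
  moreover have "(\<lambda>x::'a. indicator (cball 0 e) x *\<^sub>R bump e x) = bump e"
    using bump_support[OF assms] by (auto simp: indicator_def fun_eq_iff not_le)
  ultimately show ?thesis by metis
qed

lemma bump_integral_pos:
  assumes "e > 0" shows "(LBINT z. bump e (z::'a::euclidean_space)) > 0"
proof -
  have n: "\<not> (AE z in lborel. bump e (z::'a) = 0)"
  proof
    assume ae: "AE z in lborel. bump e (z::'a) = 0"
    have "(ball 0 e :: 'a set) \<in> null_sets lborel"
    proof -
      have "AE z in lborel. z \<notin> (ball 0 e :: 'a set)"
        using ae
      proof eventually_elim
        case (elim z)
        show ?case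
        proof
          assume "z \<in> ball 0 e"
          then have "(norm z)\<^sup>2 < e\<^sup>2" by (intro power_strict_mono) auto
          then have "bump e z > 0" by (simp add: bump_def flat_def dot_square_norm)
          then show False using elim by simp
        qed
      qed
      then show ?thesis
        by (subst AE_iff_null_sets) auto
    qed
    then have "negligible (ball 0 e :: 'a set)"
      by (simp add: negligible_iff_null_sets null_sets_completionI)
    then show False using open_not_negligible[of "ball 0 e :: 'a set"] assms by simp
  qed
  have "(LBINT z. bump e (z::'a)) \<noteq> 0"
    using n integral_nonneg_eq_0_iff_AE[OF bump_integrable[OF assms, where 'a='a]] by (simp add: bump_nonneg)
  moreover have "(LBINT z. bump e (z::'a)) \<ge> 0" by (simp add: bump_nonneg)
  ultimately show ?thesis by linarith
qed

definition moll :: "real \<Rightarrow> 'a::euclidean_space \<Rightarrow> real" where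
  "moll e z = bump e z * inverse (LBINT z. bump e (z::'a))"

lemma smooth_moll: "smooth (moll e)"
  using smooth_bump C_k_on_mult C_k_on_const unfolding smooth_def moll_def[abs_def] by blast

lemma moll_nonneg: "moll e z \<ge> 0"
  by (simp add: moll_def bump_nonneg)

lemma moll_support: "e > 0 \<Longrightarrow> norm z > e \<Longrightarrow> moll e z = 0"
  by (simp add: moll_def bump_support)

lemma moll_integrable: "e > 0 \<Longrightarrow> L1 (moll e)"
  unfolding moll_def[abs_def] by (simp add: bump_integrable)

lemma moll_integral: "e > 0 \<Longrightarrow> (LBINT z. moll e (z::'a::euclidean_space)) = 1"
  unfolding moll_def using bump_integral_pos[where 'a='a, of e] by simp

lemma cgrad_smooth:
  fixes f :: "'a::euclidean_space \<Rightarrow> real"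
  assumes "smooth f"
  shows "cgrad f (\<lambda>z. \<Sum>b\<in>Basis. frechet_derivative f (at z) b *\<^sub>R b)"
  unfolding cgrad_def
proof (intro conjI allI)
  fix z
  have "(\<Sum>b\<in>Basis. frechet_derivative f (at z) b *\<^sub>R b) \<bullet> v = frechet_derivative f (at z) v" for v
  proof -
    have l: "linear (frechet_derivative f (at z))"
      using has_derivative_linear[OF smooth_has_derivative[OF assms]] .
    have "frechet_derivative f (at z) v = frechet_derivative f (at z) (\<Sum>b\<in>Basis. (v \<bullet> b) *\<^sub>R b)"
      by (simp add: euclidean_representation)
    also have "\<dots> = (\<Sum>b\<in>Basis. (v \<bullet> b) * frechet_derivative f (at z) b)"
      by (simp add: linear_sum[OF l] linear_scale[OF l])
    finally show ?thesis by (simp add: inner_sum_left inner_commute[of v] mult.commute)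
  qed
  then show "(f has_derivative (\<bullet>) (\<Sum>b\<in>Basis. frechet_derivative f (at z) b *\<^sub>R b)) (at z)"
    by (intro has_derivative_eq_rhs[OF smooth_has_derivative[OF assms, of z]]) auto
next
  show "continuous_on UNIV (\<lambda>z. \<Sum>b\<in>Basis. frechet_derivative f (at z) b *\<^sub>R b)"
    by (intro continuous_intros smooth_continuous smooth_derivative assms)
qed

text \<open>All derivatives fall on the kernel. A directional derivative of a smooth kernel
  supported in the ball of radius \<open>r\<close> is again such a kernel, so the induction on the
  order runs over all kernels at once.\<close>

lemma smooth_conv:
  fixes k :: "'a::euclidean_space \<Rightarrow> real"
  assumes f: "locint f"
  shows "smooth k \<Longrightarrow> (\<And>z. norm z > r \<Longrightarrow> k z = 0) \<Longrightarrow> smooth (conv f k)"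
proof -
  have "smooth k \<Longrightarrow> (\<And>z. norm z > r \<Longrightarrow> k z = 0) \<Longrightarrow> C_k_on n UNIV (conv f k)" for n
  proof (induction n arbitrary: k)
    case 0
    then show ?case using conv_continuous[OF f smooth_continuous[OF 0(1)] 0(2)] by simp
  next
    case (Suc n)
    obtain D where D: "cgrad k D" using cgrad_smooth[OF Suc.prems(1)] by blast
    have Ds: "D z = 0" if "norm z > r" for z
      by (rule cgrad_zero_outside[OF D, of "cball 0 r"]) (use Suc.prems(2) that in auto)
    have Dv: "D z \<bullet> v = frechet_derivative k (at z) v" for z v
      using frechet_derivative_eq[OF cgradD[OF D]] by simp
    have "conv f D x \<bullet> v = conv f (\<lambda>z. frechet_derivative k (at z) v) x" for x v
      unfolding conv_def
      using integral_inner_left[OF conv_integrable[OF f cgrad_continuous_grad[OF D] Ds, where x=x], of v]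
      by (auto simp: Dv)
    then have *: "(conv f k has_derivative (\<lambda>v. conv f (\<lambda>z. frechet_derivative k (at z) v) x)) (at x)" for x
      using cgradD[OF cgrad_conv[OF f D Suc.prems(2)], where z=x] by simp
    show ?case
    proof (rule C_k_on_SucI[OF *])
      fix v
      show "C_k_on n UNIV (\<lambda>x. conv f (\<lambda>z. frechet_derivative k (at z) v) x)"
        by (rule Suc.IH[OF smooth_derivative[OF Suc.prems(1)]]) (use Ds in \<open>auto simp: Dv[symmetric]\<close>)
    qed
  qed
  then show "smooth k \<Longrightarrow> (\<And>z. norm z > r \<Longrightarrow> k z = 0) \<Longrightarrow> smooth (conv f k)"
    by (simp add: smooth_def)
qed

section \<open>Measure-preserving maps, and monotone maps on fibres\<close>

lemma lborel_distr_reflect: "distr lborel borel (\<lambda>y::'a::euclidean_space. x - y) = lborel"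
proof -
  have "lborel = density (distr lborel borel (\<lambda>y::'a. x + (-1) *\<^sub>R y)) (\<lambda>_. ennreal (\<bar>-1\<bar> ^ DIM('a)))"
    by (rule lborel_affine) simp
  then show ?thesis by (simp add: density_1)
qed

lemma lborel_distr_shift: "distr lborel borel (\<lambda>y::'a::euclidean_space. y + x) = lborel"
proof -
  have "(\<lambda>y::'a. y + x) = (+) x" by (auto simp: add.commute)
  then show ?thesis by (simp add: lborel_distr_plus)
qed

lemma lborel_integral_reflect:
  fixes f :: "'a::euclidean_space \<Rightarrow> 'b::{banach,second_countable_topology}"
  assumes "f \<in> borel_fun"
  shows "(LBINT y. f (x - y)) = (LBINT y. f y)"
proof -
  have "(LBINT y. f y) = (LINT y|distr lborel borel (\<lambda>y. x - y). f y)"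
    by (simp add: lborel_distr_reflect)
  also have "\<dots> = (LBINT y. f (x - y))"
    by (rule integral_distr) (use assms in auto)
  finally show ?thesis by simp
qed

lemma conv_commute:
  assumes [measurable]: "f \<in> borel_fun" "g \<in> borel_fun"
  shows "conv f g x = conv g f x"
proof -
  have "conv f g x = (LBINT y. f (x - y) *\<^sub>R g (x - (x - y)))"
    unfolding conv_def by (subst lborel_integral_reflect[of "\<lambda>y. f y *\<^sub>R g (x - y)" x]) auto
  then show ?thesis by (simp add: conv_def mult.commute)
qed

lemma nn_integral_prod_lborel:
  fixes g :: "real \<times> real \<Rightarrow> ennreal"
  assumes "g \<in> borel_fun"
  shows "(\<integral>\<^sup>+z. g z \<partial>lborel) = (\<integral>\<^sup>+x. \<integral>\<^sup>+y. g (x, y) \<partial>lborel \<partial>lborel)"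
  using lborel.nn_integral_fst[of g lborel] assms by (simp add: lborel_prod)

text \<open>On each vertical line \<open>F\<close> is a strictly increasing bijection with density
  \<open>f\<close>, hence pushes the measure \<open>f dy\<close> to Lebesgue measure. Integrating
  over the lines gives the area formula for \<open>(x, y) \<mapsto> (x, F (x, y))\<close> with
  Jacobian \<open>f\<close>.\<close>

lemma fiber_map:
  fixes f F :: "real \<times> real \<Rightarrow> real"
  assumes fm[measurable]: "f \<in> borel_fun" and Fm[measurable]: "F \<in> borel_fun"
    and pos: "\<And>z. f z > 0"
    and mono: "\<And>x y y'. y \<le> y' \<Longrightarrow> F (x, y) \<le> F (x, y')"
    and inc: "\<And>x y y'. y \<le> y' \<Longrightarrow> (\<integral>\<^sup>+s. ennreal (f (x, s)) * indicator {y..y'} s \<partial>lborel) = ennreal (F (x, y') - F (x, y))"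
    and surj: "\<And>x h. \<exists>y. F (x, y) = h"
  obtains G :: "real \<times> real \<Rightarrow> real" where "G \<in> borel_fun" "\<And>x h. F (x, G (x, h)) = h" "\<And>x y. G (x, F (x, y)) = y"
    "\<And>g :: real \<times> real \<Rightarrow> ennreal. g \<in> borel_fun \<Longrightarrow>
       (\<integral>\<^sup>+z. g (fst z, F z) * ennreal (f z) \<partial>lborel) = (\<integral>\<^sup>+z. g z \<partial>lborel)"
proof -
  have slice[measurable]: "(\<lambda>s. f (x, s)) \<in> borel_fun" "(\<lambda>s. F (x, s)) \<in> borel_fun" for x
    by (simp_all add: borel_prod[symmetric])
  \<comment> \<open>A flat piece of \<open>F\<close> would be an interval of positive length on
    which the positive density \<open>f\<close> has integral zero.\<close>
  have smono: "F (x, y) < F (x, y')" if "y < y'" for x y y'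
  proof (rule ccontr)
    assume "\<not> ?thesis"
    then have "(\<integral>\<^sup>+s. ennreal (f (x, s)) * indicator {y..y'} s \<partial>lborel) = 0"
      using inc[of y y' x] mono[of y y' x] that by simp
    then have "AE s in lborel. ennreal (f (x, s)) * indicator {y..y'} s = 0"
      by (subst (asm) nn_integral_0_iff_AE) auto
    then have "AE s in lborel. s \<notin> {y..y'}"
    proof eventually_elim
      case (elim s)
      then show ?case using pos[of "(x, s)"] by (auto simp: indicator_def ennreal_eq_0_iff split: if_splits)
    qed
    then have "emeasure lborel {y..y'} = 0"
      by (subst (asm) AE_iff_null_sets[symmetric]) auto
    then show False using that by simp
  qed
  have "\<forall>x h. \<exists>y. F (x, y) = h" using surj by blast
  then obtain G' where G': "\<And>x h. F (x, G' x h) = h" by metis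
  define G where "G = (\<lambda>z. G' (fst z) (snd z))"
  have FG: "F (x, G (x, h)) = h" for x h by (simp add: G_def G')
  have le_iff: "F (x, y) \<le> F (x, y') \<longleftrightarrow> y \<le> y'" and less_iff: "F (x, y) < F (x, y') \<longleftrightarrow> y < y'" for x y y'
    using smono[of y y' x] smono[of y' y x] by (cases y y' rule: linorder_cases; force)+
  have GF: "G (x, F (x, y)) = y" for x y
    using FG[of x "F (x, y)"] le_iff by (metis order_antisym order_refl)
  \<comment> \<open>The sublevel sets of the inverse are described by \<open>F\<close>:
    \<open>G w \<le> a\<close> holds exactly if \<open>snd w \<le> F (fst w, a)\<close>.\<close>
  have Gm: "G \<in> borel_fun"
    unfolding borel_measurable_iff_le
  proof
    fix a
    have "{w \<in> space borel. G w \<le> a} = {w. snd w \<le> F (fst w, a)}"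
      using le_iff FG by (auto simp: ) (metis le_iff FG prod.collapse)+
    also have "\<dots> \<in> sets borel"
    proof -
      have "(\<lambda>w::real \<times> real. (fst w, a)) \<in> borel_fun" "(snd :: real \<times> real \<Rightarrow> real) \<in> borel_fun"
        by (auto intro!: borel_measurable_continuous_onI continuous_intros)
      from this(2) measurable_compose[OF this(1) Fm] have "{w \<in> space borel. snd w \<le> F (fst w, a)} \<in> sets borel"
        by (rule borel_measurable_le)
      then show ?thesis by simp
    qed
    finally show "{w \<in> space borel. G w \<le> a} \<in> sets borel" .
  qed
  \<comment> \<open>Both measures agree on intervals: the preimage of \<open>(l, u)\<close> is the
    interval between two values of \<open>G\<close>, and its \<open>f\<close>-mass is the increment
    of \<open>F\<close>, namely \<open>u - l\<close>.\<close>
  have push: "distr (density lborel (\<lambda>y. ennreal (f (x, y)))) borel (\<lambda>y. F (x, y)) = lborel" for x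
  proof (rule lborel_eqI[symmetric])
    fix l u :: real assume "\<And>b. b \<in> Basis \<Longrightarrow> l \<bullet> b \<le> u \<bullet> b"
    then have lu: "l \<le> u" by simp
    have set: "(\<lambda>y. F (x, y)) -` box l u = {G (x, l)<..<G (x, u)}"
      using less_iff[of x] FG by (auto simp: box_real) (metis FG less_iff)+
    have "emeasure (distr (density lborel (\<lambda>y. ennreal (f (x, y)))) borel (\<lambda>y. F (x, y))) (box l u)
        = (\<integral>\<^sup>+s. ennreal (f (x, s)) * indicator {G (x, l)<..<G (x, u)} s \<partial>lborel)"
      by (subst emeasure_distr) (auto simp: set[unfolded box_real(1)] emeasure_density)
    also have "\<dots> = (\<integral>\<^sup>+s. ennreal (f (x, s)) * indicator {G (x, l)..G (x, u)} s \<partial>lborel)"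
    proof (rule nn_integral_cong_AE)
      show "AE s in lborel. ennreal (f (x, s)) * indicator {G (x, l)<..<G (x, u)} s = ennreal (f (x, s)) * indicator {G (x, l)..G (x, u)} s"
        using AE_lborel_singleton[of "G (x, l)"] AE_lborel_singleton[of "G (x, u)"]
        by eventually_elim (auto simp: indicator_def)
    qed
    also have "\<dots> = ennreal (u - l)"
      using inc[of "G (x, l)" "G (x, u)" x] le_iff[of x "G (x, l)" "G (x, u)"] lu by (simp add: FG)
    finally show "emeasure (distr (density lborel (\<lambda>y. ennreal (f (x, y)))) borel (\<lambda>y. F (x, y))) (box l u) = ennreal (\<Prod>b\<in>Basis. (u - l) \<bullet> b)"
      by simp
  qed simp
  have "(\<integral>\<^sup>+z. g (fst z, F z) * ennreal (f z) \<partial>lborel) = (\<integral>\<^sup>+z. g z \<partial>lborel)"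
    if gm: "g \<in> borel_fun" for g :: "real \<times> real \<Rightarrow> ennreal"
  proof -
    note gm[measurable]
    have gs[measurable]: "(\<lambda>s. g (x, s)) \<in> borel_fun" for x
      using gm by (simp add: borel_prod[symmetric])
    have m: "(\<lambda>z. g (fst z, F z) * ennreal (f z)) \<in> borel_fun"
      using gm fm Fm by (simp add: borel_prod[symmetric])
    have "(\<integral>\<^sup>+y. g (x, F (x, y)) * ennreal (f (x, y)) \<partial>lborel) = (\<integral>\<^sup>+h. g (x, h) \<partial>lborel)" for x
    proof -
      have "(\<integral>\<^sup>+h. g (x, h) \<partial>lborel) = (\<integral>\<^sup>+h. g (x, h) \<partial>distr (density lborel (\<lambda>y. ennreal (f (x, y)))) borel (\<lambda>y. F (x, y)))"
        by (simp add: push)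
      also have "\<dots> = (\<integral>\<^sup>+y. g (x, F (x, y)) \<partial>density lborel (\<lambda>y. ennreal (f (x, y))))"
        by (subst nn_integral_distr) auto
      also have "\<dots> = (\<integral>\<^sup>+y. ennreal (f (x, y)) * g (x, F (x, y)) \<partial>lborel)"
        by (subst nn_integral_density) auto
      finally show ?thesis by (simp add: mult.commute)
    qed
    then show ?thesis
      using nn_integral_prod_lborel[OF m] nn_integral_prod_lborel[OF gm] by simp
  qed
  then show ?thesis using that[OF Gm FG GF] by blast
qed

section \<open>The product rule along a line\<close>

text \<open>Unlike an oriented integral this is zero for \<open>b < a\<close>.\<close>

definition icc :: "real \<Rightarrow> real \<Rightarrow> (real \<Rightarrow> real) \<Rightarrow> real" where
  "icc a b f = (LBINT s. indicator {a..b} s * f s)"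

lemma icc_eq_integral:
  assumes "L1 f"
  shows "f integrable_on {a..b}" "icc a b f = integral {a..b} f"
proof -
  have "set_integrable lborel {a..b} f"
    using assms unfolding set_integrable_def by (intro integrable_mult_indicator) auto
  from set_borel_integral_eq_integral[OF this]
  show "f integrable_on {a..b}" "icc a b f = integral {a..b} f"
    by (auto simp: icc_def set_lebesgue_integral_def)
qed

lemma icc_split:
  assumes "L1 f" "a \<le> b" "b \<le> c"
  shows "icc a c f = icc a b f + icc b c f"
  using Henstock_Kurzweil_Integration.integral_combine[OF assms(2,3) icc_eq_integral(1)[OF assms(1)]]
  by (simp add: icc_eq_integral[OF assms(1)])

lemma icc_continuous: "L1 f \<Longrightarrow> continuous_on {a..b} (\<lambda>t. icc a t f)"
  using indefinite_integral_continuous_1[OF icc_eq_integral(1), of f a b] by (simp add: icc_eq_integral)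

lemma integrable_icc: "L1 f \<Longrightarrow> L1 (\<lambda>s. indicator {a..b::real} s * (f s :: real))"
  using integrable_mult_indicator[of "{a..b}" lborel f] by simp

text \<open>
  On a short interval \<open>[s, t]\<close> the increment of \<open>\<beta> Y \<cdot> F\<close> differs from the integral of \<open>\<beta> Y \<cdot> \<Delta>\<close> by
  at most \<open>L \<cdot> osc \<cdot> \<integral>(\<bar>\<Gamma>\<bar> + \<bar>\<Delta>\<bar>)\<close>; the hypothesis \<open>\<Gamma> F = 0\<close> turns \<open>(\<integral>\<Gamma>) F t\<close> into \<open>\<integral>\<Gamma> (F t - F r) dr\<close>. So
  only a Lipschitz bound on \<open>\<beta>\<close> is needed.
\<close>

lemma chain_rule_along_line:
  fixes Y F \<Gamma> \<Delta> \<beta> :: "real \<Rightarrow> real"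
  assumes G: "L1 \<Gamma>" and D: "L1 \<Delta>" and Ym[measurable]: "Y \<in> borel_fun"
    and Y: "AE t in lborel. 0 \<le> t \<longrightarrow> Y t = Y0 + icc 0 t \<Gamma>"
    and F: "AE t in lborel. 0 \<le> t \<longrightarrow> F t = F0 + icc 0 t \<Delta>"
    and GF: "AE t in lborel. 0 \<le> t \<longrightarrow> \<Gamma> t * F t = 0"
    and T: "T \<ge> 0" and suppF: "AE t in lborel. t > T \<longrightarrow> F t = 0" and suppD: "AE t in lborel. t > T \<longrightarrow> \<Delta> t = 0"
    and Lip: "\<And>x y. \<bar>\<beta> x - \<beta> y\<bar> \<le> L * \<bar>x - y\<bar>"
  shows "(LBINT t. indicator {0..} t * (\<beta> (Y t) * \<Delta> t)) = - \<beta> Y0 * F0"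
proof -
  have L0: "L \<ge> 0" using Lip[of 1 0] by simp
  have \<beta>c: "continuous_on UNIV \<beta>"
  proof (rule continuous_at_imp_continuous_on, intro ballI, unfold continuous_at_eps_delta, intro allI impI)
    fix x e :: real assume e: "e > 0"
    show "\<exists>d>0. \<forall>x'. dist x' x < d \<longrightarrow> dist (\<beta> x') (\<beta> x) < e"
    proof (intro exI[of _ "e / (L + 1)"] conjI allI impI)
      show "0 < e / (L + 1)" using e L0 by simp
      fix x' assume "dist x' x < e / (L + 1)"
      then have "(L + 1) * \<bar>x' - x\<bar> < e" using L0 by (simp add: dist_real_def field_simps)
      moreover have "L * \<bar>x' - x\<bar> \<le> (L + 1) * \<bar>x' - x\<bar>" by (intro mult_right_mono) auto
      ultimately show "dist (\<beta> x') (\<beta> x) < e" using Lip[of x' x] by (simp add: dist_real_def)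
    qed
  qed
  \<comment> \<open>Continuous representatives, equal to \<open>Y\<close> and \<open>F\<close> at
    almost all nonnegative times.\<close>
  define y f where "y = (\<lambda>t. Y0 + icc 0 t \<Gamma>)" and "f = (\<lambda>t. F0 + icc 0 t \<Delta>)"
  have yc: "continuous_on {0..T} y" and fc: "continuous_on {0..T} f"
    unfolding y_def f_def by (auto intro!: continuous_intros icc_continuous G D)
  \<comment> \<open>The coefficient \<open>\<beta> (y t)\<close>, set to zero outside
    \<open>[0, T]\<close> so that it is bounded and measurable on the whole line.\<close>
  define b where "b = (\<lambda>t. if t \<in> {0..T} then \<beta> (y t) else 0)"
  have bm[measurable]: "b \<in> borel_fun"
  proof -
    have "continuous_on {0..T} (\<lambda>t. \<beta> (y t))"
      by (rule continuous_on_compose2[OF \<beta>c yc]) auto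
    then have "(\<lambda>t. indicator {0..T} t *\<^sub>R \<beta> (y t)) \<in> borel_fun"
      by (intro borel_measurable_continuous_on_indicator) auto
    moreover have "(\<lambda>t. indicator {0..T} t *\<^sub>R \<beta> (y t)) = b" by (auto simp: b_def fun_eq_iff)
    ultimately show ?thesis by simp
  qed
  have "compact (y ` {0..T})" by (rule compact_continuous_image[OF yc]) auto
  then have "bounded (\<beta> ` y ` {0..T})"
    using compact_continuous_image[OF continuous_on_subset[OF \<beta>c]] by (blast intro: compact_imp_bounded)
  then obtain B where "\<And>t. t \<in> {0..T} \<Longrightarrow> \<bar>\<beta> (y t)\<bar> \<le> B" by (auto simp: bounded_iff) (metis atLeastAtMost_iff)
  then have B: "\<bar>b t\<bar> \<le> \<bar>B\<bar>" for t by (force simp: b_def)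
  have bD: "L1 (\<lambda>t. b t * \<Delta> t)"
  proof (rule Bochner_Integration.integrable_bound)
    show "L1 (\<lambda>t. \<bar>B\<bar> * \<bar>\<Delta> t\<bar>)" using D by auto
    show "AE t in lborel. norm (b t * \<Delta> t) \<le> norm (\<bar>B\<bar> * \<bar>\<Delta> t\<bar>)"
      using B by (auto simp: abs_mult intro!: mult_right_mono)
  qed (use D in \<open>auto simp: borel_measurable_integrable\<close>)
  \<comment> \<open>The defect in the product rule
    \<open>d (\<beta> y * f) = \<beta> y * df\<close>, in which the term with \<open>dy\<close> is
    absent because \<open>\<Gamma> * F = 0\<close>. The aim is that \<open>E\<close> has the same
    value at 0 and \<open>T\<close>.\<close>
  define E where "E = (\<lambda>t. \<beta> (y t) * f t - icc 0 t (\<lambda>t. b t * \<Delta> t))"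
  define \<mu> where "\<mu> = (\<lambda>t. icc 0 t (\<lambda>t. \<bar>\<Gamma> t\<bar> + \<bar>\<Delta> t\<bar>))"
  have GDi: "L1 (\<lambda>t. \<bar>\<Gamma> t\<bar> + \<bar>\<Delta> t\<bar>)" using G D by auto
  have step: "\<bar>E t - E s\<bar> \<le> L * e * (\<mu> t - \<mu> s)"
    if st: "0 \<le> s" "s \<le> t" "t \<le> T" and e: "e \<ge> 0"
      and oy: "\<And>r. r \<in> {s..t} \<Longrightarrow> \<bar>y r - y s\<bar> \<le> e" and off: "\<And>r. r \<in> {s..t} \<Longrightarrow> \<bar>f t - f r\<bar> \<le> e" for s t e
  proof -
    have yst: "y t - y s = icc s t \<Gamma>" and fst: "f t - f s = icc s t \<Delta>"
      using icc_split[OF G, of 0 s t] icc_split[OF D, of 0 s t] st by (auto simp: y_def f_def)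
    have "E t - E s = (\<beta> (y t) - \<beta> (y s)) * f t + (\<beta> (y s) * (f t - f s) - icc s t (\<lambda>t. b t * \<Delta> t))"
      using icc_split[OF bD, of 0 s t] st by (simp add: E_def algebra_simps)
    also have "\<beta> (y s) * (f t - f s) - icc s t (\<lambda>t. b t * \<Delta> t) = icc s t (\<lambda>r. (\<beta> (y s) - b r) * \<Delta> r)"
    proof -
      have "icc s t (\<lambda>r. (\<beta> (y s) - b r) * \<Delta> r)
          = (LBINT r. \<beta> (y s) * (indicator {s..t} r * \<Delta> r) - indicator {s..t} r * (b r * \<Delta> r))"
        unfolding icc_def by (simp add: algebra_simps)
      also have "\<dots> = \<beta> (y s) * icc s t \<Delta> - icc s t (\<lambda>t. b t * \<Delta> t)"
        unfolding icc_def using integrable_icc[OF D, of s t] integrable_icc[OF bD, of s t]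
        by (subst Bochner_Integration.integral_diff) auto
      finally show ?thesis by (simp add: fst)
    qed
    finally have Est: "E t - E s = (\<beta> (y t) - \<beta> (y s)) * f t + icc s t (\<lambda>r. (\<beta> (y s) - b r) * \<Delta> r)" by simp
    have i1: "L1 (\<lambda>r. (\<beta> (y s) - b r) * \<Delta> r)" using bD D by (simp add: left_diff_distrib)
    have 2: "\<bar>icc s t (\<lambda>r. (\<beta> (y s) - b r) * \<Delta> r)\<bar> \<le> L * e * icc s t (\<lambda>r. \<bar>\<Delta> r\<bar>)"
    proof -
      have "\<bar>icc s t (\<lambda>r. (\<beta> (y s) - b r) * \<Delta> r)\<bar> \<le> (LBINT r. L * e * (indicator {s..t} r * \<bar>\<Delta> r\<bar>))"
        unfolding icc_def real_norm_def[symmetric]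
      proof (rule Bochner_Integration.integral_norm_bound_integral)
        show "L1 (\<lambda>r. indicator {s..t} r * ((\<beta> (y s) - b r) * \<Delta> r))" by (rule integrable_icc[OF i1])
        show "L1 (\<lambda>r. L * e * (indicator {s..t} r * norm (\<Delta> r)))"
          using D by (intro integrable_mult_right integrable_icc) auto
        fix r
        show "norm (indicator {s..t} r * ((\<beta> (y s) - b r) * \<Delta> r)) \<le> L * e * (indicator {s..t} r * norm (\<Delta> r))"
        proof (cases "r \<in> {s..t}")
          case True
          then have "\<bar>\<beta> (y s) - b r\<bar> \<le> L * \<bar>y s - y r\<bar>" using Lip[of "y s" "y r"] st by (simp add: b_def)
          also have "\<dots> \<le> L * e" using oy[OF True] L0 by (intro mult_left_mono) auto
          finally show ?thesis using True by (simp add: abs_mult mult_right_mono)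
        qed simp
      qed
      then show ?thesis by (simp add: icc_def)
    qed
    have 1: "\<bar>(\<beta> (y t) - \<beta> (y s)) * f t\<bar> \<le> L * e * icc s t (\<lambda>r. \<bar>\<Gamma> r\<bar>)"
    proof -
      have "\<bar>(\<beta> (y t) - \<beta> (y s)) * f t\<bar> \<le> L * \<bar>y t - y s\<bar> * \<bar>f t\<bar>"
        unfolding abs_mult by (intro mult_right_mono Lip) auto
      also have "\<dots> = L * \<bar>icc s t \<Gamma> * f t\<bar>" by (simp add: yst abs_mult)
      also have "icc s t \<Gamma> * f t = (LBINT r. indicator {s..t} r * (\<Gamma> r * (f t - f r)))"
      proof -
        have "icc s t \<Gamma> * f t = (LBINT r. indicator {s..t} r * \<Gamma> r * f t)"
          by (simp add: icc_def)
        also have "\<dots> = (LBINT r. indicator {s..t} r * (\<Gamma> r * (f t - f r)))"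
        proof (rule integral_cong_AE)
          have [measurable]: "\<Gamma> \<in> borel_fun" using G by (simp add: borel_measurable_integrable)
          have fi: "(\<lambda>r. indicator {s..t} r *\<^sub>R f r) \<in> borel_fun"
            by (intro borel_measurable_continuous_on_indicator continuous_on_subset[OF fc]) (use st in auto)
          have "(\<lambda>r. indicator {s..t} r * \<Gamma> r * f t - \<Gamma> r * (indicator {s..t} r *\<^sub>R f r)) \<in> borel_fun"
            using fi by measurable
          then show "(\<lambda>r. indicator {s..t} r * (\<Gamma> r * (f t - f r))) \<in> borel_measurable lborel"
            by (simp add: algebra_simps)
          show "AE r in lborel. indicator {s..t} r * \<Gamma> r * f t = indicator {s..t} r * (\<Gamma> r * (f t - f r))"
            using F GF by eventually_elim (use st in \<open>auto simp: indicator_def f_def algebra_simps\<close>)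
        qed (use G in \<open>auto simp: borel_measurable_integrable\<close>)
        finally show ?thesis .
      qed
      also have "L * \<bar>LBINT r. indicator {s..t} r * (\<Gamma> r * (f t - f r))\<bar> \<le> L * (LBINT r. e * (indicator {s..t} r * \<bar>\<Gamma> r\<bar>))"
        unfolding real_norm_def[symmetric]
      proof (intro mult_left_mono[OF _ L0] integral_norm_bound_integral)
        show "norm (LBINT r. indicat_real {s..t} r * (\<Gamma> r * (f t - f r))) \<le> (LBINT r. e * (indicat_real {s..t} r * norm (\<Gamma> r)))"
        proof (rule order_trans[OF integral_norm_bound integral_mono'])
          show "L1 (\<lambda>r. e * (indicat_real {s..t} r * norm (\<Gamma> r)))"
            using G by (intro integrable_mult_right integrable_icc) auto
          fix r
          show "norm (indicat_real {s..t} r * (\<Gamma> r * (f t - f r))) \<le> e * (indicat_real {s..t} r * norm (\<Gamma> r))"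
            using off[of r] by (auto simp: indicator_def abs_mult mult.commute[of "\<bar>\<Gamma> r\<bar>"] intro!: mult_right_mono)
        qed (use e in auto)
      qed
      finally show ?thesis by (simp add: icc_def)
    qed
    have "\<mu> t - \<mu> s = icc s t (\<lambda>r. \<bar>\<Gamma> r\<bar>) + icc s t (\<lambda>r. \<bar>\<Delta> r\<bar>)"
      using icc_split[OF GDi, of 0 s t] st integrable_icc[of "\<lambda>r. \<bar>\<Gamma> r\<bar>" s t] integrable_icc[of "\<lambda>r. \<bar>\<Delta> r\<bar>" s t] G D
      by (simp add: \<mu>_def) (simp add: icc_def distrib_left)
    then show ?thesis unfolding Est using 1 2 abs_triangle_ineq[of "(\<beta> (y t) - \<beta> (y s)) * f t" "icc s t (\<lambda>r. (\<beta> (y s) - b r) * \<Delta> r)"]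
      by (simp add: distrib_left)
  qed
  \<comment> \<open>Cut \<open>[0, T]\<close> into equal steps shorter than the modulus of
    continuity of \<open>y\<close> and \<open>f\<close> for \<open>e\<close>. The bounds of the
    single steps telescope through \<open>\<mu>\<close>, and \<open>e\<close> is arbitrary.\<close>
  have bound: "\<bar>E T - E 0\<bar> \<le> L * e * (\<mu> T - \<mu> 0)" if e: "e > 0" for e
  proof -
    have "uniformly_continuous_on {0..T} y" "uniformly_continuous_on {0..T} f"
      using yc fc by (auto intro: compact_uniformly_continuous)
    then obtain d1 d2 where d: "d1 > 0" "d2 > 0"
      "\<And>r s. r \<in> {0..T} \<Longrightarrow> s \<in> {0..T} \<Longrightarrow> \<bar>r - s\<bar> < d1 \<Longrightarrow> \<bar>y r - y s\<bar> < e"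
      "\<And>r s. r \<in> {0..T} \<Longrightarrow> s \<in> {0..T} \<Longrightarrow> \<bar>r - s\<bar> < d2 \<Longrightarrow> \<bar>f r - f s\<bar> < e"
      using e unfolding uniformly_continuous_on_def dist_real_def by metis
    define d where "d = min d1 d2"
    have d0: "d > 0" using d by (simp add: d_def)
    obtain N :: nat where N: "real N > T / d" using reals_Archimedean2 by blast
    have N0: "N > 0" using N T d0 by (cases N) (auto simp: field_simps)
    define h where "h = T / real N"
    have h: "0 \<le> h" "h < d" using N N0 T d0 by (auto simp: h_def field_simps)
    have "k \<le> N \<Longrightarrow> \<bar>E (real k * h) - E 0\<bar> \<le> L * e * (\<mu> (real k * h) - \<mu> 0)" for k
    proof (induction k)
      case (Suc k)
      have le: "real (Suc k) * h \<le> T"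
      proof -
        have "real (Suc k) * h \<le> real N * h" using Suc.prems h by (intro mult_right_mono) auto
        then show ?thesis using N0 by (simp add: h_def)
      qed
      have "\<bar>E (real (Suc k) * h) - E (real k * h)\<bar> \<le> L * e * (\<mu> (real (Suc k) * h) - \<mu> (real k * h))"
      proof (rule step)
        show 0: "0 \<le> real k * h" using h by simp
        show 1: "real k * h \<le> real (Suc k) * h" using h by (intro mult_right_mono) auto
        have w: "real (Suc k) * h - real k * h = h" by (simp add: algebra_simps)
        have r: "r \<in> {0..T}" "\<bar>r - real k * h\<bar> < d" "\<bar>real (Suc k) * h - r\<bar> < d"
          if "r \<in> {real k * h..real (Suc k) * h}" for r
          using that 0 le w h(2) unfolding atLeastAtMost_iff by linarith+
        have k: "real k * h \<in> {0..T}" "real (Suc k) * h \<in> {0..T}"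
          using 0 1 le unfolding atLeastAtMost_iff by linarith+
        show "\<bar>y r - y (real k * h)\<bar> \<le> e" if "r \<in> {real k * h..real (Suc k) * h}" for r
          using d(3)[OF r(1)[OF that] k(1)] r(2)[OF that] by (simp add: d_def)
        show "\<bar>f (real (Suc k) * h) - f r\<bar> \<le> e" if "r \<in> {real k * h..real (Suc k) * h}" for r
          using d(4)[OF k(2) r(1)[OF that]] r(3)[OF that] by (simp add: d_def)
      qed (use le e in auto)
      then show ?case using Suc by (simp add: right_diff_distrib)
    qed simp
    from this[of N] show ?thesis using N0 by (simp add: h_def)
  qed
  have ET: "E T = E 0"
  proof (rule ccontr)
    assume ne: "E T \<noteq> E 0"
    define M where "M = L * (\<mu> T - \<mu> 0)"
    have b': "\<bar>E T - E 0\<bar> \<le> e * M" if "e > 0" for e using bound[OF that] by (simp add: M_def mult_ac)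
    have "\<bar>E T - E 0\<bar> \<le> \<bar>E T - E 0\<bar> / (2 * (\<bar>M\<bar> + 1)) * M"
      using ne by (intro b') (simp add: zero_less_divide_iff)
    also have "\<dots> \<le> \<bar>E T - E 0\<bar> / (2 * (\<bar>M\<bar> + 1)) * (\<bar>M\<bar> + 1)"
      by (intro mult_left_mono) auto
    also have "\<dots> = \<bar>E T - E 0\<bar> / 2"
    proof -
      have "\<bar>M\<bar> + 1 \<noteq> 0" by linarith
      then show ?thesis by (simp add: field_simps)
    qed
    finally show False using ne by simp
  qed
  have icc0: "icc 0 0 g = 0" for g :: "real \<Rightarrow> real"
  proof -
    have "(\<lambda>s. indicat_real {0..0} s * g s) = (\<lambda>s. g 0 * indicat_real {0} s)"
      by (auto simp: indicator_def fun_eq_iff)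
    then show ?thesis by (simp add: icc_def)
  qed
  \<comment> \<open>After \<open>T\<close> the primitive \<open>f\<close> is constant, since
    \<open>\<Delta>\<close> vanishes there, and almost everywhere zero, since \<open>F\<close>
    does.\<close>
  have fT: "f T = 0"
  proof -
    have "AE t in lborel. t > T \<longrightarrow> f t = 0"
      using F suppF by eventually_elim (use T in \<open>auto simp: f_def\<close>)
    moreover have "f t = f T" if "t > T" for t
    proof -
      have "icc T t \<Delta> = (LINT s::real|lborel. 0)" unfolding icc_def
      proof (rule integral_cong_AE)
        show "AE s in lborel. indicator {T..t} s * \<Delta> s = 0"
          using suppD AE_lborel_singleton[of T] by eventually_elim (auto simp: indicator_def)
      qed (use D in \<open>auto simp: borel_measurable_integrable\<close>)
      then show ?thesis using icc_split[OF D, of 0 T t] that T by (simp add: f_def)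
    qed
    ultimately have "AE t in lborel. t > T \<longrightarrow> f T = 0" by auto
    then have "f T = 0 \<or> (AE t in lborel. t \<notin> {T<..<T+1})"
      by (cases "f T = 0") (auto elim!: eventually_mono)
    moreover have "\<not> (AE t in lborel. t \<notin> {T<..<T+1})"
    proof
      assume "AE t in lborel. t \<notin> {T<..<T+1}"
      then have "emeasure lborel {T<..<T+1} = 0" by (subst (asm) AE_iff_null_sets[symmetric]) auto
      then show False by simp
    qed
    ultimately show ?thesis by blast
  qed
  have "(LBINT t. indicator {0..} t * (\<beta> (Y t) * \<Delta> t)) = icc 0 T (\<lambda>t. b t * \<Delta> t)"
    unfolding icc_def
  proof (rule integral_cong_AE)
    have [measurable]: "\<beta> \<in> borel_fun" "\<Delta> \<in> borel_fun"
      using \<beta>c D by (auto simp: borel_measurable_integrable intro: borel_measurable_continuous_onI)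
    show "(\<lambda>t. indicator {0..} t * (\<beta> (Y t) * \<Delta> t)) \<in> borel_measurable lborel"
      "(\<lambda>t. indicator {0..T} t * (b t * \<Delta> t)) \<in> borel_measurable lborel" by measurable
    show "AE t in lborel. indicator {0..} t * (\<beta> (Y t) * \<Delta> t) = indicator {0..T} t * (b t * \<Delta> t)"
      using Y suppD by eventually_elim (auto simp: indicator_def b_def y_def)
  qed
  also have "\<dots> = - \<beta> Y0 * F0"
    using ET fT by (simp add: E_def y_def f_def icc0)
  finally show ?thesis .
qed

section \<open>Fubini's theorem and one-dimensional cutoffs\<close>

lemma lborel_fubini:
  fixes f :: "'a::euclidean_space \<times> 'b::euclidean_space \<Rightarrow> real"
  assumes f: "L1 f"
  shows "AE x in lborel. L1 (\<lambda>y. f (x, y))" "L1 (\<lambda>x. LBINT y. f (x, y))"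
    "(LBINT x. LBINT y. f (x, y)) = (LBINT z. f z)"
    "AE y in lborel. L1 (\<lambda>x. f (x, y))" "L1 (\<lambda>y. LBINT x. f (x, y))"
    "(LBINT y. LBINT x. f (x, y)) = (LBINT z. f z)"
proof -
  have f': "integrable (lborel \<Otimes>\<^sub>M lborel) (case_prod (\<lambda>x y. f (x, y)))"
    using f by (simp add: lborel_prod)
  show "AE x in lborel. L1 (\<lambda>y. f (x, y))" by (rule lborel_pair.AE_integrable_fst[OF f'])
  show "L1 (\<lambda>x. LBINT y. f (x, y))" by (rule lborel_pair.integrable_fst[OF f'])
  show "(LBINT x. LBINT y. f (x, y)) = (LBINT z. f z)"
    using lborel_pair.integral_fst[OF f'] by (simp add: lborel_prod)
  show "AE y in lborel. L1 (\<lambda>x. f (x, y))" by (rule lborel_pair.AE_integrable_snd[OF f'])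
  show "L1 (\<lambda>y. LBINT x. f (x, y))" by (rule lborel_pair.integrable_snd[OF f'])
  show "(LBINT y. LBINT x. f (x, y)) = (LBINT z. f z)"
    using lborel_pair.integral_snd[OF f'] by (simp add: lborel_prod)
qed

lemma borel_fst_snd [measurable]:
  "(fst :: 'a::euclidean_space \<times> 'b::euclidean_space \<Rightarrow> 'a) \<in> borel_fun"
  "(snd :: 'a::euclidean_space \<times> 'b::euclidean_space \<Rightarrow> 'b) \<in> borel_fun"
  by (auto intro!: borel_measurable_continuous_onI continuous_intros)

lemma borel_Pair: 
  fixes f :: "'c \<Rightarrow> 'a::euclidean_space" and g :: "'c \<Rightarrow> 'b::euclidean_space"
  assumes "f \<in> borel_measurable M" "g \<in> borel_measurable M"
  shows "(\<lambda>x. (f x, g x)) \<in> borel_measurable M"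
  using assms by (rule borel_measurable_Pair)

lemma integrable_prod_mult:
  fixes f :: "'a::euclidean_space \<Rightarrow> real" and g :: "'b::euclidean_space \<Rightarrow> real"
  assumes f: "L1 f" and g: "L1 g"
  shows "L1 (\<lambda>z. f (fst z) * g (snd z))"
proof -
  have [measurable]: "f \<in> borel_fun" "g \<in> borel_fun"
    using f g by (auto simp: borel_measurable_integrable)
  have "integrable (lborel \<Otimes>\<^sub>M lborel) (\<lambda>z. f (fst z) * g (snd z))"
    by (rule lborel_pair.Fubini_integrable) (use f g in \<open>auto simp: abs_mult\<close>)
  then show ?thesis by (simp add: lborel_prod)
qed

lemma integrable_dominated:
  fixes f :: "'a::euclidean_space \<Rightarrow> real" and g :: "'a \<Rightarrow> real"
  assumes "L1 g" "f \<in> borel_fun" "\<And>x. \<bar>f x\<bar> \<le> g x"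
  shows "L1 f"
  using assms by (intro Bochner_Integration.integrable_bound[OF assms(1)]) (auto intro!: AE_I2 order_trans[OF assms(3)])

definition C1 :: "(real \<Rightarrow> real) \<Rightarrow> (real \<Rightarrow> real) \<Rightarrow> bool" where
  "C1 f f' \<longleftrightarrow> (\<forall>x. (f has_real_derivative f' x) (at x)) \<and> continuous_on UNIV f'"

lemma C1D: "C1 f f' \<Longrightarrow> (f has_real_derivative f' x) (at x)" "C1 f f' \<Longrightarrow> continuous_on S f'"
  unfolding C1_def by (auto intro: continuous_on_subset)

lemma C1_continuous: assumes "C1 f f'" shows "continuous_on S f"
  by (rule continuous_at_imp_continuous_on) (use DERIV_isCont[OF C1D(1)[OF assms]] in simp)

lemma C1_affine: assumes f: "C1 f f'" shows "C1 (\<lambda>x. f (a * x + b)) (\<lambda>x. f' (a * x + b) * a)"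
  unfolding C1_def
proof (intro conjI allI)
  fix x
  have "((\<lambda>x. a * x + b) has_real_derivative a) (at x)" by (auto intro!: derivative_eq_intros)
  from DERIV_chain2[OF C1D(1)[OF f] this]
  show "((\<lambda>x. f (a * x + b)) has_real_derivative f' (a * x + b) * a) (at x)" .
next
  have "continuous_on UNIV (\<lambda>x. f' (a * x + b))"
    by (rule continuous_on_compose2[OF C1D(2)[OF f, of UNIV]]) (auto intro!: continuous_intros)
  then show "continuous_on UNIV (\<lambda>x. f' (a * x + b) * a)" by (intro continuous_intros)
qed

lemma C1_mult: assumes f: "C1 f f'" and g: "C1 g g'" shows "C1 (\<lambda>x. f x * g x) (\<lambda>x. f' x * g x + f x * g' x)"
  unfolding C1_def
proof (intro conjI allI)
  fix x
  show "((\<lambda>x. f x * g x) has_real_derivative f' x * g x + f x * g' x) (at x)"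
    using DERIV_mult[OF C1D(1)[OF f] C1D(1)[OF g], of x] by (simp add: add.commute mult.commute)
next
  show "continuous_on UNIV (\<lambda>x. f' x * g x + f x * g' x)"
    by (intro continuous_intros C1_continuous[OF f] C1_continuous[OF g] C1D(2)[OF f] C1D(2)[OF g])
qed

lemma cgrad_inner: "cgrad (\<lambda>z. z \<bullet> a) (\<lambda>_. a)"
  unfolding cgrad_def by (auto intro!: derivative_eq_intros simp: inner_commute)

lemma cgrad_C1:
  assumes "C1 f f'" "cgrad g D" shows "cgrad (\<lambda>z. f (g z)) (\<lambda>z. f' (g z) *\<^sub>R D z)"
  using assms unfolding C1_def by (intro cgrad_compose) auto

lemma cgrad_fst: "cgrad (\<lambda>z::real \<times> 'b::euclidean_space. fst z) (\<lambda>_. (1, 0))"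
proof -
  have "(\<lambda>z::real \<times> 'b. z \<bullet> (1, 0)) = fst" by (auto simp: fun_eq_iff inner_prod_def)
  then show ?thesis using cgrad_inner[of "(1, 0) :: real \<times> 'b"] by metis
qed

lemma cgrad_snd: "cgrad (\<lambda>z::'b::euclidean_space \<times> real. snd z) (\<lambda>_. (0, 1))"
proof -
  have "(\<lambda>z::'b \<times> real. z \<bullet> (0, 1)) = snd" by (auto simp: fun_eq_iff inner_prod_def)
  then show ?thesis using cgrad_inner[of "(0, 1) :: 'b \<times> real"] by metis
qed

text \<open>The standard smooth step between 0 and 1. Its symmetry \<open>sstep_reflect\<close>
  later yields a periodic partition of unity.\<close>

definition sstep :: "real \<Rightarrow> real" where
  "sstep x = flat 0 x / (flat 0 x + flat 0 (1 - x))"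

lemma sstep_denom: "flat 0 x + flat 0 (1 - x) > 0"
  by (cases "x > 0") (auto simp: flat_def intro: add_pos_nonneg)

lemma sstep_bounds: "0 \<le> sstep x" "sstep x \<le> 1"
  using sstep_denom[of x] flat_nonneg[of 0 x] flat_nonneg[of 0 "1 - x"] by (auto simp: sstep_def divide_simps)

lemma sstep_0: "x \<le> 0 \<Longrightarrow> sstep x = 0" by (simp add: sstep_def flat_def)

lemma sstep_1: "x \<ge> 1 \<Longrightarrow> sstep x = 1" using sstep_denom[of x] by (simp add: sstep_def flat_def)

lemma sstep_reflect: "sstep x + sstep (1 - x) = 1"
  using sstep_denom[of x] by (simp add: sstep_def add.commute add_divide_distrib[symmetric])

lemma C1_flat: "C1 (flat 0) (flat 2)"
proof -
  have "continuous_on UNIV (flat 2)" by (rule smooth_continuous[OF smooth_flat])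
  then show ?thesis using flat_has_derivative[of 0] by (simp add: C1_def numeral_2_eq_2)
qed

lemma C1_sstep: "\<exists>s'. C1 sstep s'"
proof -
  define n where "n = flat 0"
  define d where "d = (\<lambda>x. flat 0 x + flat 0 (1 - x))"
  define d' where "d' = (\<lambda>x. flat 2 x - flat 2 (1 - x))"
  have n: "(n has_real_derivative flat 2 x) (at x)" for x
    using C1_flat by (simp add: C1_def n_def)
  have "((\<lambda>x. flat 0 (1 - x)) has_real_derivative (- flat 2 (1 - x))) (at x)" for x
    using C1_affine[OF C1_flat, of "-1" 1] by (simp add: C1_def algebra_simps)
  from DERIV_add[OF n this] have d: "(d has_real_derivative d' x) (at x)" for x
    by (simp add: d_def d'_def n_def)
  have dpos: "d x \<noteq> 0" for x using sstep_denom[of x] by (simp add: d_def)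
  have c: "continuous_on UNIV (flat k)" for k by (rule smooth_continuous[OF smooth_flat])
  have "C1 sstep (\<lambda>x. (flat 2 x * d x - n x * d' x) / (d x * d x))"
    unfolding C1_def
  proof (intro conjI allI)
    fix x
    have "((\<lambda>x. n x / d x) has_real_derivative (flat 2 x * d x - n x * d' x) / (d x * d x)) (at x)"
      by (rule DERIV_divide[OF n d dpos])
    moreover have "(\<lambda>x. n x / d x) = sstep" by (auto simp: n_def d_def sstep_def)
    ultimately show "(sstep has_real_derivative (flat 2 x * d x - n x * d' x) / (d x * d x)) (at x)" by simp
  next
    have "continuous_on UNIV (\<lambda>x. flat k (1 - x))" for k
      by (rule continuous_on_compose2[OF c]) (auto intro!: continuous_intros)
    then have "continuous_on UNIV d" "continuous_on UNIV d'" "continuous_on UNIV n"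
      unfolding d_def d'_def n_def using c by (auto intro!: continuous_intros)
    then show "continuous_on UNIV (\<lambda>x. (flat 2 x * d x - n x * d' x) / (d x * d x))"
      using dpos c[of 2] by (intro continuous_intros) auto
  qed
  then show ?thesis by blast
qed

text \<open>C1 functions vanishing outside the open interval \<open>(c, d)\<close> and converging
  pointwise to its indicator as \<open>n\<close> grows.\<close>

definition plateau :: "real \<Rightarrow> real \<Rightarrow> nat \<Rightarrow> real \<Rightarrow> real" where
  "plateau c d n x = sstep (real n * (x - c)) * sstep (real n * (d - x))"

lemma plateau_bounds: "0 \<le> plateau c d n x" "plateau c d n x \<le> 1"
  using sstep_bounds by (auto simp: plateau_def intro: mult_le_one)

lemma plateau_outside: "x \<notin> {c<..<d} \<Longrightarrow> plateau c d n x = 0"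
  by (auto simp: plateau_def not_less mult_le_0_iff intro!: sstep_0)

lemma C1_plateau: "\<exists>p'. C1 (plateau c d n) p'"
proof -
  obtain s' where s: "C1 sstep s'" using C1_sstep by blast
  show ?thesis
    unfolding plateau_def[abs_def]
    using C1_mult[OF C1_affine[OF s, of "real n" "- real n * c"] C1_affine[OF s, of "- real n" "real n * d"]]
    by (auto simp: algebra_simps)
qed

lemma plateau_tendsto: "(\<lambda>n. plateau c d n x) \<longlonglongrightarrow> indicator {c<..<d} x"
proof (cases "x \<in> {c<..<d}")
  case True
  define e where "e = min (x - c) (d - x)"
  have e: "e > 0" using True by (simp add: e_def)
  obtain N :: nat where N: "real N > 1 / e" using reals_Archimedean2 by blast
  have "plateau c d n x = 1" if "n \<ge> N" for n
  proof -
    have "1 < real N * e" using N e by (simp add: field_simps)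
    also have "\<dots> \<le> real n * e" using that e by (intro mult_right_mono) auto
    finally have 1: "1 < real n * e" .
    have "real n * e \<le> real n * (x - c)" "real n * e \<le> real n * (d - x)"
      by (auto simp: e_def intro!: mult_left_mono)
    then show ?thesis using 1 by (simp add: plateau_def sstep_1)
  qed
  then show ?thesis using True by (auto intro!: tendsto_eventually eventually_sequentiallyI[of N])
qed (simp add: plateau_outside)

section \<open>From the weak equation to an integrated equation on almost every line\<close>

text \<open>Boxes form an intersection-stable generator of the Borel sets, so the sets over which
  \<open>f\<close> integrates to zero contain all Borel sets. Complements require the integral over
  the whole space, which is a limit of integrals over growing boxes.\<close>

lemma zero_integral_on_boxes:
  fixes f :: "'a::euclidean_space \<Rightarrow> real"
  assumes f: "L1 f" and box: "\<And>a b. (LBINT x. indicator (box a b) x * f x) = 0"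
  shows "AE x in lborel. f x = 0"
proof (rule sigma_finite_measure.density_zero[OF sigma_finite_lborel f])
  let ?E = "range (\<lambda>(a, b). box a b::'a set)"
  have all: "(LBINT x. f x) = 0"
  proof -
    have "(\<lambda>n. LBINT x. indicator (box (- (real n *\<^sub>R One)) (real n *\<^sub>R One)) x * f x) \<longlonglongrightarrow> (LBINT x. f x)"
    proof (rule integral_dominated_convergence[where w="\<lambda>x. \<bar>f x\<bar>"])
      show "AE x in lborel. (\<lambda>n. indicator (box (- (real n *\<^sub>R One)) (real n *\<^sub>R One)) x * f x) \<longlonglongrightarrow> f x"
      proof (rule AE_I2)
        fix x :: 'a
        have "x \<in> (\<Union>n::nat. box (- (real n *\<^sub>R One)) (real n *\<^sub>R One))" unfolding UN_box_eq_UNIV by simp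
        then obtain n0 :: nat where n0: "x \<in> box (- (real n0 *\<^sub>R One)) (real n0 *\<^sub>R One)" by auto
        have "x \<in> box (- (real n *\<^sub>R One)) (real n *\<^sub>R One)" if "n \<ge> n0" for n
          using n0 that by (force simp: mem_box)
        then show "(\<lambda>n. indicator (box (- (real n *\<^sub>R One)) (real n *\<^sub>R One)) x * f x) \<longlonglongrightarrow> f x"
          by (intro tendsto_eventually eventually_sequentiallyI[of n0]) auto
      qed
    next
      show "AE x in lborel. norm (indicator (box (- (real n *\<^sub>R One)) (real n *\<^sub>R One)) x * f x) \<le> \<bar>f x\<bar>" for n
        by (rule AE_I2) (simp add: indicator_def)
      show "f \<in> borel_measurable lborel" "L1 (\<lambda>x. \<bar>f x\<bar>)"
        using f by (auto simp: borel_measurable_integrable)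
      then show "(\<lambda>x. indicator (box (- (real n *\<^sub>R One)) (real n *\<^sub>R One)) x * f x) \<in> borel_measurable lborel" for n
        by simp
    qed
    then show ?thesis unfolding box using LIMSEQ_unique tendsto_const by metis
  qed
  fix A :: "'a set" assume "A \<in> sets lborel"
  then have A: "A \<in> sigma_sets UNIV ?E" by (simp add: borel_eq_box)
  have sb: "sigma_sets UNIV ?E = sets (borel :: 'a measure)" by (simp add: borel_eq_box)
  have "(LBINT x. indicator A x * f x) = 0"
  proof (rule sigma_sets_induct_disjoint[OF _ _ A])
    show "Int_stable ?E" by (auto simp: Int_stable_def box_Int_box)
    show "?E \<subseteq> Pow UNIV" by simp
    show "(LBINT x. indicator B x * f x) = 0" if "B \<in> ?E" for B using that box by auto
    show "(LBINT x. indicator {} x * f x) = 0" by simp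
  next
    fix B assume B: "B \<in> sigma_sets UNIV ?E" "(LBINT x. indicator B x * f x) = 0"
    have [measurable]: "B \<in> sets borel" using B sb by auto
    have "(LBINT x. indicator (UNIV - B) x * f x) = (LBINT x. f x - indicator B x * f x)"
      by (intro Bochner_Integration.integral_cong) (auto simp: indicator_def)
    also have "\<dots> = 0"
      using integrable_mult_indicator[of B lborel f] f B all by (subst Bochner_Integration.integral_diff) auto
    finally show "(LBINT x. indicator (UNIV - B) x * f x) = 0" .
  next
    fix B :: "nat \<Rightarrow> 'a set"
    assume B: "disjoint_family B" "range B \<subseteq> sigma_sets UNIV ?E" "\<And>i. (LBINT x. indicator (B i) x * f x) = 0"
    have m: "B i \<in> sets borel" for i using B(2) sb by auto
    have "set_lebesgue_integral lborel (\<Union>i. B i) f = (\<Sum>i. set_lebesgue_integral lborel (B i) f)"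
    proof (rule lebesgue_integral_countable_add)
      show "set_integrable lborel (\<Union>i. B i) f"
        unfolding set_integrable_def using m f by (intro integrable_mult_indicator) auto
    qed (use m B(1) in \<open>auto simp: disjoint_family_on_def\<close>)
    then show "(LBINT x. indicator (\<Union>i. B i) x * f x) = 0" using B(3) by (simp add: set_lebesgue_integral_def)
  qed
  then show "set_lebesgue_integral lborel A f = 0" by (simp add: set_lebesgue_integral_def)
qed

lemma integral_tail_C1:
  assumes th: "C1 \<theta> \<theta>'" and d: "\<And>t. t \<ge> d \<Longrightarrow> \<theta> t = 0" 
  shows "(LBINT t. indicator {s..} t * \<theta>' t) = - \<theta> s"
proof -
  have e': "\<theta>' t = 0" if "t > d" for t
  proof -
    have "(\<theta> has_real_derivative 0) (at t)"
      by (rule has_field_derivative_transform_within_open[OF DERIV_const[of 0], where S="{d<..}"]) (use that d in auto)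
    then show ?thesis using th DERIV_unique unfolding C1_def by blast
  qed
  define m where "m = max s d"
  have "(LBINT t. indicator {s..} t * \<theta>' t) = (LBINT t. indicator {s..m} t *\<^sub>R \<theta>' t)"
    by (intro Bochner_Integration.integral_cong) (auto simp: indicator_def m_def e')
  also have "\<dots> = \<theta> m - \<theta> s"
    by (rule integral_FTC_atLeastAtMost)
       (use th in \<open>auto simp: C1_def m_def has_real_derivative_iff_has_vector_derivative[symmetric]
          intro: has_field_derivative_at_within continuous_on_subset\<close>)
  also have "\<theta> m = 0" by (simp add: d m_def)
  finally show ?thesis by simp
qed

lemma integrable_C1_tail:
  assumes th: "C1 \<theta> \<theta>'" and d: "\<And>t. t \<ge> d \<Longrightarrow> \<theta> t = 0"
  shows "L1 (\<lambda>t. indicator {0..} t * \<theta>' t)" "\<exists>B. \<forall>t\<ge>0. \<bar>\<theta> t\<bar> \<le> B \<and> \<bar>\<theta>' t\<bar> \<le> B"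
proof -
  have e': "\<theta>' t = 0" if "t > d" for t
  proof -
    have "(\<theta> has_real_derivative 0) (at t)"
      by (rule has_field_derivative_transform_within_open[OF DERIV_const[of 0], where S="{d<..}"]) (use that d in auto)
    then show ?thesis using th DERIV_unique unfolding C1_def by blast
  qed
  define m where "m = max 0 d"
  have c: "continuous_on {0..m} \<theta>" "continuous_on {0..m} \<theta>'"
    using th C1_continuous[OF th] unfolding C1_def by (auto intro: continuous_on_subset)
  have "L1 (\<lambda>t. indicator {0..m} t *\<^sub>R \<theta>' t)"
    by (rule borel_integrable_compact) (use c in auto)
  moreover have "(\<lambda>t. indicator {0..m} t *\<^sub>R \<theta>' t) = (\<lambda>t. indicator {0..} t * \<theta>' t)"
    by (auto simp: indicator_def m_def e' fun_eq_iff)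
  ultimately show "L1 (\<lambda>t. indicator {0..} t * \<theta>' t)" by simp
  have "bounded (\<theta> ` {0..m})" "bounded (\<theta>' ` {0..m})"
    using c by (auto intro!: compact_imp_bounded compact_continuous_image)
  then obtain B1 B2 where B: "\<And>t. 0 \<le> t \<Longrightarrow> t \<le> m \<Longrightarrow> \<bar>\<theta> t\<bar> \<le> B1" "\<And>t. 0 \<le> t \<Longrightarrow> t \<le> m \<Longrightarrow> \<bar>\<theta>' t\<bar> \<le> B2"
    unfolding bounded_iff by (metis atLeastAtMost_iff imageI real_norm_def)
  have "\<bar>\<theta> t\<bar> \<le> \<bar>B1\<bar> + \<bar>B2\<bar> \<and> \<bar>\<theta>' t\<bar> \<le> \<bar>B1\<bar> + \<bar>B2\<bar>" if "t \<ge> 0" for t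
  proof (cases "t \<le> m")
    case True then show ?thesis using B[OF that] by fastforce
  next
    case False then show ?thesis using d[of t] e'[of t] by (auto simp: m_def)
  qed
  then show "\<exists>B. \<forall>t\<ge>0. \<bar>\<theta> t\<bar> \<le> B \<and> \<bar>\<theta>' t\<bar> \<le> B" by blast
qed

text \<open>Fubini on the region \<open>0 \<le> s \<le> t\<close>: integrating
  \<open>\<theta>'\<close> over \<open>t \<ge> s\<close> yields \<open>- \<theta> s\<close>. There
  is no boundary term, since the primitive of \<open>g\<close> vanishes at 0 and
  \<open>\<theta>\<close> at large times.\<close>

lemma icc_by_parts:
  assumes g: "L1 g" and th: "C1 \<theta> \<theta>'" and d: "\<And>t. t \<ge> d \<Longrightarrow> \<theta> t = 0"
  shows "L1 (\<lambda>t. indicator {0..} t * (\<theta>' t * icc 0 t g))"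
    "(LBINT t. indicator {0..} t * (\<theta>' t * icc 0 t g)) = - (LBINT s. indicator {0..} s * (\<theta> s * g s))"
proof -
  have [measurable]: "g \<in> borel_fun" "\<theta>' \<in> borel_fun"
    using g th by (auto simp: borel_measurable_integrable C1_def intro: borel_measurable_continuous_onI)
  define H where "H = (\<lambda>(t, s). indicator {0..} t * \<theta>' t * (if 0 \<le> s \<and> s \<le> t then g s else 0))"
  have Hm[measurable]: "H \<in> borel_fun" 
    unfolding H_def by measurable
  have H: "L1 H"
  proof (rule integrable_dominated[OF _ Hm])
    show "L1 (\<lambda>z. \<bar>future z * \<theta>' (fst z)\<bar> * \<bar>g (snd z)\<bar>)"
      using integrable_C1_tail(1)[OF th d] g by (intro integrable_prod_mult) auto
  qed (auto simp: H_def abs_mult intro!: mult_left_mono)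
  have inner: "indicator {0..} t * (\<theta>' t * icc 0 t g) = (LBINT s. H (t, s))" for t
  proof -
    have "(LBINT s. H (t, s)) = (LBINT s. indicator {0..} t * \<theta>' t * (indicator {0..t} s * g s))"
      by (intro Bochner_Integration.integral_cong) (auto simp: H_def indicator_def)
    then show ?thesis by (simp add: icc_def)
  qed
  show "L1 (\<lambda>t. indicator {0..} t * (\<theta>' t * icc 0 t g))"
    unfolding inner by (rule lborel_fubini(2)[OF H])
  have "(LBINT t. indicator {0..} t * (\<theta>' t * icc 0 t g)) = (LBINT s. LBINT t. H (t, s))"
    unfolding inner using lborel_fubini(3,6)[OF H] by simp
  also have "\<dots> = (LBINT s. - (indicator {0..} s * (\<theta> s * g s)))"
  proof (intro Bochner_Integration.integral_cong refl)
    fix s :: real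
    have "(LBINT t. H (t, s)) = (LBINT t. indicator {0..} s * g s * (indicator {s..} t * \<theta>' t))"
      by (intro Bochner_Integration.integral_cong) (auto simp: H_def indicator_def)
    also have "\<dots> = - (indicator {0..} s * (\<theta> s * g s))"
      using integral_tail_C1[OF th, of d s] d by simp
    finally show "(LBINT t. H (t, s)) = - (indicator {0..} s * (\<theta> s * g s))" .
  qed
  finally show "(LBINT t. indicator {0..} t * (\<theta>' t * icc 0 t g)) = - (LBINT s. indicator {0..} s * (\<theta> s * g s))"
    by simp
qed

text \<open>The primitive is normalised at large times. Before \<open>c\<close> it is a constant
  that may differ from zero, and \<open>\<theta> 0\<close> is what brings in the initial
  datum.\<close>

lemma C1_primitive:
  assumes e: "continuous_on UNIV \<eta>" and z: "\<And>t. t \<notin> {c..d} \<Longrightarrow> \<eta> t = 0"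
  shows "\<exists>\<theta>. C1 \<theta> \<eta> \<and> (\<forall>t\<ge>d. \<theta> t = 0)"
proof -
  \<comment> \<open>A base point strictly to the left of the support that also satisfies
    \<open>c' \<le> d\<close> when the interval is empty.\<close>
  define c' where "c' = min c d - 1"
  define p where "p = (\<lambda>t. integral {c'..t} \<eta>)"
  have p: "(p has_real_derivative \<eta> t) (at t)" for t
  proof (cases "t > c'")
    case True
    have "(p has_real_derivative \<eta> t) (at t within {c'..t+1})"
      unfolding p_def by (rule integral_has_real_derivative) (use True in \<open>auto intro!: continuous_on_subset[OF e]\<close>)
    then show ?thesis using True by (simp add: at_within_Icc_at)
  next
    case False
    have p0: "0 = p t'" if "t' < c" for t'
    proof -
      have "p t' = integral {c'..t'} (\<lambda>_. 0)" unfolding p_def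
        by (rule Henstock_Kurzweil_Integration.integral_cong) (use that in \<open>simp add: z\<close>)
      then show ?thesis by simp
    qed
    have tc: "t < c" using False by (auto simp: c'_def)
    have "(p has_real_derivative 0) (at t)"
      by (rule has_field_derivative_transform_within_open[OF DERIV_const[of 0], where S="{..<c}"]) (use tc p0 in auto)
    then show ?thesis using z tc by simp
  qed
  have pd: "p t - p d = 0" if "t \<ge> d" for t
  proof -
    have "c' \<le> d" by (simp add: c'_def)
    moreover have "\<eta> integrable_on {c'..t}"
      by (intro integrable_continuous_real continuous_on_subset[OF e]) simp
    ultimately have "p t = integral {c'..d} \<eta> + integral {d..t} \<eta>" unfolding p_def
      using that by (intro Henstock_Kurzweil_Integration.integral_combine[symmetric])
    also have "integral {d..t} \<eta> = 0"
    proof -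
      have "integral {d..t} \<eta> = integral {d..t} (\<lambda>_. 0)"
        by (rule integral_spike[of "{d}"]) (simp_all add: z)
      then show ?thesis by simp
    qed
    finally show ?thesis by (simp add: p_def)
  qed
  have "C1 (\<lambda>t. p t - p d) \<eta>"
    unfolding C1_def using DERIV_diff[OF p DERIV_const] e by simp
  then show ?thesis using pd by blast
qed

lemma AE_lborel_fst_snd:
  fixes P :: "'a::euclidean_space \<Rightarrow> bool" and Q :: "'b::euclidean_space \<Rightarrow> bool"
  shows "AE x in lborel. P x \<Longrightarrow> AE z in (lborel :: ('a \<times> 'b) measure). P (fst z)"
    and "AE y in lborel. Q y \<Longrightarrow> AE z in (lborel :: ('a \<times> 'b) measure). Q (snd z)"
proof -
  assume "AE x in lborel. P x"
  then obtain N where N: "{x. \<not> P x} \<subseteq> N" "emeasure lborel N = 0" "N \<in> sets borel"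
    by (auto elim!: AE_E)
  have "emeasure (lborel \<Otimes>\<^sub>M lborel) (N \<times> (UNIV :: 'b set)) = 0"
    using N by (subst lborel.emeasure_pair_measure_Times) auto
  then have "N \<times> (UNIV :: 'b set) \<in> null_sets lborel"
    using N(3) by (auto simp: null_sets_def lborel_prod borel_prod[symmetric])
  from AE_not_in[OF this] show "AE z in (lborel :: ('a \<times> 'b) measure). P (fst z)"
    by eventually_elim (use N(1) in \<open>auto simp: mem_Times_iff\<close>)
next
  assume "AE x in lborel. Q x"
  then obtain N where N: "{x. \<not> Q x} \<subseteq> N" "emeasure lborel N = 0" "N \<in> sets borel"
    by (auto elim!: AE_E)
  have "emeasure (lborel \<Otimes>\<^sub>M lborel) ((UNIV :: 'a set) \<times> N) = 0"
    using N by (subst lborel.emeasure_pair_measure_Times) auto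
  then have "(UNIV :: 'a set) \<times> N \<in> null_sets lborel"
    using N(3) by (auto simp: null_sets_def lborel_prod borel_prod[symmetric])
  from AE_not_in[OF this] show "AE z in (lborel :: ('a \<times> 'b) measure). Q (snd z)"
    by eventually_elim (use N(1) in \<open>auto simp: mem_Times_iff\<close>)
qed

lemma integrable_dominated_AE:
  fixes f :: "'a::euclidean_space \<Rightarrow> real" and g :: "'a \<Rightarrow> real"
  assumes "L1 g" "f \<in> borel_fun" "AE x in lborel. \<bar>f x\<bar> \<le> g x"
  shows "L1 f"
  using assms by (intro Bochner_Integration.integrable_bound[OF assms(1)]) auto

lemma integrable_indicator_Icc: "L1 (indicat_real {a..b::real})"
  by (rule integrable_real_indicator) (auto simp: emeasure_lborel_Icc_eq)

lemma mem_box_prod3: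
  "z \<in> box a b \<longleftrightarrow> fst z \<in> {fst a<..<fst b} \<and> fst (snd z) \<in> {fst (snd a)<..<fst (snd b)} \<and> snd (snd z) \<in> {snd (snd a)<..<snd (snd b)}"
  for z a b :: "real \<times> (real \<times> real)"
  by (auto simp: mem_box Basis_prod_def inner_prod_def)

text \<open>The hypothesis is the weak form of \<open>dY/dt = \<Gamma>\<close> with initial value
  \<open>Y0\<close>, tested with products \<open>\<kappa> y * \<theta> t\<close>. No derivative in
  \<open>y\<close> occurs, so the equation separates into lines: the defect of the integrated
  equation is orthogonal to all products \<open>\<eta> t * \<kappa> y\<close>, hence has integral
  zero over boxes, hence vanishes almost everywhere.\<close>

lemma weak_transport_imp_integrated:
  fixes Y \<Gamma> :: "real \<times> (real \<times> real) \<Rightarrow> real" and Y0 :: "real \<times> real \<Rightarrow> real"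
  assumes Y: "L1 Y" and G: "L1 \<Gamma>" and Y0: "L1 Y0"
    and weak: "\<And>\<kappa> E M \<theta> \<theta>'. cgrad \<kappa> E \<Longrightarrow> (\<And>y. norm y > M \<Longrightarrow> \<kappa> y = 0) \<Longrightarrow> C1 \<theta> \<theta>' \<Longrightarrow>
      (LBINT z. future z * (\<kappa> (snd z) * (\<theta>' (fst z) * Y z + \<theta> (fst z) * \<Gamma> z)))
        = - (\<theta> 0 * (LBINT y. \<kappa> y * Y0 y))"
  shows "AE y in lborel. AE t in lborel. 0 \<le> t \<longrightarrow> Y (t, y) = Y0 y + icc 0 t (\<lambda>s. \<Gamma> (s, y))"
proof -
  have [measurable]: "Y \<in> borel_fun" "\<Gamma> \<in> borel_fun" "Y0 \<in> borel_fun"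
    using Y G Y0 by (auto simp: borel_measurable_integrable)
  define J where "J = (\<lambda>z. icc 0 (fst z) (\<lambda>s. \<Gamma> (s, snd z)))"
  define N where "N = (\<lambda>y. LBINT s. \<bar>\<Gamma> (s, y)\<bar>)"
  have Gn: "L1 (\<lambda>z. \<bar>\<Gamma> z\<bar>)" using G by auto
  have Ni: "L1 N" unfolding N_def by (rule lborel_fubini(5)[OF Gn])
  note Gs = lborel_fubini(4)[OF G]
  have Jm[measurable]: "J \<in> borel_fun"
  proof -
    have 1: "(\<lambda>(z, s). if 0 \<le> s \<and> s \<le> fst z then \<Gamma> (s, snd z) else 0) \<in> borel_measurable (borel \<Otimes>\<^sub>M lborel)" (is "?h \<in> _")
    proof -
      have "(\<lambda>w :: (real \<times> (real \<times> real)) \<times> real. (snd w, snd (fst w))) \<in> borel_fun"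
        by (auto intro!: borel_measurable_continuous_onI continuous_intros)
      from measurable_compose[OF this, of \<Gamma> borel]
      have [measurable]: "(\<lambda>w :: (real \<times> (real \<times> real)) \<times> real. \<Gamma> (snd w, snd (fst w))) \<in> borel_fun" by simp
      have [measurable]: "(\<lambda>w :: (real \<times> (real \<times> real)) \<times> real. fst (fst w)) \<in> borel_fun"
         by (auto intro!: borel_measurable_continuous_onI continuous_intros)
      have "(\<lambda>w :: (real \<times> (real \<times> real)) \<times> real. if 0 \<le> snd w \<and> snd w \<le> fst (fst w) then \<Gamma> (snd w, snd (fst w)) else 0) \<in> borel_fun"
        by measurable
      then show ?thesis by (simp add: borel_prod split_beta' cong: measurable_cong_sets)
    qed
    have "J = (\<lambda>z. LBINT s. (if 0 \<le> s \<and> s \<le> fst z then \<Gamma> (s, snd z) else 0))"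
      unfolding J_def icc_def by (intro ext Bochner_Integration.integral_cong) (auto simp: indicator_def)
    also have "\<dots> \<in> borel_fun"
      using lborel.borel_measurable_lebesgue_integral[OF 1] by simp
    finally show ?thesis .
  qed
  have JN: "AE z in lborel. \<bar>J z\<bar> \<le> N (snd z)"
  proof -
    have "\<bar>icc 0 t g\<bar> \<le> (LBINT s. \<bar>g s\<bar>)" if g: "L1 g" for t and g :: "real \<Rightarrow> real"
      unfolding icc_def real_norm_def[symmetric]
      by (rule Bochner_Integration.integral_norm_bound_integral) (use g integrable_icc[OF g] in \<open>auto simp: indicator_def\<close>)
    then show ?thesis using AE_lborel_fst_snd(2)[OF Gs]
      by (auto simp: J_def N_def elim!: eventually_mono)
  qed
  \<comment> \<open>The defect of the integrated equation. It is truncated in time because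
    \<open>Y0 (snd z)\<close> and \<open>J\<close> need not be integrable over all times.\<close>
  define W where "W T z = indicator {0..T} (fst z) * (Y z - (Y0 (snd z) + J z))" for T z
  have Wi: "L1 (W T)" for T
  proof -
    have "L1 (\<lambda>z. indicator {0..T} (fst z) * Y z)"
      by (rule integrable_dominated[of "\<lambda>z. \<bar>Y z\<bar>"]) (use Y in \<open>auto simp: indicator_def\<close>)
    moreover have "L1 (\<lambda>z. indicator {0..T} (fst z) * Y0 (snd z) :: real)"
      by (rule integrable_prod_mult) (use Y0 in \<open>auto simp: integrable_indicator_Icc\<close>)
    moreover have "L1 (\<lambda>z. indicator {0..T} (fst z) * J z :: real)"
    proof (rule integrable_dominated_AE)
      show "L1 (\<lambda>z. indicator {0..T} (fst z) * N (snd z) :: real)"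
        by (rule integrable_prod_mult) (use Ni in \<open>auto simp: integrable_indicator_Icc\<close>)
      show "AE z in lborel. \<bar>indicator {0..T} (fst z) * J z\<bar> \<le> indicator {0..T} (fst z) * N (snd z)"
        using JN by eventually_elim (auto simp: indicator_def)
    qed auto
    ultimately have "L1 (\<lambda>z. indicator {0..T} (fst z) * Y z - (indicator {0..T} (fst z) * Y0 (snd z) + indicator {0..T} (fst z) * J z))"
      by auto
    then show ?thesis by (simp add: W_def[abs_def] algebra_simps)
  qed
  \<comment> \<open>Use the weak equation with \<open>\<theta>\<close> the primitive of
    \<open>\<eta>\<close> that vanishes at large times; integration by parts on each line turns the
    integral of \<open>\<theta> * \<Gamma>\<close> into minus that of
    \<open>\<eta> * J\<close>.\<close>
  have key: "(LBINT z. \<eta> (fst z) * \<kappa> (snd z) * W T z) = 0"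
    if k: "cgrad \<kappa> E" "\<And>y. norm y > M \<Longrightarrow> \<kappa> y = 0" and kb: "\<And>y. \<bar>\<kappa> y\<bar> \<le> 1"
      and e: "continuous_on UNIV \<eta>" "\<And>t. t \<notin> {c..d} \<Longrightarrow> \<eta> t = 0" "0 \<le> c" "d \<le> T" for \<kappa> E M \<eta> c d T
  proof -
    obtain \<theta> where th: "C1 \<theta> \<eta>" "\<And>t. t \<ge> d \<Longrightarrow> \<theta> t = 0" using C1_primitive[OF e(1,2)] by blast
    obtain B where B: "\<And>t. t \<ge> 0 \<Longrightarrow> \<bar>\<theta> t\<bar> \<le> B" "\<And>t. t \<ge> 0 \<Longrightarrow> \<bar>\<eta> t\<bar> \<le> B"
      using integrable_C1_tail(2)[OF th] by blast
    have B0: "B \<ge> 0" using B(1)[of 0] by simp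
    have [measurable]: "\<kappa> \<in> borel_fun" "\<eta> \<in> borel_fun" "\<theta> \<in> borel_fun"
      using k(1) e(1) C1_continuous[OF th(1)] by (auto intro: borel_measurable_cgrad borel_measurable_continuous_onI)
    have bnd: "\<bar>indicator {0..} t * (\<kappa> y * (\<eta> t * x))\<bar> \<le> B * \<bar>x\<bar>" "\<bar>indicator {0..} t * (\<kappa> y * (\<theta> t * x))\<bar> \<le> B * \<bar>x\<bar>" for t y x
    proof -
      have "\<bar>\<kappa> y\<bar> * \<bar>g\<bar> * \<bar>x\<bar> \<le> 1 * B * \<bar>x\<bar>" if "\<bar>g\<bar> \<le> B" for g
        using kb[of y] that B0 by (intro mult_mono) auto
      then show "\<bar>indicator {0..} t * (\<kappa> y * (\<eta> t * x))\<bar> \<le> B * \<bar>x\<bar>" "\<bar>indicator {0..} t * (\<kappa> y * (\<theta> t * x))\<bar> \<le> B * \<bar>x\<bar>"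
        using B[of t] B0 by (auto simp: indicator_def abs_mult mult.assoc)
    qed
    have i1: "L1 (\<lambda>z. future z * (\<kappa> (snd z) * (\<eta> (fst z) * Y z)))"
      by (rule integrable_dominated[of "\<lambda>z. B * \<bar>Y z\<bar>"]) (use Y bnd in auto)
    have i2: "L1 (\<lambda>z. future z * (\<kappa> (snd z) * (\<theta> (fst z) * \<Gamma> z)))"
      by (rule integrable_dominated[of "\<lambda>z. B * \<bar>\<Gamma> z\<bar>"]) (use G bnd in auto)
    have i3: "L1 (\<lambda>z. \<eta> (fst z) * \<kappa> (snd z) * W T z)"
    proof (rule integrable_dominated)
      show "L1 (\<lambda>z. B * \<bar>W T z\<bar>)" using Wi[of T] by auto
      show "\<bar>\<eta> (fst z) * \<kappa> (snd z) * W T z\<bar> \<le> B * \<bar>W T z\<bar>" for z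
        using bnd(1)[of "fst z" "snd z" "W T z"] by (auto simp: W_def indicator_def mult_ac B0)
      have [measurable]: "W T \<in> borel_fun" using Wi by (auto simp: borel_measurable_integrable)
      show "(\<lambda>z. \<eta> (fst z) * \<kappa> (snd z) * W T z) \<in> borel_fun" by measurable
    qed
    have eW: "\<eta> (fst z) * \<kappa> (snd z) * W T z = future z * (\<kappa> (snd z) * (\<eta> (fst z) * Y z))
        - future z * (\<kappa> (snd z) * (\<eta> (fst z) * (Y0 (snd z) + J z)))" for z
      using e(2)[of "fst z"] e(3,4) by (auto simp: W_def indicator_def algebra_simps)
    have i4: "L1 (\<lambda>z. future z * (\<kappa> (snd z) * (\<eta> (fst z) * (Y0 (snd z) + J z))))"
      using Bochner_Integration.integrable_diff[OF i1 i3] by (simp add: eW)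
    have first: "(LBINT z. future z * (\<kappa> (snd z) * (\<eta> (fst z) * Y z)))
        = - (\<theta> 0 * (LBINT y. \<kappa> y * Y0 y)) - (LBINT z. future z * (\<kappa> (snd z) * (\<theta> (fst z) * \<Gamma> z)))"
      using weak[of \<kappa> E M \<theta> \<eta>, OF k th(1)] Bochner_Integration.integral_add[OF i1 i2] by (simp add: distrib_left)
    have ki: "L1 (\<lambda>y. \<kappa> y * Y0 y)"
      by (rule integrable_dominated[of "\<lambda>y. \<bar>Y0 y\<bar>"]) (use Y0 kb in \<open>auto simp: abs_mult intro: mult_left_le_one_le\<close>)
    have "(LBINT z. future z * (\<kappa> (snd z) * (\<eta> (fst z) * (Y0 (snd z) + J z))))
       = (LBINT y. LBINT t. indicator {0..} t * (\<kappa> y * (\<eta> t * (Y0 y + J (t, y)))))"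
      using lborel_fubini(6)[OF i4] by simp
    also have "\<dots> = (LBINT y. - \<theta> 0 * (\<kappa> y * Y0 y) - (LBINT t. indicator {0..} t * (\<kappa> y * (\<theta> t * \<Gamma> (t, y)))))"
    proof (rule integral_cong_AE)
      show "AE y in lborel. (LBINT t. indicator {0..} t * (\<kappa> y * (\<eta> t * (Y0 y + J (t, y)))))
        = - \<theta> 0 * (\<kappa> y * Y0 y) - (LBINT t. indicator {0..} t * (\<kappa> y * (\<theta> t * \<Gamma> (t, y))))"
        using Gs
      proof eventually_elim
        case (elim y)
        have "(LBINT t. indicator {0..} t * (\<kappa> y * (\<eta> t * (Y0 y + J (t, y)))))
          = (LBINT t. \<kappa> y * Y0 y * (indicator {0..} t * \<eta> t) + \<kappa> y * (indicator {0..} t * (\<eta> t * icc 0 t (\<lambda>s. \<Gamma> (s, y)))))"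
          by (simp add: J_def algebra_simps)
        also have "\<dots> = \<kappa> y * Y0 y * (LBINT t. indicator {0..} t * \<eta> t) + \<kappa> y * (LBINT t. indicator {0..} t * (\<eta> t * icc 0 t (\<lambda>s. \<Gamma> (s, y))))"
          using integrable_C1_tail(1)[OF th] icc_by_parts(1)[OF elim th]
          by (subst Bochner_Integration.integral_add) auto
        also have "\<dots> = - \<theta> 0 * (\<kappa> y * Y0 y) - \<kappa> y * (LBINT t. indicator {0..} t * (\<theta> t * \<Gamma> (t, y)))"
          using integral_tail_C1[OF th, where s=0] icc_by_parts(2)[OF elim th] by simp
        also have "\<kappa> y * (LBINT t. indicator {0..} t * (\<theta> t * \<Gamma> (t, y))) = (LBINT t. indicator {0..} t * (\<kappa> y * (\<theta> t * \<Gamma> (t, y))))"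
          by (subst integral_mult_right_zero[symmetric]) (simp add: mult_ac)
        finally show ?case .
      qed
    qed (use lborel_fubini(5)[OF i4] lborel_fubini(5)[OF i2] ki in \<open>auto simp: borel_measurable_integrable\<close>)
    also have "\<dots> = - (\<theta> 0 * (LBINT y. \<kappa> y * Y0 y)) - (LBINT z. future z * (\<kappa> (snd z) * (\<theta> (fst z) * \<Gamma> z)))"
      using lborel_fubini(5)[OF i2] lborel_fubini(6)[OF i2] ki by (subst Bochner_Integration.integral_diff) auto
    finally show ?thesis
      unfolding eW using first Bochner_Integration.integral_diff[OF i1 i4] by simp
  qed
  have "AE z in lborel. W T z = 0" if T: "T \<ge> 0" for T
  proof (rule zero_integral_on_boxes[OF Wi])
    fix a b :: "real \<times> (real \<times> real)"
    \<comment> \<open>The time side of the box, clipped to \<open>[0, T]\<close> as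
      \<open>key\<close> demands.\<close>
    define c d where "c = max (fst a) 0" and "d = min (fst b) T"
    define P where "P n z = plateau c d n (fst z) * (plateau (fst (snd a)) (fst (snd b)) n (fst (snd z)) * plateau (snd (snd a)) (snd (snd b)) n (snd (snd z)))" for n z
    have [measurable]: "plateau c d n \<in> borel_fun" for c d n
      using C1_plateau C1_continuous by (blast intro: borel_measurable_continuous_onI)
    have [measurable]: "W T \<in> borel_fun" using Wi by (auto simp: borel_measurable_integrable)
    have ff: "(\<lambda>z :: real \<times> (real \<times> real). fst (snd z)) \<in> borel_fun" "(\<lambda>z :: real \<times> (real \<times> real). snd (snd z)) \<in> borel_fun"
      by (auto intro!: borel_measurable_continuous_onI continuous_intros)
    note ff[measurable]
    have z: "(LBINT z. P n z * W T z) = 0" for n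
    proof -
      obtain p1 p2 where p: "C1 (plateau (fst (snd a)) (fst (snd b)) n) p1" "C1 (plateau (snd (snd a)) (snd (snd b)) n) p2"
        using C1_plateau by meson
      define M where "M = \<bar>fst (snd a)\<bar> + \<bar>fst (snd b)\<bar> + \<bar>snd (snd a)\<bar> + \<bar>snd (snd b)\<bar>"
      have "(LBINT z. plateau c d n (fst z) * (plateau (fst (snd a)) (fst (snd b)) n (fst (snd z)) * plateau (snd (snd a)) (snd (snd b)) n (snd (snd z))) * W T z) = 0"
      proof (rule key[where \<kappa>="\<lambda>y. plateau (fst (snd a)) (fst (snd b)) n (fst y) * plateau (snd (snd a)) (snd (snd b)) n (snd y)"])
        show "cgrad (\<lambda>y. plateau (fst (snd a)) (fst (snd b)) n (fst y) * plateau (snd (snd a)) (snd (snd b)) n (snd y))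
            (\<lambda>y. plateau (snd (snd a)) (snd (snd b)) n (snd y) *\<^sub>R (p1 (fst y) *\<^sub>R (1, 0)) + plateau (fst (snd a)) (fst (snd b)) n (fst y) *\<^sub>R (p2 (snd y) *\<^sub>R (0, 1)))"
          by (intro cgrad_mult cgrad_C1[OF p(1) cgrad_fst] cgrad_C1[OF p(2) cgrad_snd])
        show "plateau (fst (snd a)) (fst (snd b)) n (fst y) * plateau (snd (snd a)) (snd (snd b)) n (snd y) = 0" if "norm y > M" for y
        proof (rule ccontr)
          assume "\<not> ?thesis"
          then have "fst y \<in> {fst (snd a)<..<fst (snd b)}" "snd y \<in> {snd (snd a)<..<snd (snd b)}"
            using plateau_outside by auto
          then have "\<bar>fst y\<bar> + \<bar>snd y\<bar> \<le> M" by (auto simp: M_def)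
          moreover have "norm y \<le> \<bar>fst y\<bar> + \<bar>snd y\<bar>" using norm_Pair_le[of "fst y" "snd y"] by simp
          ultimately show False using that by simp
        qed
        show "\<bar>plateau (fst (snd a)) (fst (snd b)) n (fst y) * plateau (snd (snd a)) (snd (snd b)) n (snd y)\<bar> \<le> 1" for y
          using plateau_bounds by (simp add: abs_mult mult_le_one)
        show "continuous_on UNIV (plateau c d n)" using C1_plateau C1_continuous by blast
        show "plateau c d n t = 0" if "t \<notin> {c..d}" for t using that by (auto intro: plateau_outside)
      qed (auto simp: c_def d_def)
      then show ?thesis by (simp add: P_def)
    qed
    have "(\<lambda>n. LBINT z. P n z * W T z) \<longlonglongrightarrow> (LBINT z. indicator (box a b) z * W T z)"
    proof (rule integral_dominated_convergence[where w="\<lambda>z. \<bar>W T z\<bar>"])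
      show "L1 (\<lambda>z. \<bar>W T z\<bar>)" using Wi by auto
      show "AE z in lborel. norm (P n z * W T z) \<le> \<bar>W T z\<bar>" for n
      proof (rule AE_I2)
        fix z
        have "\<bar>P n z\<bar> \<le> 1" using plateau_bounds unfolding P_def by (simp add: abs_mult mult_le_one)
        then show "norm (P n z * W T z) \<le> \<bar>W T z\<bar>" by (auto simp: abs_mult intro: mult_left_le_one_le)
      qed
      \<comment> \<open>The clipped open interval omits the times 0 and \<open>T\<close>, at which
        \<open>W T\<close> may be nonzero; they form a null set.\<close>
      have "AE z in (lborel :: (real \<times> real \<times> real) measure). fst z \<noteq> 0" "AE z in (lborel :: (real \<times> real \<times> real) measure). fst z \<noteq> T"
        by (rule AE_lborel_fst_snd(1)[OF AE_lborel_singleton])+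
      then show "AE z in lborel. (\<lambda>n. P n z * W T z) \<longlonglongrightarrow> indicator (box a b) z * W T z"
      proof eventually_elim
        case (elim z)
        have "(\<lambda>n. P n z * W T z) \<longlonglongrightarrow> indicator {c<..<d} (fst z) * (indicator {fst (snd a)<..<fst (snd b)} (fst (snd z)) * indicator {snd (snd a)<..<snd (snd b)} (snd (snd z))) * W T z"
          unfolding P_def by (intro tendsto_intros plateau_tendsto)
        also have "indicator {c<..<d} (fst z) * (indicator {fst (snd a)<..<fst (snd b)} (fst (snd z)) * indicator {snd (snd a)<..<snd (snd b)} (snd (snd z))) * W T z = indicator (box a b) z * W T z"
          using elim by (auto simp: indicator_def mem_box_prod3 W_def c_def d_def)
        finally show ?case .
      qed
      show "(\<lambda>z. P n z * W T z) \<in> borel_measurable lborel" for n unfolding P_def by measurable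
      show "(\<lambda>z. indicator (box a b) z * W T z) \<in> borel_measurable lborel" by measurable
    qed
    then show "(LBINT z. indicator (box a b) z * W T z) = 0"
      unfolding z using LIMSEQ_unique tendsto_const by metis
  qed
  \<comment> \<open>Countably many truncations are treated at once; for given \<open>z\<close>, an
    integer \<open>n \<ge> fst z\<close> removes the truncation.\<close>
  then have "AE z in lborel. \<forall>n::nat. W (real n) z = 0" by (simp add: AE_all_countable)
  then have "AE z in lborel. 0 \<le> fst z \<longrightarrow> Y z = Y0 (snd z) + J z"
  proof eventually_elim
    case (elim z)
    obtain n :: nat where "fst z \<le> real n" using real_arch_simple by blast
    then show ?case using elim[rule_format, of n] by (auto simp: W_def)
  qed
  then have "AE z in (lborel :: real measure) \<Otimes>\<^sub>M (lborel :: (real \<times> real) measure). 0 \<le> fst z \<longrightarrow> Y z = Y0 (snd z) + J z"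
    unfolding lborel_prod .
  then have "AE x in lborel. AE y in lborel. 0 \<le> x \<longrightarrow> Y (x, y) = Y0 y + J (x, y)"
    using lborel_pair.AE_pair[of "\<lambda>z. 0 \<le> fst z \<longrightarrow> Y z = Y0 (snd z) + J z"] by simp
  then have "AE y in lborel. AE x in lborel. 0 \<le> x \<longrightarrow> Y (x, y) = Y0 y + J (x, y)"
  proof (subst (asm) lborel_pair.AE_commute)
    have "{z \<in> space borel. 0 \<le> fst z \<longrightarrow> Y z = Y0 (snd z) + J z} \<in> sets borel" by measurable
    then show "{x \<in> space (lborel \<Otimes>\<^sub>M lborel). 0 \<le> fst x \<longrightarrow> Y (fst x, snd x) = Y0 (snd x) + J (fst x, snd x)} \<in> sets (lborel \<Otimes>\<^sub>M lborel)"
      unfolding lborel_prod by simp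
  qed
  then show ?thesis by (simp add: J_def)
qed

section \<open>Renormalization in flow coordinates\<close>

lemma distr_lborel_eqI:
  fixes T :: "'a::euclidean_space \<Rightarrow> 'a"
  assumes T: "T \<in> borel_fun"
    and nn: "\<And>g :: 'a \<Rightarrow> ennreal. g \<in> borel_fun \<Longrightarrow> (\<integral>\<^sup>+x. g (T x) \<partial>lborel) = (\<integral>\<^sup>+x. g x \<partial>lborel)"
  shows "distr lborel borel T = lborel"
proof (rule measure_eqI)
  fix A assume "A \<in> sets (distr lborel borel T)"
  then have A: "A \<in> sets borel" by simp
  have "emeasure (distr lborel borel T) A = (\<integral>\<^sup>+x. indicator A x \<partial>distr lborel borel T)"
    using A by simp
  also have "\<dots> = (\<integral>\<^sup>+x. indicator A (T x) \<partial>lborel)"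
    using A T by (subst nn_integral_distr) auto
  also have "\<dots> = emeasure lborel A" using nn[of "indicator A"] A by simp
  finally show "emeasure (distr lborel borel T) A = emeasure lborel A" .
qed simp

lemma nn_integral_distr_lborel:
  assumes "distr lborel borel T = lborel" "T \<in> borel_fun" "g \<in> borel_fun"
  shows "(\<integral>\<^sup>+x. g (T x) \<partial>lborel) = (\<integral>\<^sup>+x. g x \<partial>lborel)"
  using nn_integral_distr[of T lborel borel g] assms by simp

lemma integral_distr_lborel:
  fixes g :: "'b::euclidean_space \<Rightarrow> real"
  assumes "distr (lborel :: 'a::euclidean_space measure) borel T = lborel" "T \<in> borel_fun" "g \<in> borel_fun"
  shows "(LBINT x. g (T x)) = (LBINT x. g x)" "L1 (\<lambda>x. g (T x)) \<longleftrightarrow> L1 g"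
  using integral_distr[of T lborel borel g] integrable_distr_eq[of T lborel borel g] assms by auto

lemma lipschitz_continuous:
  fixes \<beta> :: "real \<Rightarrow> real"
  assumes "\<And>x y. \<bar>\<beta> x - \<beta> y\<bar> \<le> L * \<bar>x - y\<bar>"
  shows "continuous_on UNIV \<beta>"
proof (rule continuous_on_subset[OF lipschitz_on_continuous_on])
  show "L-lipschitz_on UNIV \<beta>"
    using assms assms[of 1 0] by (intro lipschitz_onI) (auto simp: dist_real_def)
qed simp

text \<open>\<open>\<Psi>\<close> is a measure-preserving coordinate system in which the flow is the
  translation of the second coordinate. Test functions of the label \<open>\<Psi> x - (0, t)\<close>
  see only the time derivative, so after the change of variables both \<open>f\<close>, with source
  \<open>g\<close>, and \<open>\<phi>\<close>, with source \<open>\<delta>\<close>, satisfy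
  integrated equations along almost every line of constant label, and
  \<open>chain_rule_along_line\<close> applies on each of them.\<close>

lemma renormalization_by_flow_coordinates:
  fixes \<Psi> \<Xi> :: "real \<times> real \<Rightarrow> real \<times> real" and f g \<phi> \<delta> :: "real \<times> (real \<times> real) \<Rightarrow> real"
    and f0 \<phi>0 :: "real \<times> real \<Rightarrow> real" and \<beta> :: "real \<Rightarrow> real"
  assumes Pm[measurable]: "\<Psi> \<in> borel_fun" and Xm[measurable]: "\<Xi> \<in> borel_fun"
    and PX: "\<And>y. \<Psi> (\<Xi> y) = y" and XP: "\<And>x. \<Xi> (\<Psi> x) = x" and Pd: "distr lborel borel \<Psi> = lborel"
    and int: "L1 f" "L1 g" "L1 f0"
      "L1 \<phi>" "L1 \<delta>" "L1 \<phi>0"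
    and Tf: "\<And>\<kappa> E M \<theta> \<theta>'. cgrad \<kappa> E \<Longrightarrow> (\<And>y. norm y > M \<Longrightarrow> \<kappa> y = 0) \<Longrightarrow> C1 \<theta> \<theta>' \<Longrightarrow>
      (LBINT z. future z * (\<kappa> (\<Psi> (snd z) - (0, fst z)) * (\<theta>' (fst z) * f z + \<theta> (fst z) * g z)))
        = - (\<theta> 0 * (LBINT x. \<kappa> (\<Psi> x) * f0 x))"
    and Tp: "\<And>\<kappa> E M \<theta> \<theta>'. cgrad \<kappa> E \<Longrightarrow> (\<And>y. norm y > M \<Longrightarrow> \<kappa> y = 0) \<Longrightarrow> C1 \<theta> \<theta>' \<Longrightarrow>
      (LBINT z. future z * (\<kappa> (\<Psi> (snd z) - (0, fst z)) * (\<theta>' (fst z) * \<phi> z + \<theta> (fst z) * \<delta> z)))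
        = - (\<theta> 0 * (LBINT x. \<kappa> (\<Psi> x) * \<phi>0 x))"
    and gp: "\<And>z. g z * \<phi> z = 0" and T: "T \<ge> 0" and supp: "\<And>z. fst z > T \<Longrightarrow> \<phi> z = 0 \<and> \<delta> z = 0"
    and bnd: "\<And>z. \<bar>f z\<bar> \<le> C" "\<And>x. \<bar>f0 x\<bar> \<le> C" and Lip: "\<And>x y. \<bar>\<beta> x - \<beta> y\<bar> \<le> L * \<bar>x - y\<bar>"
  shows "(LBINT z. future z * (\<beta> (f z) * \<delta> z)) = - (LBINT x. \<beta> (f0 x) * \<phi>0 x)"
proof -
  have [measurable]: "f \<in> borel_fun" "g \<in> borel_fun" "f0 \<in> borel_fun"
     "\<phi> \<in> borel_fun" "\<delta> \<in> borel_fun" "\<phi>0 \<in> borel_fun"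
    using int by (auto simp: borel_measurable_integrable)
  have [measurable]: "\<beta> \<in> borel_fun"
    using lipschitz_continuous[OF Lip] by (rule borel_measurable_continuous_onI)
  have Xd: "distr lborel borel \<Xi> = lborel"
  proof (rule distr_lborel_eqI[OF Xm])
    fix h :: "real \<times> real \<Rightarrow> ennreal" assume [measurable]: "h \<in> borel_fun"
    have "(\<integral>\<^sup>+x. h (\<Xi> x) \<partial>lborel) = (\<integral>\<^sup>+x. h (\<Xi> (\<Psi> x)) \<partial>lborel)"
      by (rule nn_integral_distr_lborel[OF Pd, symmetric]) auto
    then show "(\<integral>\<^sup>+x. h (\<Xi> x) \<partial>lborel) = (\<integral>\<^sup>+x. h x \<partial>lborel)" by (simp add: XP)
  qed
  \<comment> \<open>\<open>\<Lambda> (t, y)\<close> is the position at time \<open>t\<close> of the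
    particle with label \<open>y\<close>, paired with \<open>t\<close>.\<close>
  define \<Lambda> where "\<Lambda> = (\<lambda>z::real \<times> (real \<times> real). (fst z, \<Xi> (snd z + (0, fst z))))"
  have Lm[measurable]: "\<Lambda> \<in> borel_fun"
  proof -
    have "(\<lambda>z::real \<times> (real \<times> real). snd z + (0, fst z)) \<in> borel_fun"
      by (auto intro!: borel_measurable_continuous_onI continuous_intros)
    from measurable_compose[OF this Xm] show ?thesis unfolding \<Lambda>_def by (intro borel_Pair) auto
  qed
  \<comment> \<open>At each fixed time the map is a translation followed by \<open>\<Xi>\<close>,
    and both preserve area.\<close>
  have Ld: "distr lborel borel \<Lambda> = lborel"
  proof (rule distr_lborel_eqI[OF Lm])
    fix h :: "real \<times> (real \<times> real) \<Rightarrow> ennreal" assume hm[measurable]: "h \<in> borel_fun"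
    have hL: "(\<lambda>z. h (\<Lambda> z)) \<in> borel_fun" by measurable
    have prod: "(\<integral>\<^sup>+z. k z \<partial>lborel) = (\<integral>\<^sup>+t. \<integral>\<^sup>+x. k (t, x) \<partial>lborel \<partial>lborel)"
      if "k \<in> borel_fun" for k :: "real \<times> (real \<times> real) \<Rightarrow> ennreal"
      using lborel.nn_integral_fst[of k lborel] that by (simp add: lborel_prod)
    have "(\<integral>\<^sup>+z. h (\<Lambda> z) \<partial>lborel) = (\<integral>\<^sup>+t. \<integral>\<^sup>+x. h (t, \<Xi> (x + (0, t))) \<partial>lborel \<partial>lborel)"
      by (subst prod[OF hL]) (simp add: \<Lambda>_def)
    also have "\<dots> = (\<integral>\<^sup>+t. \<integral>\<^sup>+x. h (t, x) \<partial>lborel \<partial>lborel)"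
    proof (rule nn_integral_cong)
      fix t :: real
      have ht: "(\<lambda>x. h (t, x)) \<in> borel_fun" by measurable
      have "(\<integral>\<^sup>+x. h (t, \<Xi> (x + (0, t))) \<partial>lborel) = (\<integral>\<^sup>+x. h (t, \<Xi> x) \<partial>lborel)"
        by (rule nn_integral_distr_lborel[OF lborel_distr_shift, where g="\<lambda>x. h (t, \<Xi> x)"]) auto
      also have "\<dots> = (\<integral>\<^sup>+x. h (t, x) \<partial>lborel)"
        by (rule nn_integral_distr_lborel[OF Xd, where g="\<lambda>x. h (t, x)"]) auto
      finally show "(\<integral>\<^sup>+x. h (t, \<Xi> (x + (0, t))) \<partial>lborel) = (\<integral>\<^sup>+x. h (t, x) \<partial>lborel)" .
    qed
    also have "\<dots> = (\<integral>\<^sup>+z. h z \<partial>lborel)" using prod[OF hm] by simp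
    finally show "(\<integral>\<^sup>+z. h (\<Lambda> z) \<partial>lborel) = (\<integral>\<^sup>+z. h z \<partial>lborel)" .
  qed
  have sL: "\<Psi> (snd (\<Lambda> z)) - (0, fst z) = snd z" and fL: "fst (\<Lambda> z) = fst z" for z
    by (simp_all add: \<Lambda>_def PX)
  \<comment> \<open>Stated for a generic triple of function, source and initial value, as it is
    applied to \<open>f\<close> and to \<open>\<phi>\<close>.\<close>
  have main: "AE y in lborel. AE t in lborel. 0 \<le> t \<longrightarrow> k (\<Lambda> (t, y)) = k0 (\<Xi> y) + icc 0 t (\<lambda>s. l (\<Lambda> (s, y)))"
    if ki: "L1 k" "L1 l" "L1 k0"
      and Tk: "\<And>\<kappa> E M \<theta> \<theta>'. cgrad \<kappa> E \<Longrightarrow> (\<And>y. norm y > M \<Longrightarrow> \<kappa> y = 0) \<Longrightarrow> C1 \<theta> \<theta>' \<Longrightarrow>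
        (LBINT z. future z * (\<kappa> (\<Psi> (snd z) - (0, fst z)) * (\<theta>' (fst z) * k z + \<theta> (fst z) * l z)))
          = - (\<theta> 0 * (LBINT x. \<kappa> (\<Psi> x) * k0 x))" for k l k0
  proof (rule weak_transport_imp_integrated)
    have [measurable]: "k \<in> borel_fun" "l \<in> borel_fun" "k0 \<in> borel_fun"
      using ki by (auto simp: borel_measurable_integrable)
    show "L1 (\<lambda>z. k (\<Lambda> z))" "L1 (\<lambda>z. l (\<Lambda> z))" "L1 (\<lambda>y. k0 (\<Xi> y))"
      using ki by (auto simp: integral_distr_lborel(2)[OF Ld Lm] integral_distr_lborel(2)[OF Xd Xm])
    fix \<kappa> :: "real \<times> real \<Rightarrow> real" and E and M :: real and \<theta> \<theta>' :: "real \<Rightarrow> real"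
    assume a: "cgrad \<kappa> E" "\<And>y. norm y > M \<Longrightarrow> \<kappa> y = 0" "C1 \<theta> \<theta>'"
    have [measurable]: "\<kappa> \<in> borel_fun" "\<theta> \<in> borel_fun" "\<theta>' \<in> borel_fun"
      using borel_measurable_cgrad[OF a(1)] C1_continuous[OF a(3)] C1D(2)[OF a(3)]
      by (auto intro: borel_measurable_continuous_onI)
    have sh[measurable]: "(\<lambda>z::real \<times> (real \<times> real). (0, fst z) :: real \<times> real) \<in> borel_fun"
      by (auto intro!: borel_measurable_continuous_onI continuous_intros)
    have "(LBINT z. future z * (\<kappa> (snd z) * (\<theta>' (fst z) * k (\<Lambda> z) + \<theta> (fst z) * l (\<Lambda> z))))
      = (LBINT z. (\<lambda>z. future z * (\<kappa> (\<Psi> (snd z) - (0, fst z)) * (\<theta>' (fst z) * k z + \<theta> (fst z) * l z))) (\<Lambda> z))"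
      by (simp add: sL fL)
    also have "\<dots> = (LBINT z. future z * (\<kappa> (\<Psi> (snd z) - (0, fst z)) * (\<theta>' (fst z) * k z + \<theta> (fst z) * l z)))"
      by (rule integral_distr_lborel(1)[OF Ld Lm]) measurable
    also have "\<dots> = - (\<theta> 0 * (LBINT x. \<kappa> (\<Psi> x) * k0 x))" by (rule Tk[OF a])
    also have "(LBINT x. \<kappa> (\<Psi> x) * k0 x) = (LBINT x. (\<lambda>x. \<kappa> (\<Psi> x) * k0 x) (\<Xi> x))"
      by (rule integral_distr_lborel(1)[OF Xd Xm, symmetric]) measurable
    finally show "(LBINT z. future z * (\<kappa> (snd z) * (\<theta>' (fst z) * k (\<Lambda> z) + \<theta> (fst z) * l (\<Lambda> z))))
      = - (\<theta> 0 * (LBINT y. \<kappa> y * k0 (\<Xi> y)))" by (simp add: PX)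
  qed
  have Yf: "AE y in lborel. AE t in lborel. 0 \<le> t \<longrightarrow> f (\<Lambda> (t, y)) = f0 (\<Xi> y) + icc 0 t (\<lambda>s. g (\<Lambda> (s, y)))"
  proof (rule main[OF int(1,2,3)])
    fix \<kappa> :: "real \<times> real \<Rightarrow> real" and E and M :: real and \<theta> \<theta>' :: "real \<Rightarrow> real"
    assume a: "cgrad \<kappa> E" "\<And>y. norm y > M \<Longrightarrow> \<kappa> y = 0" "C1 \<theta> \<theta>'"
    show "(LBINT z. future z * (\<kappa> (\<Psi> (snd z) - (0, fst z)) * (\<theta>' (fst z) * f z + \<theta> (fst z) * g z)))
          = - (\<theta> 0 * (LBINT x. \<kappa> (\<Psi> x) * f0 x))"
      by (rule Tf[of \<kappa> E M]) (use a in auto)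
  qed
  have Yp: "AE y in lborel. AE t in lborel. 0 \<le> t \<longrightarrow> \<phi> (\<Lambda> (t, y)) = \<phi>0 (\<Xi> y) + icc 0 t (\<lambda>s. \<delta> (\<Lambda> (s, y)))"
  proof (rule main[OF int(4,5,6)])
    fix \<kappa> :: "real \<times> real \<Rightarrow> real" and E and M :: real and \<theta> \<theta>' :: "real \<Rightarrow> real"
    assume a: "cgrad \<kappa> E" "\<And>y. norm y > M \<Longrightarrow> \<kappa> y = 0" "C1 \<theta> \<theta>'"
    show "(LBINT z. future z * (\<kappa> (\<Psi> (snd z) - (0, fst z)) * (\<theta>' (fst z) * \<phi> z + \<theta> (fst z) * \<delta> z)))
          = - (\<theta> 0 * (LBINT x. \<kappa> (\<Psi> x) * \<phi>0 x))"
      by (rule Tp[of \<kappa> E M]) (use a in auto)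
  qed
  have gi: "L1 (\<lambda>z. g (\<Lambda> z))" and di: "L1 (\<lambda>z. \<delta> (\<Lambda> z))"
    using int by (auto simp: integral_distr_lborel(2)[OF Ld Lm])
  have pi: "L1 (\<lambda>y. \<phi>0 (\<Xi> y))" using int by (auto simp: integral_distr_lborel(2)[OF Xd Xm])
  have C0: "C \<ge> 0" using bnd(2)[of 0] by linarith
  have bb: "\<bar>\<beta> x\<bar> \<le> \<bar>\<beta> 0\<bar> + L * C" if "\<bar>x\<bar> \<le> C" for x
  proof -
    have "L \<ge> 0" using Lip[of 1 0] by simp
    then have "L * \<bar>x\<bar> \<le> L * C" using that by (intro mult_left_mono) auto
    moreover have "\<bar>\<beta> x - \<beta> 0\<bar> \<le> L * \<bar>x\<bar>" using Lip[of x 0] by simp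
    ultimately show ?thesis by linarith
  qed
  define B where "B = \<bar>\<beta> 0\<bar> + L * C"
  have iz: "L1 (\<lambda>z. future z * (\<beta> (f (\<Lambda> z)) * \<delta> (\<Lambda> z)))"
  proof (rule integrable_dominated[of "\<lambda>z. B * \<bar>\<delta> (\<Lambda> z)\<bar>"])
    have p: "\<bar>\<beta> (f (\<Lambda> z)) * \<delta> (\<Lambda> z)\<bar> \<le> B * \<bar>\<delta> (\<Lambda> z)\<bar>" for z
      unfolding abs_mult B_def by (intro mult_right_mono bb bnd) auto
    show "\<bar>future z * (\<beta> (f (\<Lambda> z)) * \<delta> (\<Lambda> z))\<bar> \<le> B * \<bar>\<delta> (\<Lambda> z)\<bar>" for z
      using p[of z] order_trans[OF abs_ge_zero p[of z]] by (simp add: indicator_def)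
  qed (use di in auto)
  have iy: "L1 (\<lambda>y. \<beta> (f0 (\<Xi> y)) * \<phi>0 (\<Xi> y))"
  proof (rule integrable_dominated[of "\<lambda>y. B * \<bar>\<phi>0 (\<Xi> y)\<bar>"])
    show "\<bar>\<beta> (f0 (\<Xi> y)) * \<phi>0 (\<Xi> y)\<bar> \<le> B * \<bar>\<phi>0 (\<Xi> y)\<bar>" for y
      unfolding abs_mult B_def by (intro mult_right_mono bb bnd) auto
  qed (use pi in auto)
  have "(LBINT z. future z * (\<beta> (f z) * \<delta> z)) = (LBINT z. (\<lambda>z. future z * (\<beta> (f z) * \<delta> z)) (\<Lambda> z))"
    by (rule integral_distr_lborel(1)[OF Ld Lm, symmetric]) measurable
  also have "\<dots> = (LBINT z. future z * (\<beta> (f (\<Lambda> z)) * \<delta> (\<Lambda> z)))" by (simp add: fL)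
  also have "\<dots> = (LBINT y. LBINT t. indicator {0..} t * (\<beta> (f (\<Lambda> (t, y))) * \<delta> (\<Lambda> (t, y))))"
    using lborel_fubini(6)[OF iz] by simp
  also have "\<dots> = (LBINT y. - (\<beta> (f0 (\<Xi> y)) * \<phi>0 (\<Xi> y)))"
  proof (rule integral_cong_AE)
    show "AE y in lborel. (LBINT t. indicator {0..} t * (\<beta> (f (\<Lambda> (t, y))) * \<delta> (\<Lambda> (t, y)))) = - (\<beta> (f0 (\<Xi> y)) * \<phi>0 (\<Xi> y))"
      using Yf Yp lborel_fubini(4)[OF gi] lborel_fubini(4)[OF di]
    proof eventually_elim
      case (elim y)
      have mt[measurable]: "(\<lambda>t. \<Lambda> (t, y)) \<in> borel_fun"
        by (rule measurable_compose[OF _ Lm]) (auto intro!: borel_measurable_continuous_onI continuous_intros)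
      have "(LBINT t. indicator {0..} t * (\<beta> (f (\<Lambda> (t, y))) * \<delta> (\<Lambda> (t, y)))) = - \<beta> (f0 (\<Xi> y)) * \<phi>0 (\<Xi> y)"
      proof (rule chain_rule_along_line[OF elim(3,4) _ elim(1,2)])
        show "AE t in lborel. T < t \<longrightarrow> \<phi> (\<Lambda> (t, y)) = 0" "AE t in lborel. T < t \<longrightarrow> \<delta> (\<Lambda> (t, y)) = 0"
          using supp by (auto simp: fL)
      qed (use gp T Lip in auto)
      then show ?case by simp
    qed
  qed (use lborel_fubini(5)[OF iz] iy in \<open>auto simp: borel_measurable_integrable\<close>)
  also have "\<dots> = - (LBINT y. (\<lambda>x. \<beta> (f0 x) * \<phi>0 x) (\<Xi> y))" by simp
  also have "(LBINT y. (\<lambda>x. \<beta> (f0 x) * \<phi>0 x) (\<Xi> y)) = (LBINT x. \<beta> (f0 x) * \<phi>0 x)"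
    by (rule integral_distr_lborel(1)[OF Xd Xm]) measurable
  finally show ?thesis .
qed

section \<open>Mollification in L2\<close>

lemma moll_continuous: "continuous_on S (moll e)"
  using smooth_continuous[OF smooth_moll] continuous_on_subset by blast

lemma borel_measurable_moll [measurable]: "moll e \<in> borel_fun"
  using moll_continuous by (rule borel_measurable_continuous_onI)

lemma moll_reflect_integrable: "e > 0 \<Longrightarrow> L1 (\<lambda>y. moll e (x - y))" "e > 0 \<Longrightarrow> (LBINT y. moll e (x - y)) = 1"
  using integral_distr_lborel[OF lborel_distr_reflect[of x], of "moll e"] moll_integrable[of e] moll_integral[of e] by (auto simp: moll_integral)

lemma conv_moll_continuous:
  fixes f :: "'a::euclidean_space \<Rightarrow> real"
  assumes "e > 0" "locint f" shows "continuous_on UNIV (conv f (moll e :: 'a \<Rightarrow> real))"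
  by (rule conv_continuous[OF assms(2) moll_continuous, of e]) (use assms in \<open>auto simp: moll_support\<close>)

lemma conv_moll_integrable:
  fixes f :: "'a::euclidean_space \<Rightarrow> real"
  assumes "e > 0" "locint f" shows "L1 (\<lambda>y. f y * moll e (x - y))"
  using conv_integrable[OF assms(2) moll_continuous[of UNIV e], where r=e and x=x] assms(1)
  by (simp add: moll_support)

lemma conv_moll_uniform:
  fixes f :: "'a::euclidean_space \<Rightarrow> real"
  assumes e: "e > 0" and f: "locint f" and osc: "\<And>y. norm (x - y) \<le> e \<Longrightarrow> \<bar>f y - f x\<bar> \<le> d"
  shows "\<bar>conv f (moll e) x - f x\<bar> \<le> d"
proof -
  have i: "L1 (\<lambda>y. f y * moll e (x - y))"
    by (rule conv_moll_integrable[OF e f])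
  note m = moll_reflect_integrable[OF e, of x]
  have "conv f (moll e) x - f x = (LBINT y. f y * moll e (x - y) - f x * moll e (x - y))"
    using i m by (subst Bochner_Integration.integral_diff) (auto simp: conv_def)
  also have "\<bar>\<dots>\<bar> \<le> (LBINT y. d * moll e (x - y))"
    unfolding real_norm_def[symmetric]
  proof (rule Bochner_Integration.integral_norm_bound_integral)
    fix y show "norm (f y * moll e (x - y) - f x * moll e (x - y)) \<le> d * moll e (x - y)"
    proof (cases "norm (x - y) \<le> e")
      case True
      have "\<bar>f y - f x\<bar> * moll e (x - y) \<le> d * moll e (x - y)"
        by (intro mult_right_mono osc True moll_nonneg)
      then show ?thesis by (simp add: abs_mult moll_nonneg left_diff_distrib[symmetric])
    qed (use e in \<open>simp add: moll_support\<close>)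
  qed (use i m in auto)
  also have "\<dots> = d" using m by simp
  finally show ?thesis .
qed

text \<open>Jensen's inequality, from \<open>0 \<le> \<integral> \<rho>(x - y) (f y - c)\<^sup>2 dy\<close> with \<open>c = (f * \<rho>) x\<close>.\<close>

lemma conv_moll_L2:
  fixes f :: "'a::euclidean_space \<Rightarrow> real"
  assumes e: "e > 0" and f: "L1 f" and f2: "L1 (\<lambda>x. (f x)\<^sup>2)"
  shows "L1 (\<lambda>x. (conv f (moll e) x)\<^sup>2)" "(LBINT x. (conv f (moll e) x)\<^sup>2) \<le> (LBINT x. (f x)\<^sup>2)"
proof -
  have fm[measurable]: "f \<in> borel_fun" using f by (simp add: borel_measurable_integrable)
  note lf = locint_integrable[OF f] and lf2 = locint_integrable[OF f2]
  have i1: "L1 (\<lambda>y. f y * moll e (x - y))" and i2: "L1 (\<lambda>y. (f y)\<^sup>2 * moll e (x - y))" for x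
    by (rule conv_moll_integrable[OF e lf] conv_moll_integrable[OF e lf2])+
  define F where "F = (\<lambda>z::'a \<times> 'a. (f (fst z))\<^sup>2 * moll e (snd z - fst z))"
  have Fm[measurable]: "F \<in> borel_fun" unfolding F_def by measurable
  have mx: "L1 (\<lambda>x. moll e (x - y))" "(LBINT x. moll e (x - y)) = 1" for y :: 'a
    using integral_distr_lborel[OF lborel_distr_shift[of "- y"], of "moll e"] moll_integrable[OF e] moll_integral[OF e, where 'a='a] by auto
  have Fi: "L1 F"
  proof -
    have "integrable (lborel \<Otimes>\<^sub>M lborel) F"
    proof (rule lborel_pair.Fubini_integrable)
      show "L1 (\<lambda>x. LBINT y. norm (F (x, y)))"
        using f2 mx by (simp add: F_def abs_mult moll_nonneg)
      show "AE x in lborel. L1 (\<lambda>y. F (x, y))" using mx by (simp add: F_def)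
    qed (simp add: lborel_prod)
    then show ?thesis by (simp add: lborel_prod)
  qed
  have J: "(conv f (moll e) x)\<^sup>2 \<le> (LBINT y. F (y, x))" for x
  proof -
    define c where "c = conv f (moll e) x"
    note m = moll_reflect_integrable[OF e, of x]
    have "0 \<le> (LBINT y. (f y - c)\<^sup>2 * moll e (x - y))" by (intro Bochner_Integration.integral_nonneg) (simp add: moll_nonneg)
    also have "(\<lambda>y. (f y - c)\<^sup>2 * moll e (x - y)) = (\<lambda>y. (f y)\<^sup>2 * moll e (x - y) - (2 * c * (f y * moll e (x - y)) - c\<^sup>2 * moll e (x - y)))"
      by (auto simp: power2_eq_square algebra_simps)
    also have "(LBINT y. (f y)\<^sup>2 * moll e (x - y) - (2 * c * (f y * moll e (x - y)) - c\<^sup>2 * moll e (x - y)))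
       = (LBINT y. (f y)\<^sup>2 * moll e (x - y)) - (2 * c * (LBINT y. f y * moll e (x - y)) - c\<^sup>2 * (LBINT y. moll e (x - y)))"
      using i1 i2 m(1) by simp
    also have "\<dots> = (LBINT y. F (y, x)) - c\<^sup>2"
      using m by (simp add: F_def c_def conv_def power2_eq_square)
    finally show ?thesis by (simp add: c_def)
  qed
  have [measurable]: "conv f (moll e) \<in> borel_fun"
    by (rule borel_measurable_continuous_onI[OF conv_moll_continuous[OF e lf]])
  show c2: "L1 (\<lambda>x. (conv f (moll e) x)\<^sup>2)"
    by (rule integrable_dominated[OF lborel_fubini(5)[OF Fi]]) (use J in auto)
  have "(LBINT x. (conv f (moll e) x)\<^sup>2) \<le> (LBINT x. LBINT y. F (y, x))"
    by (rule integral_mono[OF c2 lborel_fubini(5)[OF Fi] J])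
  also have "\<dots> = (LBINT y. LBINT x. F (y, x))" using lborel_fubini(3,6)[OF Fi] by simp
  also have "\<dots> = (LBINT x. (f x)\<^sup>2)" using mx by (simp add: F_def)
  finally show "(LBINT x. (conv f (moll e) x)\<^sup>2) \<le> (LBINT x. (f x)\<^sup>2)" .
qed

lemma AE_lborel_not_in_negligible:
  assumes "negligible N" shows "AE x in lborel. x \<notin> N"
proof -
  have "AE x in lebesgue. x \<notin> N" using assms by (auto simp: negligible_iff_null_sets intro: AE_not_in)
  then show ?thesis by (simp add: AE_completion_iff)
qed

lemma integrable_indicator_cball: "L1 (indicat_real (cball (x::'a::euclidean_space) r))"
  using emeasure_compact_finite[OF compact_cball, of x r]
  by (intro integrable_real_indicator) (auto simp: less_top)

text \<open>Clipping the values of \<open>f\<close> at \<open>k\<close> changes it little in L2. A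
  measurable function is an almost everywhere limit of continuous ones; clipping these at
  \<open>k\<close> as well and cutting them off in space provides a common dominating function, so
  the limit holds in L2.\<close>

lemma continuous_dense_L2:
  fixes f :: "'a::euclidean_space \<Rightarrow> real"
  assumes fm[measurable]: "f \<in> borel_fun" and f2: "L1 (\<lambda>x. (f x)\<^sup>2)"
    and supp: "\<And>x. norm x > R \<Longrightarrow> f x = 0" and e: "e > 0"
  obtains g where "continuous_on UNIV g" "\<And>x. norm x > R + 1 \<Longrightarrow> g x = 0"
    "L1 (\<lambda>x. (f x - g x)\<^sup>2)" "(LBINT x. (f x - g x)\<^sup>2) < e"
proof -
  define clip where "clip k y = max (- real k) (min (real k) y)" for k and y :: real
  have clipm[measurable]: "clip k \<in> borel_fun" for k unfolding clip_def[abs_def] by measurable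
  have clipc: "continuous_on UNIV (clip k)" for k unfolding clip_def[abs_def] by (intro continuous_intros)
  have clipb: "\<bar>clip k y\<bar> \<le> real k" for k y unfolding clip_def by auto
  have d1: "(f x - clip k (f x))\<^sup>2 \<le> (f x)\<^sup>2" for x k
    by (rule abs_le_square_iff[THEN iffD1]) (auto simp: clip_def)
  have "(\<lambda>k. LBINT x. (f x - clip k (f x))\<^sup>2) \<longlonglongrightarrow> (LINT x::'a|lborel. 0)"
  proof (rule integral_dominated_convergence[where w="\<lambda>x. (f x)\<^sup>2"])
    show "AE x in lborel. (\<lambda>k. (f x - clip k (f x))\<^sup>2) \<longlonglongrightarrow> 0"
    proof (rule AE_I2)
      fix x
      obtain K :: nat where K: "\<bar>f x\<bar> \<le> real K" using real_arch_simple by blast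
      have "(f x - clip k (f x))\<^sup>2 = 0" if "k \<ge> K" for k using K that by (auto simp: clip_def)
      then show "(\<lambda>k. (f x - clip k (f x))\<^sup>2) \<longlonglongrightarrow> 0"
        by (intro tendsto_eventually eventually_sequentiallyI[of K])
    qed
    show "AE x in lborel. norm ((f x - clip k (f x))\<^sup>2) \<le> (f x)\<^sup>2" for k using d1 by simp
  qed (use f2 in auto)
  then have "\<forall>\<^sub>F k in sequentially. (LBINT x. (f x - clip k (f x))\<^sup>2) < e / 4"
    using e by (intro order_tendstoD(2)[where y=0]) auto
  then obtain k where k: "(LBINT x. (f x - clip k (f x))\<^sup>2) < e / 4"
    by (auto simp: eventually_sequentially)
  have ki: "L1 (\<lambda>x. (f x - clip k (f x))\<^sup>2)"
    by (rule integrable_dominated[OF f2]) (use d1 in auto)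
  have "f \<in> borel_measurable lebesgue" by (rule measurable_completion) simp
  then have "f measurable_on UNIV"
    by (intro lebesgue_measurable_imp_measurable_on) (auto simp: lebesgue_on_UNIV_eq)
  then obtain N g where N: "negligible N" and gc: "\<And>n. continuous_on UNIV (g n)"
    and gl: "\<And>x. x \<notin> N \<Longrightarrow> (\<lambda>n. g n x) \<longlonglongrightarrow> f x"
    unfolding measurable_on_def by auto
  \<comment> \<open>Equal to 1 wherever \<open>f\<close> may be nonzero and to 0 beyond
    \<open>R + 1\<close>: the approximants get bounded support and the limit stays the same.\<close>
  define cut where "cut x = max 0 (min 1 (R + 1 - norm x))" for x :: 'a
  define h where "h n x = cut x * clip k (g n x)" for n x
  have hc: "continuous_on UNIV (h n)" for n
    unfolding h_def cut_def by (intro continuous_intros continuous_on_compose2[OF clipc gc]) auto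
  have hm[measurable]: "h n \<in> borel_fun" for n by (rule borel_measurable_continuous_onI[OF hc])
  have hs: "h n x = 0" if "norm x > R + 1" for n x using that by (simp add: h_def cut_def)
  have cutb: "0 \<le> cut x" "cut x \<le> 1" for x by (auto simp: cut_def)
  have d2: "(clip k (f x) - h n x)\<^sup>2 \<le> (2 * real k)\<^sup>2 * indicator (cball 0 (R + 1)) x" for x n
  proof (cases "norm x > R + 1")
    case True then show ?thesis using hs[OF True] supp[of x] by (simp add: clip_def)
  next
    case False
    have "\<bar>h n x\<bar> \<le> 1 * real k" unfolding h_def abs_mult using cutb[of x] clipb by (intro mult_mono) auto
    then have "\<bar>clip k (f x) - h n x\<bar> \<le> \<bar>2 * real k\<bar>" using clipb[of k "f x"] by linarith
    then have "(clip k (f x) - h n x)\<^sup>2 \<le> (2 * real k)\<^sup>2" by (simp only: abs_le_square_iff)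
    then show ?thesis using False by simp
  qed
  have bi: "L1 (\<lambda>x. (2 * real k)\<^sup>2 * indicator (cball (0::'a) (R + 1)) x)"
    by (intro integrable_mult_right integrable_indicator_cball)
  have "(\<lambda>n. LBINT x. (clip k (f x) - h n x)\<^sup>2) \<longlonglongrightarrow> (LINT x::'a|lborel. 0)"
  proof (rule integral_dominated_convergence[OF _ _ bi])
    show "AE x in lborel. (\<lambda>n. (clip k (f x) - h n x)\<^sup>2) \<longlonglongrightarrow> 0"
      using AE_lborel_not_in_negligible[OF N]
    proof eventually_elim
      case (elim x)
      have "(\<lambda>n. (clip k (f x) - h n x)\<^sup>2) \<longlonglongrightarrow> (clip k (f x) - cut x * clip k (f x))\<^sup>2"
        unfolding h_def clip_def by (intro tendsto_intros gl elim)
      also have "(clip k (f x) - cut x * clip k (f x))\<^sup>2 = 0"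
        using supp[of x] by (cases "norm x > R") (auto simp: cut_def clip_def)
      finally show ?case .
    qed
    show "AE x in lborel. norm ((clip k (f x) - h n x)\<^sup>2) \<le> (2 * real k)\<^sup>2 * indicator (cball 0 (R + 1)) x" for n
      using d2 by simp
  qed auto
  then have "\<forall>\<^sub>F n in sequentially. (LBINT x. (clip k (f x) - h n x)\<^sup>2) < e / 4"
    using e by (intro order_tendstoD(2)[where y=0]) auto
  then obtain n where n: "(LBINT x. (clip k (f x) - h n x)\<^sup>2) < e / 4"
    by (auto simp: eventually_sequentially)
  have ni: "L1 (\<lambda>x. (clip k (f x) - h n x)\<^sup>2)"
    by (rule integrable_dominated[OF bi]) (use d2 in auto)
  have sq: "(f x - h n x)\<^sup>2 \<le> 2 * (f x - clip k (f x))\<^sup>2 + 2 * (clip k (f x) - h n x)\<^sup>2" for x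
    using sum_squares_bound[of "f x - clip k (f x)" "clip k (f x) - h n x"] by (simp add: power2_eq_square algebra_simps)
  have fi: "L1 (\<lambda>x. (f x - h n x)\<^sup>2)"
    by (rule integrable_dominated[of "\<lambda>x. 2 * (f x - clip k (f x))\<^sup>2 + 2 * (clip k (f x) - h n x)\<^sup>2"]) (use ki ni sq in auto)
  have "(LBINT x. (f x - h n x)\<^sup>2) \<le> (LBINT x. 2 * (f x - clip k (f x))\<^sup>2 + 2 * (clip k (f x) - h n x)\<^sup>2)"
    by (rule integral_mono[OF fi _ sq]) (use ki ni in auto)
  also have "\<dots> < e" using k n ki ni by simp
  finally show ?thesis using that[OF hc hs fi] by blast
qed

lemma integrable_of_square_integrable:
  fixes f :: "'a::euclidean_space \<Rightarrow> real"
  assumes [measurable]: "f \<in> borel_fun" and f2: "L1 (\<lambda>x. (f x)\<^sup>2)"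
    and supp: "\<And>x. norm x > R \<Longrightarrow> f x = 0"
  shows "L1 f"
proof (rule integrable_dominated[of "\<lambda>x. (f x)\<^sup>2 + indicator (cball 0 R) x"])
  have "L1 (indicator (cball (0::'a) R) :: 'a \<Rightarrow> real)"
    by (rule integrable_indicator_cball)
  then show "L1 (\<lambda>x. (f x)\<^sup>2 + indicator (cball 0 R) x)" using f2 by auto
  fix x
  have "\<bar>y\<bar> \<le> y\<^sup>2 + 1" for y :: real
  proof -
    have "0 \<le> (\<bar>y\<bar> - 1)\<^sup>2 + \<bar>y\<bar>" by simp
    then show ?thesis by (simp add: power2_eq_square algebra_simps)
  qed
  then show "\<bar>f x\<bar> \<le> (f x)\<^sup>2 + indicator (cball 0 R) x"
    using supp[of x] by (cases "norm x > R") auto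
qed simp

text \<open>Density argument: for a continuous \<open>g\<close> with bounded support close to
  \<open>f\<close>, mollification converges uniformly, and by Jensen's inequality mollifying
  \<open>f - g\<close> does not increase its L2 norm.\<close>

lemma conv_moll_tendsto_L2:
  fixes f :: "'a::euclidean_space \<Rightarrow> real"
  assumes fm[measurable]: "f \<in> borel_fun" and f2: "L1 (\<lambda>x. (f x)\<^sup>2)"
    and supp: "\<And>x. norm x > R \<Longrightarrow> f x = 0" and en: "\<And>n. e n > 0" and elim: "e \<longlonglongrightarrow> 0"
  shows "(\<lambda>n. LBINT x. (conv f (moll (e n)) x - f x)\<^sup>2) \<longlonglongrightarrow> 0"
    "L1 (\<lambda>x. (conv f (moll (e n)) x - f x)\<^sup>2)"
proof -
  note f1 = integrable_of_square_integrable[OF fm f2 supp]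
  have mc[measurable]: "conv f (moll (e n)) \<in> borel_fun" if "L1 f" for f :: "'a \<Rightarrow> real" and n
    by (rule borel_measurable_continuous_onI[OF conv_moll_continuous[OF en locint_integrable[OF that]]])
  have sq3: "(a + b + c)\<^sup>2 \<le> 3 * (a\<^sup>2 + b\<^sup>2 + c\<^sup>2)" for a b c :: real
    using sum_squares_bound[of a b] sum_squares_bound[of a c] sum_squares_bound[of b c]
    by (simp add: power2_eq_square algebra_simps)
  show fi: "L1 (\<lambda>x. (conv f (moll (e n)) x - f x)\<^sup>2)" for n
  proof (rule integrable_dominated[of "\<lambda>x. 3 * ((conv f (moll (e n)) x)\<^sup>2 + (f x)\<^sup>2 + 0\<^sup>2)"])
    show "L1 (\<lambda>x. 3 * ((conv f (moll (e n)) x)\<^sup>2 + (f x)\<^sup>2 + 0\<^sup>2))"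
      using conv_moll_L2(1)[OF en f1 f2] f2 by auto
    show "\<bar>(conv f (moll (e n)) x - f x)\<^sup>2\<bar> \<le> 3 * ((conv f (moll (e n)) x)\<^sup>2 + (f x)\<^sup>2 + 0\<^sup>2)" for x
      using sq3[of "conv f (moll (e n)) x" "- f x" 0] by simp
  qed (use mc[OF f1] in measurable)
  show "(\<lambda>n. LBINT x. (conv f (moll (e n)) x - f x)\<^sup>2) \<longlonglongrightarrow> 0"
  proof (rule LIMSEQ_I)
    fix \<epsilon> :: real assume eps: "\<epsilon> > 0"
    \<comment> \<open>Three terms, each at most \<open>\<epsilon>'\<close>, are multiplied by 3
      through \<open>sq3\<close>; nine tenths stay below \<open>\<epsilon>\<close>.\<close>
    define \<epsilon>' where "\<epsilon>' = \<epsilon> / 10"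
    have e': "\<epsilon>' > 0" using eps by (simp add: \<epsilon>'_def)
    obtain g where g: "continuous_on UNIV g" "\<And>x. norm x > R + 1 \<Longrightarrow> g x = 0"
      "L1 (\<lambda>x. (f x - g x)\<^sup>2)" "(LBINT x. (f x - g x)\<^sup>2) < \<epsilon>'"
      using continuous_dense_L2[OF fm f2 supp e'] by blast
    have gm[measurable]: "g \<in> borel_fun" by (rule borel_measurable_continuous_onI[OF g(1)])
    have lg: "locint g" by (rule locint_continuous[OF g(1)])
    have gf1: "L1 (\<lambda>x. f x - g x)"
      by (rule integrable_of_square_integrable[OF _ g(3), of "max R (R + 1)"]) (use supp g(2) in auto)
    have gi: "L1 g" using Bochner_Integration.integrable_diff[OF f1 gf1] by simp
    define V where "V = measure lborel (cball (0::'a) (R + 2))"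
    \<comment> \<open>The bound \<open>d \<le> 1\<close> allows the square of the uniform error to
      be estimated by \<open>d\<close> itself, and \<open>d * V \<le> \<epsilon>'\<close> controls
      its integral over the ball.\<close>
    define d where "d = min 1 (\<epsilon>' / (V + 1))"
    have V: "V \<ge> 0" by (simp add: V_def)
    have d: "d > 0" "d \<le> 1" "d * V \<le> \<epsilon>'"
    proof -
      show "d > 0" "d \<le> 1" using e' V by (auto simp: d_def)
      have "d * V \<le> \<epsilon>' / (V + 1) * (V + 1)" using V e' by (intro mult_mono) (auto simp: d_def)
      then show "d * V \<le> \<epsilon>'" using V by simp
    qed
    have "uniformly_continuous_on (cball 0 (R + 3)) g"
      by (intro compact_uniformly_continuous continuous_on_subset[OF g(1)]) auto
    then obtain \<eta> where eta: "\<eta> > 0" "\<And>x y. x \<in> cball 0 (R + 3) \<Longrightarrow> y \<in> cball 0 (R + 3) \<Longrightarrow> dist y x < \<eta> \<Longrightarrow> dist (g y) (g x) < d"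
      using d(1) unfolding uniformly_continuous_on_def by metis
    have "\<forall>\<^sub>F n in sequentially. e n < min \<eta> 1" using elim eta(1) by (intro order_tendstoD(2)[where y=0]) auto
    then obtain N where N: "\<And>n. n \<ge> N \<Longrightarrow> e n < min \<eta> 1" by (auto simp: eventually_sequentially)
    show "\<exists>no. \<forall>n\<ge>no. norm ((LBINT x. (conv f (moll (e n)) x - f x)\<^sup>2) - 0) < \<epsilon>"
    proof (intro exI[of _ N] allI impI)
      fix n assume n: "n \<ge> N"
      have cg: "\<bar>conv g (moll (e n)) x - g x\<bar> \<le> d * indicator (cball 0 (R + 2)) x" for x
      proof -
        have osc: "\<bar>g y - g x\<bar> \<le> d * indicator (cball 0 (R + 2)) x" if y: "norm (x - y) \<le> e n" for y
        proof -
          have y1: "norm (x - y) < \<eta>" "norm (x - y) < 1" using y N[OF n] by auto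
          show ?thesis
          proof (cases "norm x \<le> R + 2")
            case True
            then have "norm y \<le> R + 3" using y1 norm_triangle_ineq2[of y x] by (simp add: norm_minus_commute)
            then show ?thesis using eta(2)[of x y] True y1 by (simp add: dist_norm norm_minus_commute)
          next
            case False
            then have "norm y > R + 1" using y1 norm_triangle_ineq2[of x y] by simp
            then show ?thesis using g(2)[of x] g(2)[of y] False by simp
          qed
        qed
        show ?thesis by (rule conv_moll_uniform[OF en lg osc])
      qed
      have lin: "conv f (moll (e n)) x = conv (\<lambda>x. f x - g x) (moll (e n)) x + conv g (moll (e n)) x" for x
        using conv_moll_integrable[OF en[of n] locint_integrable[OF f1], where x=x] conv_moll_integrable[OF en[of n] lg, where x=x]
        by (simp add: conv_def left_diff_distrib)
      have bi: "L1 (\<lambda>x. d * indicator (cball (0::'a) (R + 2)) x)" "(LBINT x. d * indicator (cball (0::'a) (R + 2)) x) = d * V"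
        by (auto simp: V_def intro!: integrable_mult_right integrable_indicator_cball)
      have pw: "(conv f (moll (e n)) x - f x)\<^sup>2 \<le> 3 * ((conv (\<lambda>x. f x - g x) (moll (e n)) x)\<^sup>2 + d * indicator (cball 0 (R + 2)) x + (f x - g x)\<^sup>2)" for x
      proof -
        have "(conv g (moll (e n)) x - g x)\<^sup>2 \<le> d * indicator (cball 0 (R + 2)) x"
        proof -
          have "(conv g (moll (e n)) x - g x)\<^sup>2 \<le> (d * indicator (cball 0 (R + 2)) x)\<^sup>2"
            using cg[of x] by (intro abs_le_square_iff[THEN iffD1]) simp
          also have "\<dots> \<le> d * indicator (cball 0 (R + 2)) x"
            using d(1,2) by (auto simp: indicator_def power2_eq_square mult_le_one)
          finally show ?thesis .
        qed
        moreover have "(conv f (moll (e n)) x - f x)\<^sup>2 = (conv (\<lambda>x. f x - g x) (moll (e n)) x + (conv g (moll (e n)) x - g x) + (g x - f x))\<^sup>2"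
          unfolding lin by (rule arg_cong[where f="\<lambda>x. x\<^sup>2"]) simp
        ultimately show ?thesis
          using sq3[of "conv (\<lambda>x. f x - g x) (moll (e n)) x" "conv g (moll (e n)) x - g x" "g x - f x"]
          by (simp add: power2_commute[of "g x"])
      qed
      note cL = conv_moll_L2[OF en gf1 g(3), of n]
      have "(LBINT x. (conv f (moll (e n)) x - f x)\<^sup>2)
         \<le> (LBINT x. 3 * ((conv (\<lambda>x. f x - g x) (moll (e n)) x)\<^sup>2 + d * indicator (cball 0 (R + 2)) x + (f x - g x)\<^sup>2))"
        by (rule integral_mono[OF fi _ pw]) (use cL(1) bi g(3) in auto)
      also have "\<dots> = 3 * ((LBINT x. (conv (\<lambda>x. f x - g x) (moll (e n)) x)\<^sup>2) + d * V + (LBINT x. (f x - g x)\<^sup>2))"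
        using cL(1) bi g(3) by simp
      also have "\<dots> \<le> 3 * (\<epsilon>' + \<epsilon>' + \<epsilon>')" using cL(2) d(3) g(4) by simp
      also have "\<dots> < \<epsilon>" using eps by (simp add: \<epsilon>'_def)
      finally show "norm ((LBINT x. (conv f (moll (e n)) x - f x)\<^sup>2) - 0) < \<epsilon>" by simp
    qed
  qed
qed

section \<open>Weak solutions with C1 test functions\<close>

text \<open>The working notion of solution: test functions are merely C1, so that they may contain
  cutoffs and stream functions, and have genuinely compact support without periodicity. The set
  \<open>\<omega>\<close> enters only through the supports and may be closed, as it is for the balls
  in \<open>weak_sol_local\<close>.\<close>

definition weak_sol :: "'a::euclidean_space set \<Rightarrow> ('a \<Rightarrow> 'a) \<Rightarrow> ('a \<Rightarrow> real) \<Rightarrow> (real \<times> 'a \<Rightarrow> real) \<Rightarrow> bool" where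
  "weak_sol \<omega> b u0 u \<longleftrightarrow> (\<forall>\<phi> D K. cgrad \<phi> D \<longrightarrow> compact K \<longrightarrow> K \<subseteq> UNIV \<times> \<omega> \<longrightarrow> (\<forall>z. z \<notin> K \<longrightarrow> \<phi> z = 0) \<longrightarrow>
     (LBINT z. future z * (u z * flux b D z)) = - (LBINT x. u0 x * \<phi> (0, x)))"

lemma weak_solD:
  assumes "weak_sol \<omega> b u0 u" "cgrad \<phi> D" "compact K" "K \<subseteq> UNIV \<times> \<omega>" "\<And>z. z \<notin> K \<Longrightarrow> \<phi> z = 0"
  shows "(LBINT z. future z * (u z * flux b D z)) = - (LBINT x. u0 x * \<phi> (0, x))"
  using assms unfolding weak_sol_def by blast

lemma cgrad_comp_fst:
  assumes "cgrad f D" shows "cgrad (\<lambda>z::'a::euclidean_space \<times> 'b::euclidean_space. f (fst z)) (\<lambda>z. (D (fst z), 0))"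
  unfolding cgrad_def
proof (intro conjI allI)
  fix z :: "'a \<times> 'b"
  have "((\<lambda>z::'a \<times> 'b. f (fst z)) has_derivative (\<lambda>v. D (fst z) \<bullet> fst v)) (at z)"
    by (rule has_derivative_compose[OF _ cgradD[OF assms]]) (auto intro!: derivative_eq_intros)
  then show "((\<lambda>z::'a \<times> 'b. f (fst z)) has_derivative (\<bullet>) (D (fst z), 0)) (at z)"
    by (rule has_derivative_eq_rhs) (auto simp: inner_prod_def)
next
  show "continuous_on UNIV (\<lambda>z::'a \<times> 'b. (D (fst z), 0 :: 'b))"
    by (intro continuous_intros continuous_on_compose2[OF cgrad_continuous_grad[OF assms, of UNIV]]) auto
qed

lemma cgrad_comp_snd:
  assumes "cgrad f D" shows "cgrad (\<lambda>z::'a::euclidean_space \<times> 'b::euclidean_space. f (snd z)) (\<lambda>z. (0, D (snd z)))"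
  unfolding cgrad_def
proof (intro conjI allI)
  fix z :: "'a \<times> 'b"
  have "((\<lambda>z::'a \<times> 'b. f (snd z)) has_derivative (\<lambda>v. D (snd z) \<bullet> snd v)) (at z)"
    by (rule has_derivative_compose[OF _ cgradD[OF assms]]) (auto intro!: derivative_eq_intros)
  then show "((\<lambda>z::'a \<times> 'b. f (snd z)) has_derivative (\<bullet>) (0, D (snd z))) (at z)"
    by (rule has_derivative_eq_rhs) (auto simp: inner_prod_def)
next
  show "continuous_on UNIV (\<lambda>z::'a \<times> 'b. (0 :: 'a, D (snd z)))"
    by (intro continuous_intros continuous_on_compose2[OF cgrad_continuous_grad[OF assms, of UNIV]]) auto
qed

lemma cgrad_C1_real: "C1 f f' \<Longrightarrow> cgrad f f'"
  using cgrad_C1[of f f' "\<lambda>x. x" "\<lambda>_. 1"] cgrad_inner[of "1::real"] by simp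

lemma bounded_on_compact:
  fixes D :: "'a::topological_space \<Rightarrow> 'b::real_normed_vector"
  assumes "compact K" "continuous_on K D" obtains B where "B \<ge> 0" "\<And>x. x \<in> K \<Longrightarrow> norm (D x) \<le> B"
proof -
  have "bounded (D ` K)" using assms by (intro compact_imp_bounded compact_continuous_image)
  then obtain B where "\<And>x. x \<in> K \<Longrightarrow> norm (D x) \<le> B" by (auto simp: bounded_iff)
  then show ?thesis using that[of "\<bar>B\<bar>"] by fastforce
qed

lemma continuous_compact_support_integrable:
  fixes f :: "'a::euclidean_space \<Rightarrow> real"
  assumes "continuous_on UNIV f" "compact K" "\<And>x. x \<notin> K \<Longrightarrow> f x = 0"
  shows "L1 f"
proof -
  have "L1 (\<lambda>x. indicator K x *\<^sub>R f x)"
    by (rule borel_integrable_compact[OF assms(2) continuous_on_subset[OF assms(1)]]) simp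
  moreover have "(\<lambda>x. indicator K x *\<^sub>R f x) = f" using assms(3) by (auto simp: indicator_def fun_eq_iff)
  ultimately show ?thesis by simp
qed

lemma integrable_against_continuous:
  fixes b :: "'a::euclidean_space \<Rightarrow> 'b::euclidean_space" and D :: "'a \<Rightarrow> 'b"
  assumes b: "L1 (\<lambda>x. indicator K x *\<^sub>R b x)" and bm[measurable]: "b \<in> borel_fun"
    and D: "continuous_on UNIV D" and K: "compact K" and D0: "\<And>x. x \<notin> K \<Longrightarrow> D x = 0"
  shows "L1 (\<lambda>x. D x \<bullet> b x)"
proof -
  obtain B where B: "B \<ge> 0" "\<And>x. x \<in> K \<Longrightarrow> norm (D x) \<le> B"
    using bounded_on_compact[OF K continuous_on_subset[OF D]] by auto
  have [measurable]: "D \<in> borel_fun" by (rule borel_measurable_continuous_onI[OF D])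
  show ?thesis
  proof (rule integrable_dominated)
    show "L1 (\<lambda>x. B * norm (indicator K x *\<^sub>R b x))"
      by (rule integrable_mult_right[OF integrable_norm[OF b]])
    show "\<bar>D x \<bullet> b x\<bar> \<le> B * norm (indicator K x *\<^sub>R b x)" for x
    proof (cases "x \<in> K")
      case True
      have "\<bar>D x \<bullet> b x\<bar> \<le> norm (D x) * norm (b x)" by (rule Cauchy_Schwarz_ineq2)
      also have "\<dots> \<le> B * norm (b x)" by (intro mult_right_mono B True) auto
      finally show ?thesis using True by simp
    qed (simp add: D0)
  qed measurable
qed

text \<open>Test with \<open>\<theta> t * \<phi> x\<close>, where \<open>\<theta>\<close> is
  supported in times between 1 and 2. The initial term and the integral of \<open>\<theta>'\<close>
  vanish, leaving the integral of \<open>\<theta>\<close> times that of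
  \<open>D x \<bullet> b x\<close>.\<close>

lemma weak_sol_one_imp_div_free:
  fixes b :: "'a::euclidean_space \<Rightarrow> 'a"
  assumes w: "weak_sol \<omega> b (\<lambda>_. 1) (\<lambda>_. 1)" and bm: "b \<in> borel_fun"
    and b: "L1 (\<lambda>x. indicator K x *\<^sub>R b x)"
    and \<phi>: "cgrad \<phi> D" "compact K" "K \<subseteq> \<omega>" "\<And>x. x \<notin> K \<Longrightarrow> \<phi> x = 0"
  shows "(LBINT x. D x \<bullet> b x) = 0"
proof -
  \<comment> \<open>With parameter 4 the plateau equals 1 on the middle half of the interval, hence
    has positive integral.\<close>
  obtain \<theta>' where th: "C1 (plateau 1 2 4) \<theta>'" using C1_plateau by blast
  let ?\<theta> = "plateau 1 2 4"
  have th0: "?\<theta> t = 0" if "t \<ge> 2" for t using that by (auto intro: plateau_outside)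
  have thd: "(LBINT t. indicator {0..} t * \<theta>' t) = 0" 
    using integral_tail_C1[OF th, of 2 0] th0 plateau_outside[of 0 1 2 4] by simp
  have ti: "L1 ?\<theta>"
    by (rule continuous_compact_support_integrable[OF C1_continuous[OF th], of "{1..2}"]) (auto intro: plateau_outside)
  have t1: "?\<theta> t = 1" if "t \<in> {5/4..7/4}" for t
    using that by (auto simp: plateau_def sstep_1)
  have "(LBINT t. indicator {5/4..7/4::real} t) \<le> (LBINT t. ?\<theta> t)"
    by (rule integral_mono[OF integrable_indicator_Icc ti]) (use t1 plateau_bounds in \<open>auto simp: indicator_def\<close>)
  then have tpos: "(LBINT t. ?\<theta> t) > 0" by simp
  have tind: "indicator {0..} t * ?\<theta> t = ?\<theta> t" for t :: real
    using plateau_outside[of t 1 2 4] by (auto simp: indicator_def)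
  have D0: "D x = 0" if "x \<notin> K" for x
    by (rule cgrad_zero_outside[OF \<phi>(1) compact_imp_closed[OF \<phi>(2)] \<phi>(4) that])
  have Di: "L1 (\<lambda>x. D x \<bullet> b x)"
    by (rule integrable_against_continuous[OF b bm cgrad_continuous_grad[OF \<phi>(1)] \<phi>(2) D0])
  have \<phi>i: "L1 \<phi>"
    by (rule continuous_compact_support_integrable[OF cgrad_continuous[OF \<phi>(1)] \<phi>(2,4)])
  have g: "cgrad (\<lambda>z. ?\<theta> (fst z) * \<phi> (snd z)) (\<lambda>z. \<phi> (snd z) *\<^sub>R (\<theta>' (fst z), 0) + ?\<theta> (fst z) *\<^sub>R (0, D (snd z)))"
    by (rule cgrad_mult[OF cgrad_comp_fst[OF cgrad_C1_real[OF th]] cgrad_comp_snd[OF \<phi>(1)]])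
  have "(LBINT z. future z * (1 * ((\<phi> (snd z) *\<^sub>R (\<theta>' (fst z), 0) + ?\<theta> (fst z) *\<^sub>R (0, D (snd z))) \<bullet> (1, b (snd z)))))
       = - (LBINT x. 1 * (?\<theta> (fst (0::real, x)) * \<phi> (snd (0::real, x))))"
  proof (rule weak_solD[OF w g, of "{1..2} \<times> K"])
    show "compact ({1..2::real} \<times> K)" using \<phi>(2) by (intro compact_Times) auto
    show "?\<theta> (fst z) * \<phi> (snd z) = 0" if "z \<notin> {1..2} \<times> K" for z
      using that \<phi>(4)[of "snd z"] plateau_outside[of "fst z" 1 2 4] by (auto simp: mem_Times_iff)
  qed (use \<phi>(3) in auto)
  also have "\<dots> = 0" using plateau_outside[of 0 1 2 4] by simp
  also have "(\<lambda>z. future z * (1 * ((\<phi> (snd z) *\<^sub>R (\<theta>' (fst z), 0) + ?\<theta> (fst z) *\<^sub>R (0, D (snd z))) \<bullet> (1, b (snd z)))))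
     = (\<lambda>z. (future z * \<theta>' (fst z)) * \<phi> (snd z) + ?\<theta> (fst z) * (D (snd z) \<bullet> b (snd z)))"
  proof
    fix z :: "real \<times> 'a"
    have "future z * (1 * ((\<phi> (snd z) *\<^sub>R (\<theta>' (fst z), 0) + ?\<theta> (fst z) *\<^sub>R (0, D (snd z))) \<bullet> (1, b (snd z))))
       = (future z * \<theta>' (fst z)) * \<phi> (snd z) + (future z * ?\<theta> (fst z)) * (D (snd z) \<bullet> b (snd z))"
      by (simp add: inner_add_left algebra_simps)
    then show "future z * (1 * ((\<phi> (snd z) *\<^sub>R (\<theta>' (fst z), 0) + ?\<theta> (fst z) *\<^sub>R (0, D (snd z))) \<bullet> (1, b (snd z))))
       = (future z * \<theta>' (fst z)) * \<phi> (snd z) + ?\<theta> (fst z) * (D (snd z) \<bullet> b (snd z))"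
      unfolding tind .
  qed
  also have "(LBINT z. (future z * \<theta>' (fst z)) * \<phi> (snd z) + ?\<theta> (fst z) * (D (snd z) \<bullet> b (snd z)))
     = (LBINT z. (future z * \<theta>' (fst z)) * \<phi> (snd z)) + (LBINT z. ?\<theta> (fst z) * (D (snd z) \<bullet> b (snd z)))"
    by (intro Bochner_Integration.integral_add integrable_prod_mult[of "\<lambda>t. indicator {0..} t * \<theta>' t" \<phi>]
        integrable_prod_mult[of ?\<theta> "\<lambda>x. D x \<bullet> b x"] integrable_C1_tail(1)[OF th, of 2] th0 \<phi>i ti Di)
  also have "(LBINT z. (future z * \<theta>' (fst z)) * \<phi> (snd z)) = (LBINT t. indicator {0..} t * \<theta>' t) * (LBINT x. \<phi> x)"
    using lborel_fubini(3)[OF integrable_prod_mult[OF integrable_C1_tail(1)[OF th, of 2, OF th0] \<phi>i]] by simp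
  also have "(LBINT z. ?\<theta> (fst z) * (D (snd z) \<bullet> b (snd z))) = (LBINT t. ?\<theta> t) * (LBINT x. D x \<bullet> b x)"
    using lborel_fubini(3)[OF integrable_prod_mult[OF ti Di]] by simp
  finally show ?thesis using tpos thd by simp
qed

section \<open>Stream functions of mollified fields\<close>

text \<open>On a ball, Young's inequality bounds the integrand by a small constant
  \<open>\<eta>\<close> plus its square divided by \<open>\<eta>\<close>.\<close>

lemma L2_imp_L1_tendsto:
  fixes d :: "nat \<Rightarrow> 'a::euclidean_space \<Rightarrow> real"
  assumes dm[measurable]: "\<And>n. d n \<in> borel_fun" and d2: "\<And>n. L1 (\<lambda>x. (d n x)\<^sup>2)"
    and supp: "\<And>n x. norm x > M \<Longrightarrow> d n x = 0" and lim: "(\<lambda>n. LBINT x. (d n x)\<^sup>2) \<longlonglongrightarrow> 0"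
  shows "(\<lambda>n. LBINT x. \<bar>d n x\<bar>) \<longlonglongrightarrow> 0"
proof (rule LIMSEQ_I)
  fix e :: real assume e: "e > 0"
  define V where "V = measure lborel (cball (0::'a) M)"
  define \<eta> where "\<eta> = e / (2 * (V + 1))"
  have V: "V \<ge> 0" by (simp add: V_def)
  have eta: "\<eta> > 0" "\<eta> * V \<le> e / 2"
  proof -
    show "\<eta> > 0" using e V by (simp add: \<eta>_def)
    have "\<eta> * V \<le> \<eta> * (V + 1)" using \<open>\<eta> > 0\<close> by simp
    also have "\<dots> = e / 2" using V by (simp add: \<eta>_def field_simps)
    finally show "\<eta> * V \<le> e / 2" .
  qed
  have "\<forall>\<^sub>F n in sequentially. (LBINT x. (d n x)\<^sup>2) < \<eta> * (e / 2)"
    using lim eta e by (intro order_tendstoD(2)) auto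
  then obtain N where N: "\<And>n. n \<ge> N \<Longrightarrow> (LBINT x. (d n x)\<^sup>2) < \<eta> * (e / 2)" by (auto simp: eventually_sequentially)
  have pw: "\<bar>d n x\<bar> \<le> \<eta> * indicator (cball 0 M) x + (d n x)\<^sup>2 / \<eta>" for n x
  proof (cases "norm x > M")
    case False
    have "0 \<le> (\<bar>d n x\<bar> - \<eta>)\<^sup>2 + \<eta> * \<bar>d n x\<bar>" using eta by simp
    then have "\<eta> * \<bar>d n x\<bar> \<le> \<eta> * \<eta> + (d n x)\<^sup>2" by (simp add: power2_eq_square algebra_simps)
    then have "\<bar>d n x\<bar> \<le> \<eta> + (d n x)\<^sup>2 / \<eta>" using eta by (simp add: field_simps)
    then show ?thesis using False by simp
  qed (simp add: supp)
  have i: "L1 (\<lambda>x. \<eta> * indicator (cball 0 M) x + (d n x)\<^sup>2 / \<eta>)" for n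
    using d2[of n] integrable_indicator_cball[of "0::'a" M] by auto
  show "\<exists>no. \<forall>n\<ge>no. norm ((LBINT x. \<bar>d n x\<bar>) - 0) < e"
  proof (intro exI[of _ N] allI impI)
    fix n assume "n \<ge> N"
    have "(LBINT x. \<bar>d n x\<bar>) \<le> (LBINT x. \<eta> * indicator (cball 0 M) x + (d n x)\<^sup>2 / \<eta>)"
      by (rule integral_mono[OF integrable_dominated[OF i] i pw]) (use pw in auto)
    also have "\<dots> = \<eta> * V + (LBINT x. (d n x)\<^sup>2) / \<eta>"
      using d2[of n] integrable_indicator_cball[of "0::'a" M] by (simp add: V_def)
    also have "\<dots> < e"
    proof -
      have "(LBINT x. (d n x)\<^sup>2) / \<eta> < e / 2" using N[OF \<open>n \<ge> N\<close>] eta by (simp add: field_simps)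
      then show ?thesis using eta(2) by linarith
    qed
    finally show "norm ((LBINT x. \<bar>d n x\<bar>) - 0) < e" by simp
  qed
qed

lemma icc_continuous_eq_integral:
  assumes "continuous_on UNIV f"
  shows "L1 (\<lambda>s. indicator {a..b} s * f s)" "icc a b f = integral {a..b} f"
proof -
  have s: "set_integrable lborel {a..b} f"
    unfolding set_integrable_def by (rule borel_integrable_compact) (auto intro: continuous_on_subset[OF assms])
  then show "L1 (\<lambda>s. indicator {a..b} s * f s)" by (simp add: set_integrable_def)
  show "icc a b f = integral {a..b} f"
    using set_borel_integral_eq_integral(2)[OF s] by (simp add: icc_def set_lebesgue_integral_def)
qed

text \<open>Leibniz' rule gives the derivative in the first variable, the fundamental theorem that
  in the second; continuity of the latter in both variables gives total differentiability.\<close>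

lemma has_derivative_primitive_along_second:
  fixes f g :: "real \<times> real \<Rightarrow> real"
  assumes f: "continuous_on UNIV f" and fp: "\<And>x s. ((\<lambda>x. f (x, s)) has_real_derivative g (x, s)) (at x)"
    and g: "continuous_on UNIV g" and q: "c < q"
  shows "((\<lambda>z. integral {c..snd z} (\<lambda>s. f (fst z, s))) has_derivative
     (\<lambda>v. integral {c..q} (\<lambda>s. g (p, s)) * fst v + f (p, q) * snd v)) (at (p, q))"
proof -
  have fs: "continuous_on S (\<lambda>s. f (x, s))" for x S
    by (rule continuous_on_compose2[OF f]) (auto intro!: continuous_intros)
  have "((\<lambda>(x, y). integral {c..y} (\<lambda>s. f (x, s))) has_derivative
     (\<lambda>(tx, ty). integral {c..q} (\<lambda>s. g (p, s)) * tx + blinfun_mult_right (f (p, q)) ty)) (at (p, q) within UNIV \<times> {c<..})"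
  proof (rule has_derivative_partialsI)
    have "((\<lambda>x. integral (cbox c q) (\<lambda>s. f (x, s))) has_field_derivative integral (cbox c q) (\<lambda>s. g (p, s))) (at p within UNIV)"
    proof (rule leibniz_rule_field_derivative)
      show "((\<lambda>x. f (x, s)) has_real_derivative g (x, s)) (at x within UNIV)" for x s using fp by simp
      show "(\<lambda>s. f (x, s)) integrable_on cbox c q" for x by (simp add: integrable_continuous_real fs)
      show "continuous_on (UNIV \<times> cbox c q) (\<lambda>(x, t). g (x, t))" using continuous_on_subset[OF g] by simp
    qed auto
    then show "((\<lambda>x. integral {c..q} (\<lambda>s. f (x, s))) has_derivative (\<lambda>tx. integral {c..q} (\<lambda>s. g (p, s)) * tx)) (at p within UNIV)"
      by (simp add: has_field_derivative_def)
    fix x y :: real assume "y \<in> {c<..}"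
    then have y: "c < y" by simp
    have "((\<lambda>y. integral {c..y} (\<lambda>s. f (x, s))) has_real_derivative f (x, y)) (at y within {c..y+1})"
      by (rule integral_has_real_derivative[OF fs]) (use y in auto)
    then have "((\<lambda>y. integral {c..y} (\<lambda>s. f (x, s))) has_real_derivative f (x, y)) (at y)"
      using y by (simp add: at_within_Icc_at)
    then show "((\<lambda>y. integral {c..y} (\<lambda>s. f (x, s))) has_derivative blinfun_apply (blinfun_mult_right (f (x, y)))) (at y within {c<..})"
      by (auto simp: has_field_derivative_def intro!: has_derivative_at_withinI)
  next
    have "isCont f (p, q)" using f by (simp add: continuous_on_eq_continuous_at)
    then have "isCont (\<lambda>z. blinfun_mult_right (f z)) (p, q)"
      by (rule bounded_linear.isCont[OF bounded_linear_blinfun_mult_right])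
    then show "continuous (at (p, q) within UNIV \<times> {c<..}) (\<lambda>(x, y). blinfun_mult_right (f (x, y)))"
      by (simp add: continuous_at_imp_continuous_at_within case_prod_unfold)
  qed (use q in auto)
  moreover have "at (p, q) within UNIV \<times> {c<..} = at (p, q)"
    using q by (intro at_within_open open_Times) auto
  ultimately show ?thesis by (simp add: case_prod_unfold)
qed

lemma abs_fst_snd_le_norm: "\<bar>fst v\<bar> \<le> norm v" "\<bar>snd v\<bar> \<le> norm v" for v :: "real \<times> real"
proof -
  show "\<bar>fst v\<bar> \<le> norm v" using norm_fst_le[of "fst v" "snd v"] by simp
  show "\<bar>snd v\<bar> \<le> norm v" using norm_snd_le[of "snd v" "fst v"] by simp
qed

lemma conv_moll_support:
  fixes f :: "'a::euclidean_space \<Rightarrow> real"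
  assumes e: "e > 0" and supp: "\<And>x. norm x > R \<Longrightarrow> f x = 0" and x: "norm x > R + e"
  shows "conv f (moll e :: 'a \<Rightarrow> real) x = 0"
proof -
  have "f y * moll e (x - y) = 0" for y
  proof (cases "norm (x - y) > e")
    case False
    then have "norm y > R" using x norm_triangle_ineq2[of x y] by simp
    then show ?thesis by (simp add: supp)
  qed (simp add: moll_support e)
  then show ?thesis by (simp only: conv_def real_scaleR_def Bochner_Integration.integral_zero)
qed

lemma cgrad_moll: "\<exists>D. cgrad (moll e) D"
  using cgrad_smooth[OF smooth_moll] by blast

lemma cgrad_conv_moll:
  fixes f :: "'a::euclidean_space \<Rightarrow> real"
  assumes e: "e > 0" and f: "locint f" and D: "cgrad (moll e) D"
  shows "cgrad (conv f (moll e :: 'a \<Rightarrow> real)) (conv f D)"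
  by (rule cgrad_conv[OF f D, of e]) (use e in \<open>simp add: moll_support\<close>)

lemma tendsto_L1_AE_subseq_real:
  fixes F :: "nat \<Rightarrow> 'a::euclidean_space \<Rightarrow> real"
  assumes "\<And>n. L1 (F n)" "(\<lambda>n. LBINT x. \<bar>F n x\<bar>) \<longlonglongrightarrow> 0"
  obtains r :: "nat \<Rightarrow> nat" where "strict_mono r" "AE x in lborel. (\<lambda>n. F (r n) x) \<longlonglongrightarrow> 0"
  using tendsto_L1_AE_subseq[of lborel F] assms by auto

text \<open>
  The slice \<open>q = c\<close> is chosen among the lines on which (a subsequence of) the mollified field converges
  in \<open>L\<^sup>1\<close>, so that the stream functions, normalised along that line, converge as well.
\<close>

lemma stream_function:
  fixes b :: "real \<times> real \<Rightarrow> real \<times> real" and r R :: real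
  defines "Q \<equiv> {-R<..<R} \<times> {-R<..<R}"
  defines "f1 \<equiv> (\<lambda>x. indicator Q x * fst (b x))" and "f2 \<equiv> (\<lambda>x. indicator Q x * snd (b x))"
  assumes bm[measurable]: "b \<in> borel_fun" and b2: "L1 (\<lambda>x. indicator Q x * (norm (b x))\<^sup>2)"
    and div: "\<And>\<phi> D K. cgrad \<phi> D \<Longrightarrow> compact K \<Longrightarrow> K \<subseteq> Q \<Longrightarrow> (\<And>x. x \<notin> K \<Longrightarrow> \<phi> x = 0) \<Longrightarrow> (LBINT x. D x \<bullet> b x) = 0"
    and r: "0 < r" "r < R"
  obtains c m B1 B2 H where "r < m" "m < R" "- m < c" "c < - r"
    "\<And>n. continuous_on UNIV (B1 n)" "\<And>n. continuous_on UNIV (B2 n)"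
    "\<And>n. L1 (\<lambda>x. (B1 n x - f1 x)\<^sup>2)" "\<And>n. L1 (\<lambda>x. (B2 n x - f2 x)\<^sup>2)"
    "(\<lambda>n. LBINT x. (B1 n x - f1 x)\<^sup>2) \<longlonglongrightarrow> 0" "(\<lambda>n. LBINT x. (B2 n x - f2 x)\<^sup>2) \<longlonglongrightarrow> 0"
    "\<And>n x. x \<in> {-m<..<m} \<times> {c<..<m} \<Longrightarrow> (H n has_derivative (\<lambda>v. (- B2 n x, B1 n x) \<bullet> v)) (at x)"
    "AE x in lborel. x \<in> {-m<..<m} \<times> {c<..<m} \<longrightarrow>
       (\<lambda>n. H n x) \<longlonglongrightarrow> icc c (snd x) (\<lambda>s. f1 (fst x, s)) - icc (- m) (fst x) (\<lambda>s. f2 (s, c))"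
proof -
  have Qm[measurable]: "Q \<in> sets borel" unfolding Q_def by (intro borel_open open_Times) auto
  have f1m[measurable]: "f1 \<in> borel_fun" and f2m[measurable]: "f2 \<in> borel_fun"
    unfolding f1_def f2_def using measurable_compose[OF bm borel_fst_snd(1)] measurable_compose[OF bm borel_fst_snd(2)] by auto
  have i2: "L1 (\<lambda>x. (f1 x)\<^sup>2)" "L1 (\<lambda>x. (f2 x)\<^sup>2)"
  proof -
    have le: "(fst (b x))\<^sup>2 \<le> (norm (b x))\<^sup>2" "(snd (b x))\<^sup>2 \<le> (norm (b x))\<^sup>2" for x
      by (cases "b x"; simp add: norm_Pair real_sqrt_pow2)+
    show "L1 (\<lambda>x. (f1 x)\<^sup>2)" "L1 (\<lambda>x. (f2 x)\<^sup>2)"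
      by (rule integrable_dominated[OF b2]; use le in \<open>auto simp: f1_def f2_def indicator_def\<close>)+
  qed
  have supp: "f1 x = 0" "f2 x = 0" if "norm x > 2 * R" for x
  proof -
    have "x \<notin> Q"
    proof
      assume "x \<in> Q"
      then have "\<bar>fst x\<bar> + \<bar>snd x\<bar> < 2 * R" by (auto simp: Q_def)
      then show False using that norm_Pair_le[of "fst x" "snd x"] by simp
    qed
    then show "f1 x = 0" "f2 x = 0" by (auto simp: f1_def f2_def)
  qed
  have i1: "L1 f1" "L1 f2"
    using integrable_of_square_integrable[OF f1m i2(1) supp(1)] integrable_of_square_integrable[OF f2m i2(2) supp(2)] by auto
  note l1 = i1[THEN locint_integrable]
  \<comment> \<open>Midpoint between \<open>r\<close> and \<open>R\<close>: the margin
    \<open>R - m\<close> is left for the mollification, and between \<open>r\<close> and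
    \<open>m\<close> there is room for the base line \<open>c\<close>.\<close>
  define m where "m = (r + R) / 2"
  have m: "r < m" "m < R" "0 < m" using r by (auto simp: m_def)
  \<comment> \<open>The denominator \<open>real n + 2\<close> keeps every scale strictly below
    \<open>R - m\<close>, so that mollifying at points of the square of half-side \<open>m\<close>
    sees only values of \<open>b\<close> in \<open>Q\<close>.\<close>
  define e where "e n = (R - m) / (real n + 2)" for n :: nat
  have e: "e n > 0" "e n < R - m" for n
    using m mult_strict_left_mono[of 1 "real n + 2" "R - m"] by (auto simp: e_def divide_less_eq)
  have elim: "e \<longlonglongrightarrow> 0"
  proof -
    have "(\<lambda>n. (R - m) * inverse (real (n + 2))) \<longlonglongrightarrow> (R - m) * 0"
      by (intro tendsto_mult tendsto_const LIMSEQ_ignore_initial_segment[OF lim_inverse_n])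
    then show ?thesis by (simp add: e_def[abs_def] divide_inverse add.commute)
  qed
  define C1' where "C1' n = conv f1 (moll (e n))" for n
  define C2 where "C2 n = conv f2 (moll (e n))" for n
  have "\<forall>n. \<exists>D. cgrad (moll (e n) :: real \<times> real \<Rightarrow> real) D" by (intro allI cgrad_moll)
  then obtain D where D: "\<And>n. cgrad (moll (e n) :: real \<times> real \<Rightarrow> real) (D n)" by metis
  have g1: "cgrad (C1' n) (conv f1 (D n))" and g2: "cgrad (C2 n) (conv f2 (D n))" for n
    unfolding C1'_def C2_def by (rule cgrad_conv_moll[OF e(1) l1(1) D] cgrad_conv_moll[OF e(1) l1(2) D])+
  note c1 = cgrad_continuous[OF g1] and c2 = cgrad_continuous[OF g2]
  have [measurable]: "C1' n \<in> borel_fun" "C2 n \<in> borel_fun" for n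
    using borel_measurable_cgrad[OF g1] borel_measurable_cgrad[OF g2] by auto
  note L21 = conv_moll_tendsto_L2[OF f1m i2(1) supp(1) e(1) elim, folded C1'_def]
  note L22 = conv_moll_tendsto_L2[OF f2m i2(2) supp(2) e(1) elim, folded C2_def]
  have ds: "C1' n x - f1 x = 0" "C2 n x - f2 x = 0" if "norm x > 2 * R + R" for n x
  proof -
    have "norm x > 2 * R + e n" "norm x > 2 * R" using that e(2)[of n] m r by auto
    then show "C1' n x - f1 x = 0" "C2 n x - f2 x = 0"
      using conv_moll_support[OF e(1) supp(1)] conv_moll_support[OF e(1) supp(2)] supp by (auto simp: C1'_def C2_def)
  qed
  define d where "d n x = \<bar>C1' n x - f1 x\<bar> + \<bar>C2 n x - f2 x\<bar>" for n x
  have d1: "L1 (\<lambda>x. C1' n x - f1 x)" "L1 (\<lambda>x. C2 n x - f2 x)" for n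
    by (rule integrable_of_square_integrable[OF _ L21(2) ds(1)] integrable_of_square_integrable[OF _ L22(2) ds(2)], measurable)+
  have di: "L1 (d n)" for n unfolding d_def using d1 by auto
  have d0: "d n x \<ge> 0" for n x by (simp add: d_def)
  have dlim: "(\<lambda>n. LBINT x. d n x) \<longlonglongrightarrow> 0"
  proof -
    have "(\<lambda>n. (LBINT x. \<bar>C1' n x - f1 x\<bar>) + (LBINT x. \<bar>C2 n x - f2 x\<bar>)) \<longlonglongrightarrow> 0 + 0"
      by (intro tendsto_add L2_imp_L1_tendsto[OF _ L21(2) ds(1) L21(1)] L2_imp_L1_tendsto[OF _ L22(2) ds(2) L22(1)]) measurable
    then show ?thesis unfolding d_def using d1 by simp
  qed
  \<comment> \<open>The L1 distance between mollified and original field on the horizontal line at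
    height \<open>q\<close>; \<open>G\<close> will be the same for vertical lines. Two successive
    subsequences make both tend to zero on almost every line.\<close>
  define F where "F n q = (LBINT p. d n (p, q))" for n q
  have Fi: "L1 (F n)" for n unfolding F_def by (rule lborel_fubini(5)[OF di])
  have "(\<lambda>n. LBINT q. \<bar>F n q\<bar>) \<longlonglongrightarrow> 0"
    using dlim lborel_fubini(6)[OF di] by (simp add: F_def d0)
  from tendsto_L1_AE_subseq_real[OF Fi this] obtain \<rho> where \<rho>: "strict_mono \<rho>" "AE q in lborel. (\<lambda>n. F (\<rho> n) q) \<longlonglongrightarrow> 0" by blast
  define G where "G n p = (LBINT q. d n (p, q))" for n p
  have Gi: "L1 (G n)" for n unfolding G_def by (rule lborel_fubini(2)[OF di])
  have "(\<lambda>n. LBINT p. \<bar>G (\<rho> n) p\<bar>) \<longlonglongrightarrow> 0"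
    using LIMSEQ_subseq_LIMSEQ[OF dlim \<rho>(1)] lborel_fubini(3)[OF di] by (simp add: G_def d0 comp_def)
  from tendsto_L1_AE_subseq_real[OF Gi this] obtain \<sigma> where \<sigma>: "strict_mono \<sigma>" "AE p in lborel. (\<lambda>n. G (\<rho> (\<sigma> n)) p) \<longlonglongrightarrow> 0" by blast
  define \<nu> where "\<nu> = \<rho> \<circ> \<sigma>"
  have \<nu>: "strict_mono \<nu>" unfolding \<nu>_def using \<rho>(1) \<sigma>(1) by (rule strict_mono_o)
  have Flim: "AE q in lborel. (\<lambda>n. F (\<nu> n) q) \<longlonglongrightarrow> 0"
    using \<rho>(2) by eventually_elim (use LIMSEQ_subseq_LIMSEQ[OF _ \<sigma>(1)] in \<open>auto simp: \<nu>_def comp_def\<close>)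
  have Glim: "AE p in lborel. (\<lambda>n. G (\<nu> n) p) \<longlonglongrightarrow> 0" using \<sigma>(2) by (simp add: \<nu>_def)
  have dq: "AE q in lborel. \<forall>n. L1 (\<lambda>p. d n (p, q))" unfolding AE_all_countable using lborel_fubini(4)[OF di] by blast
  have dp: "AE p in lborel. \<forall>n. L1 (\<lambda>q. d n (p, q))" unfolding AE_all_countable using lborel_fubini(1)[OF di] by blast
  have ae: "AE q in lborel. (\<lambda>n. F (\<nu> n) q) \<longlonglongrightarrow> 0 \<and> (\<forall>n. L1 (\<lambda>p. d n (p, q))) \<and> L1 (\<lambda>p. f2 (p, q))" (is "AE q in _. ?P q")
    using Flim dq lborel_fubini(4)[OF i1(2)] by eventually_elim auto
  \<comment> \<open>Almost every height qualifies and the interval has positive length. A height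
    below \<open>- r\<close> puts the base line under the square of half-side
    \<open>r\<close>.\<close>
  have "\<exists>c\<in>{-m<..<-r}. ?P c"
  proof (rule ccontr)
    assume no: "\<not> ?thesis"
    have "AE q in lborel. q \<notin> {-m<..<-r}"
      using ae
    proof eventually_elim
      case (elim q)
      then show ?case using no by blast
    qed
    then have "emeasure lborel {-m<..<-r} = 0" by (subst (asm) AE_iff_null_sets[symmetric]) auto
    then show False using m by simp
  qed
  then obtain c where c: "c \<in> {-m<..<-r}" "(\<lambda>n. F (\<nu> n) c) \<longlonglongrightarrow> 0"
    "\<And>n. L1 (\<lambda>p. d n (p, c))" "L1 (\<lambda>p. f2 (p, c))"
    by blast
  \<comment> \<open>The flux integral along the path that follows the base line from
    \<open>(- m, c)\<close> to \<open>(fst x, c)\<close> and then rises to \<open>x\<close>.\<close>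
  define H where "H n x = integral {c..snd x} (\<lambda>s. C1' (\<nu> n) (fst x, s)) - integral {-m..fst x} (\<lambda>s. C2 (\<nu> n) (s, c))" for n x
  have slice: "continuous_on S (\<lambda>s. g (x, s))" "continuous_on S (\<lambda>s. g (s, x))" if "continuous_on UNIV g" for g :: "real \<times> real \<Rightarrow> real" and x S
    by (rule continuous_on_compose2[OF that]; auto intro!: continuous_intros)+
  \<comment> \<open>The kernel centred at \<open>x\<close>, reflected, is an admissible test
    function because its support lies in \<open>Q\<close>; hence the mollified field is
    divergence-free on the inner square.\<close>
  have divn: "fst (conv f1 (D n) x) + snd (conv f2 (D n) x) = 0" if x: "\<bar>fst x\<bar> \<le> m" "\<bar>snd x\<bar> \<le> m" for n x
  proof -
    have Ds: "D n z = 0" if "norm z > e n" for z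
      by (rule cgrad_zero_outside[OF D, of "cball 0 (e n)"]) (use that e(1) in \<open>auto simp: moll_support\<close>)
    have ci1: "L1 (\<lambda>y. f1 y *\<^sub>R D n (x - y))" and ci2: "L1 (\<lambda>y. f2 y *\<^sub>R D n (x - y))"
      proof -
      show "L1 (\<lambda>y. f1 y *\<^sub>R D n (x - y))"
        by (rule conv_integrable[OF l1(1) cgrad_continuous_grad[OF D], where r="e n"]) (rule Ds)
      show "L1 (\<lambda>y. f2 y *\<^sub>R D n (x - y))"
        by (rule conv_integrable[OF l1(2) cgrad_continuous_grad[OF D], where r="e n"]) (rule Ds)
    qed
    have sub: "cball x (e n) \<subseteq> Q"
    proof
      fix y assume "y \<in> cball x (e n)"
      then have "norm (x - y) < R - m" using e(2)[of n] by (simp add: dist_norm)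
      moreover have "\<bar>fst (x - y)\<bar> \<le> norm (x - y)" "\<bar>snd (x - y)\<bar> \<le> norm (x - y)"
        by (rule abs_fst_snd_le_norm)+
      ultimately have "\<bar>fst x - fst y\<bar> < R - m" "\<bar>snd x - snd y\<bar> < R - m" by auto
      then have "\<bar>fst y\<bar> < R" "\<bar>snd y\<bar> < R" using x by linarith+
      then show "y \<in> Q" unfolding Q_def mem_Times_iff by (simp add: abs_less_iff)
    qed
    have "(LBINT y. (- D n (x - y)) \<bullet> b y) = 0"
    proof (rule div[OF cgrad_reflect[OF D] _ sub])
      show "moll (e n) (x - y) = 0" if "y \<notin> cball x (e n)" for y
        using that e(1) by (intro moll_support) (auto simp: dist_norm)
    qed simp
    then have "(LBINT y. D n (x - y) \<bullet> b y) = 0" by simp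
    moreover have "D n (x - y) \<bullet> b y = fst (f1 y *\<^sub>R D n (x - y)) + snd (f2 y *\<^sub>R D n (x - y))" for y
    proof (cases "y \<in> Q")
      case True then show ?thesis by (simp add: f1_def f2_def inner_prod_def mult.commute)
    next
      case False
      then have "y \<notin> cball x (e n)" using sub by blast
      then have "norm (x - y) > e n" by (simp add: dist_norm)
      then show ?thesis by (simp add: Ds)
    qed
    ultimately have "(LBINT y. fst (f1 y *\<^sub>R D n (x - y)) + snd (f2 y *\<^sub>R D n (x - y))) = 0" by simp
    then show ?thesis using integrable_fst[OF ci1] integrable_snd[OF ci2]
      unfolding conv_def integral_fst[OF ci1, symmetric] integral_snd[OF ci2, symmetric]
      by (subst (asm) Bochner_Integration.integral_add) auto
  qed
  have Hd: "(H n has_derivative (\<lambda>v. (- C2 (\<nu> n) x, C1' (\<nu> n) x) \<bullet> v)) (at x)" if x: "x \<in> {-m<..<m} \<times> {c<..<m}" for n x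
  proof -
    define k where "k = \<nu> n"
    have pd1: "((\<lambda>p. C1' k (p, s)) has_real_derivative fst (conv f1 (D k) (p, s))) (at p)" for p s
    proof -
      have "((\<lambda>p. (p, s)) has_derivative (\<lambda>h. (h, 0))) (at p)" by (auto intro!: derivative_eq_intros)
      from has_derivative_compose[OF this cgradD[OF g1]] show ?thesis
        unfolding has_field_derivative_def by (rule has_derivative_eq_rhs) (auto simp: inner_prod_def mult.commute)
    qed
    have pd2: "((\<lambda>s. C2 k (p, s)) has_real_derivative snd (conv f2 (D k) (p, s))) (at s)" for p s
    proof -
      have "((\<lambda>s. (p, s)) has_derivative (\<lambda>h. (0, h))) (at s)" by (auto intro!: derivative_eq_intros)
      from has_derivative_compose[OF this cgradD[OF g2]] show ?thesis
        unfolding has_field_derivative_def by (rule has_derivative_eq_rhs) (auto simp: inner_prod_def mult.commute)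
    qed
    have gc: "continuous_on UNIV (\<lambda>z. fst (conv f1 (D k) z))" "continuous_on UNIV (\<lambda>z. snd (conv f2 (D k) z))"
      using cgrad_continuous_grad[OF g1] cgrad_continuous_grad[OF g2] by (auto intro!: continuous_intros)
    have xc: "c < snd x" using x by auto
    have A: "((\<lambda>z. integral {c..snd z} (\<lambda>s. C1' k (fst z, s))) has_derivative
     (\<lambda>v. integral {c..snd x} (\<lambda>s. fst (conv f1 (D k) (fst x, s))) * fst v + C1' k x * snd v)) (at x)"
      using has_derivative_primitive_along_second[OF c1 pd1 gc(1) xc, where p="fst x"] by simp
    have "((\<lambda>p. integral {-m..p} (\<lambda>s. C2 k (s, c))) has_real_derivative C2 k (fst x, c)) (at (fst x) within {-m..fst x + 1})"
      by (rule integral_has_real_derivative[OF slice(2)[OF c2]]) (use x in auto)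
    then have "((\<lambda>p. integral {-m..p} (\<lambda>s. C2 k (s, c))) has_real_derivative C2 k (fst x, c)) (at (fst x))"
      using x by (simp add: at_within_Icc_at mem_Times_iff)
    then have B: "((\<lambda>z. integral {-m..fst z} (\<lambda>s. C2 k (s, c))) has_derivative (\<lambda>v. C2 k (fst x, c) * fst v)) (at x)"
      unfolding has_field_derivative_def by (rule has_derivative_compose[rotated]) (auto intro!: derivative_eq_intros)
    \<comment> \<open>Vanishing divergence replaces the derivative of the first component in
      \<open>p\<close> by minus that of the second in \<open>q\<close>. Integration leaves a value
      on the base line, which the derivative of the horizontal part of the path cancels.\<close>
    have "integral {c..snd x} (\<lambda>s. fst (conv f1 (D k) (fst x, s))) = integral {c..snd x} (\<lambda>s. - snd (conv f2 (D k) (fst x, s)))"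
    proof (rule Henstock_Kurzweil_Integration.integral_cong)
      fix s assume s: "s \<in> {c..snd x}"
      have "fst (conv f1 (D k) (fst x, s)) + snd (conv f2 (D k) (fst x, s)) = 0"
      proof (rule divn)
        have "fst x \<in> {-m<..<m}" "snd x \<in> {c<..<m}" using x by (simp_all add: mem_Times_iff)
        then show "\<bar>fst (fst x, s)\<bar> \<le> m" "\<bar>snd (fst x, s)\<bar> \<le> m" using s c(1) by auto
      qed
      then show "fst (conv f1 (D k) (fst x, s)) = - snd (conv f2 (D k) (fst x, s))" by simp
    qed
    also have "\<dots> = - integral {c..snd x} (\<lambda>s. snd (conv f2 (D k) (fst x, s)))" by simp
    also have "integral {c..snd x} (\<lambda>s. snd (conv f2 (D k) (fst x, s))) = C2 k (fst x, snd x) - C2 k (fst x, c)"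
    proof (intro integral_unique fundamental_theorem_of_calculus)
      show "((\<lambda>s. C2 k (fst x, s)) has_vector_derivative snd (conv f2 (D k) (fst x, s))) (at s within {c..snd x})" for s
        using pd2[where p="fst x" and s=s, THEN has_field_derivative_at_within] by (simp add: has_real_derivative_iff_has_vector_derivative)
    qed (use xc in simp)
    finally have I: "integral {c..snd x} (\<lambda>s. fst (conv f1 (D k) (fst x, s))) = C2 k (fst x, c) - C2 k x" by simp
    show ?thesis
      using has_derivative_diff[OF A B] unfolding H_def k_def[symmetric] I
      by (rule has_derivative_eq_rhs) (auto simp: inner_prod_def algebra_simps)
  qed
  have Hl: "AE x in lborel. x \<in> {-m<..<m} \<times> {c<..<m} \<longrightarrow>
       (\<lambda>n. H n x) \<longlonglongrightarrow> icc c (snd x) (\<lambda>s. f1 (fst x, s)) - icc (- m) (fst x) (\<lambda>s. f2 (s, c))"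
    using AE_lborel_fst_snd(1)[OF Glim] AE_lborel_fst_snd(1)[OF dp] AE_lborel_fst_snd(1)[OF lborel_fubini(1)[OF i1(1)]]
  proof eventually_elim
    case (elim x)
    have cv: "(\<lambda>n. integral {a..t} (k n)) \<longlonglongrightarrow> icc a t k0"
      if kc: "\<And>n. continuous_on UNIV (k n)" and k0: "L1 k0" and hi: "\<And>n. L1 (h n)"
        and le: "\<And>n s. \<bar>k n s - k0 s\<bar> \<le> h n s" and hl: "(\<lambda>n. LBINT s. h n s) \<longlonglongrightarrow> 0" for a t and k h :: "nat \<Rightarrow> real \<Rightarrow> real" and k0
    proof -
      have "\<bar>integral {a..t} (k n) - icc a t k0\<bar> \<le> (LBINT s. h n s)" for n
      proof -
        note ki = icc_continuous_eq_integral(1)[OF kc[of n], of a t] and k0i = integrable_icc[OF k0, of a t]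
        have "integral {a..t} (k n) - icc a t k0 = (LBINT s. indicator {a..t} s * k n s - indicator {a..t} s * k0 s)"
          unfolding icc_continuous_eq_integral(2)[OF kc, symmetric] icc_def
          by (rule Bochner_Integration.integral_diff[OF ki k0i, symmetric])
        also have "norm \<dots> \<le> (LBINT s. h n s)"
        proof (rule Bochner_Integration.integral_norm_bound_integral[OF Bochner_Integration.integrable_diff[OF ki k0i] hi])
          fix s show "norm (indicator {a..t} s * k n s - indicator {a..t} s * k0 s) \<le> h n s"
            using le[of n s] by (auto simp: indicator_def intro: order_trans[OF abs_ge_zero])
        qed
        finally show ?thesis by simp
      qed
      then have "(\<lambda>n. integral {a..t} (k n) - icc a t k0) \<longlonglongrightarrow> 0"
        by (intro Lim_null_comparison[OF _ hl] always_eventually) simp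
      then show ?thesis by (rule LIM_zero_cancel)
    qed
    have "(\<lambda>n. integral {c..snd x} (\<lambda>s. C1' (\<nu> n) (fst x, s))) \<longlonglongrightarrow> icc c (snd x) (\<lambda>s. f1 (fst x, s))"
      by (rule cv[OF slice(1)[OF c1] elim(3), of "\<lambda>n s. d (\<nu> n) (fst x, s)"])
         (use elim(1,2) in \<open>auto simp: d_def G_def\<close>)
    moreover have "(\<lambda>n. integral {-m..fst x} (\<lambda>s. C2 (\<nu> n) (s, c))) \<longlonglongrightarrow> icc (-m) (fst x) (\<lambda>s. f2 (s, c))"
      by (rule cv[OF slice(2)[OF c2] c(4), of "\<lambda>n s. d (\<nu> n) (s, c)"])
         (use c(2,3) in \<open>auto simp: d_def F_def\<close>)
    ultimately show ?case unfolding H_def by (auto intro: tendsto_diff)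
  qed
  show thesis
    by (rule that[of m c "\<lambda>n. C1' (\<nu> n)" "\<lambda>n. C2 (\<nu> n)" H])
       (use m c(1) c1 c2 L21(2) L22(2) Hd Hl LIMSEQ_subseq_LIMSEQ[OF L21(1) \<nu>] LIMSEQ_subseq_LIMSEQ[OF L22(1) \<nu>] in \<open>auto simp: comp_def\<close>)
qed

section \<open>Test functions depending on the stream function\<close>

lemma L2_prod_tendsto:
  fixes d :: "nat \<Rightarrow> 'a::euclidean_space \<Rightarrow> real" and f :: "'a \<Rightarrow> real"
  assumes dm[measurable]: "\<And>n. d n \<in> borel_fun" and d2: "\<And>n. L1 (\<lambda>x. (d n x)\<^sup>2)"
    and fm[measurable]: "f \<in> borel_fun" and f2: "L1 (\<lambda>x. (f x)\<^sup>2)"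
    and lim: "(\<lambda>n. LBINT x. (d n x)\<^sup>2) \<longlonglongrightarrow> 0"
  shows "L1 (\<lambda>x. \<bar>d n x\<bar> * \<bar>f x\<bar>)" "(\<lambda>n. LBINT x. \<bar>d n x\<bar> * \<bar>f x\<bar>) \<longlonglongrightarrow> 0"
proof -
  have pw: "\<bar>d n x\<bar> * \<bar>f x\<bar> \<le> \<eta> * (f x)\<^sup>2 + (d n x)\<^sup>2 / \<eta>" if eta: "\<eta> > 0" for \<eta> n x
  proof -
    have "0 \<le> (\<bar>d n x\<bar> - \<eta> * \<bar>f x\<bar>)\<^sup>2 + \<eta> * (\<bar>d n x\<bar> * \<bar>f x\<bar>)" using eta by simp
    then have "\<eta> * (\<bar>d n x\<bar> * \<bar>f x\<bar>) \<le> \<eta> * (\<eta> * (f x)\<^sup>2) + (d n x)\<^sup>2" by (simp add: power2_eq_square algebra_simps)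
    then show ?thesis using eta by (simp add: field_simps)
  qed
  show i: "L1 (\<lambda>x. \<bar>d n x\<bar> * \<bar>f x\<bar>)" for n
    by (rule integrable_dominated[of "\<lambda>x. 1 * (f x)\<^sup>2 + (d n x)\<^sup>2 / 1"]) (use d2[of n] f2 pw[of 1 n] in \<open>auto simp: abs_mult\<close>)
  show "(\<lambda>n. LBINT x. \<bar>d n x\<bar> * \<bar>f x\<bar>) \<longlonglongrightarrow> 0"
  proof (rule LIMSEQ_I)
    fix e :: real assume e: "e > 0"
    define V where "V = (LBINT x. (f x)\<^sup>2)"
    define \<eta> where "\<eta> = e / (2 * (V + 1))"
    have V: "V \<ge> 0" by (simp add: V_def)
    have eta: "\<eta> > 0" using e V by (simp add: \<eta>_def)
    have "\<eta> * V \<le> \<eta> * (V + 1)" using eta by simp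
    also have "\<dots> = e / 2" using V by (simp add: \<eta>_def field_simps)
    finally have etaV: "\<eta> * V \<le> e / 2" .
    have "\<forall>\<^sub>F n in sequentially. (LBINT x. (d n x)\<^sup>2) < \<eta> * (e / 2)"
      using lim eta e by (intro order_tendstoD(2)) auto
    then obtain N where N: "\<And>n. n \<ge> N \<Longrightarrow> (LBINT x. (d n x)\<^sup>2) < \<eta> * (e / 2)" by (auto simp: eventually_sequentially)
    show "\<exists>no. \<forall>n\<ge>no. norm ((LBINT x. \<bar>d n x\<bar> * \<bar>f x\<bar>) - 0) < e"
    proof (intro exI[of _ N] allI impI)
      fix n assume "n \<ge> N"
      have "(LBINT x. \<bar>d n x\<bar> * \<bar>f x\<bar>) \<le> (LBINT x. \<eta> * (f x)\<^sup>2 + (d n x)\<^sup>2 / \<eta>)"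
        by (rule integral_mono[OF i _ pw[OF eta]]) (use d2[of n] f2 in auto)
      also have "\<dots> = \<eta> * V + (LBINT x. (d n x)\<^sup>2) / \<eta>" using d2[of n] f2 by (simp add: V_def)
      also have "\<dots> < e"
      proof -
        have "(LBINT x. (d n x)\<^sup>2) / \<eta> < e / 2" using N[OF \<open>n \<ge> N\<close>] eta by (simp add: field_simps)
        then show ?thesis using etaV by linarith
      qed
      finally show "norm ((LBINT x. \<bar>d n x\<bar> * \<bar>f x\<bar>) - 0) < e" by simp
    qed
  qed
qed

text \<open>Gluing over the open cover by \<open>S\<close> and the complement of \<open>K\<close>.
  It is meant for products of a cutoff with functions such as \<open>H n\<close>, which are
  controlled only near the support of the cutoff.\<close>

lemma cgrad_from_open_cover:
  assumes S: "open S" and d: "\<And>z. z \<in> S \<Longrightarrow> (f has_derivative (\<lambda>v. G z \<bullet> v)) (at z)" and c: "continuous_on S G"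
    and K: "closed K" "K \<subseteq> S" and z: "\<And>z. z \<notin> K \<Longrightarrow> f z = 0" "\<And>z. z \<notin> K \<Longrightarrow> G z = 0"
  shows "cgrad f G"
  unfolding cgrad_def
proof (intro conjI allI)
  fix x
  show "(f has_derivative (\<lambda>v. G x \<bullet> v)) (at x)"
  proof (cases "x \<in> S")
    case False
    then have x: "x \<in> - K" using K by auto
    have "(f has_derivative (\<lambda>v. 0)) (at x)"
      by (rule has_derivative_transform_within_open[OF has_derivative_const[of 0], where s="- K"]) (use x K z in auto)
    then show ?thesis using z(2)[of x] x by simp
  qed (rule d)
next
  have "continuous_on (- K) G"
    by (rule continuous_on_eq[OF continuous_on_const[of _ 0]]) (use z(2) in auto)
  then have "continuous_on (S \<union> - K) G" using S K c by (intro continuous_on_open_Un) auto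
  then show "continuous_on UNIV G" using K(2) by (metis Compl_partition2 Compl_subset_Compl_iff Un_mono Un_upper2 subset_antisym sup.orderE sup_commute top_greatest)
qed

lemma compact_subset_time_strip:
  fixes K :: "(real \<times> 'a::euclidean_space) set"
  assumes "compact K"
  obtains T where "T > 0" "\<And>z. z \<in> K \<Longrightarrow> \<bar>fst z\<bar> \<le> T"
proof -
  obtain B where B: "\<And>z. z \<in> K \<Longrightarrow> norm z \<le> B" using compact_imp_bounded[OF assms] by (auto simp: bounded_iff)
  have "\<bar>fst z\<bar> \<le> \<bar>B\<bar> + 1" if "z \<in> K" for z
    using B[OF that] norm_fst_le[of "fst z" "snd z"] by auto
  then show ?thesis using that[of "\<bar>B\<bar> + 1"] by fastforce
qed

text \<open>
  Testing the equation with \<open>\<phi> \<psi>(t, p, H)\<close>: the term \<open>\<partial>\<^sub>h\<psi> b \<cdot> \<nabla>H\<^sub>n\<close> equals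
  \<open>\<partial>\<^sub>h\<psi> (b\<^sub>2 (B1\<^sub>n - b\<^sub>1) - b\<^sub>1 (B2\<^sub>n - b\<^sub>2))\<close> and vanishes in the limit because \<open>b\<close> is square integrable.
\<close>

lemma weak_sol_test_stream:
  fixes b :: "real \<times> real \<Rightarrow> real \<times> real" and Q Q' :: "(real \<times> real) set"
  assumes bm[measurable]: "b \<in> borel_fun" and Q: "bounded Q" "open Q" and b2: "L1 (\<lambda>x. indicator Q x * (norm (b x))\<^sup>2)"
    and f: "f1 = (\<lambda>x. indicator Q x * fst (b x))" "f2 = (\<lambda>x. indicator Q x * snd (b x))"
    and B: "\<And>n. continuous_on UNIV (B1 n)" "\<And>n. continuous_on UNIV (B2 n)"
      "\<And>n. L1 (\<lambda>x. (B1 n x - f1 x)\<^sup>2)" "\<And>n. L1 (\<lambda>x. (B2 n x - f2 x)\<^sup>2)"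
      "(\<lambda>n. LBINT x. (B1 n x - f1 x)\<^sup>2) \<longlonglongrightarrow> 0" "(\<lambda>n. LBINT x. (B2 n x - f2 x)\<^sup>2) \<longlonglongrightarrow> 0"
    and Q': "open Q'" "Q' \<subseteq> Q" and H: "\<And>n x. x \<in> Q' \<Longrightarrow> (H n has_derivative (\<lambda>v. (- B2 n x, B1 n x) \<bullet> v)) (at x)"
    and Hl: "AE x in lborel. x \<in> Q' \<longrightarrow> (\<lambda>n. H n x) \<longlonglongrightarrow> Hl x" and Hlm[measurable]: "Hl \<in> borel_fun"
    and w: "weak_sol Q b u0 u" and um[measurable]: "u \<in> borel_fun" and u0m[measurable]: "u0 \<in> borel_fun"
    and ub: "\<And>z. \<bar>u z\<bar> \<le> C" "\<And>x. \<bar>u0 x\<bar> \<le> C"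
    and \<phi>: "cgrad \<phi> D" "compact K" "K \<subseteq> UNIV \<times> Q'" "\<And>z. z \<notin> K \<Longrightarrow> \<phi> z = 0"
    and \<psi>: "cgrad \<psi> E" and \<psi>s: "\<And>t p h. \<bar>h\<bar> > M \<Longrightarrow> \<psi> (t, (p, h)) = (0::real)"
  shows "(LBINT z. future z * (u z * (\<psi> (fst z, (fst (snd z), Hl (snd z))) * flux b D z
            + \<phi> z * (E (fst z, (fst (snd z), Hl (snd z))) \<bullet> (1, (fst (b (snd z)), 0))))))
       = - (LBINT x. u0 x * (\<phi> (0, x) * \<psi> (0, (fst x, Hl x))))" (is "?lhs = ?rhs")
proof -
  have C: "C \<ge> 0" using ub(2)[of 0] by linarith
  have [measurable]: "Q \<in> sets borel" using Q(2) by simp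
  have b1m[measurable]: "(\<lambda>x. fst (b x)) \<in> borel_fun" "(\<lambda>x. snd (b x)) \<in> borel_fun"
    using measurable_compose[OF bm borel_fst_snd(1)] measurable_compose[OF bm borel_fst_snd(2)] by auto
  have fm[measurable]: "f1 \<in> borel_fun" "f2 \<in> borel_fun" unfolding f by measurable
  have f2i: "L1 (\<lambda>x. (f1 x)\<^sup>2)" "L1 (\<lambda>x. (f2 x)\<^sup>2)"
  proof -
    have le: "(fst (b x))\<^sup>2 \<le> (norm (b x))\<^sup>2" "(snd (b x))\<^sup>2 \<le> (norm (b x))\<^sup>2" for x
      by (cases "b x"; simp add: norm_Pair real_sqrt_pow2)+
    show "L1 (\<lambda>x. (f1 x)\<^sup>2)" "L1 (\<lambda>x. (f2 x)\<^sup>2)"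
      by (rule integrable_dominated[OF b2]; use le in \<open>auto simp: f indicator_def\<close>)+
  qed
  have [measurable]: "\<phi> \<in> borel_fun" "D \<in> borel_fun" "\<psi> \<in> borel_fun" "E \<in> borel_fun"
    "B1 n \<in> borel_fun" "B2 n \<in> borel_fun" for n
    using borel_measurable_cgrad[OF \<phi>(1)] borel_measurable_cgrad_grad[OF \<phi>(1)] borel_measurable_cgrad[OF \<psi>] borel_measurable_cgrad_grad[OF \<psi>] B(1,2)
    by (auto intro: borel_measurable_continuous_onI)
  have D0: "D z = 0" if "z \<notin> K" for z
    by (rule cgrad_zero_outside[OF \<phi>(1) compact_imp_closed[OF \<phi>(2)] \<phi>(4) that])
  have E0: "E (t, (p, h)) = 0" if "\<bar>h\<bar> > M" for t p h
  proof (rule cgrad_const_on_open[OF \<psi>, where S="(\<lambda>z. \<bar>snd (snd z)\<bar>) -` {M<..}"])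
    show "open ((\<lambda>z::real \<times> real \<times> real. \<bar>snd (snd z)\<bar>) -` {M<..})" by (intro open_vimage continuous_intros open_greaterThan)
  qed (use that \<psi>s in auto)
  define wn where "wn n z = (fst z, (fst (snd z), H n (snd z)))" for n and z :: "real \<times> (real \<times> real)"
  define wl where "wl z = (fst z, (fst (snd z), Hl (snd z)))" for z :: "real \<times> (real \<times> real)"
  obtain T where T: "T > 0" "\<And>z. z \<in> K \<Longrightarrow> \<bar>fst z\<bar> \<le> T" using compact_subset_time_strip[OF \<phi>(2)] by blast
  \<comment> \<open>The values of \<open>H n\<close> are not bounded uniformly in \<open>n\<close>,
    but \<open>\<psi>\<close> and \<open>E\<close> vanish for \<open>\<bar>h\<bar> > M\<close>;
    bounds on this compact set therefore hold for every \<open>h\<close>.\<close>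
  define KV where "KV = (\<lambda>(z, h). (fst z, (fst (snd z), h))) ` (K \<times> {-\<bar>M\<bar>..\<bar>M\<bar>})"
  have "compact KV" unfolding KV_def case_prod_unfold
    by (intro compact_continuous_image compact_Times \<phi>(2) compact_Icc continuous_intros)
  then obtain BP BE where BP: "BP \<ge> 0" "\<And>y. y \<in> KV \<Longrightarrow> norm (\<psi> y) \<le> BP" and BE: "BE \<ge> 0" "\<And>y. y \<in> KV \<Longrightarrow> norm (E y) \<le> BE"
    using bounded_on_compact[OF _ cgrad_continuous[OF \<psi>], of KV] bounded_on_compact[OF _ cgrad_continuous_grad[OF \<psi>], of KV] by metis
  have bnd: "\<bar>\<psi> (fst z, (fst (snd z), h))\<bar> \<le> BP" "norm (E (fst z, (fst (snd z), h))) \<le> BE" if z: "z \<in> K" for z h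
  proof -
    have "\<bar>\<psi> (fst z, (fst (snd z), h))\<bar> \<le> BP \<and> norm (E (fst z, (fst (snd z), h))) \<le> BE"
    proof (cases "\<bar>h\<bar> > M")
      case True then show ?thesis using \<psi>s E0 BP(1) BE(1) by simp
    next
      case False
      then have "(fst z, (fst (snd z), h)) \<in> KV" unfolding KV_def using z by (intro image_eqI[of _ _ "(z, h)"]) auto
      then show ?thesis using BP(2) BE(2) by auto
    qed
    then show "\<bar>\<psi> (fst z, (fst (snd z), h))\<bar> \<le> BP" "norm (E (fst z, (fst (snd z), h))) \<le> BE" by auto
  qed
  obtain Bf where Bf: "Bf \<ge> 0" "\<And>z. z \<in> K \<Longrightarrow> norm (\<phi> z) \<le> Bf" using bounded_on_compact[OF \<phi>(2) cgrad_continuous[OF \<phi>(1)]] by blast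
  obtain BD where BD: "BD \<ge> 0" "\<And>z. z \<in> K \<Longrightarrow> norm (D z) \<le> BD" using bounded_on_compact[OF \<phi>(2) cgrad_continuous_grad[OF \<phi>(1)]] by blast
  have So: "open (UNIV \<times> Q')" using Q' by (intro open_Times) auto
  define q where "q n x = B1 n x * snd (b x) - B2 n x * fst (b x)" for n x
  \<comment> \<open>The chain rule for \<open>\<phi> * \<psi> (wn n z)\<close>, with
    \<open>(- B2 n, B1 n)\<close> as gradient of \<open>H n\<close>.\<close>
  define Gn where "Gn n z = \<psi> (wn n z) *\<^sub>R D z + \<phi> z *\<^sub>R (fst (E (wn n z)), (fst (snd (E (wn n z))) - snd (snd (E (wn n z))) * B2 n (snd z), snd (snd (E (wn n z))) * B1 n (snd z)))" for n z
  have grad: "cgrad (\<lambda>z. \<phi> z * \<psi> (wn n z)) (Gn n)" for n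
  proof (rule cgrad_from_open_cover[OF So])
    fix z :: "real \<times> real \<times> real" assume z: "z \<in> UNIV \<times> Q'"
    then have x: "snd z \<in> Q'" by auto
    have "((\<lambda>z. H n (snd z)) has_derivative (\<lambda>v. (- B2 n (snd z), B1 n (snd z)) \<bullet> snd v)) (at z)"
      by (rule has_derivative_compose[where f=snd and g="H n", OF _ H[OF x]]) (auto intro!: derivative_eq_intros)
    then have dw: "(wn n has_derivative (\<lambda>v. (fst v, (fst (snd v), (- B2 n (snd z), B1 n (snd z)) \<bullet> snd v)))) (at z)"
      unfolding wn_def[abs_def] by (auto intro!: derivative_eq_intros)
    have "((\<lambda>z. \<phi> z * \<psi> (wn n z)) has_derivative (\<lambda>v. \<phi> z * (E (wn n z) \<bullet> (fst v, (fst (snd v), (- B2 n (snd z), B1 n (snd z)) \<bullet> snd v))) + D z \<bullet> v * \<psi> (wn n z))) (at z)"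
      by (rule has_derivative_mult[OF cgradD[OF \<phi>(1)] has_derivative_compose[OF dw cgradD[OF \<psi>]]])
    then show "((\<lambda>z. \<phi> z * \<psi> (wn n z)) has_derivative (\<lambda>v. Gn n z \<bullet> v)) (at z)"
      by (rule has_derivative_eq_rhs) (auto simp: Gn_def inner_add_left inner_prod_def algebra_simps)
  next
    have Hc: "continuous_on Q' (H n)"
      by (rule continuous_at_imp_continuous_on) (use has_derivative_continuous[OF H] in auto)
    have wc: "continuous_on (UNIV \<times> Q') (wn n)" unfolding wn_def[abs_def]
      by (intro continuous_intros continuous_on_compose2[OF Hc]) auto
    have "continuous_on (UNIV \<times> Q') (\<lambda>z. \<psi> (wn n z))" "continuous_on (UNIV \<times> Q') (\<lambda>z. E (wn n z))"
      by (rule continuous_on_compose2[OF cgrad_continuous[OF \<psi>, of UNIV] wc] continuous_on_compose2[OF cgrad_continuous_grad[OF \<psi>, of UNIV] wc]; simp)+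
    moreover have "continuous_on (UNIV \<times> Q') (\<lambda>z. B1 n (snd z))" "continuous_on (UNIV \<times> Q') (\<lambda>z. B2 n (snd z))"
      by (rule continuous_on_compose2[OF B(1)] continuous_on_compose2[OF B(2)]; auto intro!: continuous_intros)+
    ultimately show "continuous_on (UNIV \<times> Q') (Gn n)" unfolding Gn_def[abs_def]
      by (intro continuous_intros cgrad_continuous[OF \<phi>(1)] cgrad_continuous_grad[OF \<phi>(1)])
  qed (use compact_imp_closed[OF \<phi>(2)] \<phi>(3,4) D0 in \<open>auto simp: Gn_def zero_prod_def\<close>)
  have eqn: "(LBINT z. future z * (u z * (Gn n z \<bullet> (1, b (snd z))))) = - (LBINT x. u0 x * (\<phi> (0, x) * \<psi> (wn n (0, x))))" for n
    by (rule weak_solD[OF w grad \<phi>(2)]) (use \<phi>(3,4) Q' in auto)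
  \<comment> \<open>\<open>An\<close> contains \<open>H n\<close> undifferentiated and converges to
    \<open>Al\<close>; \<open>Rn\<close> collects the contribution of the gradient of
    \<open>H n\<close> paired with \<open>b\<close>.\<close>
  define An where "An n z = future z * (u z * (\<psi> (wn n z) * flux b D z + \<phi> z * (E (wn n z) \<bullet> (1, (fst (b (snd z)), 0)))))" for n z
  define Al where "Al z = future z * (u z * (\<psi> (wl z) * flux b D z + \<phi> z * (E (wl z) \<bullet> (1, (fst (b (snd z)), 0)))))" for z
  define Rn where "Rn n z = future z * (u z * (\<phi> z * (snd (snd (E (wn n z))) * q n (snd z))))" for n z
  have split: "future z * (u z * (Gn n z \<bullet> (1, b (snd z)))) = An n z + Rn n z" for n z
    by (simp add: Gn_def An_def Rn_def q_def inner_add_left inner_prod_def algebra_simps)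
  have nb: "norm (1::real, b x) \<le> 1 + norm (b x)" for x using norm_Pair_le[of "1::real" "b x"] by simp
  have KQ: "z \<in> K \<Longrightarrow> snd z \<in> Q'" for z using \<phi>(3) by auto
  define W where "W z = C * (BP * BD + Bf * BE) * (indicator {-T..T} (fst z) * (indicator Q (snd z) * (2 + (norm (b (snd z)))\<^sup>2)))" for z :: "real \<times> real \<times> real"
  have Qi: "L1 (\<lambda>x. indicator Q x * (2 + (norm (b x))\<^sup>2))"
  proof -
    have "emeasure lborel Q < \<infinity>" using Q(1) emeasure_bounded_finite by blast
    then have "L1 (indicat_real Q)" by (intro integrable_real_indicator) auto
    then have "L1 (\<lambda>x. 2 * indicat_real Q x + indicator Q x * (norm (b x))\<^sup>2)" using b2 by auto
    then show ?thesis by (simp add: algebra_simps)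
  qed
  have Wi: "L1 W" unfolding W_def
    by (intro integrable_mult_right integrable_prod_mult[of "indicator {-T..T}" "\<lambda>x. indicator Q x * (2 + (norm (b x))\<^sup>2)"] integrable_indicator_Icc Qi)
  have sq: "1 + y \<le> 2 + y\<^sup>2" for y :: real
  proof -
    have "0 \<le> (y - 1/2)\<^sup>2" by simp
    then show ?thesis by (simp add: power2_eq_square algebra_simps)
  qed
  have W0: "W z \<ge> 0" for z unfolding W_def using C BP(1) BE(1) BD(1) Bf(1) by (intro mult_nonneg_nonneg add_nonneg_nonneg) auto
  have dom: "\<bar>future z * (u z * (\<psi> (fst z, (fst (snd z), h)) * flux b D z + \<phi> z * (E (fst z, (fst (snd z), h)) \<bullet> (1, (fst (b (snd z)), 0)))))\<bar> \<le> W z" for z h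
  proof (cases "z \<in> K")
    case True
    let ?X = "\<psi> (fst z, (fst (snd z), h)) * flux b D z + \<phi> z * (E (fst z, (fst (snd z), h)) \<bullet> (1, (fst (b (snd z)), 0)))"
    let ?y = "norm (b (snd z))"
    have n1: "\<bar>flux b D z\<bar> \<le> BD * (1 + ?y)"
      by (rule order_trans[OF Cauchy_Schwarz_ineq2]) (intro mult_mono BD True nb, auto)
    have "norm (1::real, (fst (b (snd z)), 0::real)) \<le> 1 + ?y"
      using norm_Pair_le[of "1::real" "(fst (b (snd z)), 0::real)"] norm_Pair_le[of "fst (b (snd z))" "0::real"] abs_fst_snd_le_norm(1)[of "b (snd z)"] by simp
    then have n2: "\<bar>E (fst z, (fst (snd z), h)) \<bullet> (1, (fst (b (snd z)), 0))\<bar> \<le> BE * (1 + ?y)"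
      by (intro order_trans[OF Cauchy_Schwarz_ineq2] mult_mono bnd True) (use BE in auto)
    have "\<bar>?X\<bar> \<le> BP * (BD * (1 + ?y)) + Bf * (BE * (1 + ?y))"
      by (rule order_trans[OF abs_triangle_ineq], unfold abs_mult, intro add_mono mult_mono n1 n2 bnd True)
         (use Bf True BP in auto)
    also have "\<dots> = (BP * BD + Bf * BE) * (1 + ?y)" by (simp add: algebra_simps)
    also have "\<dots> \<le> (BP * BD + Bf * BE) * (2 + ?y\<^sup>2)"
      using BP(1) BE(1) BD(1) Bf(1) sq[of ?y] by (intro mult_left_mono) auto
    finally have X: "\<bar>?X\<bar> \<le> (BP * BD + Bf * BE) * (2 + ?y\<^sup>2)" .
    have "\<bar>u z * ?X\<bar> \<le> C * ((BP * BD + Bf * BE) * (2 + ?y\<^sup>2))"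
      unfolding abs_mult by (rule mult_mono[OF ub(1) X C]) auto
    also have "\<dots> = W z" using True T(2)[OF True] KQ[OF True] Q'(2) by (auto simp: W_def indicator_def abs_le_iff)
    finally have "\<bar>u z * ?X\<bar> \<le> W z" .
    then show ?thesis using W0[of z] by (simp add: indicator_def)
  qed (use W0 D0 \<phi>(4) in simp)
  have wlm[measurable]: "wl \<in> borel_fun"
  proof -
    have "(\<lambda>z::real \<times> real \<times> real. fst (snd z)) \<in> borel_fun" by (auto intro!: borel_measurable_continuous_onI continuous_intros)
    then show ?thesis unfolding wl_def[abs_def] by (intro borel_Pair) measurable
  qed
  have bbm[measurable]: "(\<lambda>z::real \<times> real \<times> real. (1::real, b (snd z))) \<in> borel_fun" "(\<lambda>z::real \<times> real \<times> real. (1::real, (fst (b (snd z)), 0::real))) \<in> borel_fun"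
    by (intro borel_Pair; measurable)+
  have Alm: "Al \<in> borel_fun" unfolding Al_def[abs_def] by measurable
  have gcm: "(\<lambda>z. \<phi> z * \<psi> (wn n z)) \<in> borel_fun" for n using borel_measurable_cgrad[OF grad] .
  have Gm[measurable]: "Gn n \<in> borel_fun" for n using borel_measurable_cgrad_grad[OF grad] .
  \<comment> \<open>\<open>H n\<close> is known to be continuous only on \<open>Q'\<close>; setting
    the map to 0 elsewhere makes it Borel on the whole space and changes nothing on
    \<open>K\<close>.\<close>
  define wn' where "wn' n z = (if snd z \<in> Q' then wn n z else 0)" for n z
  have wn'm[measurable]: "wn' n \<in> borel_fun" for n
  proof -
    have Hc: "continuous_on Q' (H n)"
      by (rule continuous_at_imp_continuous_on) (use has_derivative_continuous[OF H] in auto)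
    have wc: "continuous_on (UNIV \<times> Q') (wn n)" unfolding wn_def[abs_def]
      by (intro continuous_intros continuous_on_compose2[OF Hc]) auto
    have "(\<lambda>z. indicator (UNIV \<times> Q') z *\<^sub>R wn n z) \<in> borel_fun"
      by (rule borel_measurable_continuous_on_indicator[OF borel_open[OF So] wc])
    moreover have "(\<lambda>z. indicator (UNIV \<times> Q') z *\<^sub>R wn n z) = wn' n" by (auto simp: wn'_def fun_eq_iff indicator_def)
    ultimately show ?thesis by simp
  qed
  have An': "An n z = future z * (u z * (\<psi> (wn' n z) * flux b D z + \<phi> z * (E (wn' n z) \<bullet> (1, (fst (b (snd z)), 0)))))" for n z
    using D0[of z] \<phi>(4)[of z] KQ[of z] by (cases "z \<in> K") (auto simp: An_def wn'_def)
  have Anm: "An n \<in> borel_fun" for n unfolding An'[abs_def] by measurable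
  have Ai: "L1 (An n)" for n
    by (rule integrable_dominated[OF Wi Anm]) (use dom in \<open>auto simp: An_def wn_def\<close>)
  have qm[measurable]: "q n \<in> borel_fun" for n unfolding q_def[abs_def] by measurable
  have Rn': "Rn n z = future z * (u z * (\<phi> z * (snd (snd (E (wn' n z))) * q n (snd z))))" for n z
    using \<phi>(4)[of z] KQ[of z] by (cases "z \<in> K") (auto simp: Rn_def wn'_def)
  have Rm: "Rn n \<in> borel_fun" for n
  proof -
    have "(\<lambda>z. snd (snd (E (wn' n z)))) \<in> borel_fun" by measurable
    then show ?thesis unfolding Rn'[abs_def] by measurable
  qed
  define P where "P n x = \<bar>B1 n x - f1 x\<bar> * \<bar>f2 x\<bar> + \<bar>B2 n x - f2 x\<bar> * \<bar>f1 x\<bar>" for n x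
  note P1 = L2_prod_tendsto[of "\<lambda>n x. B1 n x - f1 x" f2, OF _ B(3) fm(2) f2i(2) B(5)]
  note P2 = L2_prod_tendsto[of "\<lambda>n x. B2 n x - f2 x" f1, OF _ B(4) fm(1) f2i(1) B(6)]
  have Pi: "L1 (P n)" for n unfolding P_def using P1(1)[of n] P2(1)[of n] by auto
  have Plim: "(\<lambda>n. LBINT x. P n x) \<longlonglongrightarrow> 0"
  proof -
    have "(\<lambda>n. (LBINT x. \<bar>B1 n x - f1 x\<bar> * \<bar>f2 x\<bar>) + (LBINT x. \<bar>B2 n x - f2 x\<bar> * \<bar>f1 x\<bar>)) \<longlonglongrightarrow> 0 + 0"
      using P1(2) P2(2) by (intro tendsto_add) auto
    then show ?thesis unfolding P_def using P1(1) P2(1) by simp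
  qed
  \<comment> \<open>The product \<open>f1 * f2\<close> is subtracted from both terms of the
    determinant, so that each retains an L2-small factor.\<close>
  have qP: "\<bar>q n x\<bar> \<le> P n x" if "x \<in> Q'" for n x
  proof -
    have "x \<in> Q" using that Q' by auto
    then have "q n x = (B1 n x - f1 x) * f2 x - (B2 n x - f2 x) * f1 x" by (simp add: q_def f algebra_simps)
    then show ?thesis unfolding P_def by (metis abs_mult abs_triangle_ineq4)
  qed
  have RP: "\<bar>Rn n z\<bar> \<le> C * Bf * BE * (indicator {-T..T} (fst z) * P n (snd z))" for n z
  proof (cases "z \<in> K")
    case True
    have Pnn: "P n (snd z) \<ge> 0" by (simp add: P_def)
    have e: "\<bar>snd (snd (E (wn n z)))\<bar> \<le> BE"
      using abs_fst_snd_le_norm(2)[of "snd (E (wn n z))"] norm_snd_le[of "snd (E (wn n z))" "fst (E (wn n z))"] bnd(2)[OF True, of "H n (snd z)"]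
      by (simp add: wn_def)
    have "\<bar>u z * (\<phi> z * (snd (snd (E (wn n z))) * q n (snd z)))\<bar> \<le> C * (Bf * (BE * P n (snd z)))"
      unfolding abs_mult
      by (intro mult_mono ub e qP KQ True order_trans[OF _ Bf(2)[OF True]] mult_nonneg_nonneg) (use C Bf BE Pnn in auto)
    moreover have "0 \<le> C * (Bf * (BE * P n (snd z)))" using C Bf BE Pnn by simp
    ultimately show ?thesis using T(2)[OF True] by (simp add: Rn_def indicator_def abs_le_iff mult.assoc)
  next
    case False
    have "0 \<le> C * Bf * BE * (indicator {-T..T} (fst z) * P n (snd z))" using C Bf BE by (simp add: P_def)
    then show ?thesis using \<phi>(4)[OF False] by (simp add: Rn_def)
  qed
  have RPi: "L1 (\<lambda>z. C * Bf * BE * (indicator {-T..T} (fst z) * P n (snd z)))" for n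
    by (intro integrable_mult_right integrable_prod_mult[of "indicator {-T..T}" "P n"] integrable_indicator_Icc Pi)
  have Ri: "L1 (Rn n)" for n by (rule integrable_dominated[OF RPi Rm RP])
  have Rlim: "(\<lambda>n. LBINT z. Rn n z) \<longlonglongrightarrow> 0"
  proof (rule Lim_null_comparison)
    have "\<bar>LBINT z. Rn n z\<bar> \<le> C * Bf * BE * (2 * T * (LBINT x. P n x))" for n
    proof -
      have "\<bar>LBINT z. Rn n z\<bar> \<le> (LBINT z. C * Bf * BE * (indicator {-T..T} (fst z) * P n (snd z)))"
        using Bochner_Integration.integral_norm_bound_integral[OF Ri RPi] RP by simp
      also have "\<dots> = C * Bf * BE * (LBINT z. indicator {-T..T} (fst z) * P n (snd z))" by simp
      also have "(LBINT z. indicator {-T..T} (fst z) * P n (snd z)) = (LBINT t. indicator {-T..T} t) * (LBINT x. P n x)"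
        using lborel_fubini(3)[OF integrable_prod_mult[OF integrable_indicator_Icc Pi], of "-T" T n] by simp
      finally show ?thesis using T by simp
    qed
    then show "\<forall>\<^sub>F n in sequentially. norm (LBINT z. Rn n z) \<le> C * Bf * BE * (2 * T * (LBINT x. P n x))" by simp
    have "(\<lambda>n. C * Bf * BE * (2 * T * (LBINT x. P n x))) \<longlonglongrightarrow> C * Bf * BE * (2 * T * 0)" by (intro tendsto_intros Plim)
    then show "(\<lambda>n. C * Bf * BE * (2 * T * (LBINT x. P n x))) \<longlonglongrightarrow> 0" by simp
  qed
  have cont: "isCont \<psi> y" "isCont E y" for y
    using cgrad_continuous[OF \<psi>, of UNIV] cgrad_continuous_grad[OF \<psi>, of UNIV] by (simp_all only: continuous_on_eq_continuous_at[OF open_UNIV] UNIV_I ball_UNIV)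
  have Alim: "(\<lambda>n. LBINT z. An n z) \<longlonglongrightarrow> (LBINT z. Al z)"
  proof (rule integral_dominated_convergence[OF _ _ Wi])
    show "AE z in lborel. (\<lambda>n. An n z) \<longlonglongrightarrow> Al z"
      using AE_lborel_fst_snd(2)[OF Hl]
    proof eventually_elim
      case (elim z)
      show ?case
      proof (cases "z \<in> K")
        case True
        then have "(\<lambda>n. wn n z) \<longlonglongrightarrow> wl z" using elim KQ unfolding wn_def wl_def by (intro tendsto_intros) auto
        then have "(\<lambda>n. \<psi> (wn n z)) \<longlonglongrightarrow> \<psi> (wl z)" "(\<lambda>n. E (wn n z)) \<longlonglongrightarrow> E (wl z)"
          using cont isCont_tendsto_compose by blast+
        then show ?thesis unfolding An_def Al_def by (intro tendsto_intros)
      qed (use D0 \<phi>(4) in \<open>simp add: An_def Al_def\<close>)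
    qed
    show "AE z in lborel. norm (An n z) \<le> W z" for n using dom by (auto simp: An_def wn_def)
  qed (use Alm Anm in auto)
  have \<phi>0: "continuous_on UNIV (\<lambda>x. \<phi> (0, x))"
    by (rule continuous_on_compose2[OF cgrad_continuous[OF \<phi>(1), of UNIV]]) (auto intro!: continuous_intros)
  have K0: "compact (snd ` K)" using \<phi>(2) by (intro compact_continuous_image continuous_intros)
  have \<phi>0i: "L1 (\<lambda>x. \<phi> (0, x))"
    by (rule continuous_compact_support_integrable[OF \<phi>0 K0]) (use \<phi>(4) in force)
  have Blim: "(\<lambda>n. LBINT x. u0 x * (\<phi> (0, x) * \<psi> (wn n (0, x)))) \<longlonglongrightarrow> (LBINT x. u0 x * (\<phi> (0, x) * \<psi> (wl (0, x))))"
  proof (rule integral_dominated_convergence)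
    have c0[measurable]: "(\<lambda>x. (0::real, x)) \<in> borel_fun" by (auto intro!: borel_measurable_continuous_onI continuous_intros)
    have [measurable]: "(\<lambda>x. \<phi> (0, x)) \<in> borel_fun" using borel_measurable_continuous_onI[OF \<phi>0] .
    show "(\<lambda>x. u0 x * (\<phi> (0, x) * \<psi> (wl (0, x)))) \<in> borel_measurable lborel" by measurable
    show "(\<lambda>x. u0 x * (\<phi> (0, x) * \<psi> (wn n (0, x)))) \<in> borel_measurable lborel" for n
      using measurable_compose[OF c0 gcm[of n]] by measurable
    show "L1 (\<lambda>x. C * BP * \<bar>\<phi> (0, x)\<bar>)" using \<phi>0i by auto
    show "AE x in lborel. norm (u0 x * (\<phi> (0, x) * \<psi> (wn n (0, x)))) \<le> C * BP * \<bar>\<phi> (0, x)\<bar>" for n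
    proof (rule AE_I2)
      fix x
      show "norm (u0 x * (\<phi> (0, x) * \<psi> (wn n (0, x)))) \<le> C * BP * \<bar>\<phi> (0, x)\<bar>"
      proof (cases "(0, x) \<in> K")
        case True
        have "\<bar>u0 x\<bar> * \<bar>\<psi> (wn n (0, x))\<bar> \<le> C * BP"
          using bnd(1)[OF True, of "H n x"] by (intro mult_mono ub) (use C in \<open>auto simp: wn_def\<close>)
        from mult_right_mono[OF this, of "\<bar>\<phi> (0, x)\<bar>"] show ?thesis by (simp add: abs_mult mult_ac)
      qed (simp add: \<phi>(4))
    qed
    show "AE x in lborel. (\<lambda>n. u0 x * (\<phi> (0, x) * \<psi> (wn n (0, x)))) \<longlonglongrightarrow> u0 x * (\<phi> (0, x) * \<psi> (wl (0, x)))"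
      using Hl
    proof eventually_elim
      case (elim x)
      show ?case
      proof (cases "(0, x) \<in> K")
        case True
        then have "(\<lambda>n. wn n (0, x)) \<longlonglongrightarrow> wl (0, x)" using elim KQ[OF True] unfolding wn_def wl_def by (intro tendsto_intros) auto
        then have "(\<lambda>n. \<psi> (wn n (0, x))) \<longlonglongrightarrow> \<psi> (wl (0, x))" using cont(1) isCont_tendsto_compose by blast
        then show ?thesis by (intro tendsto_intros)
      qed (simp add: \<phi>(4))
    qed
  qed
  have "(\<lambda>n. (LBINT z. An n z) + (LBINT z. Rn n z)) \<longlonglongrightarrow> (LBINT z. Al z) + 0"
    by (intro tendsto_add Alim Rlim)
  moreover have "(LBINT z. An n z) + (LBINT z. Rn n z) = - (LBINT x. u0 x * (\<phi> (0, x) * \<psi> (wn n (0, x))))" for n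
    using eqn[of n] unfolding split using Ai[of n] Ri[of n] by simp
  ultimately have "(\<lambda>n. - (LBINT x. u0 x * (\<phi> (0, x) * \<psi> (wn n (0, x))))) \<longlonglongrightarrow> (LBINT z. Al z)" by simp
  from LIMSEQ_unique[OF this tendsto_minus[OF Blim]] show ?thesis
    unfolding Al_def wl_def by simp
qed

section \<open>Test functions depending on the travel time\<close>

lemma icc_shift: "icc (u + a) (u + b) f = icc a b (\<lambda>s. f (u + s))"
proof -
  have "icc (u + a) (u + b) f = (LBINT s. indicator {u + a..u + b} (u + s) * f (u + s))"
    unfolding icc_def using lborel_integral_real_affine[of 1 "\<lambda>s. indicator {u + a..u + b} s * f s" u] by simp
  also have "\<dots> = icc a b (\<lambda>s. f (u + s))"
    unfolding icc_def by (intro Bochner_Integration.integral_cong) (auto simp: indicator_def)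
  finally show ?thesis .
qed

lemma conv_bounded_locint:
  fixes f :: "'a::euclidean_space \<Rightarrow> real"
  assumes [measurable]: "f \<in> borel_fun" and B: "\<And>r. \<exists>B. \<forall>x. norm x \<le> r \<longrightarrow> \<bar>f x\<bar> \<le> B"
  shows "locint f"
  unfolding locint_def
proof (intro conjI allI)
  fix r
  obtain B where B: "\<And>x. norm x \<le> r \<Longrightarrow> \<bar>f x\<bar> \<le> B" using B by blast
  show "L1 (\<lambda>x. indicator (cball 0 r) x * f x)"
  proof (rule integrable_dominated[of "\<lambda>x. \<bar>B\<bar> * indicator (cball 0 r) x"])
    show "\<bar>indicator (cball 0 r) x * f x\<bar> \<le> \<bar>B\<bar> * indicator (cball 0 r) x" for x
      using B[of x] by (auto simp: indicator_def)
  qed (use integrable_indicator_cball[of "0::'a" r] in auto)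
qed simp

text \<open>Cut \<open>f\<close> off at radius \<open>\<rho> + 1\<close>: the result is bounded with
  bounded support, so its mollifications converge in L2, hence in L1, hence almost everywhere along
  a subsequence. Scales are at most 1, so inside radius \<open>\<rho>\<close> the cutoff is not
  noticed.\<close>

lemma conv_moll_AE_subseq:
  fixes f :: "'a::euclidean_space \<Rightarrow> real"
  assumes fm[measurable]: "f \<in> borel_fun" and B: "\<And>r. \<exists>B. \<forall>x. norm x \<le> r \<longrightarrow> \<bar>f x\<bar> \<le> B"
    and e: "\<And>n. e n > 0" "\<And>n. e n \<le> 1" "e \<longlonglongrightarrow> 0"
  obtains r :: "nat \<Rightarrow> nat" where "strict_mono r" "AE x in lborel. norm x \<le> \<rho> \<longrightarrow> (\<lambda>n. conv f (moll (e (r n))) x) \<longlonglongrightarrow> f x"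
proof -
  define g where "g x = indicator (cball 0 (\<rho> + 1)) x * f x" for x
  have [measurable]: "cball (0::'a) (\<rho> + 1) \<in> sets borel" by simp
  have gm[measurable]: "g \<in> borel_fun" unfolding g_def[abs_def] by measurable
  obtain B0 where B0: "\<And>x. norm x \<le> \<rho> + 1 \<Longrightarrow> \<bar>f x\<bar> \<le> B0" using B by blast
  have g2: "L1 (\<lambda>x. (g x)\<^sup>2)"
  proof (rule integrable_dominated[of "\<lambda>x. B0\<^sup>2 * indicator (cball 0 (\<rho> + 1)) x"])
    fix x
    have "(f x)\<^sup>2 \<le> B0\<^sup>2" if "norm x \<le> \<rho> + 1" using B0[OF that] by (intro abs_le_square_iff[THEN iffD1]) auto
    then show "\<bar>(g x)\<^sup>2\<bar> \<le> B0\<^sup>2 * indicator (cball 0 (\<rho> + 1)) x" by (auto simp: g_def indicator_def)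
  qed (use integrable_indicator_cball[of "0::'a" "\<rho> + 1"] in auto)
  have gs: "g x = 0" if "norm x > \<rho> + 1" for x using that by (simp add: g_def)
  have g1: "L1 g" by (rule integrable_of_square_integrable[OF gm g2 gs])
  have cm[measurable]: "conv g (moll (e n)) \<in> borel_fun" for n
    by (rule borel_measurable_continuous_onI[OF conv_moll_continuous[OF e(1) locint_integrable[OF g1]]])
  note L2 = conv_moll_tendsto_L2[OF gm g2 gs e(1) e(3)]
  have ds: "conv g (moll (e n)) x - g x = 0" if "norm x > \<rho> + 1 + 1" for n x
  proof -
    have "norm x > \<rho> + 1 + e n" "norm x > \<rho> + 1" using that e(1,2)[of n] by auto
    then show ?thesis using conv_moll_support[OF e(1) gs] gs by simp
  qed
  have di: "L1 (\<lambda>x. conv g (moll (e n)) x - g x)" for n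
    by (rule integrable_of_square_integrable[OF _ L2(2) ds]) measurable
  have "(\<lambda>n. LBINT x. \<bar>conv g (moll (e n)) x - g x\<bar>) \<longlonglongrightarrow> 0"
    by (rule L2_imp_L1_tendsto[OF _ L2(2) ds L2(1)]) measurable
  from tendsto_L1_AE_subseq_real[OF di this] obtain r where r: "strict_mono r" "AE x in lborel. (\<lambda>n. conv g (moll (e (r n))) x - g x) \<longlonglongrightarrow> 0" by blast
  have eq: "conv g (moll (e n)) x = conv f (moll (e n)) x" if "norm x \<le> \<rho>" for n x
    unfolding conv_def
  proof (rule Bochner_Integration.integral_cong[OF refl])
    fix y
    show "g y *\<^sub>R moll (e n) (x - y) = f y *\<^sub>R moll (e n) (x - y)"
    proof (cases "norm (x - y) > e n")
      case False
      then have "norm y \<le> \<rho> + 1" using that e(2)[of n] norm_triangle_ineq2[of y x] by (simp add: norm_minus_commute)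
      then show ?thesis by (simp add: g_def)
    qed (simp add: moll_support e)
  qed
  have "AE x in lborel. norm x \<le> \<rho> \<longrightarrow> (\<lambda>n. conv f (moll (e (r n))) x) \<longlonglongrightarrow> f x"
    using r(2)
  proof eventually_elim
    case (elim x)
    show ?case
    proof
      assume x: "norm x \<le> \<rho>"
      have "(\<lambda>n. conv g (moll (e (r n))) x) \<longlonglongrightarrow> g x" using elim by (rule LIM_zero_cancel)
      then show "(\<lambda>n. conv f (moll (e (r n))) x) \<longlonglongrightarrow> f x" using x by (simp add: eq g_def)
    qed
  qed
  then show ?thesis using that r(1) by blast
qed

text \<open>Mollification commutes with integration in the second variable, so the mollified
  \<open>S\<close> is a primitive of the mollified \<open>a\<close>. Fubini moves the integral of
  \<open>a\<close> past the kernel.\<close>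

lemma snd_grad_conv_primitive:
  fixes a S :: "real \<times> real \<Rightarrow> real"
  assumes am[measurable]: "a \<in> borel_fun" and ab: "\<And>x. \<bar>a x\<bar> \<le> A"
    and S: "locint S" and inc: "\<And>h p p'. p \<le> p' \<Longrightarrow> S (h, p') - S (h, p) = icc p p' (\<lambda>s. a (h, s))"
    and e: "e > 0" and D: "cgrad (moll e) D"
  shows "snd (conv S D x) = conv a (moll e) x"
proof -
  have Sm[measurable]: "S \<in> borel_fun" using S by (simp add: locint_def)
  have la: "locint a" using ab by (intro conv_bounded_locint am) blast
  have A: "A \<ge> 0" using ab[of undefined] by linarith
  obtain h p where x: "x = (h, p)" by (cases x)
  note g = cgrad_conv_moll[OF e S D]
  note ac = conv_moll_continuous[OF e la]
  have incr: "conv S (moll e) (h, p + \<delta>) - conv S (moll e) (h, p) = icc 0 \<delta> (\<lambda>s. conv a (moll e) (h, p + s))" if \<delta>: "\<delta> \<ge> 0" for \<delta>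
  proof -
    have cS: "conv S (moll e) x = (LBINT y. moll e y * S (x - y))" for x
      using conv_commute[OF Sm borel_measurable_moll, of e x] by (simp add: conv_def)
    have ca: "conv a (moll e) x = (LBINT y. moll e y * a (x - y))" for x
      using conv_commute[OF am borel_measurable_moll, of e x] by (simp add: conv_def)
    have iS: "L1 (\<lambda>y. moll e y * S (x - y))" for x
      using integral_distr_lborel(2)[OF lborel_distr_reflect[of x], of "\<lambda>y. S y * moll e (x - y)"] conv_moll_integrable[OF e S, where x=x]
      by (simp add: mult.commute)
    define F where "F w = indicator {0..\<delta>} (snd w) * (moll e (fst w) * a ((h, p + snd w) - fst w))" for w :: "(real \<times> real) \<times> real"
    have Fm: "F \<in> borel_fun"
    proof -
      have "(\<lambda>w :: (real \<times> real) \<times> real. (h, p + snd w) - fst w) \<in> borel_fun"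
        by (auto intro!: borel_measurable_continuous_onI continuous_intros)
      note [measurable] = measurable_compose[OF this am]
      show ?thesis unfolding F_def[abs_def] by measurable
    qed
    have Fi: "L1 F"
    proof (rule integrable_dominated[OF _ Fm])
      show "L1 (\<lambda>w. A * (moll e (fst w) * indicator {0..\<delta>} (snd w) :: real))"
        by (intro integrable_mult_right integrable_prod_mult[of "moll e" "indicator {0..\<delta>}"] moll_integrable e integrable_indicator_Icc)
      show "\<bar>F w\<bar> \<le> A * (moll e (fst w) * indicator {0..\<delta>} (snd w))" for w
        using mult_right_mono[OF ab[of "(h, p + snd w) - fst w"] moll_nonneg[of e "fst w"]]
        by (auto simp: F_def indicator_def abs_mult moll_nonneg mult.commute)
    qed
    have "conv S (moll e) (h, p + \<delta>) - conv S (moll e) (h, p) = (LBINT y. moll e y * S ((h, p + \<delta>) - y) - moll e y * S ((h, p) - y))"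
      unfolding cS by (rule Bochner_Integration.integral_diff[OF iS iS, symmetric])
    also have "\<dots> = (LBINT y. LBINT s. F (y, s))"
    proof (rule Bochner_Integration.integral_cong[OF refl])
      fix y :: "real \<times> real"
      have "S ((h, p + \<delta>) - y) - S ((h, p) - y) = icc (p - snd y) (p + \<delta> - snd y) (\<lambda>s. a (h - fst y, s))"
        using inc[of "p - snd y" "p + \<delta> - snd y" "h - fst y"] \<delta> by (cases y) auto
      also have "\<dots> = icc 0 \<delta> (\<lambda>s. a (h - fst y, p - snd y + s))"
        using icc_shift[of "p - snd y" 0 \<delta> "\<lambda>s. a (h - fst y, s)"] by (simp add: algebra_simps)
      finally have "moll e y * (S ((h, p + \<delta>) - y) - S ((h, p) - y)) = (LBINT s. moll e y * (indicator {0..\<delta>} s * a (h - fst y, p - snd y + s)))"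
        by (simp add: icc_def)
      also have "(\<lambda>s. moll e y * (indicator {0..\<delta>} s * a (h - fst y, p - snd y + s))) = (\<lambda>s. F (y, s))"
        by (cases y) (auto simp: F_def algebra_simps)
      finally show "moll e y * S ((h, p + \<delta>) - y) - moll e y * S ((h, p) - y) = (LBINT s. F (y, s))"
        by (simp add: right_diff_distrib)
    qed
    also have "\<dots> = (LBINT s. LBINT y. F (y, s))" using lborel_fubini(3,6)[OF Fi] by simp
    also have "\<dots> = icc 0 \<delta> (\<lambda>s. conv a (moll e) (h, p + s))"
      unfolding icc_def ca by (simp add: F_def)
    finally show ?thesis .
  qed
  have sc: "continuous_on UNIV (\<lambda>s. conv a (moll e) (h, p + s))"
    by (rule continuous_on_compose2[OF ac]) (auto intro!: continuous_intros)
  \<comment> \<open>The increment formula is available for \<open>\<delta> \<ge> 0\<close>, so the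
    two derivatives are compared from the right.\<close>
  have "((\<lambda>\<delta>. integral {0..\<delta>} (\<lambda>s. conv a (moll e) (h, p + s))) has_real_derivative conv a (moll e) (h, p + 0)) (at 0 within {0..1})"
    by (rule integral_has_real_derivative[OF continuous_on_subset[OF sc]]) auto
  then have "((\<lambda>\<delta>. integral {0..\<delta>} (\<lambda>s. conv a (moll e) (h, p + s))) has_real_derivative conv a (moll e) (h, p)) (at 0 within {0..1})"
    by simp
  then have 1: "((\<lambda>\<delta>. conv S (moll e) (h, p + \<delta>) - conv S (moll e) (h, p)) has_real_derivative conv a (moll e) (h, p)) (at 0 within {0..1})"
  proof (rule has_field_derivative_transform_within[where d=1])
    fix \<delta> :: real assume "\<delta> \<in> {0..1}"
    then show "integral {0..\<delta>} (\<lambda>s. conv a (moll e) (h, p + s)) = conv S (moll e) (h, p + \<delta>) - conv S (moll e) (h, p)"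
      using incr[of \<delta>] icc_continuous_eq_integral(2)[OF sc, of 0 \<delta>] by simp
  qed simp_all
  have hd: "((\<lambda>\<delta>. (h, p + \<delta>)) has_derivative (\<lambda>d. (0, d))) (at (0::real))" by (auto intro!: derivative_eq_intros)
  have gd: "(conv S (moll e) has_derivative (\<lambda>v. conv S D (h, p + 0) \<bullet> v)) (at (h, p + 0))" by (rule cgradD[OF g])
  have "((\<lambda>\<delta>. conv S (moll e) (h, p + \<delta>)) has_real_derivative snd (conv S D (h, p))) (at 0)"
    unfolding has_field_derivative_def
    by (rule has_derivative_eq_rhs[OF has_derivative_compose[OF hd gd]]) (auto simp: inner_prod_def)
  then have "((\<lambda>\<delta>. conv S (moll e) (h, p + \<delta>) - conv S (moll e) (h, p)) has_real_derivative snd (conv S D (h, p)) - 0) (at 0)"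
    by (rule DERIV_diff[OF _ DERIV_const])
  then have 2: "((\<lambda>\<delta>. conv S (moll e) (h, p + \<delta>) - conv S (moll e) (h, p)) has_real_derivative snd (conv S D (h, p))) (at 0 within {0..1})"
    by (simp add: has_field_derivative_at_within)
  have nb: "at 0 within {0..1::real} \<noteq> bot" by (simp add: at_within_Icc_at_right)
  show ?thesis
    using vector_derivative_unique_within[OF nb 1[unfolded has_real_derivative_iff_has_vector_derivative] 2[unfolded has_real_derivative_iff_has_vector_derivative]]
    by (simp add: x)
qed

text \<open>
  The equation tested with \<open>\<phi> \<theta>(t) \<kappa>(H, S - t)\<close>, where \<open>S\<close> is the travel time along the level line of
  \<open>H\<close>: since \<open>a b\<^sub>1 = 1\<close>, the terms containing \<open>\<nabla>\<kappa>\<close> cancel.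
\<close>

lemma weak_sol_test_flow:
  fixes b :: "real \<times> real \<Rightarrow> real \<times> real" and Q' :: "(real \<times> real) set" and a S Hl :: "real \<times> real \<Rightarrow> real"
  assumes bm[measurable]: "b \<in> borel_fun" and Q'[measurable]: "Q' \<in> sets borel" and bi: "L1 (\<lambda>x. indicator Q' x * (1 + norm (b x)))"
    and um[measurable]: "u \<in> borel_fun" and u0m[measurable]: "u0 \<in> borel_fun"
    and ub: "\<And>z. \<bar>u z\<bar> \<le> C" "\<And>x. \<bar>u0 x\<bar> \<le> C"
    and \<phi>: "cgrad \<phi> D" "compact K" "K \<subseteq> UNIV \<times> Q'" "\<And>z. z \<notin> K \<Longrightarrow> \<phi> z = 0"
    and ST: "\<And>\<psi> E M. cgrad \<psi> E \<Longrightarrow> (\<And>t p h. \<bar>h\<bar> > M \<Longrightarrow> \<psi> (t, (p, h)) = (0::real)) \<Longrightarrow>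
       (LBINT z. future z * (u z * (\<psi> (fst z, (fst (snd z), Hl (snd z))) * flux b D z
            + \<phi> z * (E (fst z, (fst (snd z), Hl (snd z))) \<bullet> (1, (fst (b (snd z)), 0))))))
       = - (LBINT x. u0 x * (\<phi> (0, x) * \<psi> (0, (fst x, Hl x))))"
    and am[measurable]: "a \<in> borel_fun" and ab: "\<And>x. \<bar>a x\<bar> \<le> A"
    and Sm[measurable]: "S \<in> borel_fun" and Hlm[measurable]: "Hl \<in> borel_fun"
    and inc: "\<And>h p p'. p \<le> p' \<Longrightarrow> S (h, p') - S (h, p) = icc p p' (\<lambda>s. a (h, s))"
    and Sb: "\<And>h p. \<bar>S (h, p)\<bar> \<le> A * (\<bar>p\<bar> + c0)"
    and null: "\<And>P. AE y in lborel. P y \<Longrightarrow> AE x in lborel. P (Hl x, fst x)"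
    and ab1: "AE x in lborel. x \<in> Q' \<longrightarrow> a (Hl x, fst x) * fst (b x) = 1"
    and \<kappa>: "cgrad \<kappa> E" "\<And>y. norm y > M \<Longrightarrow> \<kappa> y = 0" and \<theta>: "C1 \<theta> \<theta>'"
  shows "(LBINT z. future z * (\<kappa> ((Hl (snd z), S (Hl (snd z), fst (snd z))) - (0, fst z)) *
           (\<theta>' (fst z) * (u z * \<phi> z) + \<theta> (fst z) * (u z * flux b D z))))
       = - (\<theta> 0 * (LBINT x. \<kappa> (Hl x, S (Hl x, fst x)) * (u0 x * \<phi> (0, x))))"
proof -
  have C: "C \<ge> 0" using ub(2)[of 0] by linarith
  have A: "A \<ge> 0" using ab[of 0] by linarith
  have [measurable]: "\<phi> \<in> borel_fun" "D \<in> borel_fun" "\<kappa> \<in> borel_fun" "E \<in> borel_fun"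
    "\<theta> \<in> borel_fun" "\<theta>' \<in> borel_fun" "(\<lambda>x. fst (b x)) \<in> borel_fun"
    using borel_measurable_cgrad[OF \<phi>(1)] borel_measurable_cgrad_grad[OF \<phi>(1)] borel_measurable_cgrad[OF \<kappa>(1)] borel_measurable_cgrad_grad[OF \<kappa>(1)]
      C1_continuous[OF \<theta>] C1D(2)[OF \<theta>] measurable_compose[OF bm borel_fst_snd(1)]
    by (auto intro: borel_measurable_continuous_onI)
  have D0: "D z = 0" if "z \<notin> K" for z
    by (rule cgrad_zero_outside[OF \<phi>(1) compact_imp_closed[OF \<phi>(2)] \<phi>(4) that])
  have E0: "E y = 0" if "norm y > M" for y
    by (rule cgrad_zero_outside[OF \<kappa>(1), of "cball 0 M"]) (use \<kappa>(2) that in auto)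
  obtain T where T: "T > 0" "\<And>z. z \<in> K \<Longrightarrow> \<bar>fst z\<bar> \<le> T" using compact_subset_time_strip[OF \<phi>(2)] by blast
  obtain m where m: "\<And>z. z \<in> K \<Longrightarrow> norm z \<le> m" using compact_imp_bounded[OF \<phi>(2)] by (auto simp: bounded_iff)
  have mp: "\<bar>fst (snd z)\<bar> \<le> m" if "z \<in> K" for z
    using m[OF that] norm_snd_le[of "snd z" "fst z"] abs_fst_snd_le_norm(1)[of "snd z"] by simp
  define \<rho> where "\<rho> = M + m"
  have SB: "\<exists>B. \<forall>x. norm x \<le> r \<longrightarrow> \<bar>S x\<bar> \<le> B" for r
  proof (intro exI allI impI)
    fix x :: "real \<times> real" assume "norm x \<le> r"
    then have "\<bar>snd x\<bar> \<le> r" using abs_fst_snd_le_norm(2)[of x] by simp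
    then have "A * (\<bar>snd x\<bar> + c0) \<le> A * (r + c0)" using A by (intro mult_left_mono) auto
    then show "\<bar>S x\<bar> \<le> A * (r + c0)" using Sb[of "fst x" "snd x"] by simp
  qed
  have aB: "\<exists>B. \<forall>x. norm x \<le> r \<longrightarrow> \<bar>a x\<bar> \<le> B" for r using ab by blast
  have lS: "locint S" by (rule conv_bounded_locint[OF Sm SB])
  have la: "locint a" by (rule conv_bounded_locint[OF am aB])
  define e0 where "e0 n = 1 / (real n + 1)" for n :: nat
  have e0: "e0 n > 0" "e0 n \<le> 1" for n by (auto simp: e0_def)
  have e0l: "e0 \<longlonglongrightarrow> 0" using LIMSEQ_inverse_real_of_nat by (simp add: e0_def[abs_def] inverse_eq_divide add.commute)
  obtain r1 where r1: "strict_mono r1" "AE x in lborel. norm x \<le> \<rho> \<longrightarrow> (\<lambda>n. conv S (moll (e0 (r1 n))) x) \<longlonglongrightarrow> S x"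
    using conv_moll_AE_subseq[OF Sm SB e0 e0l] by blast
  have e1: "(\<lambda>n. e0 (r1 n)) \<longlonglongrightarrow> 0" using LIMSEQ_subseq_LIMSEQ[OF e0l r1(1)] by (simp add: comp_def)
  \<comment> \<open>The second subsequence is taken inside the first, so that both mollifications
    converge along the same scales \<open>e\<close>.\<close>
  obtain r2 where r2: "strict_mono r2" "AE x in lborel. norm x \<le> \<rho> \<longrightarrow> (\<lambda>n. conv a (moll (e0 (r1 (r2 n)))) x) \<longlonglongrightarrow> a x"
    using conv_moll_AE_subseq[OF am aB e0 e1] by blast
  define e where "e n = e0 (r1 (r2 n))" for n
  have e: "e n > 0" for n using e0 by (simp add: e_def)
  have Slim: "AE x in lborel. norm x \<le> \<rho> \<longrightarrow> (\<lambda>n. conv S (moll (e n)) x) \<longlonglongrightarrow> S x"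
    using r1(2) by eventually_elim (use LIMSEQ_subseq_LIMSEQ[OF _ r2(1)] in \<open>auto simp: e_def comp_def\<close>)
  have alim: "AE x in lborel. norm x \<le> \<rho> \<longrightarrow> (\<lambda>n. conv a (moll (e n)) x) \<longlonglongrightarrow> a x" using r2(2) by (simp add: e_def)
  have "\<forall>n. \<exists>D. cgrad (moll (e n) :: real \<times> real \<Rightarrow> real) D" by (intro allI cgrad_moll)
  then obtain DM where DM: "\<And>n. cgrad (moll (e n) :: real \<times> real \<Rightarrow> real) (DM n)" by metis
  define Sj where "Sj n = conv S (moll (e n))" for n
  define aj where "aj n = conv a (moll (e n))" for n
  note gS = cgrad_conv_moll[OF e lS DM, folded Sj_def]
  have gp: "snd (conv S (DM n) x) = aj n x" for n x
    unfolding aj_def by (rule snd_grad_conv_primitive[OF am ab lS inc e DM])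
  have ajb: "\<bar>aj n x\<bar> \<le> A" for n x
  proof -
    have "\<bar>aj n x\<bar> \<le> (LBINT y. A * moll (e n) (x - y))"
      unfolding aj_def conv_def real_norm_def[symmetric]
    proof (rule Bochner_Integration.integral_norm_bound_integral)
      show "L1 (\<lambda>y. a y *\<^sub>R moll (e n) (x - y))" using conv_moll_integrable[OF e la, where x=x] by simp
      show "L1 (\<lambda>y. A * moll (e n) (x - y))" using moll_reflect_integrable(1)[OF e] by auto
      show "norm (a y *\<^sub>R moll (e n) (x - y)) \<le> A * moll (e n) (x - y)" for y
        using mult_right_mono[OF ab moll_nonneg] by (simp add: abs_mult moll_nonneg)
    qed
    then show ?thesis by (simp add: moll_reflect_integrable(2)[OF e])
  qed
  have ajc: "continuous_on UNIV (aj n)" and Sjc: "continuous_on UNIV (Sj n)" for n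
    unfolding aj_def Sj_def by (rule conv_moll_continuous[OF e la] conv_moll_continuous[OF e lS])+
  have [measurable]: "aj n \<in> borel_fun" "Sj n \<in> borel_fun" for n
    using ajc Sjc by (auto intro: borel_measurable_continuous_onI)
  define yn where "yn n w = (snd (snd w), Sj n (snd (snd w), fst (snd w)) - fst w)" for n and w :: "real \<times> real \<times> real"
  \<comment> \<open>The gradient of \<open>\<kappa> (h, Sj n (h, p) - t)\<close> with respect to
    \<open>w = (t, (p, h))\<close>; note that \<open>Sj n\<close> takes its arguments in the order
    \<open>(h, p)\<close>.\<close>
  define GK where "GK n w = (- snd (E (yn n w)), (snd (E (yn n w)) * snd (conv S (DM n) (snd (snd w), fst (snd w))),
      fst (E (yn n w)) + snd (E (yn n w)) * fst (conv S (DM n) (snd (snd w), fst (snd w)))))" for n w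
  have gK: "cgrad (\<lambda>w. \<kappa> (yn n w)) (GK n)" for n
    unfolding cgrad_def
  proof (intro conjI allI)
    fix w :: "real \<times> real \<times> real"
    have "((\<lambda>w::real \<times> real \<times> real. (snd (snd w), fst (snd w))) has_derivative (\<lambda>v. (snd (snd v), fst (snd v)))) (at w)"
      by (auto intro!: derivative_eq_intros)
    from has_derivative_compose[where g="Sj n", OF this cgradD[OF gS]]
    have "(yn n has_derivative (\<lambda>v. (snd (snd v), conv S (DM n) (snd (snd w), fst (snd w)) \<bullet> (snd (snd v), fst (snd v)) - fst v))) (at w)"
      unfolding yn_def[abs_def] by (auto intro!: derivative_eq_intros)
    from has_derivative_compose[where g=\<kappa>, OF this cgradD[OF \<kappa>(1)]]
    show "((\<lambda>w. \<kappa> (yn n w)) has_derivative (\<lambda>v. GK n w \<bullet> v)) (at w)"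
      by (rule has_derivative_eq_rhs) (auto simp: GK_def inner_prod_def algebra_simps)
  next
    have "continuous_on UNIV (yn n)" unfolding yn_def[abs_def]
      by (intro continuous_intros continuous_on_compose2[OF Sjc]) auto
    then have "continuous_on UNIV (\<lambda>w. E (yn n w))"
      by (rule continuous_on_compose2[OF cgrad_continuous_grad[OF \<kappa>(1), of UNIV]]) simp
    moreover have "continuous_on UNIV (\<lambda>w::real \<times> real \<times> real. conv S (DM n) (snd (snd w), fst (snd w)))"
      by (rule continuous_on_compose2[OF cgrad_continuous_grad[OF gS, of UNIV]]) (auto intro!: continuous_intros)
    ultimately show "continuous_on UNIV (GK n)" unfolding GK_def[abs_def] by (intro continuous_intros)
  qed
  have g\<psi>: "cgrad (\<lambda>w. \<theta> (fst w) * \<kappa> (yn n w)) (\<lambda>w. \<kappa> (yn n w) *\<^sub>R (\<theta>' (fst w), 0) + \<theta> (fst w) *\<^sub>R GK n w)" for n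
    by (rule cgrad_mult[OF cgrad_comp_fst[OF cgrad_C1_real[OF \<theta>]] gK])
  have big: "norm (h, s) > M" if "\<bar>h\<bar> > M" for h s :: real
    using that abs_fst_snd_le_norm(1)[of "(h, s)"] by simp
  define x3 where "x3 z = (fst z, (fst (snd z), Hl (snd z)))" for z :: "real \<times> real \<times> real"
  \<comment> \<open>Pairing the gradient with \<open>(1, (b1, 0))\<close> removes the derivative in
    \<open>h\<close> and leaves the derivative of \<open>\<kappa>\<close> in its second variable
    with the factor \<open>aj n * b1 - 1\<close>.\<close>
  define An where "An n z = future z * (u z * (\<theta> (fst z) * \<kappa> (yn n (x3 z)) * flux b D z
       + \<phi> z * (\<kappa> (yn n (x3 z)) * \<theta>' (fst z) + \<theta> (fst z) * (snd (E (yn n (x3 z))) * (aj n (Hl (snd z), fst (snd z)) * fst (b (snd z)) - 1)))))" for n z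
  have eqn: "(LBINT z. An n z) = - (LBINT x. u0 x * (\<phi> (0, x) * (\<theta> 0 * \<kappa> (yn n (x3 (0, x))))))" for n
  proof -
    have "(LBINT z. future z * (u z * (\<theta> (fst (x3 z)) * \<kappa> (yn n (x3 z)) * flux b D z
            + \<phi> z * ((\<kappa> (yn n (x3 z)) *\<^sub>R (\<theta>' (fst (x3 z)), 0) + \<theta> (fst (x3 z)) *\<^sub>R GK n (x3 z)) \<bullet> (1, (fst (b (snd z)), 0))))))
       = - (LBINT x. u0 x * (\<phi> (0, x) * (\<theta> (fst (x3 (0, x))) * \<kappa> (yn n (x3 (0, x))))))"
      using ST[OF g\<psi>[of n], of M] by (simp add: x3_def yn_def big \<kappa>(2))
    moreover have "(\<kappa> (yn n (x3 z)) *\<^sub>R (\<theta>' (fst (x3 z)), 0) + \<theta> (fst (x3 z)) *\<^sub>R GK n (x3 z)) \<bullet> (1, (fst (b (snd z)), 0))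
       = \<kappa> (yn n (x3 z)) * \<theta>' (fst z) + \<theta> (fst z) * (snd (E (yn n (x3 z))) * (aj n (Hl (snd z), fst (snd z)) * fst (b (snd z)) - 1))" for z
      by (simp add: GK_def gp inner_add_left inner_prod_def x3_def algebra_simps)
    ultimately show ?thesis unfolding An_def by (simp add: x3_def)
  qed
  define yl where "yl z = (Hl (snd z), S (Hl (snd z), fst (snd z))) - (0, fst z)" for z :: "real \<times> real \<times> real"
  \<comment> \<open>Convergence is known almost everywhere in the variables \<open>(h, p)\<close>;
    \<open>null\<close> transfers it to almost every \<open>x\<close>. The factor
    \<open>a * b1 - 1\<close> of the limit is zero by \<open>ab1\<close>.\<close>
  have lim: "AE x in lborel. \<forall>t. (t, x) \<in> K \<longrightarrow> (\<lambda>n. \<kappa> (yn n (x3 (t, x)))) \<longlonglongrightarrow> \<kappa> (yl (t, x)) \<and>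
      (\<lambda>n. snd (E (yn n (x3 (t, x)))) * (aj n (Hl x, fst x) * fst (b x) - 1)) \<longlonglongrightarrow> 0"
    using null[OF Slim] null[OF alim] ab1
  proof eventually_elim
    case (elim x)
    show ?case
    proof (intro allI impI)
      fix t assume tx: "(t, x) \<in> K"
      have xQ: "x \<in> Q'" using \<phi>(3) tx by auto
      show "(\<lambda>n. \<kappa> (yn n (x3 (t, x)))) \<longlonglongrightarrow> \<kappa> (yl (t, x)) \<and>
         (\<lambda>n. snd (E (yn n (x3 (t, x)))) * (aj n (Hl x, fst x) * fst (b x) - 1)) \<longlonglongrightarrow> 0"
      proof (cases "\<bar>Hl x\<bar> > M")
        case True
        then show ?thesis using \<kappa>(2) E0 big by (simp add: yn_def x3_def yl_def)
      next
        case False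
        then have "norm (Hl x, fst x) \<le> \<rho>" using norm_Pair_le[of "Hl x" "fst x"] mp[OF tx] by (simp add: \<rho>_def)
        then have Sx: "(\<lambda>n. Sj n (Hl x, fst x)) \<longlonglongrightarrow> S (Hl x, fst x)" and ax: "(\<lambda>n. aj n (Hl x, fst x)) \<longlonglongrightarrow> a (Hl x, fst x)"
          using elim(1,2) by (auto simp: Sj_def aj_def)
        have y: "(\<lambda>n. yn n (x3 (t, x))) \<longlonglongrightarrow> (Hl x, S (Hl x, fst x) - t)"
          unfolding yn_def x3_def fst_conv snd_conv by (intro tendsto_intros Sx)
        have "isCont \<kappa> (Hl x, S (Hl x, fst x) - t)" "isCont E (Hl x, S (Hl x, fst x) - t)"
          using cgrad_continuous[OF \<kappa>(1), of UNIV] cgrad_continuous_grad[OF \<kappa>(1), of UNIV]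
          by (simp_all only: continuous_on_eq_continuous_at[OF open_UNIV] UNIV_I ball_UNIV)
        from isCont_tendsto_compose[OF this(1) y] isCont_tendsto_compose[OF this(2) y]
        have 1: "(\<lambda>n. \<kappa> (yn n (x3 (t, x)))) \<longlonglongrightarrow> \<kappa> (yl (t, x))" and 2: "(\<lambda>n. E (yn n (x3 (t, x)))) \<longlonglongrightarrow> E (Hl x, S (Hl x, fst x) - t)"
          by (simp_all add: yl_def)
        have "(\<lambda>n. snd (E (yn n (x3 (t, x)))) * (aj n (Hl x, fst x) * fst (b x) - 1)) \<longlonglongrightarrow> snd (E (Hl x, S (Hl x, fst x) - t)) * (a (Hl x, fst x) * fst (b x) - 1)"
          by (intro tendsto_intros 2 ax)
        then show ?thesis using 1 elim(3) xQ by simp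
      qed
    qed
  qed
  obtain Bk where Bk: "Bk \<ge> 0" "\<And>y. \<bar>\<kappa> y\<bar> \<le> Bk"
  proof -
    obtain B where "B \<ge> 0" "\<And>y. y \<in> cball 0 M \<Longrightarrow> norm (\<kappa> y) \<le> B" using bounded_on_compact[OF compact_cball cgrad_continuous[OF \<kappa>(1)]] by blast
    then have "\<bar>\<kappa> y\<bar> \<le> B" for y using \<kappa>(2)[of y] by (cases "norm y > M") auto
    then show ?thesis using that \<open>B \<ge> 0\<close> by blast
  qed
  obtain BE where BE: "BE \<ge> 0" "\<And>y. \<bar>snd (E y)\<bar> \<le> BE"
  proof -
    obtain B where B: "B \<ge> 0" "\<And>y. y \<in> cball 0 M \<Longrightarrow> norm (E y) \<le> B" using bounded_on_compact[OF compact_cball cgrad_continuous_grad[OF \<kappa>(1)]] by blast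
    have "\<bar>snd (E y)\<bar> \<le> B" for y
    proof (cases "norm y > M")
      case False then show ?thesis using B(2)[of y] abs_fst_snd_le_norm(2)[of "E y"] by simp
    qed (use E0 B in simp)
    then show ?thesis using that B(1) by blast
  qed
  obtain Bt where Bt: "Bt \<ge> 0" "\<And>t. t \<in> {-T..T} \<Longrightarrow> \<bar>\<theta> t\<bar> \<le> Bt" "\<And>t. t \<in> {-T..T} \<Longrightarrow> \<bar>\<theta>' t\<bar> \<le> Bt"
  proof -
    obtain B1 where "B1 \<ge> 0" "\<And>t. t \<in> {-T..T} \<Longrightarrow> norm (\<theta> t) \<le> B1" using bounded_on_compact[OF compact_Icc C1_continuous[OF \<theta>]] by blast
    moreover obtain B2 where "B2 \<ge> 0" "\<And>t. t \<in> {-T..T} \<Longrightarrow> norm (\<theta>' t) \<le> B2" using bounded_on_compact[OF compact_Icc C1D(2)[OF \<theta>]] by blast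
    ultimately show ?thesis using that[of "max B1 B2"] by (simp add: le_max_iff_disj)
  qed
  obtain Bf where Bf: "Bf \<ge> 0" "\<And>z. z \<in> K \<Longrightarrow> norm (\<phi> z) \<le> Bf" using bounded_on_compact[OF \<phi>(2) cgrad_continuous[OF \<phi>(1)]] by blast
  obtain BD where BD: "BD \<ge> 0" "\<And>z. z \<in> K \<Longrightarrow> norm (D z) \<le> BD" using bounded_on_compact[OF \<phi>(2) cgrad_continuous_grad[OF \<phi>(1)]] by blast
  define cW where "cW = C * (Bt * Bk * BD + Bf * (Bk * Bt + Bt * (BE * (A + 1))))"
  have cW: "cW \<ge> 0" unfolding cW_def using C Bt(1) Bk(1) BD(1) Bf(1) BE(1) A by (intro mult_nonneg_nonneg add_nonneg_nonneg) auto
  define W where "W z = cW * (indicator {-T..T} (fst z) * (indicator Q' (snd z) * (1 + norm (b (snd z)))))" for z :: "real \<times> real \<times> real"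
  have Wi: "L1 W" unfolding W_def
    by (intro integrable_mult_right integrable_prod_mult[of "indicator {-T..T}" "\<lambda>x. indicator Q' x * (1 + norm (b x))"] integrable_indicator_Icc bi)
  have W0: "W z \<ge> 0" for z unfolding W_def using cW by (intro mult_nonneg_nonneg) auto
  have dom: "\<bar>An n z\<bar> \<le> W z" for n z
  proof (cases "z \<in> K")
    case True
    let ?y = "norm (b (snd z))"
    have t: "fst z \<in> {-T..T}" using T(2)[OF True] by auto
    have nD: "\<bar>flux b D z\<bar> \<le> BD * (1 + ?y)"
      by (rule order_trans[OF Cauchy_Schwarz_ineq2]) (intro mult_mono BD True order_trans[OF norm_Pair_le], auto)
    have n1: "\<bar>\<theta> (fst z) * \<kappa> (yn n (x3 z)) * flux b D z\<bar> \<le> Bt * Bk * (BD * (1 + ?y))"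
      unfolding abs_mult by (intro mult_mono Bt Bk nD t mult_nonneg_nonneg) (use Bt Bk in auto)
    have n2: "\<bar>\<kappa> (yn n (x3 z)) * \<theta>' (fst z)\<bar> \<le> Bk * Bt * (1 + ?y)"
    proof -
      have "\<bar>\<kappa> (yn n (x3 z)) * \<theta>' (fst z)\<bar> \<le> Bk * Bt" unfolding abs_mult by (intro mult_mono Bt Bk t) (use Bk in auto)
      also have "\<dots> \<le> Bk * Bt * (1 + ?y)" using Bk(1) Bt(1) by (simp add: mult_le_cancel_left1 distrib_left)
      finally show ?thesis .
    qed
    have "\<bar>aj n (Hl (snd z), fst (snd z)) * fst (b (snd z)) - 1\<bar> \<le> A * ?y + 1"
    proof -
      have "\<bar>aj n (Hl (snd z), fst (snd z)) * fst (b (snd z))\<bar> \<le> A * ?y"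
        unfolding abs_mult by (intro mult_mono ajb abs_fst_snd_le_norm A) auto
      then show ?thesis by linarith
    qed
    also have "\<dots> \<le> (A + 1) * (1 + ?y)" using A by (simp add: algebra_simps)
    finally have n3: "\<bar>\<theta> (fst z) * (snd (E (yn n (x3 z))) * (aj n (Hl (snd z), fst (snd z)) * fst (b (snd z)) - 1))\<bar> \<le> Bt * (BE * ((A + 1) * (1 + ?y)))"
      unfolding abs_mult using A by (intro mult_mono Bt BE t mult_nonneg_nonneg) (use Bt BE in auto)
    let ?X = "\<theta> (fst z) * \<kappa> (yn n (x3 z)) * flux b D z
       + \<phi> z * (\<kappa> (yn n (x3 z)) * \<theta>' (fst z) + \<theta> (fst z) * (snd (E (yn n (x3 z))) * (aj n (Hl (snd z), fst (snd z)) * fst (b (snd z)) - 1)))"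
    have n4: "\<bar>\<phi> z * (\<kappa> (yn n (x3 z)) * \<theta>' (fst z) + \<theta> (fst z) * (snd (E (yn n (x3 z))) * (aj n (Hl (snd z), fst (snd z)) * fst (b (snd z)) - 1)))\<bar>
       \<le> Bf * (Bk * Bt * (1 + ?y) + Bt * (BE * ((A + 1) * (1 + ?y))))"
      unfolding abs_mult[of "\<phi> z"]
      by (intro mult_mono order_trans[OF abs_triangle_ineq add_mono[OF n2 n3]]) (use Bf True in auto)
    have "\<bar>?X\<bar> \<le> Bt * Bk * (BD * (1 + ?y)) + Bf * (Bk * Bt * (1 + ?y) + Bt * (BE * ((A + 1) * (1 + ?y))))"
      by (rule order_trans[OF abs_triangle_ineq add_mono[OF n1 n4]])
    also have "\<dots> = (Bt * Bk * BD + Bf * (Bk * Bt + Bt * (BE * (A + 1)))) * (1 + ?y)" by (simp add: algebra_simps)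
    finally have X: "\<bar>?X\<bar> \<le> (Bt * Bk * BD + Bf * (Bk * Bt + Bt * (BE * (A + 1)))) * (1 + ?y)" .
    have "\<bar>u z * ?X\<bar> \<le> C * ((Bt * Bk * BD + Bf * (Bk * Bt + Bt * (BE * (A + 1)))) * (1 + ?y))"
      unfolding abs_mult[of "u z"] by (rule mult_mono[OF ub(1) X C]) auto
    also have "\<dots> = W z" using True t \<phi>(3) by (auto simp: W_def cW_def indicator_def)
    finally show ?thesis using W0[of z] unfolding An_def by (cases "fst z \<ge> 0") auto
  qed (use W0 D0 \<phi>(4) in \<open>simp add: An_def\<close>)
  have hp[measurable]: "(\<lambda>z::real \<times> real \<times> real. (Hl (snd z), fst (snd z))) \<in> borel_fun"
    by (intro borel_Pair) (auto intro!: measurable_compose[OF borel_fst_snd(2) Hlm] borel_measurable_continuous_onI continuous_intros)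
  have [measurable]: "(\<lambda>z::real \<times> real \<times> real. (1::real, b (snd z))) \<in> borel_fun" by (intro borel_Pair) measurable
  have ym[measurable]: "(\<lambda>z. yn n (x3 z)) \<in> borel_fun" for n
  proof -
    have "(\<lambda>z. Sj n (Hl (snd z), fst (snd z)) - fst z) \<in> borel_fun" by measurable
    moreover have "(\<lambda>z::real \<times> real \<times> real. Hl (snd z)) \<in> borel_fun" by measurable
    ultimately show ?thesis unfolding yn_def x3_def fst_conv snd_conv by (intro borel_Pair)
  qed
  have ylm[measurable]: "yl \<in> borel_fun"
  proof -
    have "(\<lambda>z. S (Hl (snd z), fst (snd z)) - fst z) \<in> borel_fun" by measurable
    moreover have "(\<lambda>z::real \<times> real \<times> real. Hl (snd z)) \<in> borel_fun" by measurable
    ultimately have "(\<lambda>z. (Hl (snd z), S (Hl (snd z), fst (snd z)) - fst z)) \<in> borel_fun" by (intro borel_Pair)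
    then show ?thesis unfolding yl_def[abs_def] by simp
  qed
  have Em[measurable]: "(\<lambda>z. snd (E (yn n (x3 z)))) \<in> borel_fun" for n by measurable
  have Alim: "(\<lambda>n. LBINT z. An n z) \<longlonglongrightarrow> (LBINT z. future z * (u z * (\<theta> (fst z) * \<kappa> (yl z) * flux b D z + \<phi> z * (\<kappa> (yl z) * \<theta>' (fst z) + \<theta> (fst z) * 0))))"
  proof (rule integral_dominated_convergence[OF _ _ Wi])
    show "AE z in lborel. (\<lambda>n. An n z) \<longlonglongrightarrow> future z * (u z * (\<theta> (fst z) * \<kappa> (yl z) * flux b D z + \<phi> z * (\<kappa> (yl z) * \<theta>' (fst z) + \<theta> (fst z) * 0)))"
      using AE_lborel_fst_snd(2)[OF lim]
    proof eventually_elim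
      case (elim z)
      show ?case
      proof (cases "z \<in> K")
        case True
        then have "(\<lambda>n. \<kappa> (yn n (x3 z))) \<longlonglongrightarrow> \<kappa> (yl z)"
          "(\<lambda>n. snd (E (yn n (x3 z))) * (aj n (Hl (snd z), fst (snd z)) * fst (b (snd z)) - 1)) \<longlonglongrightarrow> 0"
          using elim[rule_format, of "fst z"] by auto
        then show ?thesis unfolding An_def by (intro tendsto_intros)
      qed (use D0 \<phi>(4) in \<open>simp add: An_def\<close>)
    qed
    show "(\<lambda>z. future z * (u z * (\<theta> (fst z) * \<kappa> (yl z) * flux b D z + \<phi> z * (\<kappa> (yl z) * \<theta>' (fst z) + \<theta> (fst z) * 0)))) \<in> borel_measurable lborel"
      by measurable
    show "An n \<in> borel_measurable lborel" for n unfolding An_def[abs_def] by measurable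
    show "AE z in lborel. norm (An n z) \<le> W z" for n using dom by simp
  qed
  have \<phi>0: "continuous_on UNIV (\<lambda>x. \<phi> (0, x))"
    by (rule continuous_on_compose2[OF cgrad_continuous[OF \<phi>(1), of UNIV]]) (auto intro!: continuous_intros)
  have K0: "compact (snd ` K)" using \<phi>(2) by (intro compact_continuous_image continuous_intros)
  have \<phi>0i: "L1 (\<lambda>x. \<phi> (0, x))"
    by (rule continuous_compact_support_integrable[OF \<phi>0 K0]) (use \<phi>(4) in force)
  have Blim: "(\<lambda>n. LBINT x. u0 x * (\<phi> (0, x) * (\<theta> 0 * \<kappa> (yn n (x3 (0, x)))))) \<longlonglongrightarrow> (LBINT x. u0 x * (\<phi> (0, x) * (\<theta> 0 * \<kappa> (yl (0, x)))))"
  proof (rule integral_dominated_convergence)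
    have c0[measurable]: "(\<lambda>x. (0::real, x)) \<in> borel_fun" by (auto intro!: borel_measurable_continuous_onI continuous_intros)
    have [measurable]: "(\<lambda>x. \<phi> (0, x)) \<in> borel_fun" using borel_measurable_continuous_onI[OF \<phi>0] .
    have [measurable]: "(\<lambda>x. yn n (x3 (0, x))) \<in> borel_fun" for n using measurable_compose[OF c0 ym[of n]] .
    show "(\<lambda>x. u0 x * (\<phi> (0, x) * (\<theta> 0 * \<kappa> (yl (0, x))))) \<in> borel_measurable lborel" by measurable
    show "(\<lambda>x. u0 x * (\<phi> (0, x) * (\<theta> 0 * \<kappa> (yn n (x3 (0, x)))))) \<in> borel_measurable lborel" for n by measurable
    show "L1 (\<lambda>x. C * \<bar>\<theta> 0\<bar> * Bk * \<bar>\<phi> (0, x)\<bar>)" using \<phi>0i by auto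
    show "AE x in lborel. norm (u0 x * (\<phi> (0, x) * (\<theta> 0 * \<kappa> (yn n (x3 (0, x)))))) \<le> C * \<bar>\<theta> 0\<bar> * Bk * \<bar>\<phi> (0, x)\<bar>" for n
    proof (rule AE_I2)
      fix x
      have "\<bar>u0 x\<bar> * \<bar>\<kappa> (yn n (x3 (0, x)))\<bar> \<le> C * Bk" by (intro mult_mono ub Bk) (use C in auto)
      from mult_right_mono[OF this, of "\<bar>\<theta> 0\<bar> * \<bar>\<phi> (0, x)\<bar>"]
      show "norm (u0 x * (\<phi> (0, x) * (\<theta> 0 * \<kappa> (yn n (x3 (0, x)))))) \<le> C * \<bar>\<theta> 0\<bar> * Bk * \<bar>\<phi> (0, x)\<bar>" by (simp add: abs_mult mult_ac)
    qed
    show "AE x in lborel. (\<lambda>n. u0 x * (\<phi> (0, x) * (\<theta> 0 * \<kappa> (yn n (x3 (0, x)))))) \<longlonglongrightarrow> u0 x * (\<phi> (0, x) * (\<theta> 0 * \<kappa> (yl (0, x))))"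
      using lim
    proof eventually_elim
      case (elim x)
      show ?case
      proof (cases "(0, x) \<in> K")
        case True
        then show ?thesis using elim[rule_format, OF True] by (intro tendsto_intros) auto
      qed (simp add: \<phi>(4))
    qed
  qed
  from LIMSEQ_unique[OF Alim[unfolded eqn] tendsto_minus[OF Blim]]
  have "(LBINT z. future z * (u z * (\<theta> (fst z) * \<kappa> (yl z) * flux b D z + \<phi> z * (\<kappa> (yl z) * \<theta>' (fst z) + \<theta> (fst z) * 0))))
     = - (LBINT x. \<theta> 0 * (\<kappa> (Hl x, S (Hl x, fst x)) * (u0 x * \<phi> (0, x))))"
    by (simp add: yl_def mult_ac)
  then show ?thesis unfolding yl_def by (simp add: algebra_simps)
qed

section \<open>Construction of the area-preserving flow coordinates\<close>

text \<open>The primitive vanishing at \<open>c\<close>; the case distinction supplies the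
  orientation that \<open>icc\<close> lacks.\<close>

definition prim :: "real \<Rightarrow> (real \<Rightarrow> real) \<Rightarrow> real \<Rightarrow> real" where
  "prim c f y = (if c \<le> y then icc c y f else - icc y c f)"

lemma icc_cong: "(\<And>s. a \<le> s \<Longrightarrow> s \<le> b \<Longrightarrow> f s = g s) \<Longrightarrow> icc a b f = icc a b g"
  unfolding icc_def by (intro Bochner_Integration.integral_cong) (auto simp: indicator_def)

lemma icc_split_local:
  assumes f: "\<And>a b. L1 (\<lambda>s. indicator {a..b} s * f s)" and "a \<le> b" "b \<le> c"
  shows "icc a c f = icc a b f + icc b c f"
proof -
  let ?g = "\<lambda>s. indicator {a..c} s * f s"
  have "icc a c ?g = icc a b ?g + icc b c ?g" by (rule icc_split[OF f assms(2,3)])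
  moreover have "icc a c ?g = icc a c f" "icc a b ?g = icc a b f" "icc b c ?g = icc b c f"
    using assms(2,3) by (auto intro!: icc_cong)
  ultimately show ?thesis by simp
qed

lemma prim_diff:
  assumes f: "\<And>a b. L1 (\<lambda>s. indicator {a..b} s * f s)" and "y \<le> y'"
  shows "prim c f y' - prim c f y = icc y y' f"
proof -
  consider "c \<le> y" | "y < c" "c \<le> y'" | "y' < c" using assms(2) by linarith
  then show ?thesis
  proof cases
    case 1 then show ?thesis using icc_split_local[OF f, of c y y'] assms(2) by (simp add: prim_def)
  next
    case 2 then show ?thesis using icc_split_local[OF f, of y c y'] by (simp add: prim_def)
  next
    case 3 then show ?thesis using icc_split_local[OF f, of y y' c] assms(2) by (simp add: prim_def)
  qed
qed

lemma icc_mono_const: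
  assumes f: "L1 (\<lambda>s. indicator {a..b} s * f s)" and "a \<le> b" "\<And>s. a \<le> s \<Longrightarrow> s \<le> b \<Longrightarrow> \<delta> \<le> f s"
  shows "\<delta> * (b - a) \<le> icc a b f"
proof -
  have "(LBINT s. \<delta> * indicator {a..b} s) \<le> icc a b f"
    unfolding icc_def
  proof (rule integral_mono[OF _ f])
    show "L1 (\<lambda>s. \<delta> * indicat_real {a..b} s)" by (intro integrable_mult_right integrable_indicator_Icc)
    show "\<delta> * indicator {a..b} s \<le> indicator {a..b} s * f s" for s using assms(3)[of s] by (simp add: indicator_def)
  qed
  then show ?thesis using assms(2) by simp
qed

text \<open>A lower bound \<open>\<delta>\<close> for the density outside a bounded interval makes
  the primitive grow at least linearly in both directions; continuity does the rest.\<close>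

lemma prim_surj:
  assumes f: "\<And>a b. L1 (\<lambda>s. indicator {a..b} s * f s)"
    and \<delta>: "\<delta> > 0" "\<And>s. \<bar>s\<bar> \<ge> R \<Longrightarrow> \<delta> \<le> f s" and R: "R \<ge> 0"
  shows "\<exists>y. prim c f y = h"
proof -
  define y2 where "y2 = R + \<bar>h - prim c f R\<bar> / \<delta>"
  define y1 where "y1 = - R - \<bar>h - prim c f (- R)\<bar> / \<delta>"
  have y: "R \<le> y2" "y1 \<le> - R" using \<delta>(1) by (auto simp: y1_def y2_def)
  have "\<delta> * (y2 - R) \<le> prim c f y2 - prim c f R"
    using icc_mono_const[OF f y(1), of \<delta>] \<delta>(2) R y(1) prim_diff[OF f y(1), of c] by auto
  then have 2: "h \<le> prim c f y2" using \<delta>(1) by (simp add: y2_def)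
  have "\<delta> * (- R - y1) \<le> prim c f (- R) - prim c f y1"
    using icc_mono_const[OF f y(2), of \<delta>] \<delta>(2) R y(2) prim_diff[OF f y(2), of c] by auto
  then have 1: "prim c f y1 \<le> h" using \<delta>(1) by (simp add: y1_def)
  have le: "y1 \<le> y2" using y R by linarith
  have "continuous_on {y1..y2} (\<lambda>t. prim c f y1 + icc y1 t (\<lambda>s. indicator {y1..y2} s * f s))"
    by (intro continuous_intros icc_continuous f)
  then have "continuous_on {y1..y2} (prim c f)"
  proof (rule continuous_on_eq)
    fix t assume t: "t \<in> {y1..y2}"
    have "icc y1 t (\<lambda>s. indicator {y1..y2} s * f s) = icc y1 t f" by (rule icc_cong) (use t in auto)
    then show "prim c f y1 + icc y1 t (\<lambda>s. indicator {y1..y2} s * f s) = prim c f t"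
      using prim_diff[OF f, of y1 t c] t by simp
  qed
  from IVT'[OF 1 2 le this] show ?thesis by blast
qed

lemma borel_measurable_icc_param:
  fixes g :: "real \<times> real \<Rightarrow> real" and a b :: "real \<times> real \<Rightarrow> real"
  assumes g: "g \<in> borel_fun" and a: "a \<in> borel_fun" and b: "b \<in> borel_fun"
  shows "(\<lambda>z. icc (a z) (b z) (\<lambda>s. g (fst z, s))) \<in> borel_fun"
proof -
  have "(\<lambda>w :: (real \<times> real) \<times> real. (fst (fst w), snd w)) \<in> borel_fun"
    by (auto intro!: borel_measurable_continuous_onI continuous_intros)
  from measurable_compose[OF this g]
  have [measurable]: "(\<lambda>w :: (real \<times> real) \<times> real. g (fst (fst w), snd w)) \<in> borel_fun" by simp
  have [measurable]: "(\<lambda>w :: (real \<times> real) \<times> real. a (fst w)) \<in> borel_fun" "(\<lambda>w :: (real \<times> real) \<times> real. b (fst w)) \<in> borel_fun"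
    using measurable_compose[OF borel_fst_snd(1) a] measurable_compose[OF borel_fst_snd(1) b] by auto
  have "(\<lambda>w :: (real \<times> real) \<times> real. if a (fst w) \<le> snd w \<and> snd w \<le> b (fst w) then g (fst (fst w), snd w) else 0) \<in> borel_fun"
    by measurable
  then have 1: "(\<lambda>(z, s). if a z \<le> s \<and> s \<le> b z then g (fst z, s) else 0) \<in> borel_measurable (borel \<Otimes>\<^sub>M lborel)"
  proof -
    have e: "sets (borel \<Otimes>\<^sub>M lborel) = sets (borel :: ((real \<times> real) \<times> real) measure)"
      by (metis borel_prod sets_lborel sets_pair_measure_cong)
    assume "(\<lambda>w :: (real \<times> real) \<times> real. if a (fst w) \<le> snd w \<and> snd w \<le> b (fst w) then g (fst (fst w), snd w) else 0) \<in> borel_fun"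
    then show ?thesis unfolding measurable_cong_sets[OF e refl] by (simp add: split_beta')
  qed
  have "(\<lambda>z. icc (a z) (b z) (\<lambda>s. g (fst z, s))) = (\<lambda>z. LBINT s. (if a z \<le> s \<and> s \<le> b z then g (fst z, s) else 0))"
    unfolding icc_def by (intro ext Bochner_Integration.integral_cong) (auto simp: indicator_def)
  also have "\<dots> \<in> borel_fun"
    using lborel.borel_measurable_lebesgue_integral[OF 1] by simp
  finally show ?thesis .
qed

lemma borel_measurable_prim_param:
  fixes g :: "real \<times> real \<Rightarrow> real"
  assumes g[measurable]: "g \<in> borel_fun"
  shows "(\<lambda>z. prim c (\<lambda>s. g (fst z, s)) (snd z)) \<in> borel_fun"
proof -
  have [measurable]: "(\<lambda>z. icc c (snd z) (\<lambda>s. g (fst z, s))) \<in> borel_fun" "(\<lambda>z. icc (snd z) c (\<lambda>s. g (fst z, s))) \<in> borel_fun"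
    by (rule borel_measurable_icc_param; simp)+
  show ?thesis unfolding prim_def by measurable
qed

lemma nn_integral_lborel_swap:
  fixes k :: "real \<times> real \<Rightarrow> ennreal"
  assumes k[measurable]: "k \<in> borel_fun"
  shows "(\<integral>\<^sup>+z. k (snd z, fst z) \<partial>lborel) = (\<integral>\<^sup>+z. k z \<partial>lborel)"
proof -
  have sw: "(\<lambda>z::real \<times> real. (snd z, fst z)) \<in> borel_fun"
    by (auto intro!: borel_measurable_continuous_onI continuous_intros)
  have "(\<integral>\<^sup>+z. k (snd z, fst z) \<partial>lborel) = (\<integral>\<^sup>+x. \<integral>\<^sup>+y. k (y, x) \<partial>lborel \<partial>lborel)"
    using nn_integral_prod_lborel[OF measurable_compose[OF sw k]] by simp
  also have "\<dots> = (\<integral>\<^sup>+x. \<integral>\<^sup>+y. k (x, y) \<partial>lborel \<partial>lborel)"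
    by (rule lborel_pair.Fubini) (simp add: lborel_prod)
  also have "\<dots> = (\<integral>\<^sup>+z. k z \<partial>lborel)" using nn_integral_prod_lborel[OF k] by simp
  finally show ?thesis .
qed

lemma nn_integral_icc:
  assumes f: "L1 (\<lambda>s. indicator {a..b} s * f s)" and "\<And>s. f s \<ge> 0"
  shows "(\<integral>\<^sup>+s. ennreal (f s) * indicator {a..b} s \<partial>lborel) = ennreal (icc a b f)"
proof -
  have "(\<integral>\<^sup>+s. ennreal (f s) * indicator {a..b} s \<partial>lborel) = (\<integral>\<^sup>+s. ennreal (indicator {a..b} s * f s) \<partial>lborel)"
    by (intro nn_integral_cong) (auto simp: indicator_def)
  also have "\<dots> = ennreal (icc a b f)"
    unfolding icc_def by (rule nn_integral_eq_integral[OF f]) (use assms(2) in auto)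
  finally show ?thesis .
qed

text \<open>
  \<open>(p, q) \<mapsto> (p, F)\<close> has Jacobian \<open>g\<close>, and \<open>(h, p) \<mapsto> (h, S)\<close> has Jacobian \<open>a = 1/g\<close> by construction, so their
  composition preserves area. Nothing is required of \<open>F\<close> in the variable \<open>p\<close> except measurability.
\<close>

lemma flow_coordinates:
  fixes g :: "real \<times> real \<Rightarrow> real" and A0 :: "real \<Rightarrow> real" and c \<alpha> m :: real
  defines "F \<equiv> (\<lambda>z. prim c (\<lambda>s. g (fst z, s)) (snd z) - A0 (fst z))"
  assumes gm[measurable]: "g \<in> borel_fun" and \<alpha>: "\<alpha> > 0" and g\<alpha>: "\<And>z. \<alpha> \<le> g z"
    and gi: "\<And>p a b. L1 (\<lambda>s. indicator {a..b} s * g (p, s))"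
    and gout: "\<And>p q. \<bar>p\<bar> \<ge> m \<Longrightarrow> g (p, q) = \<alpha>" and m: "m \<ge> 0"
    and A0[measurable]: "A0 \<in> borel_fun"
  obtains a S \<Xi> where "a \<in> borel_fun" "\<And>y. \<bar>a y\<bar> \<le> 1 / \<alpha>" "S \<in> borel_fun" "F \<in> borel_fun"
    "\<And>h p p'. p \<le> p' \<Longrightarrow> S (h, p') - S (h, p) = icc p p' (\<lambda>s. a (h, s))"
    "\<And>h p. \<bar>S (h, p)\<bar> \<le> 1 / \<alpha> * (\<bar>p\<bar> + 0)"
    "\<And>P. AE y in lborel. P y \<Longrightarrow> AE x in lborel. P (F x, fst x)"
    "\<And>x. a (F x, fst x) * g x = 1"
    "(\<lambda>x. (F x, S (F x, fst x))) \<in> borel_fun" "\<Xi> \<in> borel_fun"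
    "\<And>y. (F (\<Xi> y), S (F (\<Xi> y), fst (\<Xi> y))) = y" "\<And>x. \<Xi> (F x, S (F x, fst x)) = (x :: real \<times> real)"
    "distr lborel borel (\<lambda>x. (F x, S (F x, fst x))) = lborel"
proof -
  have gpos: "g z > 0" for z using g\<alpha>[of z] \<alpha> by linarith
  have pm[measurable]: "(\<lambda>z. prim c (\<lambda>s. g (fst z, s)) (snd z)) \<in> borel_fun"
    by (rule borel_measurable_prim_param[OF gm])
  have Fm[measurable]: "F \<in> borel_fun" unfolding F_def by measurable
  have Finc: "F (x, y') - F (x, y) = icc y y' (\<lambda>s. g (x, s))" if "y \<le> y'" for x y y'
    unfolding F_def using prim_diff[OF gi that] by simp
  have Fmono: "F (x, y) \<le> F (x, y')" if "y \<le> y'" for x y y'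
    using Finc[OF that, of x] icc_mono_const[OF gi that, of 0 x] gpos[THEN less_imp_le] by simp
  have Fsurj: "\<exists>y. F (x, y) = h" for x h
    using prim_surj[of "\<lambda>s. g (x, s)" \<alpha> 0 c "h + A0 x", OF gi \<alpha> g\<alpha>] by (auto simp: F_def algebra_simps)
  have Fnn: "(\<integral>\<^sup>+s. ennreal (g (x, s)) * indicator {y..y'} s \<partial>lborel) = ennreal (F (x, y') - F (x, y))" if "y \<le> y'" for x y y'
    unfolding Finc[OF that] by (rule nn_integral_icc[OF gi]) (rule less_imp_le[OF gpos])
  obtain G0 where G0: "G0 \<in> borel_fun" "\<And>x h. F (x, G0 (x, h)) = h" "\<And>x y. G0 (x, F (x, y)) = y"
    "\<And>k :: real \<times> real \<Rightarrow> ennreal. k \<in> borel_fun \<Longrightarrow> (\<integral>\<^sup>+z. k (fst z, F z) * ennreal (g z) \<partial>lborel) = (\<integral>\<^sup>+z. k z \<partial>lborel)"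
    using fiber_map[OF gm Fm gpos Fmono Fnn Fsurj] by blast
  note G0m[measurable] = G0(1)
  have sw[measurable]: "(\<lambda>z::real \<times> real. (snd z, fst z)) \<in> borel_fun"
    by (auto intro!: borel_measurable_continuous_onI continuous_intros)
  \<comment> \<open>For \<open>y = (h, p)\<close>: the reciprocal speed at the point with abscissa
    \<open>p\<close> on the level line of \<open>F\<close> at height \<open>h\<close>.\<close>
  define a where "a y = 1 / g (snd y, G0 (snd y, fst y))" for y
  have am[measurable]: "a \<in> borel_fun"
  proof -
    have "(\<lambda>y::real \<times> real. G0 (snd y, fst y)) \<in> borel_fun" by (rule measurable_compose[OF sw G0m])
    then have "(\<lambda>y::real \<times> real. (snd y, G0 (snd y, fst y))) \<in> borel_fun" by (intro borel_Pair) auto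
    note [measurable] = measurable_compose[OF this gm]
    show ?thesis unfolding a_def[abs_def] by measurable
  qed
  have apos: "a y > 0" for y using gpos by (simp add: a_def)
  have ale: "a y \<le> 1 / \<alpha>" for y unfolding a_def using g\<alpha> \<alpha> by (intro divide_left_mono mult_pos_pos gpos) auto
  have aout: "a (h, p) = 1 / \<alpha>" if "\<bar>p\<bar> \<ge> m" for h p using gout[OF that] by (simp add: a_def)
  have ai: "L1 (\<lambda>s. indicator {u..v} s * a (h, s))" for h u v
  proof (rule integrable_dominated[of "\<lambda>s. 1 / \<alpha> * indicator {u..v} s"])
    have "(\<lambda>s::real. (h, s)) \<in> borel_fun" by (auto intro!: borel_measurable_continuous_onI continuous_intros)
    note [measurable] = measurable_compose[OF this am]
    show "(\<lambda>s. indicator {u..v} s * a (h, s)) \<in> borel_fun" by measurable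
    show "\<bar>indicator {u..v} s * a (h, s)\<bar> \<le> 1 / \<alpha> * indicator {u..v} s" for s
      using ale[of "(h, s)"] apos[of "(h, s)"] by (auto simp: indicator_def)
  qed (intro integrable_mult_right integrable_indicator_Icc)
  \<comment> \<open>Travel time along the level line, counted from abscissa 0.\<close>
  define S where "S z = prim 0 (\<lambda>s. a (fst z, s)) (snd z)" for z
  have Sm[measurable]: "S \<in> borel_fun" unfolding S_def[abs_def] by (rule borel_measurable_prim_param[OF am])
  have Sinc: "S (h, p') - S (h, p) = icc p p' (\<lambda>s. a (h, s))" if "p \<le> p'" for h p p'
    unfolding S_def using prim_diff[OF ai that] by simp
  have Smono: "S (x, y) \<le> S (x, y')" if "y \<le> y'" for x y y'
    using Sinc[OF that, of x] icc_mono_const[OF ai that, of 0 x] apos[THEN less_imp_le] by simp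
  have Ssurj: "\<exists>y. S (x, y) = h" for x h
    using prim_surj[of "\<lambda>s. a (x, s)" "1 / \<alpha>" m 0 h, OF ai _ _ m] \<alpha> aout by (auto simp: S_def)
  have Snn: "(\<integral>\<^sup>+s. ennreal (a (x, s)) * indicator {y..y'} s \<partial>lborel) = ennreal (S (x, y') - S (x, y))" if "y \<le> y'" for x y y'
    unfolding Sinc[OF that] by (rule nn_integral_icc[OF ai]) (rule less_imp_le[OF apos])
  obtain G1 where G1: "G1 \<in> borel_fun" "\<And>x h. S (x, G1 (x, h)) = h" "\<And>x y. G1 (x, S (x, y)) = y"
    "\<And>k :: real \<times> real \<Rightarrow> ennreal. k \<in> borel_fun \<Longrightarrow> (\<integral>\<^sup>+z. k (fst z, S z) * ennreal (a z) \<partial>lborel) = (\<integral>\<^sup>+z. k z \<partial>lborel)"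
    using fiber_map[OF am Sm apos Smono Snn Ssurj] by blast
  note G1m[measurable] = G1(1)
  have Sb: "\<bar>S (h, p)\<bar> \<le> 1 / \<alpha> * (\<bar>p\<bar> + 0)" for h p
  proof -
    have b: "\<bar>icc u v (\<lambda>s. a (h, s))\<bar> \<le> 1 / \<alpha> * (v - u)" if "u \<le> v" for u v
    proof -
      have "\<bar>icc u v (\<lambda>s. a (h, s))\<bar> \<le> (LBINT s. 1 / \<alpha> * indicator {u..v} s)"
        unfolding icc_def real_norm_def[symmetric]
      proof (rule Bochner_Integration.integral_norm_bound_integral[OF ai])
        show "L1 (\<lambda>s. 1 / \<alpha> * indicator {u..v} s :: real)" by (intro integrable_mult_right integrable_indicator_Icc)
        show "norm (indicator {u..v} s * a (h, s)) \<le> 1 / \<alpha> * indicator {u..v} s" for s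
          using ale[of "(h, s)"] apos[of "(h, s)"] by (auto simp: indicator_def)
      qed
      then show ?thesis using that by simp
    qed
    show ?thesis using b[of 0 p] b[of p 0] by (auto simp: S_def prim_def)
  qed
  have aF: "a (F x, fst x) * g x = 1" for x
    using gpos[of x] G0(3)[of "fst x" "snd x"] by (simp add: a_def)
  \<comment> \<open>The area formula for \<open>F\<close> shows that the preimage of a null set has
    zero \<open>g\<close>-mass, hence is null because \<open>g\<close> is positive; the swap of
    coordinates preserves area.\<close>
  have null: "AE x in lborel. P (F x, fst x)" if "AE y in lborel. P y" for P
  proof -
    obtain N where N: "{y. \<not> P y} \<subseteq> N" "emeasure lborel N = 0" "N \<in> sets borel"
      using \<open>AE y in lborel. P y\<close> by (auto elim!: AE_E)
    note [measurable] = N(3)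
    have k: "(\<lambda>z::real \<times> real. indicator N (snd z, fst z) :: ennreal) \<in> borel_fun"
      by (rule measurable_compose[OF sw]) simp
    have "(\<integral>\<^sup>+z. indicator N (F z, fst z) * ennreal (g z) \<partial>lborel) = (\<integral>\<^sup>+z. indicator N (snd z, fst z) \<partial>lborel)"
      using G0(4)[OF k] by simp
    also have "\<dots> = (\<integral>\<^sup>+z. indicator N z \<partial>lborel)" by (rule nn_integral_lborel_swap) simp
    also have "\<dots> = 0" using N by simp
    finally have "(\<integral>\<^sup>+z. indicator N (F z, fst z) * ennreal (g z) \<partial>lborel) = 0" .
    moreover have "(\<lambda>z. indicator N (F z, fst z) * ennreal (g z)) \<in> borel_measurable lborel"
    proof -
      have "(\<lambda>z. (F z, fst z)) \<in> borel_fun" by (intro borel_Pair) auto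
      from measurable_compose[OF this, of "indicator N :: _ \<Rightarrow> ennreal" borel] show ?thesis by simp
    qed
    ultimately have "AE z in lborel. indicator N (F z, fst z) * ennreal (g z) = 0"
      by (simp add: nn_integral_0_iff_AE)
    then show ?thesis
    proof eventually_elim
      case (elim z)
      then have "(F z, fst z) \<notin> N" using gpos[of z] by (auto simp: indicator_def ennreal_eq_0_iff split: if_splits)
      then show ?case using N(1) by blast
    qed
  qed
  define \<Psi> where "\<Psi> x = (F x, S (F x, fst x))" for x
  have Ff: "(\<lambda>x. (F x, fst x)) \<in> borel_fun" by (intro borel_Pair) auto
  have Pm: "\<Psi> \<in> borel_fun" unfolding \<Psi>_def[abs_def]
    by (intro borel_Pair measurable_compose[OF Ff Sm]) auto
  define \<Xi> where "\<Xi> y = (G1 y, G0 (G1 y, fst y))" for y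
  have G1f: "(\<lambda>y. (G1 y, fst y)) \<in> borel_fun" by (intro borel_Pair) auto
  have Xm: "\<Xi> \<in> borel_fun" unfolding \<Xi>_def[abs_def]
    by (intro borel_Pair measurable_compose[OF G1f G0m]) auto
  have PX: "\<Psi> (\<Xi> y) = y" for y using G1(2)[of "fst y" "snd y"] by (simp add: \<Psi>_def \<Xi>_def G0(2))
  have XP: "\<Xi> (\<Psi> x) = x" for x using G1(3) G0(3)[of "fst x" "snd x"] by (simp add: \<Psi>_def \<Xi>_def)
  \<comment> \<open>Insert \<open>a (F x, fst x) * g x = 1\<close> and apply the area formula first
    to \<open>F\<close> with density \<open>g\<close>, then to \<open>S\<close> with density
    \<open>a\<close>.\<close>
  have Pd: "distr lborel borel \<Psi> = lborel"
  proof (rule distr_lborel_eqI[OF Pm])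
    fix k :: "real \<times> real \<Rightarrow> ennreal" assume km[measurable]: "k \<in> borel_fun"
    define k1 where "k1 w = k (fst w, S w) * ennreal (a w)" for w
    have fS: "(\<lambda>w. (fst w, S w)) \<in> borel_fun" by (intro borel_Pair) auto
    have k1m: "k1 \<in> borel_fun" unfolding k1_def[abs_def]
      using measurable_compose[OF fS km] by measurable
    have k1s: "(\<lambda>z. k1 (snd z, fst z)) \<in> borel_fun" by (rule measurable_compose[OF sw k1m])
    have "(\<integral>\<^sup>+x. k (\<Psi> x) \<partial>lborel) = (\<integral>\<^sup>+z. k1 (F z, fst z) * ennreal (g z) \<partial>lborel)"
    proof (rule nn_integral_cong)
      fix x
      have "ennreal (a (F x, fst x)) * ennreal (g x) = 1"
        using aF[of x] apos[of "(F x, fst x)"] gpos[of x] by (simp add: ennreal_mult[symmetric])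
      then show "k (\<Psi> x) = k1 (F x, fst x) * ennreal (g x)" by (simp add: k1_def \<Psi>_def mult.assoc)
    qed
    also have "\<dots> = (\<integral>\<^sup>+z. k1 (snd z, fst z) \<partial>lborel)" using G0(4)[OF k1s] by simp
    also have "\<dots> = (\<integral>\<^sup>+z. k1 z \<partial>lborel)" by (rule nn_integral_lborel_swap[OF k1m])
    also have "\<dots> = (\<integral>\<^sup>+z. k z \<partial>lborel)" unfolding k1_def by (rule G1(4)[OF km])
    finally show "(\<integral>\<^sup>+x. k (\<Psi> x) \<partial>lborel) = (\<integral>\<^sup>+x. k x \<partial>lborel)" .
  qed
  have ab: "\<bar>a y\<bar> \<le> 1 / \<alpha>" for y using ale[of y] apos[of y] by simp
  show ?thesis
    by (rule that[OF am ab Sm Fm Sinc Sb null aF Pm[unfolded \<Psi>_def[abs_def]] Xm PX[unfolded \<Psi>_def] XP[unfolded \<Psi>_def] Pd[unfolded \<Psi>_def[abs_def]]])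
qed

section \<open>Renormalization in a square\<close>

text \<open>Equal to 1 for \<open>\<bar>x\<bar> \<le> \<rho>\<close> and to 0 for
  \<open>\<bar>x\<bar> \<ge> \<rho> + e\<close>. For \<open>\<rho> = 0\<close> and
  \<open>e = 1\<close> its integer translates add up to 1.\<close>

definition cutoff :: "real \<Rightarrow> real \<Rightarrow> real \<Rightarrow> real" where
  "cutoff \<rho> e x = sstep ((x + \<rho> + e) / e) * sstep ((\<rho> + e - x) / e)"

lemma cutoff_inside: "e > 0 \<Longrightarrow> \<bar>x\<bar> \<le> \<rho> \<Longrightarrow> cutoff \<rho> e x = 1"
  by (simp add: cutoff_def sstep_1 abs_le_iff field_simps)

lemma cutoff_outside: "e > 0 \<Longrightarrow> \<bar>x\<bar> \<ge> \<rho> + e \<Longrightarrow> cutoff \<rho> e x = 0"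
proof -
  assume e: "e > 0" and x: "\<bar>x\<bar> \<ge> \<rho> + e"
  then have "(x + \<rho> + e) / e \<le> 0 \<or> (\<rho> + e - x) / e \<le> 0" by (auto simp: divide_le_0_iff)
  then show ?thesis by (auto simp: cutoff_def sstep_0)
qed

lemma cutoff_bounds: "0 \<le> cutoff \<rho> e x" "cutoff \<rho> e x \<le> 1"
  using sstep_bounds by (auto simp: cutoff_def intro: mult_le_one)

lemma C1_cutoff: "\<exists>c'. C1 (cutoff \<rho> e) c'"
proof -
  obtain s' where s: "C1 sstep s'" using C1_sstep by blast
  have "C1 (\<lambda>x. sstep (1 / e * x + (\<rho> + e) / e) * sstep (- 1 / e * x + (\<rho> + e) / e))
     (\<lambda>x. (s' (1 / e * x + (\<rho> + e) / e) * (1 / e)) * sstep (- 1 / e * x + (\<rho> + e) / e) + sstep (1 / e * x + (\<rho> + e) / e) * (s' (- 1 / e * x + (\<rho> + e) / e) * (- 1 / e)))"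
    by (rule C1_mult[OF C1_affine[OF s] C1_affine[OF s]])
  moreover have "(\<lambda>x. sstep (1 / e * x + (\<rho> + e) / e) * sstep (- 1 / e * x + (\<rho> + e) / e)) = cutoff \<rho> e"
    by (auto simp: cutoff_def fun_eq_iff add_divide_distrib diff_divide_distrib algebra_simps)
  ultimately show ?thesis by metis
qed

lemma integrable_flux_test:
  fixes b :: "'a::euclidean_space \<Rightarrow> 'a" and D :: "real \<times> 'a \<Rightarrow> real \<times> 'a"
  assumes bm[measurable]: "b \<in> borel_fun" and Q[measurable]: "Q \<in> sets borel"
    and bi: "L1 (\<lambda>x. indicator Q x * (1 + norm (b x)))"
    and D: "continuous_on UNIV D" and K: "compact K" "K \<subseteq> UNIV \<times> Q" and D0: "\<And>z. z \<notin> K \<Longrightarrow> D z = 0"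
    and u: "u \<in> borel_fun" "\<And>z. \<bar>u z\<bar> \<le> C"
  shows "L1 (\<lambda>z. u z * flux b D z)"
proof -
  note [measurable] = u(1)
  have C: "C \<ge> 0" using u(2)[of undefined] by linarith
  have [measurable]: "D \<in> borel_fun" by (rule borel_measurable_continuous_onI[OF D])
  obtain T where T: "T > 0" "\<And>z. z \<in> K \<Longrightarrow> \<bar>fst z\<bar> \<le> T" using compact_subset_time_strip[OF K(1)] by blast
  obtain B where B: "B \<ge> 0" "\<And>z. z \<in> K \<Longrightarrow> norm (D z) \<le> B"
    using bounded_on_compact[OF K(1) continuous_on_subset[OF D]] by auto
  have [measurable]: "(\<lambda>z::real \<times> 'a. (1::real, b (snd z))) \<in> borel_fun" by (intro borel_Pair) measurable
  show ?thesis
  proof (rule integrable_dominated)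
    show "L1 (\<lambda>z. C * B * (indicator {-T..T} (fst z) * (indicator Q (snd z) * (1 + norm (b (snd z))))))"
      by (intro integrable_mult_right integrable_prod_mult[of "indicator {-T..T}" "\<lambda>x. indicator Q x * (1 + norm (b x))"] integrable_indicator_Icc bi)
    show "\<bar>u z * flux b D z\<bar> \<le> C * B * (indicator {-T..T} (fst z) * (indicator Q (snd z) * (1 + norm (b (snd z)))))" for z
    proof (cases "z \<in> K")
      case True
      have "\<bar>flux b D z\<bar> \<le> B * (1 + norm (b (snd z)))"
        by (rule order_trans[OF Cauchy_Schwarz_ineq2]) (intro mult_mono B True order_trans[OF norm_Pair_le], auto)
      then have "\<bar>u z * flux b D z\<bar> \<le> C * (B * (1 + norm (b (snd z))))"
        unfolding abs_mult by (intro mult_mono u C) auto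
      then show ?thesis using True T(2)[OF True] K(2) by (auto simp: indicator_def abs_le_iff mult.assoc)
    next
      case False
      have "0 \<le> C * B * (indicator {-T..T} (fst z) * (indicator Q (snd z) * (1 + norm (b (snd z)))))"
        using C B by (intro mult_nonneg_nonneg) auto
      then show ?thesis using D0[OF False] by simp
    qed
  qed measurable
qed

lemma integrable_slice_test:
  fixes u0 :: "'a::euclidean_space \<Rightarrow> real" and \<phi> :: "real \<times> 'a \<Rightarrow> real"
  assumes \<phi>: "cgrad \<phi> D" "compact K" "\<And>z. z \<notin> K \<Longrightarrow> \<phi> z = 0" and u0m[measurable]: "u0 \<in> borel_fun" and ub: "\<And>x. \<bar>u0 x\<bar> \<le> C"
  shows "L1 (\<lambda>x. u0 x * \<phi> (0, x))"
proof -
  have c: "continuous_on UNIV (\<lambda>x. \<phi> (0, x))"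
    by (rule continuous_on_compose2[OF cgrad_continuous[OF \<phi>(1), of UNIV]]) (auto intro!: continuous_intros)
  have K0: "compact (snd ` K)" using \<phi>(2) by (intro compact_continuous_image continuous_intros)
  have i: "L1 (\<lambda>x. \<phi> (0, x))"
    by (rule continuous_compact_support_integrable[OF c K0]) (use \<phi>(3) in force)
  show ?thesis
    by (rule integrable_dominated[of "\<lambda>x. C * \<bar>\<phi> (0, x)\<bar>"])
       (use i borel_measurable_continuous_onI[OF c] in \<open>auto simp: abs_mult intro!: mult_right_mono ub\<close>)
qed

lemma integrable_time_flux_test:
  fixes b :: "'a::euclidean_space \<Rightarrow> 'a" and D :: "real \<times> 'a \<Rightarrow> real \<times> 'a"
  assumes bm[measurable]: "b \<in> borel_fun"
    and bi: "\<And>K. compact K \<Longrightarrow> K \<subseteq> \<omega> \<Longrightarrow> L1 (\<lambda>x. indicator K x * (1 + norm (b x)))"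
    and \<phi>: "cgrad \<phi> D" "compact K" "K \<subseteq> UNIV \<times> \<omega>" "\<And>z. z \<notin> K \<Longrightarrow> \<phi> z = 0"
    and um[measurable]: "u \<in> borel_fun" and ub: "\<And>z. \<bar>u z\<bar> \<le> C"
  shows "L1 (\<lambda>z. future z * (u z * flux b D z))"
proof -
  have K0: "compact (snd ` K)" using \<phi>(2) by (intro compact_continuous_image continuous_intros)
  have K0m: "snd ` K \<in> sets borel" using K0 by (simp add: borel_compact)
  have K0\<omega>: "snd ` K \<subseteq> \<omega>" using \<phi>(3) by auto
  have KK0: "K \<subseteq> UNIV \<times> snd ` K" by force
  have D0: "D z = 0" if "z \<notin> K" for z by (rule cgrad_zero_outside[OF \<phi>(1) compact_imp_closed[OF \<phi>(2)] \<phi>(4) that])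
  have [measurable]: "(fst :: real \<times> 'a \<Rightarrow> real) \<in> borel_fun" by (rule borel_fst_snd)
  have vm: "(\<lambda>z. future z * u z) \<in> borel_fun" by measurable
  have "C \<ge> 0" using ub[of 0] by linarith
  then have vb: "\<bar>future z * u z\<bar> \<le> C" for z using ub[of z] by (auto simp: indicator_def)
  show ?thesis
    using integrable_flux_test[OF bm K0m bi[OF K0 K0\<omega>] cgrad_continuous_grad[OF \<phi>(1)] \<phi>(2) KK0 D0 vm vb]
    by (simp add: mult.assoc)
qed

lemma compact_in_open_square:
  fixes K :: "(real \<times> real) set"
  assumes "compact K" "K \<subseteq> {-R<..<R} \<times> {-R<..<R}" "R > 0"
  obtains r where "0 < r" "r < R" "\<And>x. x \<in> K \<Longrightarrow> \<bar>fst x\<bar> \<le> r \<and> \<bar>snd x\<bar> \<le> r"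
proof (cases "K = {}")
  case True then show ?thesis using that[of "R/2"] assms(3) by auto
next
  case False
  have "continuous_on K (\<lambda>x. max \<bar>fst x\<bar> \<bar>snd x\<bar>)" by (intro continuous_intros)
  from continuous_attains_sup[OF assms(1) False this] obtain x0 where x0: "x0 \<in> K" "\<And>x. x \<in> K \<Longrightarrow> max \<bar>fst x\<bar> \<bar>snd x\<bar> \<le> max \<bar>fst x0\<bar> \<bar>snd x0\<bar>" by blast
  have "x0 \<in> {-R<..<R} \<times> {-R<..<R}" using x0(1) assms(2) by blast
  then have "max \<bar>fst x0\<bar> \<bar>snd x0\<bar> < R" by (auto simp: mem_Times_iff abs_less_iff)
  then show ?thesis
  proof (intro that[of "max (R/2) (max \<bar>fst x0\<bar> \<bar>snd x0\<bar>)"])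
    fix x assume "x \<in> K"
    from x0(2)[OF this] show "\<bar>fst x\<bar> \<le> max (R/2) (max \<bar>fst x0\<bar> \<bar>snd x0\<bar>) \<and> \<bar>snd x\<bar> \<le> max (R/2) (max \<bar>fst x0\<bar> \<bar>snd x0\<bar>)"
      by linarith
  qed (use assms(3) in auto)
qed

text \<open>The local form of the result, in coordinates where the first component of
  \<open>b\<close> is bounded below. The given test function \<open>\<phi>\<close> is compactly
  supported in the square, which leaves room for a base line below its support and for a cutoff
  around it. The stream function provides flow coordinates near the support, and the solutions
  \<open>u\<close> and 1, localised by \<open>\<phi>c\<close> and \<open>\<phi>\<close>, are fed
  into \<open>renormalization_by_flow_coordinates\<close>.\<close>

theorem local_renormalization:
  fixes b :: "real \<times> real \<Rightarrow> real \<times> real" and R \<alpha> C L :: real and u0 :: "real \<times> real \<Rightarrow> real" and u :: "real \<times> real \<times> real \<Rightarrow> real"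
  defines "Q \<equiv> {-R<..<R} \<times> {-R<..<R}"
  assumes R: "R > 0" and \<alpha>: "\<alpha> > 0" and bm[measurable]: "b \<in> borel_fun"
    and b2: "L1 (\<lambda>x. indicator Q x * (norm (b x))\<^sup>2)" and b1: "\<And>x. x \<in> Q \<Longrightarrow> \<alpha> \<le> fst (b x)"
    and one: "weak_sol Q b (\<lambda>_. 1) (\<lambda>_. 1)" and w: "weak_sol Q b u0 u"
    and um[measurable]: "u \<in> borel_fun" and u0m[measurable]: "u0 \<in> borel_fun"
    and ub: "\<And>z. \<bar>u z\<bar> \<le> C" "\<And>x. \<bar>u0 x\<bar> \<le> C"
    and Lip: "\<And>x y. \<bar>\<beta> x - \<beta> y\<bar> \<le> L * \<bar>x - y\<bar>"
  shows "weak_sol Q b (\<lambda>x. \<beta> (u0 x)) (\<lambda>z. \<beta> (u z))"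
  unfolding weak_sol_def
proof (intro allI impI)
  fix \<phi> :: "real \<times> real \<times> real \<Rightarrow> real" and D K
  assume \<phi>: "cgrad \<phi> D" "compact K" "K \<subseteq> UNIV \<times> Q" and "\<forall>z. z \<notin> K \<longrightarrow> \<phi> z = 0"
  then have \<phi>0: "\<And>z. z \<notin> K \<Longrightarrow> \<phi> z = 0" by blast
  have C: "C \<ge> 0" using ub(2)[of 0] by linarith
  have Qo: "open Q" unfolding Q_def by (intro open_Times) auto
  have Qm[measurable]: "Q \<in> sets borel" using Qo by simp
  have Qb: "bounded Q"
    unfolding Q_def by (intro bounded_Times bounded_subset[OF bounded_closed_interval[of "-R" R]]) (auto simp: box_real)
  have biQ: "L1 (\<lambda>x. indicator Q x * (1 + norm (b x)))"
  proof -
    have "emeasure lborel Q < \<infinity>" using Qb emeasure_bounded_finite by blast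
    then have "L1 (indicat_real Q)" by (intro integrable_real_indicator) auto
    then have i: "L1 (\<lambda>x. 2 * indicat_real Q x + indicator Q x * (norm (b x))\<^sup>2)" using b2 by auto
    have sq: "1 + y \<le> 2 + y\<^sup>2" for y :: real
    proof -
      have "0 \<le> (y - 1/2)\<^sup>2" by simp
      then show ?thesis by (simp add: power2_eq_square algebra_simps)
    qed
    show ?thesis
      by (rule integrable_dominated[OF i]) (use sq in \<open>auto simp: indicator_def\<close>)
  qed
  have bK: "L1 (\<lambda>x. indicator K' x *\<^sub>R b x)" if "K' \<subseteq> Q" "compact K'" for K'
  proof (rule Bochner_Integration.integrable_bound[OF biQ])
    have [measurable]: "K' \<in> sets borel" using that by (simp add: borel_compact)
    show "(\<lambda>x. indicator K' x *\<^sub>R b x) \<in> borel_measurable lborel" by measurable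
    show "AE x in lborel. norm (indicator K' x *\<^sub>R b x) \<le> norm (indicator Q x * (1 + norm (b x)))"
      using that(1) by (intro AE_I2) (auto simp: indicator_def)
  qed
  have K0: "compact (snd ` K)" using \<phi>(2) by (intro compact_continuous_image continuous_intros)
  have "snd ` K \<subseteq> {-R<..<R} \<times> {-R<..<R}" using \<phi>(3) by (auto simp: Q_def)
  from compact_in_open_square[OF K0 this R] obtain r where r: "0 < r" "r < R" "\<And>x. x \<in> snd ` K \<Longrightarrow> \<bar>fst x\<bar> \<le> r \<and> \<bar>snd x\<bar> \<le> r" by blast
  have div: "(LBINT x. E x \<bullet> b x) = 0"
    if "cgrad \<psi> E" "compact K'" "K' \<subseteq> Q" "\<And>x. x \<notin> K' \<Longrightarrow> \<psi> x = 0" for \<psi> E K'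
    by (rule weak_sol_one_imp_div_free[OF one bm bK that]) (use that in auto)
  obtain c m B1 B2 H where st: "r < m" "m < R" "- m < c" "c < - r"
    "\<And>n. continuous_on UNIV (B1 n)" "\<And>n. continuous_on UNIV (B2 n)"
    "\<And>n. L1 (\<lambda>x. (B1 n x - indicator Q x * fst (b x))\<^sup>2)" "\<And>n. L1 (\<lambda>x. (B2 n x - indicator Q x * snd (b x))\<^sup>2)"
    "(\<lambda>n. LBINT x. (B1 n x - indicator Q x * fst (b x))\<^sup>2) \<longlonglongrightarrow> 0" "(\<lambda>n. LBINT x. (B2 n x - indicator Q x * snd (b x))\<^sup>2) \<longlonglongrightarrow> 0"
    "\<And>n x. x \<in> {-m<..<m} \<times> {c<..<m} \<Longrightarrow> (H n has_derivative (\<lambda>v. (- B2 n x, B1 n x) \<bullet> v)) (at x)"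
    "AE x in lborel. x \<in> {-m<..<m} \<times> {c<..<m} \<longrightarrow>
       (\<lambda>n. H n x) \<longlonglongrightarrow> icc c (snd x) (\<lambda>s. indicator Q (fst x, s) * fst (b (fst x, s))) - icc (- m) (fst x) (\<lambda>s. indicator Q (s, c) * snd (b (s, c)))"
    unfolding Q_def by (rule stream_function[OF bm b2[unfolded Q_def] _ r(1,2)]) ((rule div[unfolded Q_def]; assumption), (rule that[unfolded Q_def]; assumption))
  define f1 where "f1 x = indicator Q x * fst (b x)" for x
  define f2 where "f2 x = indicator Q x * snd (b x)" for x
  have [measurable]: "(\<lambda>x. fst (b x)) \<in> borel_fun" "(\<lambda>x. snd (b x)) \<in> borel_fun"
    using measurable_compose[OF bm borel_fst_snd(1)] measurable_compose[OF bm borel_fst_snd(2)] by auto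
  have f1m[measurable]: "f1 \<in> borel_fun" and f2m[measurable]: "f2 \<in> borel_fun"
    unfolding f1_def[abs_def] f2_def[abs_def] by measurable
  have f1i: "L1 f1"
    by (rule integrable_dominated[OF biQ f1m]) (auto simp: f1_def indicator_def intro: order_trans[OF abs_fst_snd_le_norm(1)])
  define Q' where "Q' = {-m<..<m} \<times> {c<..<m}"
  have Q'o: "open Q'" unfolding Q'_def by (intro open_Times) auto
  have Q'm[measurable]: "Q' \<in> sets borel" using Q'o by simp
  have Q'Q: "Q' \<subseteq> Q" using st(1-4) by (auto simp: Q'_def Q_def)
  have KQ': "K \<subseteq> UNIV \<times> Q'"
  proof
    fix z assume "z \<in> K"
    then have "\<bar>fst (snd z)\<bar> \<le> r \<and> \<bar>snd (snd z)\<bar> \<le> r" using r(3) by auto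
    then show "z \<in> UNIV \<times> Q'" using st(1-4) by (auto simp: Q'_def mem_Times_iff)
  qed
  \<comment> \<open>The vertical lines on which \<open>b1\<close> is integrable. Finiteness of the
    integral is expressed by \<open>nn_integral\<close>, which makes the set measurable.\<close>
  define good where "good p \<longleftrightarrow> (\<integral>\<^sup>+s. ennreal \<bar>f1 (p, s)\<bar> \<partial>lborel) < \<infinity>" for p
  have goodm[measurable]: "Measurable.pred borel good"
  proof -
    have "(\<lambda>p. \<integral>\<^sup>+s. ennreal \<bar>f1 (p, s)\<bar> \<partial>lborel) \<in> borel_fun"
      using lborel.borel_measurable_nn_integral_fst[of "\<lambda>z. ennreal \<bar>f1 z\<bar>" lborel] by (simp add: lborel_prod)
    then show ?thesis unfolding good_def[abs_def] by measurable
  qed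
  have f1s[measurable]: "(\<lambda>s. f1 (p, s)) \<in> borel_fun" for p
    by (rule measurable_compose[OF _ f1m]) (auto intro!: borel_measurable_continuous_onI continuous_intros)
  have goodI: "good p \<longleftrightarrow> L1 (\<lambda>s. f1 (p, s))" for p
    by (simp add: good_def integrable_iff_bounded)
  have goodAE: "AE p in lborel. good p" using lborel_fubini(1)[OF f1i] by (simp add: goodI)
  \<comment> \<open>Closed at height \<open>c\<close>, in contrast to \<open>Q'\<close>, since the
    primitives are taken over closed intervals starting at \<open>c\<close>.\<close>
  define Qc where "Qc = {-m<..<m} \<times> {c..<m}"
  have QcQ: "Qc \<subseteq> Q" using st(1-4) by (auto simp: Qc_def Q_def)
  have Qcm[measurable]: "Qc \<in> sets borel" unfolding Qc_def by (simp add: borel_Times)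
  \<comment> \<open>\<open>b1\<close> is replaced by the constant \<open>\<alpha>\<close> outside
    the rectangle and on exceptional lines: then every vertical primitive is finite and maps the
    line onto itself, and the travel time has a constant density far away.\<close>
  define g where "g x = (if x \<in> Qc \<and> good (fst x) then f1 x else \<alpha>)" for x
  have gm[measurable]: "g \<in> borel_fun" unfolding g_def[abs_def] by measurable
  have g\<alpha>: "\<alpha> \<le> g x" for x using b1[of x] QcQ by (auto simp: g_def f1_def)
  have gi: "L1 (\<lambda>s. indicator {u..v} s * g (p, s))" for p u v
  proof (rule integrable_dominated[of "\<lambda>s. (if good p then \<bar>f1 (p, s)\<bar> else 0) + \<alpha> * indicator {u..v} s"])
    show "L1 (\<lambda>s. (if good p then \<bar>f1 (p, s)\<bar> else 0) + \<alpha> * indicat_real {u..v} s)"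
      by (intro Bochner_Integration.integrable_add integrable_mult_right integrable_indicator_Icc)
        (cases "good p"; use goodI[of p] in simp)
    have "(\<lambda>s::real. (p, s)) \<in> borel_fun" by (auto intro!: borel_measurable_continuous_onI continuous_intros)
    note [measurable] = measurable_compose[OF this gm]
    show "(\<lambda>s. indicator {u..v} s * g (p, s)) \<in> borel_fun" by measurable
    show "\<bar>indicator {u..v} s * g (p, s)\<bar> \<le> (if good p then \<bar>f1 (p, s)\<bar> else 0) + \<alpha> * indicator {u..v} s" for s
      using \<alpha> by (auto simp: g_def indicator_def)
  qed
  have m0: "m \<ge> 0" using st(1) r(1) by simp
  have gout: "g (p, q) = \<alpha>" if "\<bar>p\<bar> \<ge> m" for p q using that by (auto simp: g_def Qc_def)
  define A0 where "A0 p = icc (- m) p (\<lambda>s. f2 (s, c))" for p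
  have A0m: "A0 \<in> borel_fun"
  proof -
    have [measurable]: "(\<lambda>s. f2 (s, c)) \<in> borel_fun"
      by (rule measurable_compose[OF _ f2m]) (auto intro!: borel_measurable_continuous_onI continuous_intros)
    have "(\<lambda>z::real \<times> real. icc (- m) (fst z) (\<lambda>s. (\<lambda>w. f2 (snd w, c)) (fst z, s))) \<in> borel_fun"
      by (rule borel_measurable_icc_param) measurable
    then have i: "(\<lambda>z::real \<times> real. A0 (fst z)) \<in> borel_fun" by (simp add: A0_def)
    have "(\<lambda>p::real. (p, 0::real)) \<in> borel_fun" by (auto intro!: borel_measurable_continuous_onI continuous_intros)
    from measurable_compose[OF this i] show ?thesis by simp
  qed
  define F where "F = (\<lambda>z. prim c (\<lambda>s. g (fst z, s)) (snd z) - A0 (fst z))"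
  obtain a S \<Xi> where fc: "a \<in> borel_fun" "\<And>y. \<bar>a y\<bar> \<le> 1 / \<alpha>" "S \<in> borel_fun" "F \<in> borel_fun"
    "\<And>h p p'. p \<le> p' \<Longrightarrow> S (h, p') - S (h, p) = icc p p' (\<lambda>s. a (h, s))"
    "\<And>h p. \<bar>S (h, p)\<bar> \<le> 1 / \<alpha> * (\<bar>p\<bar> + 0)"
    "\<And>P. AE y in lborel. P y \<Longrightarrow> AE x in lborel. P (F x, fst x)"
    "\<And>x. a (F x, fst x) * g x = 1"
    "(\<lambda>x. (F x, S (F x, fst x))) \<in> borel_fun" "\<Xi> \<in> borel_fun"
    "\<And>y. (F (\<Xi> y), S (F (\<Xi> y), fst (\<Xi> y))) = y" "\<And>x. \<Xi> (F x, S (F x, fst x)) = x"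
    "distr lborel borel (\<lambda>x. (F x, S (F x, fst x))) = lborel"
    using flow_coordinates[OF gm \<alpha> g\<alpha> gi gout m0 A0m, of c] unfolding F_def by blast
  have Hl: "AE x in lborel. x \<in> Q' \<longrightarrow> (\<lambda>n. H n x) \<longlonglongrightarrow> F x"
    using st(12) AE_lborel_fst_snd(1)[OF goodAE]
  proof eventually_elim
    case (elim x)
    show ?case
    proof
      assume x: "x \<in> Q'"
      have "icc c (snd x) (\<lambda>s. f1 (fst x, s)) = icc c (snd x) (\<lambda>s. g (fst x, s))"
        by (rule icc_cong) (use x elim(2) in \<open>auto simp: g_def Q'_def Qc_def\<close>)
      moreover have "c \<le> snd x" using x by (auto simp: Q'_def)
      ultimately have "icc c (snd x) (\<lambda>s. f1 (fst x, s)) - icc (- m) (fst x) (\<lambda>s. f2 (s, c)) = F x"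
        by (simp add: F_def A0_def prim_def)
      then show "(\<lambda>n. H n x) \<longlonglongrightarrow> F x" using elim(1) x by (simp add: f1_def f2_def Q'_def)
    qed
  qed
  have ab1: "AE x in lborel. x \<in> Q' \<longrightarrow> a (F x, fst x) * fst (b x) = 1"
    using AE_lborel_fst_snd(1)[OF goodAE]
  proof eventually_elim
    case (elim x)
    show ?case
    proof
      assume x: "x \<in> Q'"
      then have "g x = fst (b x)" using elim Q'Q by (auto simp: g_def f1_def Qc_def Q'_def)
      then show "a (F x, fst x) * fst (b x) = 1" using fc(8)[of x] by simp
    qed
  qed
  have bi: "L1 (\<lambda>x. indicator Q' x * (1 + norm (b x)))"
    by (rule integrable_dominated[OF biQ]) (use Q'Q in \<open>auto simp: indicator_def\<close>)
  define \<Psi> where "\<Psi> = (\<lambda>x. (F x, S (F x, fst x)))"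
  \<comment> \<open>Formulated for an arbitrary solution \<open>v\<close>, as it serves for
    \<open>u\<close> with test function \<open>\<phi>c\<close> and for the constant 1 with test
    function \<open>\<phi>\<close>.\<close>
  have test: "(LBINT z. future z * (\<kappa> (\<Psi> (snd z) - (0, fst z)) * (\<theta>' (fst z) * (v z * \<psi> z) + \<theta> (fst z) * (v z * flux b E z))))
     = - (\<theta> 0 * (LBINT x. \<kappa> (\<Psi> x) * (v0 x * \<psi> (0, x))))"
    if v: "v \<in> borel_fun" "v0 \<in> borel_fun" "\<And>z. \<bar>v z\<bar> \<le> C'" "\<And>x. \<bar>v0 x\<bar> \<le> C'" "weak_sol Q b v0 v"
      and \<psi>: "cgrad \<psi> E" "compact K'" "K' \<subseteq> UNIV \<times> Q'" "\<And>z. z \<notin> K' \<Longrightarrow> \<psi> z = 0"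
      and \<kappa>: "cgrad \<kappa> EK" "\<And>y. norm y > M \<Longrightarrow> \<kappa> y = 0" "C1 \<theta> \<theta>'" for v v0 C' \<psi> E K' \<kappa> EK M \<theta> \<theta>'
    unfolding \<Psi>_def
  proof (rule weak_sol_test_flow[OF bm Q'm bi v(1-4) \<psi> _ fc(1,2,3,4,5,6) fc(7) ab1 \<kappa>(1) _ \<kappa>(3), of M])
    show "(LBINT z. future z * (v z * (\<psi>' (fst z, (fst (snd z), F (snd z))) * flux b E z
            + \<psi> z * (E' (fst z, (fst (snd z), F (snd z))) \<bullet> (1, (fst (b (snd z)), 0))))))
       = - (LBINT x. v0 x * (\<psi> (0, x) * \<psi>' (0, (fst x, F x))))"
      if "cgrad \<psi>' E'" "\<And>t p h. \<bar>h\<bar> > M' \<Longrightarrow> \<psi>' (t, (p, h)) = (0::real)" for \<psi>' E' M'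
      by (rule weak_sol_test_stream[OF bm Qb Qo b2 refl refl st(5-10) Q'o Q'Q st(11)[folded Q'_def] Hl fc(4) v(5,1-4) \<psi> that(1), of M'])
         (use that(2) in auto)
  qed (use \<kappa>(2) in auto)
  obtain T where T: "T > 0" "\<And>z. z \<in> K \<Longrightarrow> \<bar>fst z\<bar> \<le> T" using compact_subset_time_strip[OF \<phi>(2)] by blast
  \<comment> \<open>Half of the smaller gap separating the square of half-side \<open>r\<close> from
    the sides \<open>m\<close> and \<open>c\<close>, so that the support of the cutoff still lies in
    \<open>Q'\<close>.\<close>
  define e where "e = min (m - r) (- r - c) / 2"
  have e: "e > 0" "r + e < m" "c < - (r + e)" using st(1-4) by (auto simp: e_def min_def field_simps)
  obtain ct cp where ct: "C1 (cutoff T 1) ct" and cp: "C1 (cutoff r e) cp" using C1_cutoff by meson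
  define \<phi>c where "\<phi>c z = cutoff T 1 (fst z) * (cutoff r e (fst (snd z)) * cutoff r e (snd (snd z)))" for z :: "real \<times> real \<times> real"
  have "\<exists>Dc. cgrad \<phi>c Dc"
    unfolding \<phi>c_def[abs_def]
    using cgrad_mult[OF cgrad_comp_fst[OF cgrad_C1_real[OF ct]] cgrad_comp_snd[OF cgrad_mult[OF cgrad_comp_fst[OF cgrad_C1_real[OF cp]] cgrad_comp_snd[OF cgrad_C1_real[OF cp]]]]]
    by blast
  then obtain Dc where Dc: "cgrad \<phi>c Dc" by blast
  define Kc where "Kc = {-(T+1)..T+1} \<times> ({-(r+e)..r+e} \<times> {-(r+e)..r+e})"
  have Kc: "compact Kc" "Kc \<subseteq> UNIV \<times> Q'"
    unfolding Kc_def Q'_def using e st(1-4) by (auto intro!: compact_Times)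
  have \<phi>c0: "\<phi>c z = 0" if "z \<notin> Kc" for z
  proof -
    have "\<bar>fst z\<bar> \<ge> T + 1 \<or> \<bar>fst (snd z)\<bar> \<ge> r + e \<or> \<bar>snd (snd z)\<bar> \<ge> r + e"
      using that by (auto simp: Kc_def mem_Times_iff abs_le_iff not_le)
    then show ?thesis using cutoff_outside[of 1 T] cutoff_outside[of e r] e(1) by (auto simp: \<phi>c_def)
  qed
  have \<phi>c1: "\<phi>c z = 1" if "z \<in> K" for z
    using T(2)[OF that] r(3)[of "snd z"] that e(1) by (auto simp: \<phi>c_def cutoff_inside)
  have \<phi>cb: "\<bar>\<phi>c z\<bar> \<le> 1" for z unfolding \<phi>c_def abs_mult using cutoff_bounds by (simp add: mult_le_one)
  have D0: "D z = 0" if "z \<notin> K" for z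
    by (rule cgrad_zero_outside[OF \<phi>(1) compact_imp_closed[OF \<phi>(2)] \<phi>0 that])
  have Dc0: "Dc z = 0" if "z \<notin> Kc" for z
    by (rule cgrad_zero_outside[OF Dc compact_imp_closed[OF Kc(1)] \<phi>c0 that])
  \<comment> \<open>On the open set where \<open>\<phi>\<close> is nonzero the cutoff is constantly
    1. This provides the cancellation of sources required by the product rule.\<close>
  have Dc1: "Dc z = 0" if "\<phi> z \<noteq> 0" for z
  proof (rule cgrad_const_on_open[OF Dc, where S="{z. \<phi> z \<noteq> 0}" and c=1])
    show "open {z. \<phi> z \<noteq> 0}" by (intro open_Collect_neq cgrad_continuous[OF \<phi>(1)] continuous_on_const)
    show "\<phi>c x = 1" if "x \<in> {z. \<phi> z \<noteq> 0}" for x by (rule \<phi>c1) (use that \<phi>0[of x] in blast)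
  qed (use that in simp)
  have bulk: "L1 (\<lambda>z. v z * \<psi> z)"
    if "cgrad \<psi> E" "compact K'" "\<And>z. z \<notin> K' \<Longrightarrow> \<psi> z = 0" "v \<in> borel_fun" "\<And>x. \<bar>v x\<bar> \<le> C'"
    for \<psi> :: "real \<times> real \<times> real \<Rightarrow> real" and E K' and v :: "real \<times> real \<times> real \<Rightarrow> real" and C'
  proof -
    have i: "L1 \<psi>"
      by (rule continuous_compact_support_integrable[OF cgrad_continuous[OF that(1)] that(2,3)])
    show ?thesis
      by (rule integrable_dominated[of "\<lambda>x. C' * \<bar>\<psi> x\<bar>"])
         (use i that(4) borel_measurable_cgrad[OF that(1)] in \<open>auto simp: abs_mult intro!: mult_right_mono that(5)\<close>)
  qed
  \<comment> \<open>The factors 1 display \<open>\<phi>\<close> and its flux as quantities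
    transported by the constant solution. At the end \<open>\<phi>c\<close> disappears from
    \<open>\<beta> (u z * \<phi>c z)\<close>, because it equals 1 wherever the other factor is
    nonzero.\<close>
  have "(LBINT z. future z * (\<beta> (u z * \<phi>c z) * (1 * flux b D z)))
      = - (LBINT x. \<beta> (u0 x * \<phi>c (0, x)) * (1 * \<phi> (0, x)))"
  proof (rule renormalization_by_flow_coordinates[where \<Psi>=\<Psi> and \<Xi>=\<Xi> and g="\<lambda>z. u z * flux b Dc z" and \<phi>="\<lambda>z. 1 * \<phi> z"
      and f="\<lambda>z. u z * \<phi>c z" and ?f0.0="\<lambda>x. u0 x * \<phi>c (0, x)" and \<delta>="\<lambda>z. 1 * flux b D z" and ?\<phi>0.0="\<lambda>x. 1 * \<phi> (0, x)" and T=T and C=C and L=L])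
    show "\<Psi> \<in> borel_fun" "\<Xi> \<in> borel_fun" "\<And>y. \<Psi> (\<Xi> y) = y" "\<And>x. \<Xi> (\<Psi> x) = x" "distr lborel borel \<Psi> = lborel"
      using fc(9-13) by (auto simp: \<Psi>_def)
    show "L1 (\<lambda>z. u z * \<phi>c z)" by (rule bulk[OF Dc Kc(1) \<phi>c0 um ub(1)])
    show "L1 (\<lambda>z. u z * flux b Dc z)"
      by (rule integrable_flux_test[OF bm Q'm bi cgrad_continuous_grad[OF Dc] Kc Dc0 um ub(1)])
    show "L1 (\<lambda>x. u0 x * \<phi>c (0, x))" by (rule integrable_slice_test[OF Dc Kc(1) \<phi>c0 u0m ub(2)])
    show "L1 (\<lambda>z. 1 * \<phi> z)" by (rule bulk[OF \<phi>(1,2) \<phi>0, of _ 1]) auto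
    show "L1 (\<lambda>z. 1 * flux b D z)"
      by (rule integrable_flux_test[OF bm Q'm bi cgrad_continuous_grad[OF \<phi>(1)] \<phi>(2) KQ' D0, of _ 1]) auto
    show "L1 (\<lambda>x. 1 * \<phi> (0, x))" by (rule integrable_slice_test[OF \<phi>(1,2) \<phi>0, of _ 1]) auto
    show "u z * flux b Dc z * (1 * \<phi> z) = 0" for z using Dc1[of z] by auto
    show "0 \<le> T" using T by simp
    show "1 * \<phi> z = 0 \<and> 1 * flux b D z = 0" if "fst z > T" for z
    proof -
      have "z \<notin> K" using T(2)[of z] that by auto
      then show ?thesis using \<phi>0 D0 by simp
    qed
    show "\<bar>u z * \<phi>c z\<bar> \<le> C" for z
      using mult_mono[OF ub(1)[of z] \<phi>cb[of z] C] by (simp add: abs_mult)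
    show "\<bar>u0 x * \<phi>c (0, x)\<bar> \<le> C" for x
      using mult_mono[OF ub(2)[of x] \<phi>cb[of "(0, x)"] C] by (simp add: abs_mult)
    fix \<kappa> :: "real \<times> real \<Rightarrow> real" and EK and M :: real and \<theta> \<theta>' :: "real \<Rightarrow> real"
    assume k: "cgrad \<kappa> EK" "\<And>y. norm y > M \<Longrightarrow> \<kappa> y = 0" "C1 \<theta> \<theta>'"
    show "(LBINT z. future z * (\<kappa> (\<Psi> (snd z) - (0, fst z)) * (\<theta>' (fst z) * (u z * \<phi>c z) + \<theta> (fst z) * (u z * flux b Dc z))))
        = - (\<theta> 0 * (LBINT x. \<kappa> (\<Psi> x) * (u0 x * \<phi>c (0, x))))"
      by (rule test[OF um u0m ub w Dc Kc \<phi>c0 k(1) _ k(3), of M]) (use k(2) in auto)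
    show "(LBINT z. future z * (\<kappa> (\<Psi> (snd z) - (0, fst z)) * (\<theta>' (fst z) * (1 * \<phi> z) + \<theta> (fst z) * (1 * flux b D z))))
        = - (\<theta> 0 * (LBINT x. \<kappa> (\<Psi> x) * (1 * \<phi> (0, x))))"
      by (rule test[OF _ _ _ _ one \<phi>(1,2) KQ' \<phi>0 k(1) _ k(3), of 1 M]) (use k(2) in auto)
  qed (rule Lip)
  moreover have "\<beta> (u z * \<phi>c z) * (1 * flux b D z) = \<beta> (u z) * flux b D z" for z
    using D0[of z] \<phi>c1[of z] by (cases "z \<in> K") auto
  moreover have "\<beta> (u0 x * \<phi>c (0, x)) * (1 * \<phi> (0, x)) = \<beta> (u0 x) * \<phi> (0, x)" for x
    using \<phi>0[of "(0, x)"] \<phi>c1[of "(0, x)"] by (cases "(0, x) \<in> K") auto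
  ultimately show "(LBINT z. future z * (\<beta> (u z) * flux b D z)) = - (LBINT x. \<beta> (u0 x) * \<phi> (0, x))"
    by (simp only:)
qed

section \<open>Borel representatives of Lebesgue measurable functions\<close>

lemma AE_lebesgue_iff: "(AE x in lebesgue. P x) \<longleftrightarrow> (AE x in lborel. P x)"
  by (rule AE_completion_iff)

lemma integral_lebesgue_eq_lborel:
  fixes f f' :: "'a::euclidean_space \<Rightarrow> real"
  assumes f': "f' \<in> borel_fun" and eq: "AE x in lborel. f x = f' x"
  shows "integral\<^sup>L lebesgue f = integral\<^sup>L lborel f'" "f \<in> borel_measurable lebesgue"
    "integrable lebesgue f \<longleftrightarrow> L1 f'"
proof -
  have fm': "f' \<in> borel_measurable lebesgue" by (rule measurable_completion) (use f' in simp)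
  have eq': "AE x in lebesgue. f' x = f x"
    unfolding AE_lebesgue_iff using eq by eventually_elim simp
  show fm: "f \<in> borel_measurable lebesgue" by (rule borel_measurable_AE[OF fm' eq'])
  have "integral\<^sup>L lebesgue f = integral\<^sup>L lebesgue f'"
    by (rule integral_cong_AE[OF fm fm']) (use eq' in \<open>auto simp: eq_commute\<close>)
  then show "integral\<^sup>L lebesgue f = integral\<^sup>L lborel f'" using integral_completion[of f' lborel] f' by simp
  have "integrable lebesgue f \<longleftrightarrow> integrable lebesgue f'"
    by (rule integrable_cong_AE[OF fm fm']) (use eq' in \<open>auto simp: eq_commute\<close>)
  then show "integrable lebesgue f \<longleftrightarrow> L1 f'" using integrable_completion[of f' lborel] f' by simp
qed

text \<open>The flow coordinates compose functions with Borel maps, which preserves Borel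
  measurability; hence all data are replaced by Borel representatives, here one component at a
  time.\<close>

lemma lebesgue_borel_version:
  fixes f :: "'a::euclidean_space \<Rightarrow> 'b::euclidean_space"
  assumes "f \<in> borel_measurable (lebesgue_on S)" "S \<in> sets lebesgue"
  obtains g where "g \<in> borel_fun" "AE x in lborel. x \<in> S \<longrightarrow> g x = f x"
proof -
  define h where "h x = (if x \<in> S then f x else 0)" for x
  have h: "h \<in> borel_measurable lebesgue"
    unfolding h_def[abs_def] using borel_measurable_if[OF assms(2)] assms(1) by blast
  have "\<exists>g'\<in>borel_measurable lborel. AE x in lborel. h x \<bullet> i = g' x" for i
    by (rule completion_ex_borel_measurable_real) (use h in measurable)
  then obtain G where G: "\<And>i. G i \<in> borel_measurable lborel" "\<And>i. AE x in lborel. h x \<bullet> i = G i x" by metis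
  show ?thesis
  proof
    show "(\<lambda>x. \<Sum>i\<in>Basis. G i x *\<^sub>R i) \<in> borel_fun" using G(1) by (intro borel_measurable_sum) auto
    have "AE x in lborel. \<forall>i\<in>Basis. h x \<bullet> i = G i x" by (rule AE_finite_allI) (use G(2) in auto)
    then show "AE x in lborel. x \<in> S \<longrightarrow> (\<Sum>i\<in>Basis. G i x *\<^sub>R i) = f x"
    proof eventually_elim
      case (elim x)
      have "(\<Sum>i\<in>Basis. G i x *\<^sub>R i) = (\<Sum>i\<in>Basis. (h x \<bullet> i) *\<^sub>R i)" using elim by simp
      then show ?case by (simp add: euclidean_representation h_def)
    qed
  qed
qed

lemma AE_lebesgue_on_iff:
  assumes "S \<in> sets lebesgue"
  shows "(AE x in lebesgue_on S. P x) \<longleftrightarrow> (AE x in lborel. x \<in> S \<longrightarrow> P x)"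
  using AE_restrict_space_iff[of S lebesgue P] assms by (simp add: AE_lebesgue_iff)

text \<open>Clamping the representative to \<open>[- \<bar>C\<bar>, \<bar>C\<bar>]\<close> makes the
  bound hold everywhere and alters it on a null subset of \<open>S\<close> at most.\<close>

lemma lebesgue_bounded_borel_version:
  fixes f :: "'a::euclidean_space \<Rightarrow> real"
  assumes f: "f \<in> borel_measurable (lebesgue_on S)" and S: "S \<in> sets lebesgue" and bd: "AE x in lebesgue_on S. \<bar>f x\<bar> \<le> C"
  obtains g where "g \<in> borel_fun" "AE x in lborel. x \<in> S \<longrightarrow> g x = f x" "\<And>x. \<bar>g x\<bar> \<le> \<bar>C\<bar>"
proof -
  obtain h where h: "h \<in> borel_fun" "AE x in lborel. x \<in> S \<longrightarrow> h x = f x"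
    using lebesgue_borel_version[OF f S] by blast
  show ?thesis
  proof
    show "(\<lambda>x. max (- \<bar>C\<bar>) (min \<bar>C\<bar> (h x))) \<in> borel_fun" using h(1) by measurable
    show "AE x in lborel. x \<in> S \<longrightarrow> max (- \<bar>C\<bar>) (min \<bar>C\<bar> (h x)) = f x"
      using h(2) bd[unfolded AE_lebesgue_on_iff[OF S]] by eventually_elim (auto simp: min_def max_def)
  qed auto
qed

section \<open>Periodization over a discrete group\<close>

text \<open>The translates of \<open>w\<close> form a partition of unity where \<open>f\<close> is
  nonzero. Insert it and shift each summand by its own \<open>\<gamma>\<close>.\<close>

lemma integral_unfold:
  fixes f w :: "'a::euclidean_space \<Rightarrow> real"
  assumes G: "finite G" and f: "L1 f" and w[measurable]: "w \<in> borel_fun" and wb: "\<And>x. \<bar>w x\<bar> \<le> 1"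
    and one: "\<And>y. f y \<noteq> 0 \<Longrightarrow> (\<Sum>\<gamma>\<in>G. w (y - \<gamma>)) = 1"
  shows "(LBINT y. f y) = (LBINT x. w x * (\<Sum>\<gamma>\<in>G. f (x + \<gamma>)))"
proof -
  have fm[measurable]: "f \<in> borel_fun" using f borel_measurable_integrable by force
  have i: "L1 (\<lambda>y. w (y - \<gamma>) * f y)" for \<gamma>
    by (rule integrable_dominated[of "\<lambda>y. \<bar>f y\<bar>"]) (use f wb in \<open>auto simp: abs_mult intro!: mult_left_le_one_le\<close>)
  have sh: "(LBINT y. w (y - \<gamma>) * f y) = (LBINT x. w x * f (x + \<gamma>))"
    "L1 (\<lambda>x. w x * f (x + \<gamma>))" for \<gamma>
    using integral_distr_lborel[OF lborel_distr_shift[of \<gamma>], of "\<lambda>y. w (y - \<gamma>) * f y"] i[of \<gamma>] by auto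
  have "(LBINT y. f y) = (LBINT y. (\<Sum>\<gamma>\<in>G. w (y - \<gamma>) * f y))"
  proof (rule Bochner_Integration.integral_cong[OF refl])
    fix y show "f y = (\<Sum>\<gamma>\<in>G. w (y - \<gamma>) * f y)" using one[of y] by (cases "f y = 0") (auto simp flip: sum_distrib_right)
  qed
  also have "\<dots> = (\<Sum>\<gamma>\<in>G. LBINT x. w x * f (x + \<gamma>))"
    using i by (subst Bochner_Integration.integral_sum) (auto simp: sh)
  also have "\<dots> = (LBINT x. (\<Sum>\<gamma>\<in>G. w x * f (x + \<gamma>)))"
    by (subst Bochner_Integration.integral_sum) (auto simp: sh)
  finally show ?thesis by (simp add: sum_distrib_left)
qed

lemma AE_lborel_shift:
  assumes "AE x in lborel. P x" shows "AE x in lborel. P (x + (c::'a::euclidean_space))"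
proof -
  have "AE x in distr lborel borel (\<lambda>y. y + c). P x" using assms by (simp only: lborel_distr_shift)
  then show ?thesis by (rule AE_distrD[rotated]) simp
qed

text \<open>Common to the trivial group of the plane, the integer lattice, and their copies in
  space-time with zero time component.\<close>

definition discrete_group :: "'a::euclidean_space set \<Rightarrow> bool" where
  "discrete_group \<Gamma> \<longleftrightarrow> 0 \<in> \<Gamma> \<and> (\<forall>x\<in>\<Gamma>. \<forall>y\<in>\<Gamma>. x + y \<in> \<Gamma> \<and> x - y \<in> \<Gamma>) \<and> (\<forall>B. bounded B \<longrightarrow> finite (\<Gamma> \<inter> B))"

lemma discrete_groupD:
  assumes "discrete_group \<Gamma>"
  shows "0 \<in> \<Gamma>" "x \<in> \<Gamma> \<Longrightarrow> y \<in> \<Gamma> \<Longrightarrow> x + y \<in> \<Gamma>" "x \<in> \<Gamma> \<Longrightarrow> y \<in> \<Gamma> \<Longrightarrow> x - y \<in> \<Gamma>" "x \<in> \<Gamma> \<Longrightarrow> - x \<in> \<Gamma>"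
    "bounded B \<Longrightarrow> finite (\<Gamma> \<inter> B)"
proof -
  show "x \<in> \<Gamma> \<Longrightarrow> - x \<in> \<Gamma>" using assms unfolding discrete_group_def by (metis diff_0)
qed (use assms in \<open>auto simp: discrete_group_def\<close>)

lemma discrete_group_finite:
  assumes \<Gamma>: "discrete_group \<Gamma>" and B: "bounded B" "bounded K"
  shows "finite {\<gamma>\<in>\<Gamma>. \<exists>x\<in>B. x + \<gamma> \<in> K}"
proof (rule finite_subset)
  show "{\<gamma>\<in>\<Gamma>. \<exists>x\<in>B. x + \<gamma> \<in> K} \<subseteq> \<Gamma> \<inter> (\<Union>x\<in>K. \<Union>y\<in>B. {x - y})"
    by clarsimp (metis add_diff_cancel_left')
  have "bounded (\<Union>x\<in>K. \<Union>y\<in>B. {x - y})" by (rule bounded_differences[OF B(2,1)])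
  then show "finite (\<Gamma> \<inter> (\<Union>x\<in>K. \<Union>y\<in>B. {x - y}))" using discrete_groupD(5)[OF \<Gamma>] by blast
qed

text \<open>For \<open>f\<close> vanishing outside \<open>K\<close> this is the full sum of
  translates. Restricting to translates that hit a bounded \<open>K\<close> keeps the index set
  finite, so no convergence is involved.\<close>

definition periodization :: "'a::euclidean_space set \<Rightarrow> 'a set \<Rightarrow> ('a \<Rightarrow> 'b::real_normed_vector) \<Rightarrow> 'a \<Rightarrow> 'b" where
  "periodization \<Gamma> K f z = (\<Sum>\<gamma> | \<gamma> \<in> \<Gamma> \<and> z + \<gamma> \<in> K. f (z + \<gamma>))"

lemma periodization_eq:
  assumes "finite G" "G \<subseteq> \<Gamma>" "\<And>\<gamma>. \<gamma> \<in> \<Gamma> \<Longrightarrow> z + \<gamma> \<in> K \<Longrightarrow> \<gamma> \<in> G" "\<And>x. x \<notin> K \<Longrightarrow> f x = 0"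
  shows "periodization \<Gamma> K f z = (\<Sum>\<gamma>\<in>G. f (z + \<gamma>))"
  unfolding periodization_def by (rule sum.mono_neutral_left) (use assms in auto)

lemma periodization_periodic:
  assumes \<Gamma>: "discrete_group \<Gamma>" and c: "c \<in> \<Gamma>"
  shows "periodization \<Gamma> K f (z + c) = periodization \<Gamma> K f z"
  unfolding periodization_def
proof (rule sum.reindex_bij_witness[where i="\<lambda>\<gamma>. \<gamma> - c" and j="\<lambda>\<gamma>. \<gamma> + c"])
qed (use discrete_groupD[OF \<Gamma>] c in \<open>auto simp: algebra_simps\<close>)

text \<open>Near each point a single finite set of translations represents the sum, so that
  derivatives may be taken term by term.\<close>

lemma periodization_local:
  assumes \<Gamma>: "discrete_group \<Gamma>" and K: "bounded K" "\<And>x. x \<notin> K \<Longrightarrow> f x = 0"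
  obtains G where "finite G" "G \<subseteq> \<Gamma>" "\<And>x. x \<in> ball z 1 \<Longrightarrow> periodization \<Gamma> K f x = (\<Sum>\<gamma>\<in>G. f (x + \<gamma>))"
    "\<And>x \<gamma>. x \<in> ball z 1 \<Longrightarrow> \<gamma> \<in> \<Gamma> \<Longrightarrow> x + \<gamma> \<in> K \<Longrightarrow> \<gamma> \<in> G"
proof
  let ?G = "{\<gamma>\<in>\<Gamma>. \<exists>x\<in>ball z 1. x + \<gamma> \<in> K}"
  show G: "finite ?G" by (rule discrete_group_finite[OF \<Gamma>]) (use K in auto)
  show "periodization \<Gamma> K f x = (\<Sum>\<gamma>\<in>?G. f (x + \<gamma>))" if "x \<in> ball z 1" for x
    using that by (intro periodization_eq[OF G] K(2)) blast+
qed blast+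

lemma periodization_has_derivative:
  assumes \<Gamma>: "discrete_group \<Gamma>" and K: "bounded K" "\<And>x. x \<notin> K \<Longrightarrow> f x = 0" "\<And>x v. x \<notin> K \<Longrightarrow> f' x v = 0"
    and f: "\<And>x. (f has_derivative f' x) (at x)"
  shows "(periodization \<Gamma> K f has_derivative (\<lambda>v. periodization \<Gamma> K (\<lambda>x. f' x v) z)) (at z)"
proof -
  obtain G where G: "finite G" "G \<subseteq> \<Gamma>" "\<And>x. x \<in> ball z 1 \<Longrightarrow> periodization \<Gamma> K f x = (\<Sum>\<gamma>\<in>G. f (x + \<gamma>))"
    "\<And>x \<gamma>. x \<in> ball z 1 \<Longrightarrow> \<gamma> \<in> \<Gamma> \<Longrightarrow> x + \<gamma> \<in> K \<Longrightarrow> \<gamma> \<in> G"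
    by (rule periodization_local[OF \<Gamma> K(1), of f z]) ((rule K(2); assumption), (rule that; assumption))
  have "periodization \<Gamma> K (\<lambda>x. f' x v) z = (\<Sum>\<gamma>\<in>G. f' (z + \<gamma>) v)" for v
    by (rule periodization_eq[OF G(1,2)]) (use G(4)[of z] K(3) in auto)
  moreover have "((\<lambda>x. \<Sum>\<gamma>\<in>G. f (x + \<gamma>)) has_derivative (\<lambda>v. \<Sum>\<gamma>\<in>G. f' (z + \<gamma>) v)) (at z)"
  proof (rule has_derivative_sum)
    fix \<gamma> show "((\<lambda>x. f (x + \<gamma>)) has_derivative f' (z + \<gamma>)) (at z)"
      by (rule has_derivative_compose[OF _ f, of _ "\<lambda>v. v", simplified]) (auto intro!: derivative_eq_intros)
  qed
  ultimately show ?thesis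
    using has_derivative_transform_within_open[of "\<lambda>x. \<Sum>\<gamma>\<in>G. f (x + \<gamma>)" _ z UNIV "ball z 1"] G(3) by simp
qed

text \<open>Differentiation commutes with periodization, and derivatives of \<open>f\<close> are
  again smooth and vanish outside \<open>K\<close>; hence induction on the order over all such
  \<open>f\<close>.\<close>

lemma smooth_periodization:
  fixes f :: "'a::euclidean_space \<Rightarrow> real"
  assumes \<Gamma>: "discrete_group \<Gamma>" and K: "compact K"
  shows "smooth f \<Longrightarrow> (\<And>x. x \<notin> K \<Longrightarrow> f x = 0) \<Longrightarrow> smooth (periodization \<Gamma> K f)"
proof -
  have d0: "frechet_derivative f (at x) v = 0" if f: "smooth f" "\<And>x. x \<notin> K \<Longrightarrow> f x = 0" and x: "x \<notin> K" for f :: "'a \<Rightarrow> real" and x v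
  proof -
    have "((\<lambda>_. 0) has_derivative (\<lambda>_. 0::real)) (at x)" by simp
    then have "(f has_derivative (\<lambda>_. 0)) (at x)"
      by (rule has_derivative_transform_within_open[of _ _ _ _ "- K"]) (use f(2) x compact_imp_closed[OF K] in auto)
    then show ?thesis by (rule frechet_derivative_eq)
  qed
  have "smooth f \<Longrightarrow> (\<And>x. x \<notin> K \<Longrightarrow> f x = 0) \<Longrightarrow> C_k_on k UNIV (periodization \<Gamma> K f)" for k
  proof (induction k arbitrary: f)
    case 0
    have "isCont (periodization \<Gamma> K f) z" for z
      by (rule has_derivative_continuous[OF periodization_has_derivative[OF \<Gamma> compact_imp_bounded[OF K] 0(2) d0[OF 0] smooth_has_derivative[OF 0(1)]]])
    then show ?case by (simp add: continuous_at_imp_continuous_on)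
  next
    case (Suc k)
    show ?case
    proof (rule C_k_on_SucI)
      show "(periodization \<Gamma> K f has_derivative (\<lambda>v. periodization \<Gamma> K (\<lambda>x. frechet_derivative f (at x) v) z)) (at z)" for z
        by (rule periodization_has_derivative[OF \<Gamma> compact_imp_bounded[OF K] Suc.prems(2) d0[OF Suc.prems] smooth_has_derivative[OF Suc.prems(1)]])
      show "C_k_on k UNIV (\<lambda>x. periodization \<Gamma> K (\<lambda>x. frechet_derivative f (at x) v) x)" for v
        using Suc.IH[OF smooth_derivative[OF Suc.prems(1)] d0[OF Suc.prems]] by blast
    qed
  qed
  then show "smooth f \<Longrightarrow> (\<And>x. x \<notin> K \<Longrightarrow> f x = 0) \<Longrightarrow> smooth (periodization \<Gamma> K f)" unfolding smooth_def by blast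
qed

section \<open>Passing from smooth to C1 test functions\<close>

lemma uniform_continuity_compact_support:
  fixes f :: "'a::euclidean_space \<Rightarrow> 'b::real_normed_vector"
  assumes f: "continuous_on UNIV f" and K: "compact K" "\<And>x. x \<notin> K \<Longrightarrow> f x = 0" and d: "d > 0"
  obtains e where "e > 0" "\<And>x y. norm (x - y) \<le> e \<Longrightarrow> norm (f y - f x) \<le> d"
proof -
  define K' where "K' = {x + y | x y. x \<in> K \<and> y \<in> cball 0 (1::real)}"
  have "compact K'" unfolding K'_def by (intro compact_sums K compact_cball)
  then have "uniformly_continuous_on K' f" using f by (intro compact_uniformly_continuous) (auto intro: continuous_on_subset)
  then obtain e where e: "e > 0" "\<And>x y. x \<in> K' \<Longrightarrow> y \<in> K' \<Longrightarrow> dist y x < e \<Longrightarrow> dist (f y) (f x) < d"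
    unfolding uniformly_continuous_on_def using d by metis
  have near: "y \<in> K'" if "x \<in> K" "norm (x - y) \<le> 1" for x y
    unfolding K'_def using that by (intro CollectI exI[of _ x] exI[of _ "y - x"]) (auto simp: norm_minus_commute)
  show ?thesis
  proof
    show "min (e / 2) 1 > 0" using e by simp
    fix x y :: 'a assume n: "norm (x - y) \<le> min (e / 2) 1"
    show "norm (f y - f x) \<le> d"
    proof (cases "x \<in> K \<or> y \<in> K")
      case True
      then have "x \<in> K'" "y \<in> K'" using near[of x x] near[of x y] near[of y x] near[of y y] n by (auto simp: norm_minus_commute)
      then show ?thesis using e(2)[of x y] n e(1) by (simp add: dist_norm norm_minus_commute)
    next
      case False
      then show ?thesis using K(2)[of x] K(2)[of y] d by auto
    qed
  qed
qed

text \<open>Mollification approximates \<open>\<phi>\<close> and its gradient uniformly, both being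
  uniformly continuous. The compact set \<open>K'\<close> is fixed before \<open>d\<close> is
  chosen, so all approximants share it.\<close>

lemma smooth_approximation:
  fixes \<phi> :: "'a::euclidean_space \<Rightarrow> real"
  assumes \<phi>: "cgrad \<phi> D" "compact K" "\<And>x. x \<notin> K \<Longrightarrow> \<phi> x = 0" and U: "open U" "K \<subseteq> U"
  obtains K' where "compact K'" "K \<subseteq> K'" "K' \<subseteq> U"
    "\<And>d. d > 0 \<Longrightarrow> \<exists>\<psi> E. smooth \<psi> \<and> cgrad \<psi> E \<and> (\<forall>x. x \<notin> K' \<longrightarrow> \<psi> x = 0) \<and> (\<forall>x. \<bar>\<psi> x - \<phi> x\<bar> \<le> d) \<and> (\<forall>x. norm (E x - D x) \<le> d)"
proof -
  obtain r where r: "r > 0" "(\<Union>x\<in>K. cball x r) \<subseteq> U" using compact_subset_open_imp_cball_epsilon_subset[OF \<phi>(2) U] by blast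
  define K' where "K' = {x + y | x y. x \<in> K \<and> y \<in> cball 0 r}"
  have K': "compact K'" unfolding K'_def by (intro compact_sums \<phi> compact_cball)
  have "K' \<subseteq> (\<Union>x\<in>K. cball x r)" by (auto simp: K'_def dist_norm)
  then have K'U: "K' \<subseteq> U" using r(2) by blast
  have near: "y \<in> K'" if "x \<in> K" "norm (y - x) \<le> r" for x y
    unfolding K'_def using that by (intro CollectI exI[of _ x] exI[of _ "y - x"]) auto
  have KK': "K \<subseteq> K'" using near[of x x for x] r(1) by auto
  have D0: "D x = 0" if "x \<notin> K" for x by (rule cgrad_zero_outside[OF \<phi>(1) compact_imp_closed[OF \<phi>(2)] \<phi>(3) that])
  have l\<phi>: "locint \<phi>" by (rule locint_continuous[OF cgrad_continuous[OF \<phi>(1)]])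
  obtain M where M: "\<And>x. x \<in> K \<Longrightarrow> norm x \<le> M" using compact_imp_bounded[OF \<phi>(2)] by (auto simp: bounded_iff)
  show ?thesis
  proof (rule that[OF K' KK' K'U])
    fix d :: real assume d: "d > 0"
    \<comment> \<open>Gradients are estimated by components, and the norm is at most the sum over
      \<open>DIM('a)\<close> of them.\<close>
    define d' where "d' = d / DIM('a)"
    have d': "d' > 0" "d' \<le> d" using d DIM_positive[where 'a='a] unfolding d'_def by (auto simp: divide_le_eq)
    obtain e1 where e1: "e1 > 0" "\<And>x y. norm (x - y) \<le> e1 \<Longrightarrow> norm (\<phi> y - \<phi> x) \<le> d'"
      by (rule uniform_continuity_compact_support[OF cgrad_continuous[OF \<phi>(1)] \<phi>(2) _ d'(1)]) (use \<phi>(3) in blast)+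
    obtain e2 where e2: "e2 > 0" "\<And>x y. norm (x - y) \<le> e2 \<Longrightarrow> norm (D y - D x) \<le> d'"
      by (rule uniform_continuity_compact_support[OF cgrad_continuous_grad[OF \<phi>(1)] \<phi>(2) _ d'(1)]) (use D0 in blast)+
    define e where "e = min r (min e1 e2)"
    have e: "e > 0" "e \<le> r" "e \<le> e1" "e \<le> e2" using r e1 e2 by (auto simp: e_def)
    define \<psi> where "\<psi> = conv \<phi> (moll e)"
    have mm: "moll e \<in> borel_fun" by (rule borel_measurable_moll)
    have lm: "locint (moll e :: 'a \<Rightarrow> real)" by (rule locint_integrable[OF moll_integrable[OF e(1)]])
    have sm: "smooth \<psi>" unfolding \<psi>_def by (rule smooth_conv[OF l\<phi> smooth_moll, of e]) (rule moll_support[OF e(1)])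
    \<comment> \<open>By commutativity of the convolution the derivative may fall on
      \<open>\<phi>\<close>, so the gradient of the mollification is the mollified
      \<open>D\<close>.\<close>
    define E where "E = conv (moll e) D"
    have "\<psi> = conv (moll e) \<phi>" unfolding \<psi>_def by (intro ext conv_commute borel_measurable_cgrad[OF \<phi>(1)] mm)
    moreover have "cgrad (conv (moll e) \<phi>) E"
      unfolding E_def by (rule cgrad_conv[OF lm \<phi>(1), of M]) (use M \<phi>(3) in force)
    ultimately have cE: "cgrad \<psi> E" by simp
    have sup: "\<psi> x = 0" if "x \<notin> K'" for x
    proof -
      have "\<phi> y *\<^sub>R moll e (x - y) = 0" for y
      proof (cases "y \<in> K")
        case True
        then have "norm (x - y) > e" using near[OF True, of x] that e(2) by force
        then show ?thesis by (simp add: moll_support[OF e(1)])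
      qed (use \<phi>(3) in simp)
      then show ?thesis unfolding \<psi>_def conv_def by (simp only: integral_zero)
    qed
    have b1: "\<bar>\<psi> x - \<phi> x\<bar> \<le> d" for x
      unfolding \<psi>_def
      by (rule order_trans[OF conv_moll_uniform[OF e(1) l\<phi>] d'(2)]) (use e1(2) e(3) in \<open>force simp: real_norm_def\<close>)
    have b2: "norm (E x - D x) \<le> d" for x
    proof -
      have comp: "\<bar>(E x - D x) \<bullet> b\<bar> \<le> d'" if b: "b \<in> Basis" for b
      proof -
        have c: "continuous_on UNIV (\<lambda>y. D y \<bullet> b)" by (intro continuous_intros cgrad_continuous_grad[OF \<phi>(1)])
        have i: "L1 (\<lambda>y. moll e y *\<^sub>R D (x - y))"
          by (rule conv_integrable[OF lm cgrad_continuous_grad[OF \<phi>(1)], where r=M and x=x]) (use M D0 in force)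
        have "E x \<bullet> b = conv (moll e) (\<lambda>y. D y \<bullet> b) x"
          unfolding E_def conv_def using integral_inner_left[of b lborel, OF i] by simp
        also have "\<dots> = conv (\<lambda>y. D y \<bullet> b) (moll e) x"
          by (rule conv_commute[OF mm borel_measurable_continuous_onI[OF c]])
        finally have eq: "(E x - D x) \<bullet> b = conv (\<lambda>y. D y \<bullet> b) (moll e) x - D x \<bullet> b" by (simp add: inner_diff_left)
        show ?thesis
          unfolding eq
        proof (rule conv_moll_uniform[OF e(1) locint_continuous[OF c]])
          fix y assume "norm (x - y) \<le> e"
          then have "norm (D y - D x) \<le> d'" using e2(2)[of x y] e(4) by linarith
          then show "\<bar>D y \<bullet> b - D x \<bullet> b\<bar> \<le> d'" using Basis_le_norm[OF b, of "D y - D x"] by (simp add: inner_diff_left)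
        qed
      qed
      have "norm (E x - D x) \<le> (\<Sum>b\<in>Basis. \<bar>(E x - D x) \<bullet> b\<bar>)" by (rule norm_le_l1)
      also have "\<dots> \<le> of_nat DIM('a) * d'" by (rule sum_bounded_above) (rule comp)
      also have "\<dots> = d" by (simp add: d'_def)
      finally show ?thesis .
    qed
    show "\<exists>\<psi> E. smooth \<psi> \<and> cgrad \<psi> E \<and> (\<forall>x. x \<notin> K' \<longrightarrow> \<psi> x = 0) \<and> (\<forall>x. \<bar>\<psi> x - \<phi> x\<bar> \<le> d) \<and> (\<forall>x. norm (E x - D x) \<le> d)"
      using sm cE sup b1 b2 by blast
  qed
qed

text \<open>Both sides of the equation are continuous in the C1 norm of the test function as long as
  the supports stay in one compact set, so the identity passes to limits of smooth test
  functions.\<close>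

lemma weak_sol_smoothI:
  fixes b :: "'a::euclidean_space \<Rightarrow> 'a" and u0 :: "'a \<Rightarrow> real" and u :: "real \<times> 'a \<Rightarrow> real"
  assumes bm[measurable]: "b \<in> borel_fun" and \<omega>: "open \<omega>"
    and bi: "\<And>K. compact K \<Longrightarrow> K \<subseteq> \<omega> \<Longrightarrow> L1 (\<lambda>x. indicator K x * (1 + norm (b x)))"
    and um[measurable]: "u \<in> borel_fun" and u0m[measurable]: "u0 \<in> borel_fun"
    and ub: "\<And>z. \<bar>u z\<bar> \<le> C" "\<And>x. \<bar>u0 x\<bar> \<le> C"
    and H: "\<And>\<phi> D K. smooth \<phi> \<Longrightarrow> cgrad \<phi> D \<Longrightarrow> compact K \<Longrightarrow> K \<subseteq> UNIV \<times> \<omega> \<Longrightarrow> (\<And>z. z \<notin> K \<Longrightarrow> \<phi> z = 0) \<Longrightarrow>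
      (LBINT z. future z * (u z * flux b D z)) = - (LBINT x. u0 x * \<phi> (0, x))"
  shows "weak_sol \<omega> b u0 u"
  unfolding weak_sol_def
proof (intro allI impI)
  fix \<phi> :: "real \<times> 'a \<Rightarrow> real" and D K
  assume \<phi>: "cgrad \<phi> D" "compact K" "K \<subseteq> UNIV \<times> \<omega>" and "\<forall>z. z \<notin> K \<longrightarrow> \<phi> z = 0"
  then have \<phi>0: "\<And>z. z \<notin> K \<Longrightarrow> \<phi> z = 0" by blast
  have C: "C \<ge> 0" using ub(2)[of 0] by linarith
  have Uo: "open (UNIV \<times> \<omega> :: (real \<times> 'a) set)" using \<omega> by (intro open_Times) auto
  obtain K' where K': "compact K'" "K \<subseteq> K'" "K' \<subseteq> UNIV \<times> \<omega>"
    "\<And>d. d > 0 \<Longrightarrow> \<exists>\<psi> E. smooth \<psi> \<and> cgrad \<psi> E \<and> (\<forall>x. x \<notin> K' \<longrightarrow> \<psi> x = 0) \<and> (\<forall>x. \<bar>\<psi> x - \<phi> x\<bar> \<le> d) \<and> (\<forall>x. norm (E x - D x) \<le> d)"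
    by (rule smooth_approximation[OF \<phi>(1,2) _ Uo \<phi>(3)]) ((rule \<phi>0; assumption), (rule that; assumption))
  define K0 where "K0 = snd ` K'"
  have K0: "compact K0" "K0 \<subseteq> \<omega>" using K'(1,3) by (auto simp: K0_def intro!: compact_continuous_image continuous_intros)
  have K0m[measurable]: "K0 \<in> sets borel" using K0(1) by (simp add: borel_compact)
  obtain T where T: "T > 0" "\<And>z. z \<in> K' \<Longrightarrow> \<bar>fst z\<bar> \<le> T" using compact_subset_time_strip[OF K'(1)] by blast
  define v where "v z = future z * u z" for z
  have vm[measurable]: "v \<in> borel_fun"
    unfolding v_def[abs_def] using borel_fst_snd(1)[where 'a=real and 'b='a] by measurable
  have vb: "\<bar>v z\<bar> \<le> C" for z using ub(1)[of z] C by (auto simp: v_def indicator_def)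
  have [measurable]: "(\<lambda>z::real \<times> 'a. (1::real, b (snd z))) \<in> borel_fun" by (intro borel_Pair) measurable
  define I where "I E = (LBINT z. v z * flux b E z)" for E :: "real \<times> 'a \<Rightarrow> real \<times> 'a"
  define J where "J \<psi> = (LBINT x. u0 x * \<psi> (0, x))" for \<psi> :: "real \<times> 'a \<Rightarrow> real"
  have vI: "(LBINT z. future z * (u z * flux b E z)) = I E" for E
    by (simp add: I_def v_def mult.assoc)
  define w where "w z = C * (indicator {-T..T} (fst z) * (indicator K0 (snd z) * (1 + norm (b (snd z)))))" for z
  have wi: "L1 w"
    unfolding w_def[abs_def]
    by (intro integrable_mult_right integrable_prod_mult[of "indicator {-T..T}" "\<lambda>x. indicator K0 x * (1 + norm (b x))"] integrable_indicator_Icc bi K0)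
  have i0: "L1 (\<lambda>x. C * indicator K0 x)"
    by (intro integrable_mult_right integrable_real_indicator) (use emeasure_compact_finite[OF K0(1)] in \<open>auto simp: less_top\<close>)
  define A where "A = (LBINT z. w z) + (LBINT x. C * indicator K0 x)"
  \<comment> \<open>An approximant with error \<open>d\<close> satisfies the equation exactly, so
    the defect for \<open>\<phi>\<close> is at most \<open>d\<close> times a constant independent of
    \<open>d\<close>.\<close>
  have key: "\<bar>I D + J \<phi>\<bar> \<le> d * A" if d: "d > 0" for d
  proof -
    obtain \<psi> E where \<psi>: "smooth \<psi>" "cgrad \<psi> E" "\<And>x. x \<notin> K' \<Longrightarrow> \<psi> x = 0" "\<And>x. \<bar>\<psi> x - \<phi> x\<bar> \<le> d" "\<And>x. norm (E x - D x) \<le> d"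
      using K'(4)[OF d] by blast
    have \<phi>0': "\<phi> z = 0" if "z \<notin> K'" for z using \<phi>0 K'(2) that by blast
    have E0: "E z = 0" if "z \<notin> K'" for z
      by (rule cgrad_zero_outside[OF \<psi>(2) compact_imp_closed[OF K'(1)] \<psi>(3) that])
    have D0: "D z = 0" if "z \<notin> K'" for z
      by (rule cgrad_zero_outside[OF \<phi>(1) compact_imp_closed[OF K'(1)] \<phi>0' that])
    have K'K0: "K' \<subseteq> UNIV \<times> K0" by (auto simp: K0_def image_iff) force
    have iE: "L1 (\<lambda>z. v z * flux b E z)"
      by (rule integrable_flux_test[OF bm K0m bi[OF K0] cgrad_continuous_grad[OF \<psi>(2)] K'(1) K'K0 E0 vm vb])
    have iD: "L1 (\<lambda>z. v z * flux b D z)"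
      by (rule integrable_flux_test[OF bm K0m bi[OF K0] cgrad_continuous_grad[OF \<phi>(1)] K'(1) K'K0 D0 vm vb])
    have "I E = - J \<psi>" unfolding vI[symmetric] J_def by (rule H[OF \<psi>(1,2) K'(1,3) \<psi>(3)])
    moreover have "\<bar>I D - I E\<bar> \<le> d * (LBINT z. w z)"
    proof -
      have "I D - I E = (LBINT z. v z * flux b D z - v z * flux b E z)"
        unfolding I_def by (rule Bochner_Integration.integral_diff[OF iD iE, symmetric])
      also have "norm \<dots> \<le> (LBINT z. d * w z)"
      proof (rule Bochner_Integration.integral_norm_bound_integral)
        fix z
        show "norm (v z * flux b D z - v z * flux b E z) \<le> d * w z"
        proof (cases "z \<in> K'")
          case True
          have "\<bar>(E z - D z) \<bullet> (1, b (snd z))\<bar> \<le> d * (1 + norm (b (snd z)))"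
            by (rule order_trans[OF Cauchy_Schwarz_ineq2], intro mult_mono \<psi>(5) order_trans[OF norm_Pair_le]) (use d in auto)
          then have "\<bar>v z * ((E z - D z) \<bullet> (1, b (snd z)))\<bar> \<le> C * (d * (1 + norm (b (snd z))))"
            unfolding abs_mult by (intro mult_mono vb C) auto
          moreover have "w z = C * (1 + norm (b (snd z)))" using T(2)[OF True] True by (simp add: w_def K0_def abs_le_iff)
          ultimately show ?thesis by (simp add: inner_diff_left algebra_simps abs_minus_commute)
        next
          case False
          have "0 \<le> w z" using C by (auto simp: w_def intro!: mult_nonneg_nonneg)
          then show ?thesis using E0[OF False] D0[OF False] d by simp
        qed
      qed (use iD iE wi in auto)
      finally show ?thesis by simp
    qed
    moreover have "\<bar>J \<phi> - J \<psi>\<bar> \<le> d * (LBINT x. C * indicator K0 x)"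
    proof -
      have "J \<phi> - J \<psi> = (LBINT x. u0 x * \<phi> (0, x) - u0 x * \<psi> (0, x))"
        unfolding J_def by (rule Bochner_Integration.integral_diff[OF integrable_slice_test[OF \<phi>(1) K'(1) \<phi>0' u0m ub(2)] integrable_slice_test[OF \<psi>(2) K'(1) \<psi>(3) u0m ub(2)], symmetric])
      also have "norm \<dots> \<le> (LBINT x. d * (C * indicator K0 x))"
      proof (rule Bochner_Integration.integral_norm_bound_integral)
        fix x
        show "norm (u0 x * \<phi> (0, x) - u0 x * \<psi> (0, x)) \<le> d * (C * indicator K0 x)"
        proof (cases "x \<in> K0")
          case True
          have "\<bar>u0 x * (\<psi> (0, x) - \<phi> (0, x))\<bar> \<le> C * d" unfolding abs_mult by (intro mult_mono ub \<psi> C) auto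
          then show ?thesis using True by (simp add: algebra_simps abs_minus_commute)
        next
          case False
          then have "(0, x) \<notin> K'" by (force simp: K0_def)
          then show ?thesis using \<phi>0' \<psi>(3) False by simp
        qed
      qed (use integrable_slice_test[OF \<phi>(1) K'(1) \<phi>0' u0m ub(2)] integrable_slice_test[OF \<psi>(2) K'(1) \<psi>(3) u0m ub(2)] i0 in auto)
      finally show ?thesis by simp
    qed
    ultimately show ?thesis unfolding A_def by (simp add: ring_distribs)
  qed
  have "I D + J \<phi> = 0"
  proof (rule ccontr)
    assume n: "I D + J \<phi> \<noteq> 0"
    have A: "A \<ge> 0" using key[of 1] by simp
    have "\<bar>I D + J \<phi>\<bar> \<le> \<bar>I D + J \<phi>\<bar> / (2 * (A + 1)) * A" by (rule key) (use n A in simp)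
    also have "\<dots> < \<bar>I D + J \<phi>\<bar>" using n A by (simp add: field_simps add_nonneg_pos)
    finally show False by simp
  qed
  then show "(LBINT z. future z * (u z * flux b D z)) = - (LBINT x. u0 x * \<phi> (0, x))"
    unfolding vI J_def by linarith
qed

section \<open>Locality of weak solutions\<close>

lemma weak_sol_mono: "weak_sol \<omega> b u0 u \<Longrightarrow> \<omega>' \<subseteq> \<omega> \<Longrightarrow> weak_sol \<omega>' b u0 u"
  unfolding weak_sol_def by (meson Sigma_mono order_trans subset_refl)

lemma weak_sol_cong_field:
  fixes b b' :: "'a::euclidean_space \<Rightarrow> 'a"
  assumes w: "weak_sol \<omega> b u0 u" and [measurable]: "b \<in> borel_fun" "b' \<in> borel_fun" "u \<in> borel_fun"
    and eq: "AE x in lborel. x \<in> \<omega> \<longrightarrow> b' x = b x"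
  shows "weak_sol \<omega> b' u0 u"
  unfolding weak_sol_def
proof (intro allI impI)
  fix \<phi> :: "real \<times> 'a \<Rightarrow> real" and D K
  assume \<phi>: "cgrad \<phi> D" "compact K" "K \<subseteq> UNIV \<times> \<omega>" "\<forall>z. z \<notin> K \<longrightarrow> \<phi> z = 0"
  have D0: "D z = 0" if "z \<notin> K" for z
    by (rule cgrad_zero_outside[OF \<phi>(1) compact_imp_closed[OF \<phi>(2)] _ that]) (use \<phi>(4) in blast)
  have [measurable]: "D \<in> borel_fun" by (rule borel_measurable_cgrad_grad[OF \<phi>(1)])
  have [measurable]: "(\<lambda>z::real \<times> 'a. (1::real, b (snd z))) \<in> borel_fun" "(\<lambda>z::real \<times> 'a. (1::real, b' (snd z))) \<in> borel_fun"
    by (intro borel_Pair; measurable)+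
  have [measurable]: "(fst :: real \<times> 'a \<Rightarrow> real) \<in> borel_fun" by (rule borel_fst_snd)
  have "(LBINT z. future z * (u z * flux b' D z)) = (LBINT z. future z * (u z * flux b D z))"
  proof (rule integral_cong_AE)
    show "AE z in lborel. future z * (u z * flux b' D z) = future z * (u z * flux b D z)"
      using AE_lborel_fst_snd(2)[OF eq]
    proof eventually_elim
      case (elim z)
      then show ?case using D0[of z] \<phi>(3) by (cases "z \<in> K") auto
    qed
  qed measurable
  then show "(LBINT z. future z * (u z * flux b' D z)) = - (LBINT x. u0 x * \<phi> (0, x))"
    using weak_solD[OF w \<phi>(1-3)] \<phi>(4) by simp
qed

text \<open>A partition of unity, removed one ball at a time. Finitely many balls, on whose doubles
  the equation holds, cover the spatial projection of the support. A cutoff around one of them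
  splits the test function into a part supported in the double ball and a remainder whose support
  the other balls cover; the equation is linear in the test function.\<close>

lemma weak_sol_local:
  fixes b :: "'a::euclidean_space \<Rightarrow> 'a" and u0 :: "'a \<Rightarrow> real" and u :: "real \<times> 'a \<Rightarrow> real"
  assumes bm[measurable]: "b \<in> borel_fun"
    and bi: "\<And>K. compact K \<Longrightarrow> K \<subseteq> \<omega> \<Longrightarrow> L1 (\<lambda>x. indicator K x * (1 + norm (b x)))"
    and um[measurable]: "u \<in> borel_fun" and u0m[measurable]: "u0 \<in> borel_fun"
    and ub: "\<And>z. \<bar>u z\<bar> \<le> C" "\<And>x. \<bar>u0 x\<bar> \<le> C"
    and loc: "\<And>x. x \<in> \<omega> \<Longrightarrow> \<exists>V. open V \<and> x \<in> V \<and> weak_sol V b u0 u"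
  shows "weak_sol \<omega> b u0 u"
proof -
  define I where "I E = (LBINT z. future z * (u z * flux b E z))" for E :: "real \<times> 'a \<Rightarrow> real \<times> 'a"
  define J where "J \<psi> = (LBINT x. u0 x * \<psi> (0, x))" for \<psi> :: "real \<times> 'a \<Rightarrow> real"
  have main: "I D = - J \<phi>"
    if "finite F" "cgrad \<phi> D" "compact K" "K \<subseteq> UNIV \<times> \<omega>" "\<And>z. z \<notin> K \<Longrightarrow> \<phi> z = 0"
      "\<And>x \<rho>. (x, \<rho>) \<in> F \<Longrightarrow> \<rho> > 0 \<and> weak_sol (cball x (2 * \<rho>)) b u0 u" "snd ` K \<subseteq> (\<Union>(x, \<rho>)\<in>F. ball x \<rho>)"
    for F and \<phi> :: "real \<times> 'a \<Rightarrow> real" and D K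
    using that
  proof (induction F arbitrary: \<phi> D K rule: finite_induct)
    case empty
    then have K: "K = {}" by auto
    then have "D z = 0" for z by (intro cgrad_const_on_open[OF empty(1) open_UNIV]) (use empty(4) in auto)
    moreover have "\<phi> z = 0" for z using K empty(4) by auto
    ultimately show ?case by (simp add: I_def J_def)
  next
    case (insert p F)
    obtain x \<rho> where p: "p = (x, \<rho>)" by (cases p)
    have \<rho>: "\<rho> > 0" "weak_sol (cball x (2 * \<rho>)) b u0 u" using insert.prems(5)[of x \<rho>] p by auto
    \<comment> \<open>Applied to the squared distance from \<open>x\<close>, this cutoff is 1 up to
      distance \<open>\<rho>\<close> and 0 from distance \<open>2 * \<rho>\<close> on, since the
      squares differ by three times the square of \<open>\<rho>\<close>.\<close>
    obtain c' where c': "C1 (cutoff (\<rho>\<^sup>2) (3 * \<rho>\<^sup>2)) c'" using C1_cutoff by blast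
    have sq: "cgrad (\<lambda>y. (y - x) \<bullet> (y - x)) (\<lambda>y. 2 *\<^sub>R (y - x))"
      unfolding cgrad_def by (auto intro!: derivative_eq_intros continuous_intros simp: inner_commute)
    define \<theta> where "\<theta> y = cutoff (\<rho>\<^sup>2) (3 * \<rho>\<^sup>2) ((y - x) \<bullet> (y - x))" for y
    obtain T where T: "cgrad \<theta> T" using cgrad_C1[OF c' sq] unfolding \<theta>_def[abs_def] by blast
    have e: "3 * \<rho>\<^sup>2 > 0" using \<rho>(1) by simp
    have \<theta>1: "\<theta> y = 1" if "y \<in> ball x \<rho>" for y
      unfolding \<theta>_def
    proof (rule cutoff_inside[OF e])
      have "norm (y - x) \<le> \<rho>" using that by (simp add: dist_norm norm_minus_commute)
      then show "\<bar>(y - x) \<bullet> (y - x)\<bar> \<le> \<rho>\<^sup>2" by (simp add: power2_norm_eq_inner[symmetric] power_mono)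
    qed
    have \<theta>0: "\<theta> y = 0" if "y \<notin> cball x (2 * \<rho>)" for y
      unfolding \<theta>_def
    proof (rule cutoff_outside[OF e])
      have "2 * \<rho> \<le> norm (y - x)" using that by (simp add: dist_norm norm_minus_commute)
      then have "(2 * \<rho>)\<^sup>2 \<le> (norm (y - x))\<^sup>2" using \<rho>(1) by (intro power_mono) auto
      then show "\<rho>\<^sup>2 + 3 * \<rho>\<^sup>2 \<le> \<bar>(y - x) \<bullet> (y - x)\<bar>" by (simp add: power2_norm_eq_inner[symmetric] power_mult_distrib)
    qed
    define \<phi>1 where "\<phi>1 z = \<phi> z * \<theta> (snd z)" for z
    define \<phi>2 where "\<phi>2 z = \<phi> z - \<phi>1 z" for z
    obtain D1 where D1: "cgrad \<phi>1 D1" using cgrad_mult[OF insert.prems(1) cgrad_comp_snd[OF T]] unfolding \<phi>1_def[abs_def] by blast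
    define D2 where "D2 z = D z - D1 z" for z
    have D2: "cgrad \<phi>2 D2" using cgrad_diff[OF insert.prems(1) D1] unfolding \<phi>2_def[abs_def] D2_def[abs_def] .
    define K1 where "K1 = K \<inter> (UNIV \<times> cball x (2 * \<rho>))"
    define K2 where "K2 = K - (UNIV \<times> ball x \<rho>)"
    have K1: "compact K1" unfolding K1_def by (intro compact_Int_closed insert.prems(2) closed_Times) auto
    have K2: "compact K2" unfolding K2_def by (intro compact_diff insert.prems(2) open_Times) auto
    have s1: "\<phi>1 z = 0" if "z \<notin> K1" for z
      using that insert.prems(4)[of z] \<theta>0[of "snd z"] by (auto simp: K1_def \<phi>1_def mem_Times_iff)
    have s2: "\<phi>2 z = 0" if "z \<notin> K2" for z
      using that insert.prems(4)[of z] \<theta>1[of "snd z"] by (auto simp: K2_def \<phi>2_def \<phi>1_def mem_Times_iff)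
    have K12: "K1 \<subseteq> UNIV \<times> \<omega>" "K2 \<subseteq> UNIV \<times> \<omega>" using insert.prems(3) by (auto simp: K1_def K2_def)
    have 1: "I D1 = - J \<phi>1"
      unfolding I_def J_def by (rule weak_solD[OF \<rho>(2) D1 K1 _ s1]) (auto simp: K1_def)
    have 2: "I D2 = - J \<phi>2"
    proof (rule insert.IH[OF D2 K2 K12(2) s2])
      show "snd ` K2 \<subseteq> (\<Union>(x, \<rho>)\<in>F. ball x \<rho>)"
      proof
        fix y assume "y \<in> snd ` K2"
        then have "y \<in> snd ` K" "y \<notin> ball x \<rho>" by (auto simp: K2_def)
        moreover have "snd ` K \<subseteq> ball x \<rho> \<union> (\<Union>(x, \<rho>)\<in>F. ball x \<rho>)" using insert.prems(6) by (simp add: p)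
        ultimately show "y \<in> (\<Union>(x, \<rho>)\<in>F. ball x \<rho>)" by blast
      qed
    qed (use insert.prems(5) in auto)
    have "I D = (LBINT z. future z * (u z * flux b D1 z) + future z * (u z * flux b D2 z))"
      unfolding I_def D2_def by (intro Bochner_Integration.integral_cong refl) (simp add: inner_diff_left algebra_simps)
    also have "\<dots> = I D1 + I D2"
      unfolding I_def by (rule Bochner_Integration.integral_add[OF integrable_time_flux_test[OF bm bi D1 K1 K12(1) s1 um ub(1)] integrable_time_flux_test[OF bm bi D2 K2 K12(2) s2 um ub(1)]])
    also have "\<dots> = - (J \<phi>1 + J \<phi>2)" using 1 2 by simp
    also have "J \<phi>1 + J \<phi>2 = (LBINT x. u0 x * \<phi>1 (0, x) + u0 x * \<phi>2 (0, x))"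
      unfolding J_def by (rule Bochner_Integration.integral_add[OF integrable_slice_test[OF D1 K1 s1 u0m ub(2)] integrable_slice_test[OF D2 K2 s2 u0m ub(2)], symmetric])
    also have "\<dots> = J \<phi>" unfolding J_def \<phi>2_def by (intro Bochner_Integration.integral_cong refl) (simp add: algebra_simps)
    finally show ?case .
  qed
  show ?thesis
    unfolding weak_sol_def
  proof (intro allI impI)
    fix \<phi> :: "real \<times> 'a \<Rightarrow> real" and D K
    assume \<phi>: "cgrad \<phi> D" "compact K" "K \<subseteq> UNIV \<times> \<omega>" "\<forall>z. z \<notin> K \<longrightarrow> \<phi> z = 0"
    have "\<exists>\<rho>>0. weak_sol (cball x (2 * \<rho>)) b u0 u" if "x \<in> \<omega>" for x
    proof -
      obtain V where V: "open V" "x \<in> V" "weak_sol V b u0 u" using loc[OF \<open>x \<in> \<omega>\<close>] by blast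
      obtain r where "r > 0" "cball x r \<subseteq> V" using V(1,2) open_contains_cball by blast
      then show ?thesis using weak_sol_mono[OF V(3)] by (intro exI[of _ "r / 2"]) auto
    qed
    then obtain \<rho> where \<rho>: "\<And>x. x \<in> \<omega> \<Longrightarrow> \<rho> x > 0 \<and> weak_sol (cball x (2 * \<rho> x)) b u0 u" by metis
    have K0: "compact (snd ` K)" using \<phi>(2) by (intro compact_continuous_image continuous_intros)
    have "snd ` K \<subseteq> (\<Union>x\<in>snd ` K. ball x (\<rho> x))" using \<rho> \<phi>(3) by force
    then obtain X where X: "X \<subseteq> snd ` K" "finite X" "snd ` K \<subseteq> (\<Union>x\<in>X. ball x (\<rho> x))"
      using compactE_image[OF K0, of "snd ` K" "\<lambda>x. ball x (\<rho> x)"] by blast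
    have "X \<subseteq> \<omega>" using X(1) \<phi>(3) by force
    then have "0 < \<rho> x" "weak_sol (cball x (2 * \<rho> x)) b u0 u" if "x \<in> X" for x using \<rho> that by auto
    note X\<rho> = this
    have "I D = - J \<phi>"
      by (rule main[OF _ \<phi>(1-3), of "(\<lambda>x. (x, \<rho> x)) ` X"]) (use X(2,3) X\<rho> \<phi>(4) in auto)
    then show "(LBINT z. future z * (u z * flux b D z)) = - (LBINT x. u0 x * \<phi> (0, x))"
      unfolding I_def J_def .
  qed
qed

section \<open>Isometries and reduction to a positive first component\<close>

lemma distr_lborel_Pair_map:
  fixes T :: "'a::euclidean_space \<Rightarrow> 'b::euclidean_space"
  assumes T: "distr lborel borel T = lborel" and Tm[measurable]: "T \<in> borel_fun"
  shows "distr lborel borel (\<lambda>z::real \<times> 'a. (fst z, T (snd z))) = lborel"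
proof -
  have "lborel = (lborel :: real measure) \<Otimes>\<^sub>M (lborel :: 'b measure)" by (simp add: lborel_prod)
  also have "\<dots> = distr lborel borel (\<lambda>t::real. t) \<Otimes>\<^sub>M distr lborel borel T" by (simp add: T distr_id2)
  also have "\<dots> = distr (lborel \<Otimes>\<^sub>M lborel) (borel \<Otimes>\<^sub>M borel) (\<lambda>(x, y). (x, T y))"
    by (rule pair_measure_distr) (auto simp: T intro: lborel.sigma_finite_measure_axioms)
  also have "\<dots> = distr lborel borel (\<lambda>z. (fst z, T (snd z)))"
    by (simp add: lborel_prod borel_prod case_prod_unfold)
  finally show ?thesis by simp
qed

text \<open>\<open>M\<close> is both inverse and adjoint of \<open>L\<close>, so pairings are
  preserved when test functions are carried over by the inverse of \<open>T\<close> and the field is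
  pulled back by \<open>M\<close>. The two spaces may differ as types, which also covers the
  identification of \<open>real^2\<close> with pairs.\<close>

lemma weak_sol_isometry:
  fixes L :: "'a::euclidean_space \<Rightarrow> 'b::euclidean_space" and M :: "'b \<Rightarrow> 'a"
  assumes w: "weak_sol \<omega> b u0 u" and L: "linear L" and M: "linear M" and adj: "\<And>x y. L x \<bullet> y = x \<bullet> M y"
    and inv1: "\<And>y. L (M y) = y" and inv2: "\<And>x. M (L x) = x" and c: "\<And>x. T x = c + L x"
    and d: "distr lborel borel T = lborel"
    and bm[measurable]: "b \<in> borel_fun" and um[measurable]: "u \<in> borel_fun" and u0m[measurable]: "u0 \<in> borel_fun"
  shows "weak_sol (T -` \<omega>) (\<lambda>x. M (b (T x))) (\<lambda>x. u0 (T x)) (\<lambda>z. u (fst z, T (snd z)))"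
  unfolding weak_sol_def
proof (intro allI impI)
  fix \<phi> :: "real \<times> 'a \<Rightarrow> real" and D K
  assume \<phi>: "cgrad \<phi> D" "compact K" "K \<subseteq> UNIV \<times> T -` \<omega>" "\<forall>z. z \<notin> K \<longrightarrow> \<phi> z = 0"
  have bl: "bounded_linear L" "bounded_linear M" using L M by (auto simp: linear_conv_bounded_linear)
  have Lc: "continuous_on S L" and Mc: "continuous_on S' M" for S S' using bl by (auto intro: linear_continuous_on)
  have Tc: "continuous_on UNIV T" unfolding c[abs_def] by (intro continuous_intros Lc)
  have Tm[measurable]: "T \<in> borel_fun" by (rule borel_measurable_continuous_onI[OF Tc])
  define S where "S y = M (y - c)" for y
  have ST: "S (T x) = x" for x by (simp add: S_def c inv2)
  have TS: "T (S y) = y" for y by (simp add: S_def c inv1)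
  have Sc: "continuous_on UNIV S" unfolding S_def[abs_def] by (rule continuous_on_compose2[OF Mc[of UNIV]]) (auto intro!: continuous_intros)
  define \<phi>' where "\<phi>' z = \<phi> (fst z, S (snd z))" for z
  define D' where "D' z = (fst (D (fst z, S (snd z))), L (snd (D (fst z, S (snd z)))))" for z
  have cS: "continuous_on UNIV (\<lambda>z::real \<times> 'b. (fst z, S (snd z)))"
    by (intro continuous_intros continuous_on_compose2[OF Sc]) auto
  have cD: "continuous_on UNIV (\<lambda>z::real \<times> 'b. D (fst z, S (snd z)))"
    by (rule continuous_on_compose2[OF cgrad_continuous_grad[OF \<phi>(1), of UNIV] cS]) auto
  have \<phi>': "cgrad \<phi>' D'"
    unfolding cgrad_def
  proof (intro conjI allI)
    show "continuous_on UNIV D'"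
      unfolding D'_def[abs_def] by (intro continuous_intros cD continuous_on_compose2[OF Lc[of UNIV]]) auto
    fix z
    have "((\<lambda>z::real \<times> 'b. (fst z, S (snd z))) has_derivative (\<lambda>v. (fst v, M (snd v)))) (at z)"
    proof (rule has_derivative_Pair)
      show "((\<lambda>z::real \<times> 'b. S (snd z)) has_derivative (\<lambda>v. M (snd v))) (at z)"
        unfolding S_def by (rule bounded_linear.has_derivative[OF bl(2)]) (auto intro!: derivative_eq_intros)
    qed (auto intro!: derivative_eq_intros)
    from has_derivative_compose[OF this cgradD[OF \<phi>(1)]]
    show "(\<phi>' has_derivative (\<bullet>) (D' z)) (at z)"
      unfolding \<phi>'_def[abs_def]
      by (rule has_derivative_eq_rhs) (auto simp: D'_def inner_prod_def adj)
  qed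
  define K' where "K' = (\<lambda>z. (fst z, T (snd z))) ` K"
  have K': "compact K'" unfolding K'_def
    by (rule compact_continuous_image[OF _ \<phi>(2)]) (intro continuous_intros continuous_on_compose2[OF Tc], auto)
  have K'\<omega>: "K' \<subseteq> UNIV \<times> \<omega>" using \<phi>(3) by (auto simp: K'_def)
  have \<phi>'0: "\<phi>' z = 0" if "z \<notin> K'" for z
  proof -
    have "(fst z, S (snd z)) \<notin> K"
    proof
      assume "(fst z, S (snd z)) \<in> K"
      then have "z \<in> K'" unfolding K'_def by (rule rev_image_eqI) (simp add: TS)
      then show False using that by simp
    qed
    then show ?thesis using \<phi>(4) by (simp add: \<phi>'_def)
  qed
  have [measurable]: "D' \<in> borel_fun" by (rule borel_measurable_cgrad_grad[OF \<phi>'])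
  have [measurable]: "(\<lambda>z::real \<times> 'b. (1::real, b (snd z))) \<in> borel_fun" by (intro borel_Pair) measurable
  have f[measurable]: "(fst :: real \<times> 'b \<Rightarrow> real) \<in> borel_fun" "(fst :: real \<times> 'a \<Rightarrow> real) \<in> borel_fun"
    by (rule borel_fst_snd)+
  define F where "F z = future z * (u z * flux b D' z)" for z
  have Fm: "F \<in> borel_fun" unfolding F_def[abs_def] by measurable
  have Tm2: "(\<lambda>z::real \<times> 'a. (fst z, T (snd z))) \<in> borel_fun" by (intro borel_Pair) measurable
  have "(LBINT z. future z * (u (fst z, T (snd z)) * (D z \<bullet> (1, M (b (T (snd z)))))))
      = (LBINT z. F (fst z, T (snd z)))"
    by (intro Bochner_Integration.integral_cong refl) (simp add: F_def D'_def ST inner_prod_def adj)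
  also have "\<dots> = (LBINT z. F z)"
    by (rule integral_distr_lborel(1)[OF distr_lborel_Pair_map[OF d Tm] Tm2 Fm])
  also have "\<dots> = - (LBINT x. u0 x * \<phi>' (0, x))"
    unfolding F_def by (rule weak_solD[OF w \<phi>' K' K'\<omega> \<phi>'0])
  also have "(LBINT x. u0 x * \<phi>' (0, x)) = (LBINT x. u0 (T x) * \<phi>' (0, T x))"
  proof (rule integral_distr_lborel(1)[OF d Tm, symmetric])
    have [measurable]: "(\<lambda>x. \<phi>' (0, x)) \<in> borel_fun"
      by (rule borel_measurable_continuous_onI, rule continuous_on_compose2[OF cgrad_continuous[OF \<phi>', of UNIV]]) (auto intro!: continuous_intros)
    show "(\<lambda>x. u0 x * \<phi>' (0, x)) \<in> borel_fun" by measurable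
  qed
  finally show "(LBINT z. future z * (u (fst z, T (snd z)) * (D z \<bullet> (1, M (b (T (snd z))))))) = - (LBINT x. u0 (T x) * \<phi> (0, x))"
    by (simp add: \<phi>'_def ST)
qed

lemma distr_lborel_orthogonal:
  fixes A :: "real^2 \<Rightarrow> real^2"
  assumes A: "orthogonal_transformation A"
  shows "distr lborel borel A = lborel"
proof (rule lborel_eqI[symmetric])
  have Ac: "continuous_on UNIV A" using A by (simp add: orthogonal_transformation_linear linear_continuous_on linear_linear)
  have Am[measurable]: "A \<in> borel_fun" by (rule borel_measurable_continuous_onI[OF Ac])
  fix l u :: "real^2" assume lu: "\<And>b. b \<in> Basis \<Longrightarrow> l \<bullet> b \<le> u \<bullet> b"
  obtain B where B: "orthogonal_transformation B" "\<And>x. B (A x) = x" "\<And>x. A (B x) = x"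
    using orthogonal_transformation_inv[OF A] orthogonal_transformation_bij[OF A]
    by (metis bij_inv_eq_iff)
  have pre: "A -` box l u = B ` box l u" using B(2,3) by (auto simp: image_iff) metis
  have lm: "box l u \<in> lmeasurable" by simp
  have op: "A -` box l u \<in> sets borel" by (rule borel_open[OF open_vimage[OF open_box Ac]])
  have bd: "B ` box l u \<in> lmeasurable" by (rule measurable_orthogonal_image[OF B(1) lm])
  have "emeasure (distr lborel borel A) (box l u) = emeasure lborel (A -` box l u)" by (simp add: emeasure_distr)
  also have "\<dots> = emeasure lebesgue (B ` box l u)" using op by (simp add: pre)
  also have "\<dots> = ennreal (measure lebesgue (B ` box l u))" by (rule emeasure_eq_measure2[OF bd])
  also have "\<dots> = ennreal (measure lebesgue (box l u))" by (simp only: measure_orthogonal_image[OF B(1) lm])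
  also have "\<dots> = emeasure lebesgue (box l u)" by (rule emeasure_eq_measure2[OF lm, symmetric])
  also have "\<dots> = ennreal (\<Prod>b\<in>Basis. (u - l) \<bullet> b)" using lu by (simp add: emeasure_lborel_box)
  finally show "emeasure (distr lborel borel A) (box l u) = ennreal (\<Prod>b\<in>Basis. (u - l) \<bullet> b)" .
qed simp

lemma borel_measurable_vec2: "(\<lambda>p::real \<times> real. vector [fst p, snd p] :: real^2) \<in> borel_fun"
proof (rule borel_measurable_continuous_onI)
  have "continuous_on UNIV (\<lambda>p::real \<times> real. \<chi> i::2. if i = 1 then fst p else snd p)"
  proof (rule continuous_on_vec_lambda)
    fix i :: 2 show "continuous_on UNIV (\<lambda>p::real \<times> real. if i = 1 then fst p else snd p)"
      by (cases "i = 1") (auto intro!: continuous_intros)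
  qed
  moreover have "(\<lambda>p::real \<times> real. vector [fst p, snd p] :: real^2) = (\<lambda>p. \<chi> i. if i = 1 then fst p else snd p)"
    by (auto simp: vec_eq_iff forall_2)
  ultimately show "continuous_on UNIV (\<lambda>p::real \<times> real. vector [fst p, snd p] :: real^2)" by (simp only:)
qed

lemma distr_lborel_vec2: "distr lborel borel (\<lambda>p::real \<times> real. vector [fst p, snd p] :: real^2) = lborel"
proof (rule lborel_eqI[symmetric])
  let ?J = "\<lambda>p::real \<times> real. vector [fst p, snd p] :: real^2"
  note [measurable] = borel_measurable_vec2
  have basis2: "(Basis :: (real^2) set) = {axis 1 1, axis 2 1}" by (auto simp: Basis_vec_def UNIV_2)
  have ne: "axis 1 1 \<noteq> (axis 2 1 :: real^2)" by (simp add: axis_eq_axis)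
  have basisp: "(Basis :: (real \<times> real) set) = {(1, 0), (0, 1)}" by (auto simp: Basis_prod_def)
  fix l u :: "real^2" assume lu: "\<And>b. b \<in> Basis \<Longrightarrow> l \<bullet> b \<le> u \<bullet> b"
  have lu': "l $ 1 \<le> u $ 1" "l $ 2 \<le> u $ 2" using lu[of "axis 1 1"] lu[of "axis 2 1"] by (auto simp: inner_axis)
  have pre: "?J -` box l u = box (l $ 1, l $ 2) (u $ 1, u $ 2)"
    by (auto simp: box_def basis2 basisp inner_axis)
  have "emeasure (distr lborel borel ?J) (box l u) = emeasure lborel (box (l $ 1, l $ 2) (u $ 1, u $ 2))"
    by (simp add: emeasure_distr pre)
  also have "\<dots> = ennreal (\<Prod>b\<in>Basis. (u - l) \<bullet> b)"
    using lu' ne by (simp add: emeasure_lborel_box_eq basis2 basisp inner_axis)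
  finally show "emeasure (distr lborel borel ?J) (box l u) = ennreal (\<Prod>b\<in>Basis. (u - l) \<bullet> b)" .
qed simp

lemma distr_lborel_comp:
  fixes S :: "'a::euclidean_space \<Rightarrow> 'b::euclidean_space" and T :: "'b \<Rightarrow> 'c::euclidean_space"
  assumes "distr lborel borel S = lborel" "distr lborel borel T = lborel" "S \<in> borel_fun" "T \<in> borel_fun"
  shows "distr lborel borel (\<lambda>x. T (S x)) = lborel"
  using distr_distr[of T borel borel S lborel] assms by (simp add: comp_def)

lemma distr_lborel_inverse:
  fixes S :: "'a::euclidean_space \<Rightarrow> 'b::euclidean_space" and T :: "'b \<Rightarrow> 'a"
  assumes "distr lborel borel S = lborel" "S \<in> borel_fun" "T \<in> borel_fun" "\<And>x. T (S x) = x"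
  shows "distr lborel borel T = lborel"
proof -
  have "distr (distr lborel borel S) borel T = distr lborel borel (T \<circ> S)" by (rule distr_distr) (use assms in auto)
  also have "\<dots> = lborel" using assms(4) by (simp add: comp_def distr_id2)
  finally show ?thesis using assms(1) by simp
qed

text \<open>An orthonormal frame with first vector \<open>e1\<close> identifies a neighbourhood of
  \<open>x0\<close> with a square on which the first component of the field is at least
  \<open>\<alpha>\<close>. The result of \<open>local_renormalization\<close> is then carried
  back.\<close>

lemma planar_local_renormalization:
  fixes b :: "real^2 \<Rightarrow> real^2" and u0 :: "real^2 \<Rightarrow> real" and u :: "real \<times> (real^2) \<Rightarrow> real"
  assumes bm[measurable]: "b \<in> borel_fun" and r: "r > 0" and \<alpha>: "\<alpha> > 0" and e1: "norm e1 = 1"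
    and dir: "\<And>y. y \<in> ball x0 r \<Longrightarrow> \<alpha> \<le> b y \<bullet> e1" and b2: "L1 (\<lambda>x. indicator (ball x0 r) x * (norm (b x))\<^sup>2)"
    and one: "weak_sol (ball x0 r) b (\<lambda>_. 1) (\<lambda>_. 1)" and w: "weak_sol (ball x0 r) b u0 u"
    and um[measurable]: "u \<in> borel_fun" and u0m[measurable]: "u0 \<in> borel_fun"
    and ub: "\<And>z. \<bar>u z\<bar> \<le> C" "\<And>x. \<bar>u0 x\<bar> \<le> C"
    and Lip: "\<And>x y. \<bar>\<beta> x - \<beta> y\<bar> \<le> L' * \<bar>x - y\<bar>"
  shows "\<exists>V. open V \<and> x0 \<in> V \<and> weak_sol V b (\<lambda>x. \<beta> (u0 x)) (\<lambda>z. \<beta> (u z))"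
proof -
  \<comment> \<open>\<open>e1\<close> turned by a quarter circle, completing an orthonormal
    frame.\<close>
  define e2 :: "real^2" where "e2 = vector [- (e1 $ 2), e1 $ 1]"
  have n1: "(e1 $ 1)\<^sup>2 + (e1 $ 2)\<^sup>2 = 1"
    using e1 by (simp add: norm_eq_1 inner_vec_def sum_2 power2_eq_square)
  define L where "L p = fst p *\<^sub>R e1 + snd p *\<^sub>R e2" for p :: "real \<times> real"
  define M where "M y = (y \<bullet> e1, y \<bullet> e2)" for y
  define T where "T p = x0 + L p" for p
  define S where "S y = - M x0 + M y" for y
  define J where "J p = (vector [fst p, snd p] :: real^2)" for p :: "real \<times> real"
  define A where "A v = (v $ 1) *\<^sub>R e1 + (v $ 2) *\<^sub>R e2" for v :: "real^2"
  have lL: "linear L" unfolding L_def[abs_def] by (intro linearI) (auto simp: algebra_simps)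
  have lM: "linear M" unfolding M_def[abs_def] by (intro linearI) (auto simp: inner_add_left)
  have lA: "linear A" unfolding A_def[abs_def] by (intro linearI) (auto simp: algebra_simps)
  have adj: "L x \<bullet> y = x \<bullet> M y" for x y by (simp add: L_def M_def inner_prod_def inner_add_left inner_add_right inner_commute)
  have adj': "M y \<bullet> x = y \<bullet> L x" for x y using adj[of x y] by (simp add: inner_commute)
  have ee: "e1 \<bullet> e1 = 1" "e2 \<bullet> e2 = 1" "e1 \<bullet> e2 = 0" "e2 \<bullet> e1 = 0"
    using n1 by (simp_all add: e2_def inner_vec_def sum_2 power2_eq_square add.commute)
  have inv2: "M (L p) = p" for p by (simp add: L_def M_def inner_add_left ee)
  have inv1: "L (M y) = y" for y
  proof -
    have "e1 $ 1 * e1 $ 1 = 1 - e1 $ 2 * e1 $ 2" using n1 by (simp add: power2_eq_square)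
    then show ?thesis
      unfolding vec_eq_iff forall_2 by (simp add: L_def M_def e2_def inner_vec_def sum_2) algebra
  qed
  have nL: "norm (L p) = norm p" for p using adj[of p "L p"] inv2[of p] by (simp add: norm_eq_sqrt_inner)
  have nM: "norm (M y) = norm y" for y using nL[of "M y"] inv1[of y] by simp
  have ST: "S (T p) = p" for p using lM by (simp add: S_def T_def linear_add inv2)
  have TS: "T (S y) = y" for y using lL lM by (simp add: S_def T_def linear_add linear_diff inv1)
  have ct: "continuous_on UNIV L" "continuous_on UNIV M" "continuous_on UNIV A"
    using lL lM lA by (auto intro: linear_continuous_on simp: linear_linear)
  have Tm[measurable]: "T \<in> borel_fun" unfolding T_def[abs_def]
    by (intro borel_measurable_continuous_onI continuous_intros ct)
  have Sm[measurable]: "S \<in> borel_fun" unfolding S_def[abs_def]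
    by (intro borel_measurable_continuous_onI continuous_intros ct)
  have Mm[measurable]: "M \<in> borel_fun" by (intro borel_measurable_continuous_onI ct)
  have Am[measurable]: "A \<in> borel_fun" by (intro borel_measurable_continuous_onI ct)
  have L_AJ: "L = (\<lambda>p. A (J p))" by (auto simp: L_def A_def J_def)
  have orth: "orthogonal_transformation A"
    unfolding orthogonal_transformation
  proof (intro conjI lA allI)
    fix v
    have "A v = L (v $ 1, v $ 2)" by (simp add: A_def L_def)
    then have "norm (A v) = norm (v $ 1, v $ 2)" by (simp add: nL)
    then show "norm (A v) = norm v" by (simp add: norm_eq_sqrt_inner inner_vec_def sum_2)
  qed
  have Jm: "J \<in> borel_fun" unfolding J_def[abs_def] by (rule borel_measurable_vec2)
  have dL: "distr lborel borel L = lborel"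
    unfolding L_AJ by (rule distr_lborel_comp[OF _ distr_lborel_orthogonal[OF orth] Jm Am]) (use distr_lborel_vec2 in \<open>simp add: J_def[abs_def]\<close>)
  have Lm: "L \<in> borel_fun" by (intro borel_measurable_continuous_onI ct)
  have dT: "distr lborel borel T = lborel"
  proof -
    have "T = (\<lambda>p. L p + x0)" by (auto simp: T_def)
    then show ?thesis using distr_lborel_comp[OF dL lborel_distr_shift[of x0] Lm] by simp
  qed
  have dS: "distr lborel borel S = lborel" by (rule distr_lborel_inverse[OF dT Tm Sm ST])
  \<comment> \<open>A point of the square has
    \<open>\<bar>fst p\<bar> + \<bar>snd p\<bar> < r\<close>, so its image lies in the ball of
    radius \<open>r\<close>.\<close>
  define R where "R = r / 2"
  define Q where "Q = {-R<..<R} \<times> {-R<..<R}"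
  have R: "R > 0" using r by (simp add: R_def)
  have QT: "T p \<in> ball x0 r" if "p \<in> Q" for p
  proof -
    have "norm p \<le> \<bar>fst p\<bar> + \<bar>snd p\<bar>" using norm_Pair_le[of "fst p" "snd p"] by simp
    also have "\<dots> < r" using that by (auto simp: Q_def R_def)
    finally show ?thesis by (simp add: T_def dist_norm nL)
  qed
  define b' where "b' x = M (b (T x))" for x
  have b'm[measurable]: "b' \<in> borel_fun" unfolding b'_def[abs_def] by measurable
  have Qm[measurable]: "Q \<in> sets borel" unfolding Q_def by (intro borel_open open_Times) auto
  have b'2: "L1 (\<lambda>x. indicator Q x * (norm (b' x))\<^sup>2)"
  proof (rule integrable_dominated)
    show "L1 (\<lambda>x. indicator (ball x0 r) (T x) * (norm (b (T x)))\<^sup>2)"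
      using integral_distr_lborel(2)[OF dT Tm, of "\<lambda>x. indicator (ball x0 r) x * (norm (b x))\<^sup>2"] b2 by simp
    show "\<bar>indicator Q x * (norm (b' x))\<^sup>2\<bar> \<le> indicator (ball x0 r) (T x) * (norm (b (T x)))\<^sup>2" for x
      using QT[of x] by (auto simp: indicator_def b'_def nM)
  qed measurable
  have QT': "Q \<subseteq> T -` ball x0 r" using QT by auto
  have one': "weak_sol Q b' (\<lambda>_. 1) (\<lambda>_. 1)"
    unfolding b'_def[abs_def] by (rule weak_sol_mono[OF weak_sol_isometry[OF one lL lM adj inv1 inv2 T_def dT bm] QT']) auto
  have w': "weak_sol Q b' (\<lambda>x. u0 (T x)) (\<lambda>z. u (fst z, T (snd z)))"
    unfolding b'_def[abs_def] by (rule weak_sol_mono[OF weak_sol_isometry[OF w lL lM adj inv1 inv2 T_def dT bm um u0m] QT'])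
  have pm[measurable]: "(\<lambda>z::real \<times> real \<times> real. (fst z, T (snd z))) \<in> borel_fun"
    by (intro borel_Pair borel_fst_snd measurable_compose[OF borel_fst_snd(2) Tm])
  have u'm: "(\<lambda>z. u (fst z, T (snd z))) \<in> borel_fun" by (rule measurable_compose[OF pm um])
  have u0'm: "(\<lambda>x. u0 (T x)) \<in> borel_fun" by measurable
  have \<beta>m[measurable]: "\<beta> \<in> borel_fun" using lipschitz_continuous[OF Lip] by (rule borel_measurable_continuous_onI)
  have dir': "\<alpha> \<le> fst (b' x)" if "x \<in> Q" for x using dir[OF QT[OF that]] by (simp add: b'_def M_def)
  have res: "weak_sol Q b' (\<lambda>x. \<beta> (u0 (T x))) (\<lambda>z. \<beta> (u (fst z, T (snd z))))"
    unfolding Q_def by (rule local_renormalization[OF R \<alpha> b'm b'2[unfolded Q_def] dir'[unfolded Q_def] one'[unfolded Q_def] w'[unfolded Q_def] u'm u0'm ub Lip])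
  \<comment> \<open>Carrying back by the inverse isometry \<open>S\<close>, whose linear part is
    \<open>M\<close> with adjoint \<open>L\<close>.\<close>
  have "weak_sol (S -` Q) (\<lambda>y. L (b' (S y))) (\<lambda>y. \<beta> (u0 (T (S y)))) (\<lambda>z. \<beta> (u (fst (fst z, S (snd z)), T (snd (fst z, S (snd z))))))"
    by (rule weak_sol_isometry[OF res lM lL adj' inv2 inv1 S_def dS b'm]) (use u'm u0'm \<beta>m in measurable)
  then have "weak_sol (S -` Q) b (\<lambda>x. \<beta> (u0 x)) (\<lambda>z. \<beta> (u z))" by (simp add: TS b'_def inv1)
  moreover have "open (S -` Q)"
    unfolding S_def[abs_def] by (rule open_vimage) (auto simp: Q_def intro!: open_Times continuous_intros ct)
  moreover have "x0 \<in> S -` Q" using R by (simp add: S_def Q_def zero_prod_def)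
  ultimately show ?thesis by blast
qed

section \<open>Unfolding between the torus and the plane\<close>

lemma discrete_group_periods: "discrete_group (periods X)"
proof (cases X)
  case Plane
  then show ?thesis by (simp add: discrete_group_def)
next
  case Torus
  have fin: "finite ({z::real^2. \<forall>i. z $ i \<in> \<int>} \<inter> B)" if "bounded B" for B
  proof -
    obtain M where M: "\<And>x. x \<in> B \<Longrightarrow> norm x \<le> M" using \<open>bounded B\<close> by (auto simp: bounded_iff)
    define N where "N = {k::int. \<bar>real_of_int k\<bar> \<le> M}"
    have "N \<subseteq> {- \<lfloor>M\<rfloor>..\<lfloor>M\<rfloor>}" unfolding N_def by (auto simp: abs_le_iff le_floor_iff) (metis add.inverse_inverse le_floor_iff minus_le_iff of_int_minus)
    then have N: "finite N" using finite_subset by blast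
    have "{z::real^2. \<forall>i. z $ i \<in> \<int>} \<inter> B \<subseteq> (\<lambda>(k, l). vector [real_of_int k, real_of_int l]) ` (N \<times> N)"
    proof
      fix z assume z: "z \<in> {z::real^2. \<forall>i. z $ i \<in> \<int>} \<inter> B"
      then have "z $ 1 \<in> \<int>" "z $ 2 \<in> \<int>" by auto
      then obtain k l where kl: "z $ 1 = real_of_int k" "z $ 2 = real_of_int l" by (auto elim!: Ints_cases)
      have "\<bar>z $ i\<bar> \<le> M" for i using component_le_norm_cart[of z i] M[of z] z by auto
      then have "k \<in> N" "l \<in> N" unfolding N_def using kl by (metis mem_Collect_eq)+
      moreover have "z = vector [real_of_int k, real_of_int l]" using kl by (auto simp: vec_eq_iff forall_2)
      ultimately show "z \<in> (\<lambda>(k, l). vector [real_of_int k, real_of_int l]) ` (N \<times> N)" by force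
    qed
    then show ?thesis using N finite_subset by blast
  qed
  show ?thesis unfolding Torus discrete_group_def using fin by auto
qed

lemma discrete_group_Pair:
  fixes \<Gamma> :: "'a::euclidean_space set"
  assumes "discrete_group \<Gamma>" shows "discrete_group ({0::real} \<times> \<Gamma>)"
  unfolding discrete_group_def
proof (intro conjI allI impI)
  fix B :: "(real \<times> 'a) set" assume "bounded B"
  then have "finite (\<Gamma> \<inter> snd ` B)" using discrete_groupD(5)[OF assms] bounded_snd by blast
  then show "finite ({0} \<times> \<Gamma> \<inter> B)"
    by (rule finite_subset[rotated, OF finite_imageI[of _ "Pair 0"]]) force
qed (use discrete_groupD[OF assms] in \<open>auto simp: zero_prod_def\<close>)

lemma cell_ex1:
  obtains \<gamma> where "\<gamma> \<in> periods X" "y - \<gamma> \<in> cell X" "\<And>\<gamma>'. \<gamma>' \<in> periods X \<Longrightarrow> y - \<gamma>' \<in> cell X \<Longrightarrow> \<gamma>' = \<gamma>"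
proof (cases X)
  case Plane
  then show ?thesis using that[of 0] by simp
next
  case Torus
  show ?thesis
  proof (rule that[of "\<chi> i. real_of_int \<lfloor>y $ i\<rfloor>"])
    show "(\<chi> i. real_of_int \<lfloor>y $ i\<rfloor>) \<in> periods X" by (simp add: Torus)
    show "y - (\<chi> i. real_of_int \<lfloor>y $ i\<rfloor>) \<in> cell X" by (simp add: Torus) linarith
    fix \<gamma>' assume g: "\<gamma>' \<in> periods X" "y - \<gamma>' \<in> cell X"
    have "\<gamma>' $ i = real_of_int \<lfloor>y $ i\<rfloor>" for i
    proof -
      obtain k where k: "\<gamma>' $ i = real_of_int k" using g(1) by (auto simp: Torus elim: Ints_cases)
      have "0 \<le> y $ i - real_of_int k" "y $ i - real_of_int k < 1" using g(2) k by (auto simp: Torus simp flip: k)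
      then have "\<lfloor>y $ i\<rfloor> = k" by linarith
      then show ?thesis using k by simp
    qed
    then show "\<gamma>' = (\<chi> i. real_of_int \<lfloor>y $ i\<rfloor>)" by (simp add: vec_eq_iff)
  qed
qed

lemma bounded_cell: "bounded (cell Torus)"
proof (rule bounded_subset[OF bounded_cbox])
  show "cell Torus \<subseteq> cbox 0 1" by (auto simp: mem_box_cart less_imp_le)
qed

lemma cell_finite:
  assumes "bounded K" shows "finite {\<gamma>\<in>periods X. \<exists>x\<in>cell X. x + \<gamma> \<in> K}"
proof (cases X)
  case Torus
  show ?thesis unfolding Torus by (rule discrete_group_finite[OF discrete_group_periods bounded_cell assms])
qed simp

lemma cell_borel: "cell X \<in> sets borel"
proof (cases X)
  case Torus
  have "cell Torus = (\<Inter>i\<in>UNIV. {x. 0 \<le> x $ i} \<inter> {x. x $ i < 1})" by auto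
  moreover have "{x::real^2. 0 \<le> x $ i} \<inter> {x. x $ i < 1} \<in> sets borel" for i
    by (intro sets.Int borel_closed borel_open closed_Collect_le open_Collect_less continuous_intros)
  ultimately show ?thesis using Torus by auto
qed simp

text \<open>Exactly one translate of each point lies in \<open>Q\<close>, so integrating a sum of
  translates of \<open>f\<close> over \<open>Q\<close> gives the integral of \<open>f\<close> over
  the whole space. \<open>f'\<close> is a Borel representative of \<open>f\<close>, and
  \<open>G\<close> contains every translation that matters on its support.\<close>

lemma integral_cell_unfold:
  fixes f f' g :: "'a::euclidean_space \<Rightarrow> real"
  assumes Q[measurable]: "Q \<in> sets borel" and ex1: "\<And>y. \<exists>\<gamma>\<in>\<Gamma>. y - \<gamma> \<in> Q \<and> (\<forall>\<gamma>'\<in>\<Gamma>. y - \<gamma>' \<in> Q \<longrightarrow> \<gamma>' = \<gamma>)"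
    and G: "finite G" "G \<subseteq> \<Gamma>" and f': "L1 f'" and eq: "AE x in lborel. f x = f' x"
    and sup: "\<And>y \<gamma>. f' y \<noteq> 0 \<Longrightarrow> \<gamma> \<in> \<Gamma> \<Longrightarrow> y - \<gamma> \<in> Q \<Longrightarrow> \<gamma> \<in> G"
    and g: "\<And>x. x \<in> Q \<Longrightarrow> g x = (\<Sum>\<gamma>\<in>G. f (x + \<gamma>))"
  shows "(LINT x|lebesgue. indicator Q x * g x) = (LBINT x. f' x)"
proof -
  have [measurable]: "f' \<in> borel_fun" using f' borel_measurable_integrable by force
  have "(LINT x|lebesgue. indicator Q x * g x) = (LBINT x. indicator Q x * (\<Sum>\<gamma>\<in>G. f' (x + \<gamma>)))"
  proof (rule integral_lebesgue_eq_lborel(1))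
    have "AE x in lborel. \<forall>\<gamma>\<in>G. f (x + \<gamma>) = f' (x + \<gamma>)"
      using AE_lborel_shift[OF eq] by (intro AE_finite_allI G) auto
    then show "AE x in lborel. indicator Q x * g x = indicator Q x * (\<Sum>\<gamma>\<in>G. f' (x + \<gamma>))"
      by eventually_elim (auto simp: g indicator_def)
  qed measurable
  also have "\<dots> = (LBINT x. f' x)"
  proof (rule integral_unfold[OF G(1) f', symmetric])
    fix y assume y: "f' y \<noteq> 0"
    obtain \<gamma> where \<gamma>: "\<gamma> \<in> \<Gamma>" "y - \<gamma> \<in> Q" "\<And>\<gamma>'. \<gamma>' \<in> \<Gamma> \<Longrightarrow> y - \<gamma>' \<in> Q \<Longrightarrow> \<gamma>' = \<gamma>" using ex1[of y] by blast
    have "(\<Sum>\<gamma>'\<in>G. indicator Q (y - \<gamma>') :: real) = (\<Sum>\<gamma>'\<in>{\<gamma>}. indicator Q (y - \<gamma>'))"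
    proof (rule sum.mono_neutral_right[OF G(1)])
      show "{\<gamma>} \<subseteq> G" using sup[OF y \<gamma>(1,2)] by simp
      show "\<forall>i\<in>G - {\<gamma>}. indicat_real Q (y - i) = 0" using \<gamma>(3) G(2) by (auto simp: indicator_def)
    qed
    then show "(\<Sum>\<gamma>\<in>G. indicator Q (y - \<gamma>) :: real) = 1" using \<gamma>(2) by simp
  qed auto
  finally show ?thesis .
qed

lemma deriv_grad_eq:
  fixes \<Phi> :: "real \<times> (real^2) \<Rightarrow> real"
  assumes "(\<Phi> has_derivative (\<lambda>v. e \<bullet> v)) (at (t, x))"
  shows "deriv (\<lambda>s. \<Phi> (s, x)) t = fst e" "grad (\<lambda>y. \<Phi> (t, y)) x = snd e"
proof -
  have "((\<lambda>s. \<Phi> (s, x)) has_derivative (\<lambda>v. e \<bullet> (v, 0))) (at t)"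
    by (rule has_derivative_compose[of "\<lambda>s. (s, x)" "\<lambda>v. (v, 0)", OF _ assms]) (auto intro!: derivative_eq_intros)
  then have "((\<lambda>s. \<Phi> (s, x)) has_real_derivative fst e) (at t)"
    by (simp add: has_field_derivative_def inner_prod_def)
  then show "deriv (\<lambda>s. \<Phi> (s, x)) t = fst e" by (rule DERIV_imp_deriv)
  have "((\<lambda>y. \<Phi> (t, y)) has_derivative (\<lambda>v. e \<bullet> (0, v))) (at x)"
    by (rule has_derivative_compose[of "\<lambda>y. (t, y)" "\<lambda>v. (0, v)", OF _ assms]) (auto intro!: derivative_eq_intros)
  from frechet_derivative_eq[OF this] show "grad (\<lambda>y. \<Phi> (t, y)) x = snd e"
    by (simp add: grad_def inner_prod_def vec_eq_iff inner_axis)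
qed

lemma grad_eq:
  assumes "(\<psi> has_derivative (\<lambda>v. e \<bullet> v)) (at x)" shows "grad \<psi> x = e"
  using frechet_derivative_eq[OF assms] by (simp add: grad_def vec_eq_iff inner_axis)

lemma periodization_cgrad:
  assumes \<Gamma>: "discrete_group \<Gamma>" and K: "compact K" "\<And>x. x \<notin> K \<Longrightarrow> \<phi> x = 0" and \<phi>: "cgrad \<phi> D"
  shows "(periodization \<Gamma> K \<phi> has_derivative (\<lambda>v. periodization \<Gamma> K D z \<bullet> v)) (at z)"
proof -
  have D0: "D x \<bullet> v = 0" if "x \<notin> K" for x v
    using cgrad_zero_outside[OF \<phi> compact_imp_closed[OF K(1)] K(2) that] by simp
  have "(periodization \<Gamma> K \<phi> has_derivative (\<lambda>v. periodization \<Gamma> K (\<lambda>x. D x \<bullet> v) z)) (at z)"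
    by (rule periodization_has_derivative[OF \<Gamma> compact_imp_bounded[OF K(1)] K(2) D0 cgradD[OF \<phi>]])
  then show ?thesis by (simp add: periodization_def inner_sum_left)
qed

lemma test_fun_periodization:
  assumes \<Gamma>: "discrete_group \<Gamma>" and K: "compact K" "K \<subseteq> U" "\<And>x. x \<notin> K \<Longrightarrow> \<phi> x = 0" and \<phi>: "smooth \<phi>"
  shows "test_fun \<Gamma> U (periodization \<Gamma> K \<phi>)"
  unfolding test_fun_def
proof (intro conjI exI[of _ K] allI impI K)
  show "smooth (periodization \<Gamma> K \<phi>)" by (rule smooth_periodization[OF \<Gamma> K(1) \<phi> K(3)])
  show "periodic_on \<Gamma> UNIV (periodization \<Gamma> K \<phi>)" unfolding periodic_on_def using periodization_periodic[OF \<Gamma>] by blast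
  fix x assume n: "periodization \<Gamma> K \<phi> x \<noteq> 0"
  show "\<exists>\<gamma>\<in>\<Gamma>. x + \<gamma> \<in> K"
  proof (rule ccontr)
    assume "\<not> ?thesis"
    then have "{\<gamma>. \<gamma> \<in> \<Gamma> \<and> x + \<gamma> \<in> K} = {}" by blast
    then show False using n unfolding periodization_def by (metis sum.empty)
  qed
qed

lemma smooth_slice:
  fixes \<phi> :: "real \<times> 'a::euclidean_space \<Rightarrow> real"
  assumes "smooth \<phi>" shows "smooth (\<lambda>x. \<phi> (t, x))"
proof -
  have "smooth \<phi> \<Longrightarrow> C_k_on k UNIV (\<lambda>x. \<phi> (t, x))" for k
  proof (induction k arbitrary: \<phi>)
    case 0
    have "continuous_on UNIV (\<lambda>x. \<phi> (t, x))"
      by (rule continuous_on_compose2[OF smooth_continuous[OF 0]]) (auto intro!: continuous_intros)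
    then show ?case by simp
  next
    case (Suc k)
    show ?case
    proof (rule C_k_on_SucI)
      show "((\<lambda>x. \<phi> (t, x)) has_derivative (\<lambda>v. frechet_derivative \<phi> (at (t, x)) (0, v))) (at x)" for x
        by (rule has_derivative_compose[of "\<lambda>x. (t, x)" "\<lambda>v. (0, v)", OF _ smooth_has_derivative[OF Suc.prems]]) (auto intro!: derivative_eq_intros)
      show "C_k_on k UNIV (\<lambda>x. frechet_derivative \<phi> (at (t, x)) (0, v))" for v
        by (rule Suc.IH[OF smooth_derivative[OF Suc.prems]])
    qed
  qed
  then show ?thesis using assms by (simp add: smooth_def)
qed

lemma cell_ex1_Pair:
  "\<exists>\<gamma>\<in>{0::real} \<times> periods X. y - \<gamma> \<in> UNIV \<times> cell X \<and> (\<forall>\<gamma>'\<in>{0} \<times> periods X. y - \<gamma>' \<in> UNIV \<times> cell X \<longrightarrow> \<gamma>' = \<gamma>)"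
proof -
  obtain \<gamma> where \<gamma>: "\<gamma> \<in> periods X" "snd y - \<gamma> \<in> cell X" "\<And>\<gamma>'. \<gamma>' \<in> periods X \<Longrightarrow> snd y - \<gamma>' \<in> cell X \<Longrightarrow> \<gamma>' = \<gamma>"
    using cell_ex1[of X "snd y"] by blast
  show ?thesis
  proof (rule bexI[of _ "(0, \<gamma>)"], intro conjI ballI impI)
    show "y - (0, \<gamma>) \<in> UNIV \<times> cell X" using \<gamma>(2) by (simp only: mem_Times_iff snd_diff snd_conv UNIV_I simp_thms)
    fix \<gamma>' assume g: "\<gamma>' \<in> {0::real} \<times> periods X" "y - \<gamma>' \<in> UNIV \<times> cell X"
    have "snd \<gamma>' = \<gamma>" using g \<gamma>(3)[of "snd \<gamma>'"] by (simp only: mem_Times_iff snd_diff)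
    then show "\<gamma>' = (0, \<gamma>)" using g(1) by (simp only: prod_eq_iff mem_Times_iff singleton_iff fst_conv snd_conv simp_thms)
  qed (use \<gamma>(1) in simp)
qed

lemma cell_ex1_bex:
  "\<exists>\<gamma>\<in>periods X. y - \<gamma> \<in> cell X \<and> (\<forall>\<gamma>'\<in>periods X. y - \<gamma>' \<in> cell X \<longrightarrow> \<gamma>' = \<gamma>)"
  using cell_ex1[of X y] by metis

lemma invariant_under_iff:
  assumes "invariant_under (periods X) \<omega>" "\<gamma> \<in> periods X"
  shows "x + \<gamma> \<in> \<omega> \<longleftrightarrow> x \<in> \<omega>"
proof
  assume "x + \<gamma> \<in> \<omega>"
  then have "x + \<gamma> + - \<gamma> \<in> \<omega>" using assms discrete_groupD(4)[OF discrete_group_periods] unfolding invariant_under_def by blast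
  then show "x \<in> \<omega>" by simp
qed (use assms in \<open>auto simp: invariant_under_def\<close>)

text \<open>The periodization of \<open>\<psi>\<close> is an admissible periodic test function. As
  \<open>b\<close> and \<open>\<Omega>\<close> are periodic, the integral over the cell unfolds to
  the integral of \<open>D x \<bullet> b' x\<close> over the plane.\<close>

lemma div_free_imp_weak:
  fixes b b' :: "real^2 \<Rightarrow> real^2"
  assumes div: "div_free X \<Omega> b" and inv: "invariant_under (periods X) \<Omega>" and per: "periodic_on (periods X) \<Omega> b"
    and bm[measurable]: "b' \<in> borel_fun" and eq: "AE x in lborel. x \<in> \<omega> \<longrightarrow> b' x = b x" and \<omega>: "\<omega> \<subseteq> \<Omega>"
    and bi: "\<And>K. compact K \<Longrightarrow> K \<subseteq> \<omega> \<Longrightarrow> L1 (\<lambda>x. indicator K x * (1 + norm (b' x)))"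
    and \<psi>: "smooth \<psi>" "cgrad \<psi> D" "compact K" "K \<subseteq> \<omega>" "\<And>x. x \<notin> K \<Longrightarrow> \<psi> x = 0"
  shows "(LBINT x. D x \<bullet> b' x) = 0"
proof -
  let ?\<Gamma> = "periods X" and ?Q = "cell X"
  note dg = discrete_group_periods[of X]
  have D0: "D x = 0" if "x \<notin> K" for x by (rule cgrad_zero_outside[OF \<psi>(2) compact_imp_closed[OF \<psi>(3)] \<psi>(5) that])
  have Dm[measurable]: "D \<in> borel_fun" by (rule borel_measurable_cgrad_grad[OF \<psi>(2)])
  let ?\<Psi> = "periodization ?\<Gamma> K \<psi>" and ?E = "periodization ?\<Gamma> K D"
  have tf: "test_fun ?\<Gamma> \<Omega> ?\<Psi>" by (rule test_fun_periodization[OF dg \<psi>(3) _ \<psi>(5,1)]) (use \<psi>(4) \<omega> in auto)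
  have gr: "grad ?\<Psi> x = ?E x" for x by (rule grad_eq[OF periodization_cgrad[OF dg \<psi>(3,5,2)]])
  define G where "G = {\<gamma>\<in>?\<Gamma>. \<exists>x\<in>?Q. x + \<gamma> \<in> K}"
  have G: "finite G" "G \<subseteq> ?\<Gamma>" unfolding G_def using cell_finite[OF compact_imp_bounded[OF \<psi>(3)]] by auto
  obtain B where B: "B \<ge> 0" "\<And>z. z \<in> K \<Longrightarrow> norm (D z) \<le> B"
    using bounded_on_compact[OF \<psi>(3) cgrad_continuous_grad[OF \<psi>(2)]] by blast
  have f'i: "L1 (\<lambda>x. D x \<bullet> b' x)"
  proof (rule integrable_dominated)
    show "L1 (\<lambda>x. B * (indicator K x * (1 + norm (b' x))))" by (intro integrable_mult_right bi \<psi>)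
    show "\<bar>D x \<bullet> b' x\<bar> \<le> B * (indicator K x * (1 + norm (b' x)))" for x
    proof (cases "x \<in> K")
      case True
      have "\<bar>D x \<bullet> b' x\<bar> \<le> norm (D x) * norm (b' x)" by (rule Cauchy_Schwarz_ineq2)
      also have "\<dots> \<le> B * (1 + norm (b' x))" by (intro mult_mono B True) (auto simp: B)
      finally show ?thesis using True by simp
    qed (simp add: D0)
  qed measurable
  define f where "f x = indicator \<Omega> x * (D x \<bullet> b x)" for x
  have ff': "AE x in lborel. f x = D x \<bullet> b' x"
    using eq
  proof eventually_elim
    case (elim x)
    then show ?case using \<psi>(4) \<omega> D0[of x] by (cases "x \<in> K") (auto simp: f_def)
  qed
  have "(LINT x|lebesgue. indicator ?Q x * (indicator \<Omega> x * (b x \<bullet> ?E x))) = (LBINT x. D x \<bullet> b' x)"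
  proof (rule integral_cell_unfold[OF cell_borel cell_ex1_bex G f'i ff'])
    show "\<gamma> \<in> G" if "D y \<bullet> b' y \<noteq> 0" "\<gamma> \<in> ?\<Gamma>" "y - \<gamma> \<in> ?Q" for y \<gamma>
    proof -
      have "y \<in> K" using that(1) D0 by force
      then show ?thesis unfolding G_def using that by (intro CollectI conjI bexI[of _ "y - \<gamma>"]) auto
    qed
    fix x assume x: "x \<in> ?Q"
    have E: "?E x = (\<Sum>\<gamma>\<in>G. D (x + \<gamma>))"
      by (rule periodization_eq[OF G]) (use x D0 in \<open>auto simp: G_def\<close>)
    have "f (x + \<gamma>) = indicator \<Omega> x * (b x \<bullet> D (x + \<gamma>))" if "\<gamma> \<in> G" for \<gamma>
    proof -
      have g: "\<gamma> \<in> ?\<Gamma>" using that G(2) by auto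
      then have "x \<in> \<Omega> \<Longrightarrow> b (x + \<gamma>) = b x" using per unfolding periodic_on_def by blast
      then show ?thesis using invariant_under_iff[OF inv g, of x] by (auto simp: f_def indicator_def inner_commute)
    qed
    then show "indicator \<Omega> x * (b x \<bullet> ?E x) = (\<Sum>\<gamma>\<in>G. f (x + \<gamma>))"
      unfolding E by (simp add: inner_sum_right sum_distrib_left)
  qed
  moreover have "(LINT x:\<Omega> \<inter> ?Q|lebesgue. b x \<bullet> grad ?\<Psi> x) = 0" using div tf unfolding div_free_def by blast
  moreover have "(LINT x:\<Omega> \<inter> ?Q|lebesgue. b x \<bullet> grad ?\<Psi> x) = (LINT x|lebesgue. indicator ?Q x * (indicator \<Omega> x * (b x \<bullet> ?E x)))"
    unfolding set_lebesgue_integral_def gr by (intro Bochner_Integration.integral_cong refl) (simp add: indicator_inter_arith)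
  ultimately show ?thesis by simp
qed

text \<open>Split the flux into time and space parts. At each fixed time the spatial slice of the
  test function is a test function for the divergence and contributes zero; on each line of fixed
  position the time part integrates to minus the initial value.\<close>

lemma weak_sol_one:
  fixes b' :: "real^2 \<Rightarrow> real^2"
  assumes bm[measurable]: "b' \<in> borel_fun" and \<omega>: "open \<omega>"
    and bi: "\<And>K. compact K \<Longrightarrow> K \<subseteq> \<omega> \<Longrightarrow> L1 (\<lambda>x. indicator K x * (1 + norm (b' x)))"
    and div: "\<And>\<psi> D K. smooth \<psi> \<Longrightarrow> cgrad \<psi> D \<Longrightarrow> compact K \<Longrightarrow> K \<subseteq> \<omega> \<Longrightarrow> (\<And>x. x \<notin> K \<Longrightarrow> \<psi> x = 0) \<Longrightarrow> (LBINT x. D x \<bullet> b' x) = 0"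
  shows "weak_sol \<omega> b' (\<lambda>_. 1) (\<lambda>_. 1)"
proof (rule weak_sol_smoothI[OF bm \<omega> bi, where C=1])
  fix \<phi> :: "real \<times> (real^2) \<Rightarrow> real" and D K
  assume \<phi>: "smooth \<phi>" "cgrad \<phi> D" "compact K" "K \<subseteq> UNIV \<times> \<omega>" "\<And>z. z \<notin> K \<Longrightarrow> \<phi> z = 0"
  define K0 where "K0 = snd ` K"
  have K0: "compact K0" "K0 \<subseteq> \<omega>" using \<phi>(3,4) by (auto simp: K0_def intro!: compact_continuous_image continuous_intros)
  have K0m: "K0 \<in> sets borel" using K0(1) by (simp add: borel_compact)
  have KK0: "K \<subseteq> UNIV \<times> K0" by (force simp: K0_def)
  have D0: "D z = 0" if "z \<notin> K" for z by (rule cgrad_zero_outside[OF \<phi>(2) compact_imp_closed[OF \<phi>(3)] \<phi>(5) that])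
  obtain T where T: "T > 0" "\<And>z. z \<in> K \<Longrightarrow> \<bar>fst z\<bar> \<le> T" using compact_subset_time_strip[OF \<phi>(3)] by blast
  have f[measurable]: "(fst :: real \<times> (real^2) \<Rightarrow> real) \<in> borel_fun" by (rule borel_fst_snd)
  define w where "w z = indicat_real {0..} (fst z)" for z :: "real \<times> (real^2)"
  have wm: "w \<in> borel_fun" unfolding w_def[abs_def] by measurable
  have wb: "\<bar>w z\<bar> \<le> 1" for z by (auto simp: w_def)
  have i: "L1 (\<lambda>z. w z * flux b' D z)"
    by (rule integrable_flux_test[OF bm K0m bi[OF K0] cgrad_continuous_grad[OF \<phi>(2)] \<phi>(3) KK0 D0 wm wb])
  \<comment> \<open>The time derivative is the flux of the zero field, so the same integrability
    lemma applies.\<close>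
  have it: "L1 (\<lambda>z. w z * (D z \<bullet> (1, 0)))"
    using integrable_flux_test[of "\<lambda>_. 0", OF _ K0m _ cgrad_continuous_grad[OF \<phi>(2)] \<phi>(3) KK0 D0 wm wb] emeasure_compact_finite[OF K0(1)]
    by (simp add: K0m less_top)
  have ix: "L1 (\<lambda>z. w z * (snd (D z) \<bullet> b' (snd z)))"
    using Bochner_Integration.integrable_diff[OF i it] by (simp add: inner_prod_def algebra_simps)
  have slice: "cgrad (\<lambda>x. \<phi> (t, x)) (\<lambda>x. snd (D (t, x)))" for t
    unfolding cgrad_def
  proof (intro conjI allI)
    show "continuous_on UNIV (\<lambda>x. snd (D (t, x)))"
      by (intro continuous_intros continuous_on_compose2[OF cgrad_continuous_grad[OF \<phi>(2), of UNIV]]) (auto intro!: continuous_intros)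
    fix x
    have "((\<lambda>y. \<phi> (t, y)) has_derivative (\<lambda>v. D (t, x) \<bullet> (0, v))) (at x)"
      by (rule has_derivative_compose[of "\<lambda>y. (t, y)" "\<lambda>v. (0, v)", OF _ cgradD[OF \<phi>(2)]]) (auto intro!: derivative_eq_intros)
    then show "((\<lambda>x. \<phi> (t, x)) has_derivative (\<bullet>) (snd (D (t, x)))) (at x)" by (simp add: inner_prod_def)
  qed
  have sx: "(LBINT x. w (t, x) * (snd (D (t, x)) \<bullet> b' x)) = 0" for t
  proof -
    have "(LBINT x. snd (D (t, x)) \<bullet> b' x) = 0"
      by (rule div[OF smooth_slice[OF \<phi>(1)] slice K0]) (use \<phi>(5) in \<open>force simp: K0_def\<close>)
    then show ?thesis by (simp add: w_def)
  qed
  have tline: "(LBINT t. w (t, x) * (D (t, x) \<bullet> (1, 0))) = - \<phi> (0, x)" for x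
  proof -
    have "C1 (\<lambda>t. \<phi> (t, x)) (\<lambda>t. D (t, x) \<bullet> (1, 0))"
      unfolding C1_def
    proof (intro conjI allI)
      show "continuous_on UNIV (\<lambda>t. D (t, x) \<bullet> (1, 0))"
        by (intro continuous_intros continuous_on_compose2[OF cgrad_continuous_grad[OF \<phi>(2), of UNIV]]) (auto intro!: continuous_intros)
      fix t
      have "((\<lambda>s. \<phi> (s, x)) has_derivative (\<lambda>v. D (t, x) \<bullet> (v, 0))) (at t)"
        by (rule has_derivative_compose[of "\<lambda>s. (s, x)" "\<lambda>v. (v, 0)", OF _ cgradD[OF \<phi>(2)]]) (auto intro!: derivative_eq_intros)
      then show "((\<lambda>t. \<phi> (t, x)) has_real_derivative D (t, x) \<bullet> (1, 0)) (at t)"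
        by (simp add: inner_prod_def has_field_derivative_def)
    qed
    moreover have "\<phi> (t, x) = 0" if "t \<ge> T + 1" for t
    proof -
      have "(t, x) \<notin> K" using T(2)[of "(t, x)"] that by auto
      then show ?thesis by (rule \<phi>(5))
    qed
    ultimately have "(LBINT t. indicator {0..} t * (D (t, x) \<bullet> (1, 0))) = - \<phi> (0, x)" by (rule integral_tail_C1)
    then show ?thesis by (simp add: w_def)
  qed
  have "(LBINT z. w z * flux b' D z) = (LBINT z. w z * (snd (D z) \<bullet> b' (snd z))) + (LBINT z. w z * (D z \<bullet> (1, 0)))"
    by (subst Bochner_Integration.integral_add[OF ix it, symmetric]) (simp add: inner_prod_def algebra_simps)
  also have "(LBINT z. w z * (snd (D z) \<bullet> b' (snd z))) = 0" using lborel_fubini(3)[OF ix] sx by simp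
  also have "(LBINT z. w z * (D z \<bullet> (1, 0))) = - (LBINT x. \<phi> (0, x))" using lborel_fubini(6)[OF it] by (simp add: tline)
  finally show "(LBINT z. future z * (1 * flux b' D z)) = - (LBINT x. 1 * \<phi> (0, x))"
    by (simp add: w_def)
qed auto

lemma periods_Pair_finite:
  fixes K :: "(real \<times> (real^2)) set"
  assumes "bounded K"
  shows "finite {\<gamma>\<in>{0} \<times> periods X. \<exists>z\<in>UNIV \<times> cell X. z + \<gamma> \<in> K}"
proof (rule finite_subset)
  show "{\<gamma>\<in>{0} \<times> periods X. \<exists>z\<in>UNIV \<times> cell X. z + \<gamma> \<in> K} \<subseteq> Pair 0 ` {\<gamma>\<in>periods X. \<exists>x\<in>cell X. x + \<gamma> \<in> snd ` K}"
  proof clarify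
    fix \<gamma> t x assume a: "\<gamma> \<in> periods X" "x \<in> cell X" "(t, x) + (0, \<gamma>) \<in> K"
    then have "x + \<gamma> \<in> snd ` K" by (metis add_Pair image_eqI snd_conv)
    then show "(0, \<gamma>) \<in> Pair 0 ` {\<gamma>\<in>periods X. \<exists>x\<in>cell X. x + \<gamma> \<in> snd ` K}" using a by blast
  qed
  show "finite (Pair (0::real) ` {\<gamma>\<in>periods X. \<exists>x\<in>cell X. x + \<gamma> \<in> snd ` K})"
    using cell_finite[OF bounded_snd[OF assms]] by blast
qed

text \<open>A compactly supported test function is periodized into one admissible for the given
  equation. Periodicity of \<open>b\<close>, \<open>u\<close>, \<open>u0\<close> and
  \<open>\<omega>\<close> unfolds both integrals over the cell to integrals over the plane.\<close>

lemma is_solution_imp_weak_sol: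
  fixes b b' :: "real^2 \<Rightarrow> real^2" and u u' :: "real \<times> (real^2) \<Rightarrow> real"
  assumes sol: "is_solution X b \<omega> u0 u" and inv: "invariant_under (periods X) \<omega>" and per: "periodic_on (periods X) \<omega> b" and \<omega>: "open \<omega>"
    and bm[measurable]: "b' \<in> borel_fun" and b: "AE x in lborel. x \<in> \<omega> \<longrightarrow> b' x = b x"
    and um[measurable]: "u' \<in> borel_fun" and u: "AE z in lborel. z \<in> {0..} \<times> \<omega> \<longrightarrow> u' z = u z"
    and u0m[measurable]: "u0' \<in> borel_fun" and u0: "AE x in lborel. x \<in> \<omega> \<longrightarrow> u0' x = u0 x"
    and ub: "\<And>z. \<bar>u' z\<bar> \<le> C" "\<And>x. \<bar>u0' x\<bar> \<le> C"
    and bi: "\<And>K. compact K \<Longrightarrow> K \<subseteq> \<omega> \<Longrightarrow> L1 (\<lambda>x. indicator K x * (1 + norm (b' x)))"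
  shows "weak_sol \<omega> b' u0' u'"
proof (rule weak_sol_smoothI[OF bm \<omega> bi um u0m ub])
  fix \<phi> :: "real \<times> (real^2) \<Rightarrow> real" and D K
  assume \<phi>: "smooth \<phi>" "cgrad \<phi> D" "compact K" "K \<subseteq> UNIV \<times> \<omega>" "\<And>z. z \<notin> K \<Longrightarrow> \<phi> z = 0"
  let ?\<Gamma> = "{0::real} \<times> periods X" and ?Q = "(UNIV :: real set) \<times> cell X"
  have dg: "discrete_group ?\<Gamma>" by (rule discrete_group_Pair[OF discrete_group_periods])
  have perb: "x \<in> \<omega> \<Longrightarrow> \<gamma> \<in> periods X \<Longrightarrow> b (x + \<gamma>) = b x" for x \<gamma> using per unfolding periodic_on_def by blast
  have peru: "z \<in> {0..} \<times> \<omega> \<Longrightarrow> \<gamma> \<in> ?\<Gamma> \<Longrightarrow> u (z + \<gamma>) = u z" for z \<gamma>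
    using sol unfolding is_solution_def L_inf_def periodic_on_def by blast
  have peru0: "x \<in> \<omega> \<Longrightarrow> \<gamma> \<in> periods X \<Longrightarrow> u0 (x + \<gamma>) = u0 x" for x \<gamma>
    using sol unfolding is_solution_def L_inf_def periodic_on_def by blast
  have D0: "D z = 0" if "z \<notin> K" for z by (rule cgrad_zero_outside[OF \<phi>(2) compact_imp_closed[OF \<phi>(3)] \<phi>(5) that])
  let ?\<Phi> = "periodization ?\<Gamma> K \<phi>" and ?E = "periodization ?\<Gamma> K D"
  have tf: "test_fun ?\<Gamma> (UNIV \<times> \<omega>) ?\<Phi>" by (rule test_fun_periodization[OF dg \<phi>(3,4,5,1)])
  have dg1: "deriv (\<lambda>s. ?\<Phi> (s, x)) t = fst (?E (t, x))" "grad (\<lambda>y. ?\<Phi> (t, y)) x = snd (?E (t, x))" for t x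
    using deriv_grad_eq[OF periodization_cgrad[OF dg \<phi>(3,5,2)]] by blast+
  have Qm: "?Q \<in> sets borel" by (intro borel_Times cell_borel) auto
  define G where "G = {\<gamma>\<in>?\<Gamma>. \<exists>z\<in>?Q. z + \<gamma> \<in> K}"
  have G: "finite G" "G \<subseteq> ?\<Gamma>" unfolding G_def using periods_Pair_finite[OF compact_imp_bounded[OF \<phi>(3)]] by auto
  define f where "f z = indicator ({0..} \<times> \<omega>) z * (u z * flux b D z)" for z
  have "AE z in lborel. f z = future z * (u' z * flux b' D z)"
    using AE_lborel_fst_snd(2)[OF b] u
  proof eventually_elim
    case (elim z)
    then show ?case using \<phi>(4) D0[of z] by (cases "z \<in> K") (auto simp: f_def indicator_def)
  qed
  note ff' = this
  have "(LINT z|lebesgue. indicator ?Q z * (indicator ({0..} \<times> \<omega>) z * (u z * flux b ?E z)))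
      = (LBINT z. future z * (u' z * flux b' D z))"
  proof (rule integral_cell_unfold[OF Qm cell_ex1_Pair G integrable_time_flux_test[OF bm bi \<phi>(2-5) um ub(1)] ff'])
    show "\<gamma> \<in> G" if "indicator {0..} (fst y) * (u' y * (D y \<bullet> (1, b' (snd y)))) \<noteq> 0" "\<gamma> \<in> ?\<Gamma>" "y - \<gamma> \<in> ?Q" for y \<gamma>
    proof -
      have "y \<in> K" using that(1) D0[of y] by (cases "y \<in> K") auto
      then show ?thesis unfolding G_def using that(2,3) by (intro CollectI conjI bexI[of _ "y - \<gamma>"]) simp_all
    qed
    fix z assume z: "z \<in> ?Q"
    have E: "?E z = (\<Sum>\<gamma>\<in>G. D (z + \<gamma>))"
      by (rule periodization_eq[OF G _ D0]) (use z in \<open>unfold G_def, blast\<close>)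
    have "f (z + \<gamma>) = indicator ({0..} \<times> \<omega>) z * (u z * (D (z + \<gamma>) \<bullet> (1, b (snd z))))" if "\<gamma> \<in> G" for \<gamma>
    proof -
      have g: "\<gamma> \<in> ?\<Gamma>" using that G(2) by blast
      then obtain \<gamma>' where g': "\<gamma> = (0, \<gamma>')" "\<gamma>' \<in> periods X" by auto
      have "z + \<gamma> \<in> {0..} \<times> \<omega> \<longleftrightarrow> z \<in> {0..} \<times> \<omega>" using invariant_under_iff[OF inv g'(2), of "snd z"] by (simp add: g' mem_Times_iff)
      moreover have "z \<in> {0..} \<times> \<omega> \<Longrightarrow> b (snd (z + \<gamma>)) = b (snd z)" using perb[OF _ g'(2)] by (simp add: g' mem_Times_iff)
      ultimately show ?thesis using peru[OF _ g, of z] by (simp add: f_def indicator_def)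
    qed
    then show "indicator ({0..} \<times> \<omega>) z * (u z * flux b ?E z) = (\<Sum>\<gamma>\<in>G. f (z + \<gamma>))"
      unfolding E by (simp add: inner_sum_left sum_distrib_left)
  qed
  moreover have "(LINT (t, x):{0..} \<times> (\<omega> \<inter> cell X)|lebesgue. u (t, x) * (deriv (\<lambda>s. ?\<Phi> (s, x)) t + b x \<bullet> grad (\<lambda>y. ?\<Phi> (t, y)) x))
      = (LINT z|lebesgue. indicator ?Q z * (indicator ({0..} \<times> \<omega>) z * (u z * flux b ?E z)))"
    unfolding set_lebesgue_integral_def dg1
    by (intro Bochner_Integration.integral_cong refl) (auto simp: indicator_def inner_prod_def inner_commute)
  moreover have "(LINT (t, x):{0..} \<times> (\<omega> \<inter> cell X)|lebesgue. u (t, x) * (deriv (\<lambda>s. ?\<Phi> (s, x)) t + b x \<bullet> grad (\<lambda>y. ?\<Phi> (t, y)) x))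
      = - (LINT x:\<omega> \<inter> cell X|lebesgue. u0 x * ?\<Phi> (0, x))"
    using sol tf unfolding is_solution_def by blast
  moreover have "(LINT x:\<omega> \<inter> cell X|lebesgue. u0 x * ?\<Phi> (0, x)) = (LINT x|lebesgue. indicator (cell X) x * (indicator \<omega> x * (u0 x * ?\<Phi> (0, x))))"
    unfolding set_lebesgue_integral_def by (intro Bochner_Integration.integral_cong refl) (auto simp: indicator_def)
  moreover have "\<dots> = (LBINT x. u0' x * \<phi> (0, x))"
  proof -
    define G0 where "G0 = snd ` G"
    have G0: "finite G0" "G0 \<subseteq> periods X" using G by (auto simp: G0_def)
    have ff0: "AE x in lborel. indicator \<omega> x * (u0 x * \<phi> (0, x)) = u0' x * \<phi> (0, x)"
      using u0
    proof eventually_elim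
      case (elim x)
      then show ?case using \<phi>(4) \<phi>(5)[of "(0, x)"] by (cases "(0, x) \<in> K") (auto simp: indicator_def)
    qed
    show ?thesis
    proof (rule integral_cell_unfold[OF cell_borel cell_ex1_bex G0 integrable_slice_test[OF \<phi>(2,3,5) u0m ub(2)] ff0])
      show "\<gamma> \<in> G0" if "u0' y * \<phi> (0, y) \<noteq> 0" "\<gamma> \<in> periods X" "y - \<gamma> \<in> cell X" for y \<gamma>
      proof -
        have "(0, y) \<in> K" using that(1) \<phi>(5)[of "(0, y)"] by auto
        then have "(0, \<gamma>) \<in> G" unfolding G_def using that(2,3) by (intro CollectI conjI bexI[of _ "(0, y - \<gamma>)"]) auto
        then show ?thesis unfolding G0_def by force
      qed
      fix x assume x: "x \<in> cell X"
      have "?\<Phi> (0, x) = (\<Sum>\<gamma>\<in>G. \<phi> ((0, x) + \<gamma>))"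
        by (rule periodization_eq[OF G _ \<phi>(5)]) (use x in \<open>unfold G_def, blast\<close>)
      also have "\<dots> = (\<Sum>\<gamma>\<in>G0. \<phi> (0, x + \<gamma>))"
      proof -
        have eq: "\<gamma> = (0, snd \<gamma>)" if "\<gamma> \<in> G" for \<gamma>
        proof -
          have "\<gamma> \<in> ?\<Gamma>" using G(2) that by blast
          then show ?thesis by auto
        qed
        have "inj_on snd G"
        proof (rule inj_onI)
          fix \<gamma> \<gamma>' assume "\<gamma> \<in> G" "\<gamma>' \<in> G" "snd \<gamma> = snd \<gamma>'"
          then show "\<gamma> = \<gamma>'" using eq[of \<gamma>] eq[of \<gamma>'] by (simp only:)
        qed
        moreover have "\<phi> ((0, x) + \<gamma>) = \<phi> (0, x + snd \<gamma>)" if "\<gamma> \<in> G" for \<gamma>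
          by (subst eq[OF that]) simp
        ultimately show ?thesis unfolding G0_def by (simp add: sum.reindex)
      qed
      finally have E: "?\<Phi> (0, x) = (\<Sum>\<gamma>\<in>G0. \<phi> (0, x + \<gamma>))" .
      have "indicator \<omega> (x + \<gamma>) * (u0 (x + \<gamma>) * \<phi> (0, x + \<gamma>)) = indicator \<omega> x * (u0 x * \<phi> (0, x + \<gamma>))" if "\<gamma> \<in> G0" for \<gamma>
      proof -
        have g: "\<gamma> \<in> periods X" using that G0(2) by blast
        show ?thesis using invariant_under_iff[OF inv g, of x] peru0[OF _ g, of x] by (simp add: indicator_def)
      qed
      then show "indicator \<omega> x * (u0 x * ?\<Phi> (0, x)) = (\<Sum>\<gamma>\<in>G0. indicator \<omega> (x + \<gamma>) * (u0 (x + \<gamma>) * \<phi> (0, x + \<gamma>)))"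
        unfolding E sum_distrib_left by (simp only: cong: sum.cong)
    qed
  qed
  ultimately show "(LBINT z. future z * (u' z * flux b' D z)) = - (LBINT x. u0' x * \<phi> (0, x))" by simp
qed

lemma cutoff_partition:
  assumes "\<bar>x\<bar> < 1"
  shows "cutoff 0 1 (x - 1) + cutoff 0 1 x + cutoff 0 1 (x + 1) = 1"
proof (cases "x \<ge> 0")
  case True
  then have "cutoff 0 1 (x - 1) = sstep x" "cutoff 0 1 x = sstep (1 - x)" "cutoff 0 1 (x + 1) = 0"
    using assms by (auto simp: cutoff_def sstep_0 sstep_1)
  then show ?thesis using sstep_reflect[of x] by simp
next
  case False
  then have "cutoff 0 1 (x - 1) = 0" "cutoff 0 1 x = sstep (x + 1)" "cutoff 0 1 (x + 1) = sstep (- x)"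
    using assms by (auto simp: cutoff_def sstep_0 sstep_1)
  then show ?thesis using sstep_reflect[of "- x"] by (simp add: add.commute)
qed

text \<open>The tool for the converse passage: multiplication by \<open>\<chi>'\<close> makes a
  periodic function compactly supported in space, and summing translates restores it on the cell,
  since the values of \<open>\<chi>'\<close> add up to 1 and its gradients to 0. In the plane the
  constant 1 serves.\<close>

lemma periodic_partition:
  obtains \<chi>' T G where "cgrad \<chi>' T" "finite G" "G \<subseteq> periods X"
    "\<And>x. x \<in> cell X \<Longrightarrow> (\<Sum>\<gamma>\<in>G. \<chi>' (x + \<gamma>)) = 1" "\<And>x. x \<in> cell X \<Longrightarrow> (\<Sum>\<gamma>\<in>G. T (x + \<gamma>)) = 0"
    "\<And>y \<gamma>. \<chi>' y \<noteq> 0 \<or> T y \<noteq> 0 \<Longrightarrow> \<gamma> \<in> periods X \<Longrightarrow> y - \<gamma> \<in> cell X \<Longrightarrow> \<gamma> \<in> G"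
    "\<And>K. bounded K \<Longrightarrow> finite {\<gamma>\<in>periods X. \<exists>x. \<chi>' x \<noteq> 0 \<and> x + \<gamma> \<in> K}"
proof (cases X)
  case Plane
  show ?thesis by (rule that[of "\<lambda>_. 1" "\<lambda>_. 0" "{0}"]) (use Plane cgrad_const in auto)
next
  case Torus
  define \<kappa> where "\<kappa> = cutoff 0 1"
  obtain \<kappa>' where \<kappa>': "C1 \<kappa> \<kappa>'" using C1_cutoff unfolding \<kappa>_def by blast
  define \<eta> where "\<eta> x = \<kappa> (x $ 1) * \<kappa> (x $ 2)" for x :: "real^2"
  have c: "cgrad (\<lambda>x::real^2. x $ i) (\<lambda>_. axis i 1)" for i
    using cgrad_inner[of "axis i 1 :: real^2"] by (simp add: inner_axis)
  obtain T where T: "cgrad \<eta> T" using cgrad_mult[OF cgrad_C1[OF \<kappa>' c[of 1]] cgrad_C1[OF \<kappa>' c[of 2]]] unfolding \<eta>_def[abs_def] by blast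
  define B where "B = cbox (-1) (1 :: real^2)"
  have B: "x \<in> B \<longleftrightarrow> \<bar>x $ 1\<bar> \<le> 1 \<and> \<bar>x $ 2\<bar> \<le> 1" for x by (auto simp: B_def mem_box_cart forall_2 abs_le_iff)
  have \<eta>0: "\<eta> x = 0" if "x \<notin> B" for x
    using that cutoff_outside[of 1 0 "x $ 1"] cutoff_outside[of 1 0 "x $ 2"] by (auto simp: B \<eta>_def \<kappa>_def)
  have T0: "T x = 0" if "x \<notin> B" for x
    by (rule cgrad_zero_outside[OF T _ \<eta>0 that]) (auto simp: B_def)
  \<comment> \<open>The support of \<open>\<kappa>\<close> is contained in \<open>[- 1, 1]\<close>,
    so only the translations by -1, 0 and 1 matter for a coordinate in the cell.\<close>
  define I where "I = {-1, 0, 1 :: real}"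
  define G where "G = (\<lambda>(k, l). vector [k, l] :: real^2) ` (I \<times> I)"
  have G\<Gamma>: "G \<subseteq> periods X" by (auto simp: G_def I_def Torus forall_2)
  have inj: "inj_on (\<lambda>(k, l). vector [k, l] :: real^2) (I \<times> I)" by (auto simp: inj_on_def vec_eq_iff forall_2)
  \<comment> \<open>An open set containing the half-open cell: the sum is constant on it, and
    therefore its gradient vanishes on the cell.\<close>
  define U where "U = {x::real^2. \<bar>x $ 1\<bar> < 1 \<and> \<bar>x $ 2\<bar> < 1}"
  have U: "open U" unfolding U_def by (intro open_Collect_conj open_Collect_less continuous_intros)
  have cU: "x \<in> U" if "x \<in> cell X" for x using that by (simp add: Torus U_def forall_2)
  have one: "(\<Sum>\<gamma>\<in>G. \<eta> (x + \<gamma>)) = 1" if "x \<in> U" for x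
  proof -
    have s: "(\<Sum>k\<in>I. \<kappa> (y + k)) = 1" if "\<bar>y\<bar> < 1" for y
      using cutoff_partition[OF that] by (simp add: I_def \<kappa>_def algebra_simps)
    have "(\<Sum>\<gamma>\<in>G. \<eta> (x + \<gamma>)) = (\<Sum>(k, l)\<in>I \<times> I. \<kappa> (x $ 1 + k) * \<kappa> (x $ 2 + l))"
      unfolding G_def by (subst sum.reindex[OF inj]) (auto simp: \<eta>_def intro!: sum.cong)
    also have "\<dots> = (\<Sum>k\<in>I. \<kappa> (x $ 1 + k)) * (\<Sum>l\<in>I. \<kappa> (x $ 2 + l))"
      by (simp add: sum_product sum.cartesian_product)
    finally show ?thesis using s[of "x $ 1"] s[of "x $ 2"] that by (simp add: U_def)
  qed
  show ?thesis
  proof (rule that[OF T _ G\<Gamma>])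
    show "finite G" by (simp add: G_def I_def)
    show "(\<Sum>\<gamma>\<in>G. \<eta> (x + \<gamma>)) = 1" if "x \<in> cell X" for x using one cU[OF that] by blast
    show "(\<Sum>\<gamma>\<in>G. T (x + \<gamma>)) = 0" if "x \<in> cell X" for x
    proof (rule cgrad_const_on_open[OF _ U cU[OF that] one])
      show "cgrad (\<lambda>x. \<Sum>\<gamma>\<in>G. \<eta> (x + \<gamma>)) (\<lambda>x. \<Sum>\<gamma>\<in>G. T (x + \<gamma>))"
        by (rule cgrad_sum) (use cgrad_shift[OF T] in \<open>auto simp: G_def I_def\<close>)
    qed
    show "\<gamma> \<in> G" if "\<eta> y \<noteq> 0 \<or> T y \<noteq> 0" "\<gamma> \<in> periods X" "y - \<gamma> \<in> cell X" for y \<gamma>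
    proof -
      have y: "\<bar>y $ 1\<bar> \<le> 1" "\<bar>y $ 2\<bar> \<le> 1" using that(1) \<eta>0[of y] T0[of y] B[of y] by blast+
      have "\<gamma> $ 1 \<in> \<int>" "\<gamma> $ 2 \<in> \<int>" using that(2) by (auto simp: Torus)
      then obtain k l where kl: "\<gamma> $ 1 = real_of_int k" "\<gamma> $ 2 = real_of_int l" by (auto elim!: Ints_cases)
      have d: "0 \<le> y $ 1 - \<gamma> $ 1" "y $ 1 - \<gamma> $ 1 < 1" "0 \<le> y $ 2 - \<gamma> $ 2" "y $ 2 - \<gamma> $ 2 < 1" using that(3) by (auto simp: Torus)
      have "k \<in> {-1, 0, 1}" "l \<in> {-1, 0, 1}" using d y unfolding kl by auto
      then have "\<gamma> $ 1 \<in> I" "\<gamma> $ 2 \<in> I" unfolding kl I_def by auto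
      moreover have "\<gamma> = vector [\<gamma> $ 1, \<gamma> $ 2]" by (auto simp: vec_eq_iff forall_2)
      ultimately show ?thesis unfolding G_def by (intro image_eqI[of _ _ "(\<gamma> $ 1, \<gamma> $ 2)"]) auto
    qed
    show "finite {\<gamma>\<in>periods X. \<exists>x. \<eta> x \<noteq> 0 \<and> x + \<gamma> \<in> K}" if "bounded K" for K
    proof (rule finite_subset)
      show "finite {\<gamma>\<in>periods X. \<exists>x\<in>B. x + \<gamma> \<in> K}"
        by (rule discrete_group_finite[OF discrete_group_periods _ that]) (simp add: B_def)
    qed (use \<eta>0 in blast)
  qed
qed

text \<open>Testing the planar equation with \<open>\<theta> z = \<phi> z * \<chi>' (snd z)\<close>
  and folding the integrals back into the cell recovers the equation for \<open>\<phi>\<close>,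
  because the translates of \<open>\<theta>\<close> and of its gradient sum to \<open>\<phi>\<close>
  and \<open>D\<close> there.\<close>

lemma weak_sol_imp_solution:
  fixes b b' :: "real^2 \<Rightarrow> real^2" and v v' :: "real \<times> (real^2) \<Rightarrow> real"
  assumes w: "weak_sol \<omega> b' v0' v'" and inv: "invariant_under (periods X) \<omega>" and per: "periodic_on (periods X) \<omega> b"
    and bm[measurable]: "b' \<in> borel_fun" and b: "AE x in lborel. x \<in> \<omega> \<longrightarrow> b' x = b x"
    and vm[measurable]: "v' \<in> borel_fun" and v: "AE z in lborel. z \<in> {0..} \<times> \<omega> \<longrightarrow> v' z = v z"
    and v0m[measurable]: "v0' \<in> borel_fun" and v0: "AE x in lborel. x \<in> \<omega> \<longrightarrow> v0' x = v0 x"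
    and vb: "\<And>z. \<bar>v' z\<bar> \<le> C" "\<And>x. \<bar>v0' x\<bar> \<le> C"
    and bi: "\<And>K. compact K \<Longrightarrow> K \<subseteq> \<omega> \<Longrightarrow> L1 (\<lambda>x. indicator K x * (1 + norm (b' x)))"
    and L: "L_inf (periods X) \<omega> v0" "L_inf ({0} \<times> periods X) ({0..} \<times> \<omega>) v"
  shows "is_solution X b \<omega> v0 v"
  unfolding is_solution_def
proof (intro conjI allI impI L)
  fix \<phi> assume tf: "test_fun ({0::real} \<times> periods X) (UNIV \<times> \<omega>) \<phi>"
  let ?\<Gamma> = "{0::real} \<times> periods X" and ?Q = "(UNIV :: real set) \<times> cell X"
  have dg: "discrete_group ?\<Gamma>" by (rule discrete_group_Pair[OF discrete_group_periods])
  have perb: "x \<in> \<omega> \<Longrightarrow> \<gamma> \<in> periods X \<Longrightarrow> b (x + \<gamma>) = b x" for x \<gamma> using per unfolding periodic_on_def by blast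
  have perv: "z \<in> {0..} \<times> \<omega> \<Longrightarrow> \<gamma> \<in> ?\<Gamma> \<Longrightarrow> v (z + \<gamma>) = v z" for z \<gamma>
    using L(2) unfolding L_inf_def periodic_on_def by blast
  have perv0: "x \<in> \<omega> \<Longrightarrow> \<gamma> \<in> periods X \<Longrightarrow> v0 (x + \<gamma>) = v0 x" for x \<gamma>
    using L(1) unfolding L_inf_def periodic_on_def by blast
  obtain K where K: "compact K" "K \<subseteq> UNIV \<times> \<omega>" "\<And>z. \<phi> z \<noteq> 0 \<Longrightarrow> \<exists>\<gamma>\<in>?\<Gamma>. z + \<gamma> \<in> K" and sm: "smooth \<phi>"
    and per\<phi>: "\<And>z \<gamma>. \<gamma> \<in> ?\<Gamma> \<Longrightarrow> \<phi> (z + \<gamma>) = \<phi> z"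
    using tf unfolding test_fun_def periodic_on_def by blast
  obtain D where D: "cgrad \<phi> D" using cgrad_smooth[OF sm] by blast
  have perD: "D (z + \<gamma>) = D z" if "\<gamma> \<in> ?\<Gamma>" for z \<gamma>
  proof -
    have "cgrad \<phi> (\<lambda>z. D (z + \<gamma>))" using cgrad_shift[OF D, of \<gamma>] per\<phi>[OF that] by simp
    from cgrad_unique[OF this D] show ?thesis by (rule fun_cong)
  qed
  have dgr: "deriv (\<lambda>s. \<phi> (s, x)) t = fst (D (t, x))" "grad (\<lambda>y. \<phi> (t, y)) x = snd (D (t, x))" for t x
    using deriv_grad_eq[OF cgradD[OF D]] by blast+
  obtain \<chi>' T G0 where P: "cgrad \<chi>' T" "finite G0" "G0 \<subseteq> periods X"
    "\<And>x. x \<in> cell X \<Longrightarrow> (\<Sum>\<gamma>\<in>G0. \<chi>' (x + \<gamma>)) = 1" "\<And>x. x \<in> cell X \<Longrightarrow> (\<Sum>\<gamma>\<in>G0. T (x + \<gamma>)) = 0"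
    "\<And>y \<gamma>. \<chi>' y \<noteq> 0 \<or> T y \<noteq> 0 \<Longrightarrow> \<gamma> \<in> periods X \<Longrightarrow> y - \<gamma> \<in> cell X \<Longrightarrow> \<gamma> \<in> G0"
    "\<And>K. bounded K \<Longrightarrow> finite {\<gamma>\<in>periods X. \<exists>x. \<chi>' x \<noteq> 0 \<and> x + \<gamma> \<in> K}"
    by (rule periodic_partition[of X]) (rule that; assumption)
  define \<theta> where "\<theta> z = \<phi> z * \<chi>' (snd z)" for z
  define E where "E z = \<chi>' (snd z) *\<^sub>R D z + \<phi> z *\<^sub>R (0, T (snd z))" for z
  have \<theta>E: "cgrad \<theta> E" unfolding \<theta>_def[abs_def] E_def[abs_def] by (rule cgrad_mult[OF D cgrad_comp_snd[OF P(1)]])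
  \<comment> \<open>The translations that take a point where \<open>\<chi>'\<close> is nonzero into
    the projection of \<open>K\<close>. They are finitely many, so the union \<open>K'\<close> of
    translates of \<open>K\<close> is compact and carries the support of
    \<open>\<theta>\<close>.\<close>
  define G2 where "G2 = {\<gamma>\<in>periods X. \<exists>x. \<chi>' x \<noteq> 0 \<and> x + \<gamma> \<in> snd ` K}"
  have G2: "finite G2" unfolding G2_def by (rule P(7)[OF bounded_snd[OF compact_imp_bounded[OF K(1)]]])
  define K' where "K' = (\<Union>\<gamma>\<in>G2. (\<lambda>z. z - (0, \<gamma>)) ` K)"
  have K': "compact K'" unfolding K'_def by (intro compact_UN G2 compact_continuous_image K continuous_intros)
  have K'\<omega>: "K' \<subseteq> UNIV \<times> \<omega>"
  proof
    fix z assume "z \<in> K'"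
    then obtain \<gamma> k where gk: "\<gamma> \<in> G2" "k \<in> K" "z = k - (0, \<gamma>)" by (auto simp: K'_def)
    have "snd z + \<gamma> \<in> \<omega>" using gk K(2) by auto
    then show "z \<in> UNIV \<times> \<omega>" using invariant_under_iff[OF inv, of \<gamma> "snd z"] gk(1) by (simp add: G2_def mem_Times_iff)
  qed
  have \<theta>0: "\<theta> z = 0" if "z \<notin> K'" for z
  proof (rule ccontr)
    assume "\<theta> z \<noteq> 0"
    then have n: "\<phi> z \<noteq> 0" "\<chi>' (snd z) \<noteq> 0" by (auto simp: \<theta>_def)
    then obtain \<gamma> where g: "\<gamma> \<in> periods X" "z + (0, \<gamma>) \<in> K" using K(3)[OF n(1)] by blast
    have "snd z + \<gamma> \<in> snd ` K" using imageI[OF g(2), of snd] by simp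
    then have "\<gamma> \<in> G2" using g n unfolding G2_def by blast
    moreover have "z = (z + (0, \<gamma>)) - (0, \<gamma>)" by simp
    ultimately have "z \<in> K'" unfolding K'_def using g(2) by blast
    then show False using that by simp
  qed
  have E0: "E z = 0" if "z \<notin> K'" for z by (rule cgrad_zero_outside[OF \<theta>E compact_imp_closed[OF K'] \<theta>0 that])
  have weak: "(LBINT z. future z * (v' z * flux b' E z)) = - (LBINT x. v0' x * \<theta> (0, x))"
    by (rule weak_solD[OF w \<theta>E K' K'\<omega> \<theta>0])
  have Qm: "?Q \<in> sets borel" by (intro borel_Times cell_borel) auto
  define G where "G = Pair (0::real) ` G0"
  have G: "finite G" "G \<subseteq> ?\<Gamma>" unfolding G_def using P(2,3) by auto
  have sumG: "(\<Sum>\<gamma>\<in>G. h \<gamma>) = (\<Sum>\<gamma>\<in>G0. h (0, \<gamma>))" for h :: "real \<times> (real^2) \<Rightarrow> real \<times> (real^2)"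
    unfolding G_def by (subst sum.reindex) (auto simp: inj_on_def)
  define f where "f z = indicator ({0..} \<times> \<omega>) z * (v z * flux b E z)" for z
  have "AE z in lborel. f z = future z * (v' z * flux b' E z)"
    using AE_lborel_fst_snd(2)[OF b] v
  proof eventually_elim
    case (elim z)
    then show ?case using K'\<omega> E0[of z] by (cases "z \<in> K'") (auto simp: f_def indicator_def)
  qed
  note ff' = this
  have "(LINT z|lebesgue. indicator ?Q z * (indicator ({0..} \<times> \<omega>) z * (v z * flux b D z)))
      = (LBINT z. future z * (v' z * flux b' E z))"
  proof (rule integral_cell_unfold[OF Qm cell_ex1_Pair G integrable_time_flux_test[OF bm bi \<theta>E K' K'\<omega> \<theta>0 vm vb(1)] ff'])
    show "\<gamma> \<in> G" if "indicator {0..} (fst y) * (v' y * (E y \<bullet> (1, b' (snd y)))) \<noteq> 0" "\<gamma> \<in> ?\<Gamma>" "y - \<gamma> \<in> ?Q" for y \<gamma>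
    proof -
      have "E y \<noteq> 0" using that(1) by auto
      then have n: "\<chi>' (snd y) \<noteq> 0 \<or> T (snd y) \<noteq> 0" by (auto simp: E_def zero_prod_def)
      from that(2) obtain \<gamma>' where g': "\<gamma> = (0, \<gamma>')" "\<gamma>' \<in> periods X" by auto
      have "snd y - \<gamma>' \<in> cell X" using that(3) by (simp add: g' mem_Times_iff)
      then show ?thesis using P(6)[OF n g'(2)] by (simp add: G_def g')
    qed
    fix z assume z: "z \<in> ?Q"
    \<comment> \<open>Since \<open>\<phi>\<close> and \<open>D\<close> are periodic, translation
      acts only on the partition of unity: the coefficients of \<open>D z\<close> add up to 1 and
      those of \<open>\<phi> z\<close> to 0.\<close>
    have "(\<Sum>\<gamma>\<in>G. E (z + \<gamma>)) = (\<Sum>\<gamma>\<in>G0. \<chi>' (snd z + \<gamma>) *\<^sub>R D z + \<phi> z *\<^sub>R (0, T (snd z + \<gamma>)))"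
      unfolding sumG
    proof (rule sum.cong[OF refl])
      fix \<gamma> assume "\<gamma> \<in> G0"
      then have g: "(0, \<gamma>) \<in> ?\<Gamma>" using P(3) by auto
      show "E (z + (0, \<gamma>)) = \<chi>' (snd z + \<gamma>) *\<^sub>R D z + \<phi> z *\<^sub>R (0, T (snd z + \<gamma>))"
        unfolding E_def perD[OF g] per\<phi>[OF g] by simp
    qed
    also have "\<dots> = (\<Sum>\<gamma>\<in>G0. \<chi>' (snd z + \<gamma>)) *\<^sub>R D z + \<phi> z *\<^sub>R (0, \<Sum>\<gamma>\<in>G0. T (snd z + \<gamma>))"
      by (simp add: sum.distrib scaleR_sum_left prod_eq_iff fst_sum snd_sum scaleR_sum_right)
    also have "\<dots> = D z" using z P(4,5)[of "snd z"] by (simp add: mem_Times_iff zero_prod_def[symmetric])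
    finally have SE: "D z = (\<Sum>\<gamma>\<in>G. E (z + \<gamma>))" by simp
    have "f (z + \<gamma>) = indicator ({0..} \<times> \<omega>) z * (v z * (E (z + \<gamma>) \<bullet> (1, b (snd z))))" if "\<gamma> \<in> G" for \<gamma>
    proof -
      have g: "\<gamma> \<in> ?\<Gamma>" using that G(2) by blast
      then obtain \<gamma>' where g': "\<gamma> = (0, \<gamma>')" "\<gamma>' \<in> periods X" by auto
      have "z + \<gamma> \<in> {0..} \<times> \<omega> \<longleftrightarrow> z \<in> {0..} \<times> \<omega>" using invariant_under_iff[OF inv g'(2), of "snd z"] by (simp add: g' mem_Times_iff)
      moreover have "z \<in> {0..} \<times> \<omega> \<Longrightarrow> b (snd (z + \<gamma>)) = b (snd z)" using perb[OF _ g'(2)] by (simp add: g' mem_Times_iff)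
      ultimately show ?thesis using perv[OF _ g, of z] by (simp add: f_def indicator_def)
    qed
    then show "indicator ({0..} \<times> \<omega>) z * (v z * flux b D z) = (\<Sum>\<gamma>\<in>G. f (z + \<gamma>))"
      unfolding SE by (simp add: inner_sum_left sum_distrib_left)
  qed
  moreover have "(LINT (t, x):{0..} \<times> (\<omega> \<inter> cell X)|lebesgue. v (t, x) * (deriv (\<lambda>s. \<phi> (s, x)) t + b x \<bullet> grad (\<lambda>y. \<phi> (t, y)) x))
      = (LINT z|lebesgue. indicator ?Q z * (indicator ({0..} \<times> \<omega>) z * (v z * flux b D z)))"
    unfolding set_lebesgue_integral_def dgr
    by (intro Bochner_Integration.integral_cong refl) (auto simp: indicator_def inner_prod_def inner_commute)
  moreover have "(LINT x:\<omega> \<inter> cell X|lebesgue. v0 x * \<phi> (0, x)) = (LINT x|lebesgue. indicator (cell X) x * (indicator \<omega> x * (v0 x * \<phi> (0, x))))"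
    unfolding set_lebesgue_integral_def by (intro Bochner_Integration.integral_cong refl) (auto simp: indicator_def)
  moreover have "\<dots> = (LBINT x. v0' x * \<theta> (0, x))"
  proof -
    have ff0: "AE x in lborel. indicator \<omega> x * (v0 x * \<theta> (0, x)) = v0' x * \<theta> (0, x)"
      using v0
    proof eventually_elim
      case (elim x)
      then show ?case using K'\<omega> \<theta>0[of "(0, x)"] by (cases "(0, x) \<in> K'") (auto simp: indicator_def)
    qed
    show ?thesis
    proof (rule integral_cell_unfold[OF cell_borel cell_ex1_bex P(2,3) integrable_slice_test[OF \<theta>E K' \<theta>0 v0m vb(2)] ff0])
      show "\<gamma> \<in> G0" if "v0' y * \<theta> (0, y) \<noteq> 0" "\<gamma> \<in> periods X" "y - \<gamma> \<in> cell X" for y \<gamma>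
        using P(6)[of y \<gamma>] that by (simp add: \<theta>_def)
      fix x assume x: "x \<in> cell X"
      have "indicator \<omega> (x + \<gamma>) * (v0 (x + \<gamma>) * \<theta> (0, x + \<gamma>)) = indicator \<omega> x * (v0 x * (\<phi> (0, x) * \<chi>' (x + \<gamma>)))" if "\<gamma> \<in> G0" for \<gamma>
      proof -
        have g: "\<gamma> \<in> periods X" using that P(3) by blast
        then have "\<phi> (0, x + \<gamma>) = \<phi> (0, x)" using per\<phi>[of "(0, \<gamma>)" "(0, x)"] by simp
        then show ?thesis using invariant_under_iff[OF inv g, of x] perv0[OF _ g, of x] by (simp add: indicator_def \<theta>_def)
      qed
      then have "(\<Sum>\<gamma>\<in>G0. indicator \<omega> (x + \<gamma>) * (v0 (x + \<gamma>) * \<theta> (0, x + \<gamma>))) = indicator \<omega> x * (v0 x * (\<phi> (0, x) * (\<Sum>\<gamma>\<in>G0. \<chi>' (x + \<gamma>))))"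
        by (simp add: sum_distrib_left)
      then show "indicator \<omega> x * (v0 x * \<phi> (0, x)) = (\<Sum>\<gamma>\<in>G0. indicator \<omega> (x + \<gamma>) * (v0 (x + \<gamma>) * \<theta> (0, x + \<gamma>)))"
        using P(4)[OF x] by simp
    qed
  qed
  ultimately show "(LINT (t, x):{0..} \<times> (\<omega> \<inter> cell X)|lebesgue. v (t, x) * (deriv (\<lambda>s. \<phi> (s, x)) t + b x \<bullet> grad (\<lambda>y. \<phi> (t, y)) x))
      = - (LINT x:\<omega> \<inter> cell X|lebesgue. v0 x * \<phi> (0, x))"
    using weak by simp
qed

section \<open>Renormalization for the given notion of solution\<close>

lemma C1b_lipschitz:
  assumes "C1b \<beta>" obtains L where "L \<ge> 0" "\<And>x y. \<bar>\<beta> x - \<beta> y\<bar> \<le> L * \<bar>x - y\<bar>"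
proof -
  obtain L where L: "\<And>x. \<bar>deriv \<beta> x\<bar> \<le> L" using assms by (auto simp: C1b_def bounded_iff)
  have "L \<ge> 0" using L[of 0] by linarith
  moreover have "\<bar>\<beta> x - \<beta> y\<bar> \<le> L * \<bar>x - y\<bar>" for x y
  proof -
    have "(\<beta> has_field_derivative deriv \<beta> z) (at z within UNIV)" for z
      using assms by (auto simp: C1b_def differentiable_on_def intro: DERIV_deriv_iff_real_differentiable[THEN iffD2])
    then have "norm (\<beta> x - \<beta> y) \<le> L * norm (x - y)"
      by (intro field_differentiable_bound[of UNIV \<beta> "deriv \<beta>"]) (use L in auto)
    then show ?thesis by simp
  qed
  ultimately show ?thesis using that by blast
qed

lemma L_inf_compose:
  assumes u: "L_inf \<Gamma> S u" and \<beta>: "continuous_on UNIV \<beta>" and L: "L \<ge> 0" "\<And>x y. \<bar>\<beta> x - \<beta> y\<bar> \<le> L * \<bar>x - y\<bar>"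
  shows "L_inf \<Gamma> S (\<beta> \<circ> u)"
  unfolding L_inf_def
proof (intro conjI)
  show "periodic_on \<Gamma> S (\<beta> \<circ> u)" using u by (simp add: L_inf_def periodic_on_def)
  have "u \<in> borel_measurable (lebesgue_on S)" using u by (simp add: L_inf_def)
  then show "\<beta> \<circ> u \<in> borel_measurable (lebesgue_on S)"
    unfolding comp_def using measurable_compose[OF _ borel_measurable_continuous_onI[OF \<beta>]] by blast
  obtain C where "AE x in lebesgue_on S. \<bar>u x\<bar> \<le> C" using u by (auto simp: L_inf_def)
  then have "AE x in lebesgue_on S. \<bar>(\<beta> \<circ> u) x\<bar> \<le> \<bar>\<beta> 0\<bar> + L * C"
  proof eventually_elim
    case (elim x)
    have "\<bar>\<beta> (u x) - \<beta> 0\<bar> \<le> L * \<bar>u x\<bar>" using L(2)[of "u x" 0] by simp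
    also have "\<dots> \<le> L * C" by (intro mult_left_mono elim L(1))
    finally show ?case by simp
  qed
  then show "\<exists>C. AE x in lebesgue_on S. \<bar>(\<beta> \<circ> u) x\<bar> \<le> C" by blast
qed

theorem theorem1:
  fixes X :: ambient and \<Omega> \<Omega>' :: "(real^2) set" and b :: "real^2 \<Rightarrow> real^2"
  assumes domain: "(X = Torus \<and> \<Omega> = UNIV) \<or> (X = Plane \<and> \<Omega> = UNIV) \<or>
      (X = Plane \<and> bounded \<Omega> \<and> regular_domain \<Omega> \<and> weakly_tangent \<Omega> b)"
    and b_periodic: "periodic_on (periods X) \<Omega> b"
    and b_L1: "L_loc 1 \<Omega> b"
    and b_div: "div_free X \<Omega> b"
    and sub: "open \<Omega>'" "\<Omega>' \<subseteq> \<Omega>" "invariant_under (periods X) \<Omega>'"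
    and b_L2: "L_loc 2 \<Omega>' b"
    and P: "\<And>x. x \<in> \<Omega>' \<Longrightarrow> cond_P \<Omega> b x"
  shows "cond_R X b \<Omega>'"
  unfolding cond_R_def is_renormalized_solution_def
proof (intro allI impI)
  fix u0 u \<beta>
  assume Lu0: "L_inf (periods X) \<Omega>' u0" and sol: "is_solution X b \<Omega>' u0 u" and \<beta>: "C1b \<beta>"
  have Lu: "L_inf ({0} \<times> periods X) ({0..} \<times> \<Omega>') u" using sol unfolding is_solution_def by blast
  obtain L where L: "L \<ge> 0" "\<And>x y. \<bar>\<beta> x - \<beta> y\<bar> \<le> L * \<bar>x - y\<bar>" using C1b_lipschitz[OF \<beta>] by blast
  have \<beta>c: "continuous_on UNIV \<beta>" by (rule lipschitz_continuous[OF L(2)])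
  have \<beta>m[measurable]: "\<beta> \<in> borel_fun" by (rule borel_measurable_continuous_onI[OF \<beta>c])
  have inv\<Omega>: "invariant_under (periods X) \<Omega>" using domain by (auto simp: invariant_under_def)
  have per: "periodic_on (periods X) \<Omega>' b" using b_periodic sub(2) by (auto simp: periodic_on_def)
  have \<Omega>'l: "\<Omega>' \<in> sets lebesgue" using sub(1) by simp
  have S\<Omega>'l: "({0..} \<times> \<Omega>' :: (real \<times> (real^2)) set) \<in> sets lebesgue"
  proof -
    have "({0..} \<times> \<Omega>' :: (real \<times> (real^2)) set) \<in> sets borel" using sub(1) by (intro borel_Times) auto
    then show ?thesis by simp
  qed
  obtain b' where b'm[measurable]: "b' \<in> borel_fun" and b': "AE x in lborel. x \<in> \<Omega>' \<longrightarrow> b' x = b x"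
    using lebesgue_borel_version[OF _ \<Omega>'l, of b] b_L2 unfolding L_loc_def by blast
  obtain C0 where "AE x in lebesgue_on \<Omega>'. \<bar>u0 x\<bar> \<le> C0" using Lu0 unfolding L_inf_def by blast
  then obtain u0' where u0'm[measurable]: "u0' \<in> borel_fun" and u0': "AE x in lborel. x \<in> \<Omega>' \<longrightarrow> u0' x = u0 x" "\<And>x. \<bar>u0' x\<bar> \<le> \<bar>C0\<bar>"
    using lebesgue_bounded_borel_version[OF _ \<Omega>'l, of u0 C0] Lu0 unfolding L_inf_def by blast
  obtain C1 where "AE x in lebesgue_on ({0..} \<times> \<Omega>'). \<bar>u x\<bar> \<le> C1" using Lu unfolding L_inf_def by blast
  then obtain u' where u'm[measurable]: "u' \<in> borel_fun" and u': "AE x in lborel. x \<in> {0..} \<times> \<Omega>' \<longrightarrow> u' x = u x" "\<And>x. \<bar>u' x\<bar> \<le> \<bar>C1\<bar>"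
    using lebesgue_bounded_borel_version[OF _ S\<Omega>'l, of u C1] Lu unfolding L_inf_def by blast
  define C where "C = max \<bar>C0\<bar> \<bar>C1\<bar>"
  have bd: "\<bar>u' z\<bar> \<le> C" "\<bar>u0' x\<bar> \<le> C" for z x using u0'(2)[of x] u'(2)[of z] by (auto simp: C_def)
  have b2: "L1 (\<lambda>x. indicator K x * (norm (b' x))\<^sup>2)" if K: "compact K" "K \<subseteq> \<Omega>'" for K
  proof -
    have [measurable]: "K \<in> sets borel" using K(1) by (simp add: borel_compact)
    have "integrable lebesgue (\<lambda>x. indicator K x *\<^sub>R norm (b x) ^ 2)" using b_L2 K unfolding L_loc_def set_integrable_def by blast
    moreover have "AE x in lborel. indicator K x *\<^sub>R norm (b x) ^ 2 = indicator K x * (norm (b' x))\<^sup>2"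
      using b' by eventually_elim (use K(2) in \<open>auto simp: indicator_def\<close>)
    ultimately show ?thesis using integral_lebesgue_eq_lborel(3)[of "\<lambda>x. indicator K x * (norm (b' x))\<^sup>2"] by simp
  qed
  have bi: "L1 (\<lambda>x. indicator K x * (1 + norm (b' x)))" if K: "compact K" "K \<subseteq> \<Omega>'" for K
  proof (rule integrable_dominated)
    have [measurable]: "K \<in> sets borel" using K(1) by (simp add: borel_compact)
    show "L1 (\<lambda>x. 2 * indicator K x + indicator K x * (norm (b' x))\<^sup>2)"
      by (intro Bochner_Integration.integrable_add integrable_mult_right b2 K integrable_real_indicator)
         (use emeasure_compact_finite[OF K(1)] in \<open>auto simp: less_top\<close>)
    have "1 + y \<le> 2 + y\<^sup>2" for y :: real
    proof -
      have "0 \<le> (y - 1/2)\<^sup>2" by simp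
      then show ?thesis by (simp add: power2_eq_square algebra_simps)
    qed
    then show "\<bar>indicator K x * (1 + norm (b' x))\<bar> \<le> 2 * indicator K x + indicator K x * (norm (b' x))\<^sup>2" for x
      by (auto simp: indicator_def)
    show "(\<lambda>x. indicator K x * (1 + norm (b' x))) \<in> borel_fun" by measurable
  qed
  have w: "weak_sol \<Omega>' b' u0' u'"
    by (rule is_solution_imp_weak_sol[OF sol sub(3) per sub(1) b'm b' u'm u'(1) u0'm u0'(1) bd bi])
  \<comment> \<open>Vanishing divergence, recast as the statement that the constant 1 solves the
    equation.\<close>
  have one: "weak_sol \<Omega>' b' (\<lambda>_. 1) (\<lambda>_. 1)"
    by (rule weak_sol_one[OF b'm sub(1) bi]) (assumption, assumption, rule div_free_imp_weak[OF b_div inv\<Omega> b_periodic b'm b' sub(2) bi])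
  have loc: "\<exists>V. open V \<and> x0 \<in> V \<and> weak_sol V b' (\<lambda>x. \<beta> (u0' x)) (\<lambda>z. \<beta> (u' z))" if x0: "x0 \<in> \<Omega>'" for x0
  proof -
    obtain \<xi> \<alpha> \<epsilon> where \<xi>: "0 < \<alpha>" "0 < \<epsilon>" "AE y in lebesgue_on (ball x0 \<epsilon>). b y \<bullet> \<xi> \<ge> \<alpha>"
      using P[OF x0] unfolding cond_P_def by blast
    have ae: "AE y in lborel. y \<in> ball x0 \<epsilon> \<longrightarrow> \<alpha> \<le> b y \<bullet> \<xi>"
      using \<xi>(3) AE_lebesgue_on_iff[of "ball x0 \<epsilon>"] by simp
    \<comment> \<open>For \<open>\<xi> = 0\<close> the lower bound \<open>\<alpha> > 0\<close> could
      hold almost everywhere only on a null ball.\<close>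
    have \<xi>0: "\<xi> \<noteq> 0"
    proof
      assume "\<xi> = 0"
      then have "AE y in lborel. y \<notin> ball x0 \<epsilon>" using ae \<xi>(1) by simp
      then have "ball x0 \<epsilon> \<in> null_sets lborel" by (subst AE_iff_null_sets) auto
      then have "negligible (ball x0 \<epsilon>)" by (simp add: negligible_iff_null_sets null_sets_completionI)
      then show False using open_not_negligible[of "ball x0 \<epsilon>"] \<xi>(2) by auto
    qed
    obtain r0 where r0: "r0 > 0" "cball x0 r0 \<subseteq> \<Omega>'" using sub(1) x0 open_contains_cball by blast
    \<comment> \<open>The ball in \<open>cond_P\<close> lies in \<open>\<Omega>\<close>, whereas
      square integrability and the representative \<open>b'\<close> are available in
      \<open>\<Omega>'\<close>; the smaller ball satisfies both demands.\<close>
    define r where "r = min r0 \<epsilon>"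
    have r: "r > 0" "cball x0 r \<subseteq> \<Omega>'" "ball x0 r \<subseteq> ball x0 \<epsilon>" using r0 \<xi>(2) by (auto simp: r_def)
    define e where "e = (1 / norm \<xi>) *\<^sub>R \<xi>"
    define a where "a = \<alpha> / norm \<xi>"
    have e: "norm e = 1" and a: "a > 0" using \<xi>0 \<xi>(1) by (auto simp: e_def a_def)
    have ee: "e \<bullet> e = 1" using e by (simp add: norm_eq_1)
    \<comment> \<open>The lower bound holds almost everywhere. Replacing the field by
      \<open>a *\<^sub>R e\<close> on the exceptional null subset of the ball makes it hold at every
      point of the ball, as the fibrewise construction requires.\<close>
    define b'' where "b'' y = (if y \<in> ball x0 r \<and> b' y \<bullet> e < a then a *\<^sub>R e else b' y)" for y
    have "(\<lambda>y. b' y \<bullet> e) \<in> borel_fun" by (intro borel_measurable_inner b'm borel_measurable_const)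
    then have "{y. b' y \<bullet> e < a} \<in> sets borel" using borel_measurable_less[of "\<lambda>y. b' y \<bullet> e" borel "\<lambda>_. a"] by simp
    then have "ball x0 r \<inter> {y. b' y \<bullet> e < a} \<in> sets borel" by (intro sets.Int) auto
    moreover have "b'' = (\<lambda>y. if y \<in> ball x0 r \<inter> {y. b' y \<bullet> e < a} then a *\<^sub>R e else b' y)" by (auto simp: b''_def)
    ultimately have b''m[measurable]: "b'' \<in> borel_fun" by (simp only:) (intro measurable_If_set b'm borel_measurable_const, simp)
    have aeq: "AE y in lborel. b'' y = b' y"
      using ae b'
    proof eventually_elim
      case (elim y)
      show ?case
      proof (cases "y \<in> ball x0 r")
        case True
        then have "\<alpha> \<le> b' y \<bullet> \<xi>" using elim r(2,3) by (metis ball_subset_cball subsetD)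
        then have "a \<le> b' y \<bullet> e" using \<xi>0 by (simp add: a_def e_def divide_right_mono)
        then show ?thesis by (simp add: b''_def)
      qed (simp add: b''_def)
    qed
    have dir: "a \<le> b'' y \<bullet> e" if "y \<in> ball x0 r" for y using that by (auto simp: b''_def ee)
    have [measurable]: "ball x0 r \<in> sets borel" by simp
    have b''2: "L1 (\<lambda>x. indicator (ball x0 r) x * (norm (b'' x))\<^sup>2)"
    proof (rule integrable_dominated_AE[OF b2[OF compact_cball r(2)]])
      show "AE x in lborel. \<bar>indicator (ball x0 r) x * (norm (b'' x))\<^sup>2\<bar> \<le> indicator (cball x0 r) x * (norm (b' x))\<^sup>2"
        using aeq by eventually_elim (auto simp: indicator_def)
    qed measurable
    have br: "ball x0 r \<subseteq> \<Omega>'" using r(2) ball_subset_cball by blast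
    have aeq1: "AE x in lborel. x \<in> ball x0 r \<longrightarrow> b'' x = b' x" using aeq by eventually_elim simp
    have one'': "weak_sol (ball x0 r) b'' (\<lambda>_. 1) (\<lambda>_. 1)"
      by (rule weak_sol_cong_field[OF weak_sol_mono[OF one br] b'm b''m _ aeq1]) simp
    have w'': "weak_sol (ball x0 r) b'' u0' u'"
      by (rule weak_sol_cong_field[OF weak_sol_mono[OF w br] b'm b''m u'm aeq1])
    obtain V where V: "open V" "x0 \<in> V" "weak_sol V b'' (\<lambda>x. \<beta> (u0' x)) (\<lambda>z. \<beta> (u' z))"
      using planar_local_renormalization[OF b''m r(1) a e dir b''2 one'' w'' u'm u0'm bd L(2)] by blast
    have "weak_sol V b' (\<lambda>x. \<beta> (u0' x)) (\<lambda>z. \<beta> (u' z))"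
    proof (rule weak_sol_cong_field[OF V(3) b''m b'm])
      show "AE x in lborel. x \<in> V \<longrightarrow> b' x = b'' x" using aeq by eventually_elim simp
    qed measurable
    then show ?thesis using V by blast
  qed
  have vm: "(\<lambda>z. \<beta> (u' z)) \<in> borel_fun" "(\<lambda>x. \<beta> (u0' x)) \<in> borel_fun" by measurable
  have vb: "\<bar>\<beta> y\<bar> \<le> \<bar>\<beta> 0\<bar> + L * C" if "\<bar>y\<bar> \<le> C" for y
    using L(2)[of y 0] mult_left_mono[OF that L(1)] by simp
  \<comment> \<open>Every point of \<open>\<Omega>'\<close> has a neighbourhood on which
    \<open>\<beta> (u' z)\<close> solves the equation, and weak solutions are local.\<close>
  have glob: "weak_sol \<Omega>' b' (\<lambda>x. \<beta> (u0' x)) (\<lambda>z. \<beta> (u' z))"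
    by (rule weak_sol_local[OF b'm bi vm vb[OF bd(1)] vb[OF bd(2)] loc])
  have v: "AE z in lborel. z \<in> {0..} \<times> \<Omega>' \<longrightarrow> \<beta> (u' z) = (\<beta> \<circ> u) z" using u'(1) by eventually_elim auto
  have v0: "AE x in lborel. x \<in> \<Omega>' \<longrightarrow> \<beta> (u0' x) = (\<beta> \<circ> u0) x" using u0'(1) by eventually_elim auto
  show "is_solution X b \<Omega>' (\<beta> \<circ> u0) (\<beta> \<circ> u)"
    by (rule weak_sol_imp_solution[OF glob sub(3) per b'm b' vm(1) v vm(2) v0 vb[OF bd(1)] vb[OF bd(2)] bi
          L_inf_compose[OF Lu0 \<beta>c L] L_inf_compose[OF Lu \<beta>c L]])
qed

end
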